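(* Let $s, t \in \mathbb{N}$. Let $b_1, \dots, b_s$ be distinct integers with $b_i \geq 2$ for all $i = 1, \dots, s$, and let $\beta_1, \dots, \beta_t$ be distinct non-integer real numbers with $\beta_j > 1$ for all $j = 1, \dots, t$. Then (Lebesgue-)almost every $x \in [0,1)$ is jointly $(b_1, \dots, b_s, \beta_1, \dots, \beta_t)$-normal. Moreover, if $\log \beta_j \ne \frac{\pi^2}{6 \log 2}$ for every $j = 1, \dots, t$, then almost every $x \in [0,1)$ is jointly $(b_1, \dots, b_s, \beta_1, \dots, \beta_t, CF)$-normal.
   Context: $\lambda$ is Lebesgue measure on $[0,1]$; $\mathbb{N}=\{1,2,\dots\}$; $[\cdot]$ applied to a real number is the integer part. For an integer $b\ge2$ let $T_bx=bx \bmod 1$; for a non-integer $\beta>1$ let $T_\beta x=\beta x\bmod 1$, and let $\mu_\beta$ be the unique $T_\beta$-invariant ergodic probability measure with $1-\frac1\beta\le\frac{d\mu_\beta}{d\lambda}\le\frac1{1-1/\beta}$. Let $\mu_G(A)=\frac1{\log2}\int_A\frac{dx}{1+x}$ be the Gauss measure. Expansions of $x\in[0,1)$: (1) the $b_i$-expansion $x=\sum_{n\ge1} a^{(i)}_n b_i^{-n}$, $a_n^{(i)}\in\{0,\dots,b_i-1\}$ (with $a_n^{(i)} = [b_iT_{b_i}^{n-1}x]$); (2) the $\beta_j$-expansion $x=\sum_{n\ge1} d_n^{(j)}\beta_j^{-n}$ with $d_n^{(j)}=[\beta_jT_{\beta_j}^{n-1}x]\in\{0,1,\dots,[\beta_j]\}$;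 (3) the regular continued fraction expansion $x=[c_1,c_2,c_3,\dots]=\cfrac{1}{c_1+\cfrac1{c_2+\cdots}}$, $c_n\in\mathbb{N}$ (for irrational $x$). Cylinder sets: for a finite string $S=(v_1,\dots,v_k)$, $C_{b_i}(S)$, $C_{\beta_j}(S)$, $C_G(S)$ denote the sets of numbers in $[0,1)$ whose first $k$ digits in, respectively, the $b_i$-expansion, the $\beta_j$-expansion, the continued fraction expansion are $(v_1,\dots,v_k)$. $x$ is jointly $(b_1,\dots,b_s,\beta_1,\dots,\beta_t)$-normal if for all finite strings $V_i=(v^{(i)}_1,\dots,v^{(i)}_{k_i})\in\{0,\dots,b_i-1\}^{k_i}$ ($1\le i\le s$) and $W_j=(w^{(j)}_1,\dots,w^{(j)}_{l_j})\in\{0,\dots,[\beta_j]\}^{l_j}$ ($1\le j\le t$), $$\lim_{N\to\infty}\frac1N\#\{1\le n\le N: a^{(i)}_{n+p-1}=v^{(i)}_p\ (1\le p\le k_i,1\le i\le s),\ d^{(j)}_{n+q-1}=w^{(j)}_q\ (1\le q\le l_j,1\le j\le t)\}=\prod_{i=1}^s\lambda(C_{b_i}(V_i))\prod_{j=1}^t\mu_{\beta_j}(C_{\beta_j}(W_j)).$$ $x$ is jointly $(b_1,\dots,b_s,\beta_1,\dots,\beta_t,CF)$-normal if for all finite strings $V_i=(v^{(i)}_1,\dots,v^{(i)}_{k_i})\in\{0,\dots,b_i-1\}^{k_i}$ ($1\le i\le s$), $W_j=(w^{(j)}_1,\dots,w^{(j)}_{l_j})\in\{0,\dots,[\beta_j]\}^{l_j}$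 ($1\le j\le t$) and $U=(u_1,\dots,u_m)\in\mathbb{N}^m$, $$\lim_{N\to\infty}\frac1N\#\{1\le n\le N: a^{(i)}_{n+p-1}=v^{(i)}_p\ (1\le p\le k_i,1\le i\le s),\ d^{(j)}_{n+q-1}=w^{(j)}_q\ (1\le q\le l_j,1\le j\le t),\ c_{n+r-1}=u_r\ (1\le r\le m)\}=\prod_{i=1}^s\lambda(C_{b_i}(V_i))\prod_{j=1}^t\mu_{\beta_j}(C_{\beta_j}(W_j))\cdot\mu_G(C_G(U)).$$ *)

theory Defs
  imports "HOL-Probability.Probability"
begin

section \<open>Expansions in an integer or a non-integer base\<close>

text \<open>The base \<open>\<beta>\<close> is any real greater than 1; the \<open>b\<close>-expansion for an integer \<open>b \<ge> 2\<close>
  is the case \<open>\<beta> = real_of_int b\<close>. Digits are numbered from 1; strings are lists,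
  so their entries are numbered from 0.\<close>

definition beta_map :: "real \<Rightarrow> real \<Rightarrow> real" where
  "beta_map \<beta> x = frac (\<beta> * x)"

definition beta_digit :: "real \<Rightarrow> real \<Rightarrow> nat \<Rightarrow> int" where
  "beta_digit \<beta> x n = \<lfloor>\<beta> * (beta_map \<beta> ^^ (n - 1)) x\<rfloor>"

definition beta_cylinder :: "real \<Rightarrow> int list \<Rightarrow> real set" where
  "beta_cylinder \<beta> v = {x \<in> {0..<1}. \<forall>p<length v. beta_digit \<beta> x (p + 1) = v ! p}"


section \<open>The invariant measure of the beta map\<close>

definition unit_lebesgue :: "real measure" where
  "unit_lebesgue = restrict_space lborel {0..1}"

definition invariant_measure :: "('a \<Rightarrow> 'a) \<Rightarrow> 'a measure \<Rightarrow> bool" where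
  "invariant_measure T M \<longleftrightarrow> T \<in> measurable M M \<and> distr M M T = M"

definition ergodic_measure :: "('a \<Rightarrow> 'a) \<Rightarrow> 'a measure \<Rightarrow> bool" where
  "ergodic_measure T M \<longleftrightarrow>
     (\<forall>A\<in>sets M. T -` A \<inter> space M = A \<longrightarrow> measure M A = 0 \<or> measure M A = 1)"

definition is_renyi_measure :: "real \<Rightarrow> real measure \<Rightarrow> bool" where
  "is_renyi_measure \<beta> M \<longleftrightarrow>
     sets M = sets unit_lebesgue \<and> prob_space M \<and>
     invariant_measure (beta_map \<beta>) M \<and> ergodic_measure (beta_map \<beta>) M \<and>
     absolutely_continuous unit_lebesgue M \<and>
     (AE x in unit_lebesgue. ennreal (1 - 1 / \<beta>) \<le> RN_deriv unit_lebesgue M x \<and>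
        RN_deriv unit_lebesgue M x \<le> ennreal (1 / (1 - 1 / \<beta>)))"

text \<open>For every non-integer \<open>\<beta> > 1\<close> exactly one such measure exists (Renyi, Parry).\<close>

definition renyi_measure :: "real \<Rightarrow> real measure" where
  "renyi_measure \<beta> = (THE M. is_renyi_measure \<beta> M)"


section \<open>Regular continued fractions\<close>

fun finite_cfrac :: "nat list \<Rightarrow> real" where
  "finite_cfrac [] = 0"
| "finite_cfrac (c # cs) = 1 / (real c + finite_cfrac cs)"

text \<open>\<open>x = [c 1, c 2, \<dots>]\<close>; the value of \<open>c\<close> at 0 is irrelevant.\<close>

definition cf_expansion :: "real \<Rightarrow> (nat \<Rightarrow> nat) \<Rightarrow> bool" where
  "cf_expansion x c \<longleftrightarrow>
     (\<forall>n\<ge>1. c n \<ge> 1) \<and> (\<lambda>n. finite_cfrac (map c [1..<Suc n])) \<longlonglongrightarrow> x"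

text \<open>Meaningful for irrational \<open>x\<close> in the unit interval and \<open>n \<ge> 1\<close>; such an \<open>x\<close> has exactly
  one infinite expansion, and a rational has none.\<close>

definition cf_digit :: "real \<Rightarrow> nat \<Rightarrow> nat" where
  "cf_digit x n = (THE k. \<exists>c. cf_expansion x c \<and> c n = k)"

text \<open>Rationals, whose expansions are finite, are left out; they form a null set.\<close>

definition cf_cylinder :: "nat list \<Rightarrow> real set" where
  "cf_cylinder u = {x \<in> {0..<1} - \<rat>. \<forall>r<length u. cf_digit x (r + 1) = u ! r}"

definition gauss_measure :: "real measure" where
  "gauss_measure = density unit_lebesgue (\<lambda>x. ennreal (1 / ln 2 * (1 / (1 + x))))"


section \<open>Joint normality\<close>

text \<open>\<open>digits_match\<close> says that the strings \<open>V i\<close> and \<open>W j\<close> all occur at position \<open>n\<close> in the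
  respective expansions of \<open>x\<close>; with \<open>p\<close> counted from 0, the digit compared with the
  entry \<open>p\<close> is the one of index \<open>n + p\<close>.\<close>

definition admissible_strings ::
  "nat \<Rightarrow> nat \<Rightarrow> (nat \<Rightarrow> int) \<Rightarrow> (nat \<Rightarrow> real) \<Rightarrow> (nat \<Rightarrow> int list) \<Rightarrow> (nat \<Rightarrow> int list) \<Rightarrow> bool" where
  "admissible_strings s t b \<beta> V W \<longleftrightarrow>
     (\<forall>i\<in>{1..s}. set (V i) \<subseteq> {0..b i - 1}) \<and> (\<forall>j\<in>{1..t}. set (W j) \<subseteq> {0..\<lfloor>\<beta> j\<rfloor>})"

definition digits_match ::
  "nat \<Rightarrow> nat \<Rightarrow> (nat \<Rightarrow> int) \<Rightarrow> (nat \<Rightarrow> real) \<Rightarrow> (nat \<Rightarrow> int list) \<Rightarrow> (nat \<Rightarrow> int list) \<Rightarrow>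
    real \<Rightarrow> nat \<Rightarrow> bool" where
  "digits_match s t b \<beta> V W x n \<longleftrightarrow>
     (\<forall>i\<in>{1..s}. \<forall>p<length (V i). beta_digit (real_of_int (b i)) x (n + p) = V i ! p) \<and>
     (\<forall>j\<in>{1..t}. \<forall>q<length (W j). beta_digit (\<beta> j) x (n + q) = W j ! q)"

definition cylinder_product ::
  "nat \<Rightarrow> nat \<Rightarrow> (nat \<Rightarrow> int) \<Rightarrow> (nat \<Rightarrow> real) \<Rightarrow> (nat \<Rightarrow> int list) \<Rightarrow> (nat \<Rightarrow> int list) \<Rightarrow> real" where
  "cylinder_product s t b \<beta> V W =
     (\<Prod>i=1..s. measure unit_lebesgue (beta_cylinder (real_of_int (b i)) (V i))) *
     (\<Prod>j=1..t. measure (renyi_measure (\<beta> j)) (beta_cylinder (\<beta> j) (W j)))"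

definition jointly_normal ::
  "nat \<Rightarrow> nat \<Rightarrow> (nat \<Rightarrow> int) \<Rightarrow> (nat \<Rightarrow> real) \<Rightarrow> real \<Rightarrow> bool" where
  "jointly_normal s t b \<beta> x \<longleftrightarrow>
     (\<forall>V W. admissible_strings s t b \<beta> V W \<longrightarrow>
        (\<lambda>N. real (card {n \<in> {1..N}. digits_match s t b \<beta> V W x n}) / real N)
          \<longlonglongrightarrow> cylinder_product s t b \<beta> V W)"

definition jointly_CF_normal ::
  "nat \<Rightarrow> nat \<Rightarrow> (nat \<Rightarrow> int) \<Rightarrow> (nat \<Rightarrow> real) \<Rightarrow> real \<Rightarrow> bool" where
  "jointly_CF_normal s t b \<beta> x \<longleftrightarrow> x \<notin> \<rat> \<and>
     (\<forall>V W U. admissible_strings s t b \<beta> V W \<and> set U \<subseteq> {1..} \<longrightarrow>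
        (\<lambda>N. real (card {n \<in> {1..N}. digits_match s t b \<beta> V W x n \<and>
                (\<forall>r<length U. cf_digit x (n + r) = U ! r)}) / real N)
          \<longlonglongrightarrow> cylinder_product s t b \<beta> V W * measure gauss_measure (cf_cylinder U))"

end

theory Submission
  imports Defs "HOL-Real_Asymp.Real_Asymp"
begin

text \<open>Fix one string per expansion. For the map number \<open>i\<close>, of entropy \<open>H i\<close>, the event that the
  string occurs at position \<open>n\<close> is determined at the scale \<open>exp (- H i * n)\<close> and is nearly independent
  of every set that only has structure at scales much coarser than that. The entropies are \<open>ln b\<close>,
  \<open>ln \<beta>\<close> and \<open>pi\<^sup>2 / (6 * ln 2)\<close>. When they are distinct, the scales \<open>H i * n\<close> and \<open>H i * m\<close>
  belonging to a typical pair of times \<open>m\<close>, \<open>n\<close> are all well separated, so the events at these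
  times decouple one by one from the finest scale to the coarsest. This bounds the variance of
  the number of joint occurrences up to time \<open>N\<close>, and the Borel-Cantelli lemma along
  \<open>N = k ^ 8\<close> gives the frequency almost everywhere.

  Near independence comes from exponential mixing of the transfer operator on a cone of monotone
  densities: a Lasota-Yorke and Doeblin argument for \<open>\<beta>\<close>-maps, Iosifescu's contraction for the
  Gauss map. For the Gauss map the number of cylinders meeting the scale \<open>exp (- H * n)\<close> is
  controlled by a weak law for the logarithms of the orbit.\<close>

text \<open>All maps act on the same point \<open>x\<close>. Their product preserves the product
  measure, but the diagonal is null for it, so an ergodic theorem for the product system says
  nothing about Lebesgue almost every \<open>x\<close>; correlations are therefore estimated
  directly under Lebesgue measure. Distinct entropies separate the maps at one and the same time
  \<open>n\<close>. Commensurable entropies, as for the bases 2 and 4, do no harm: the scales of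
  different times may then coincide, but only for a small proportion of the pairs of times, which a
  variance bound tolerates. Two integer or non-integer bases differ by hypothesis and so do their
  logarithms; that no integer base has the entropy of the Gauss map is a numerical fact that has to
  be proved. Beta cylinders have a deterministic upper bound for their length, Gauss cylinders only
  a typical length. This is why the mixing notion carries a deviation \<open>a\<close> and
  exceptional sets. The Renyi measure is a definite description, so existence and uniqueness have to
  be established as well. Parry's explicit density gives existence; mixing for all integrable
  functions gives ergodicity and uniqueness.\<close>

section \<open>Lebesgue measure on the unit interval and almost sure convergence of
  frequencies\<close>

lemma space_unit_lebesgue [simp]: "space unit_lebesgue = {0..1}"
  by (simp add: unit_lebesgue_def space_restrict_space)

lemma sets_unit_lebesgue_iff: "A \<in> sets unit_lebesgue \<longleftrightarrow> A \<in> sets borel \<and> A \<subseteq> {0..1}"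
  unfolding unit_lebesgue_def by (subst sets_restrict_space_iff) auto

lemma emeasure_unit_lebesgue: "A \<subseteq> {0..1} \<Longrightarrow> emeasure unit_lebesgue A = emeasure lborel A"
  unfolding unit_lebesgue_def by (subst emeasure_restrict_space) auto

lemma measure_unit_lebesgue: "A \<subseteq> {0..1} \<Longrightarrow> measure unit_lebesgue A = measure lborel A"
  by (simp add: measure_def emeasure_unit_lebesgue)

interpretation unit: prob_space unit_lebesgue
  by standard (simp add: emeasure_unit_lebesgue)

lemma prob_unit_interval [simp]: "unit.prob {0..1} = 1"
  using unit.prob_space by simp

lemma prob_endpoints: "unit.prob {0, 1} = 0" "{0, 1} \<in> sets unit_lebesgue"
proof -
  have "emeasure lborel {0, 1::real} = 0" by (intro emeasure_lborel_countable) auto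
  then show "unit.prob {0, 1} = 0" by (simp add: measure_unit_lebesgue) (simp add: measure_def)
qed (simp add: sets_unit_lebesgue_iff)

lemma integrable_indicator_unit_lebesgue:
  "A \<in> sets unit_lebesgue \<Longrightarrow> integrable unit_lebesgue (indicat_real A)"
  by (intro integrable_real_indicator) (auto simp: less_top[symmetric])

lemma measurable_unit_lebesgue:
  "f \<in> measurable borel M \<Longrightarrow> f \<in> measurable unit_lebesgue M"
  unfolding unit_lebesgue_def by (simp add: measurable_restrict_space1)

lemma AE_unit_lebesgue_iff: "(AE x in unit_lebesgue. P x) \<longleftrightarrow> (AE x in lborel. x \<in> {0..1} \<longrightarrow> P x)"
  unfolding unit_lebesgue_def by (subst AE_restrict_space_iff) auto

text \<open>Borel-Cantelli in integral form: by Tonelli the sum of all \<open>f k\<close> has a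
  finite integral, so it is finite almost everywhere and its terms tend to 0.\<close>

lemma (in prob_space) AE_summable_integral_tendsto_zero:
  fixes f :: "nat \<Rightarrow> 'a \<Rightarrow> real"
  assumes int: "\<And>k. integrable M (f k)" and nonneg: "\<And>k x. x \<in> space M \<Longrightarrow> 0 \<le> f k x"
    and le: "\<And>k. (\<integral>x. f k x \<partial>M) \<le> g k" and sum: "summable g"
  shows "AE x in M. (\<lambda>k. f k x) \<longlonglongrightarrow> 0"
proof -
  have g0: "0 \<le> g k" for k
    using le[of k] integral_nonneg_AE[of "f k" M] nonneg by (smt (verit) AE_I2)
  have "(\<integral>\<^sup>+x. (\<Sum>k. ennreal (f k x)) \<partial>M) = (\<Sum>k. \<integral>\<^sup>+x. ennreal (f k x) \<partial>M)"
    using int by (intro nn_integral_suminf) auto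
  also have "\<dots> = (\<Sum>k. ennreal (\<integral>x. f k x \<partial>M))"
    using int nonneg by (subst nn_integral_eq_integral) auto
  also have "\<dots> \<le> (\<Sum>k. ennreal (g k))"
    by (intro suminf_le ennreal_leI le) auto
  also have "\<dots> < \<infinity>"
    using ennreal_suminf_neq_top[OF sum g0] by (simp add: top.not_eq_extremum)
  finally have "AE x in M. (\<Sum>k. ennreal (f k x)) \<noteq> \<infinity>"
    using int by (intro nn_integral_PInf_AE) auto
  then show ?thesis
  proof (rule AE_mp, intro AE_I2 impI)
    fix x assume x: "x \<in> space M" and "(\<Sum>k. ennreal (f k x)) \<noteq> \<infinity>"
    then have "summable (\<lambda>k. f k x)"
      using nonneg by (intro summable_suminf_not_top) auto
    then show "(\<lambda>k. f k x) \<longlonglongrightarrow> 0" by (rule summable_LIMSEQ_zero)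
  qed
qed

text \<open>A monotone count is squeezed between its values at the two neighbouring powers, and
  \<open>((k+1) / (k+2)) ^ q\<close> tends to 1. Polynomial spacing is what makes this work; along a
  geometric sequence the squeeze would lose a constant factor.\<close>

lemma frequency_tendsto_from_subsequence:
  fixes c :: "nat \<Rightarrow> nat" and q :: nat
  assumes mono: "mono c" and q: "q > 0"
    and lim: "(\<lambda>k. real (c ((k+1)^q)) / real ((k+1)^q)) \<longlonglongrightarrow> p"
  shows "(\<lambda>N. real (c N) / real N) \<longlonglongrightarrow> p"
proof -
  \<comment> \<open>\<open>N\<close> lies between the powers of \<open>k N + 1\<close> and
    \<open>k N + 2\<close>; the shift by one keeps every denominator positive.\<close>
  define k :: "nat \<Rightarrow> nat" where "k N = (GREATEST k. (k+1)^q \<le> N)" for N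
  have k: "(k N + 1)^q \<le> N \<and> N < (k N + 2)^q" if "N \<ge> 1" for N
  proof -
    have bound: "j \<le> N" if "(j+1)^q \<le> N" for j
      using that q self_le_power[of "j+1" q] by linarith
    have ex: "(0+1)^q \<le> N" using that by simp
    have "(k N + 1)^q \<le> N" unfolding k_def
      by (rule GreatestI_nat[where P = "\<lambda>k. (k+1)^q \<le> N" and k = 0 and b = N]) (use ex bound in auto)
    moreover have "\<not> (Suc (k N) + 1)^q \<le> N"
    proof
      assume "(Suc (k N) + 1)^q \<le> N"
      then have "Suc (k N) \<le> k N" unfolding k_def
        by (intro Greatest_le_nat[where P = "\<lambda>k. (k+1)^q \<le> N" and b = N]) (use bound in auto)
      then show False by simp
    qed
    ultimately show ?thesis by (simp add: not_le)
  qed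
  have ktop: "filterlim k at_top at_top"
  proof (subst filterlim_at_top, intro allI)
    fix Z
    show "eventually (\<lambda>N. Z \<le> k N) at_top"
      using eventually_ge_at_top[of "max 1 ((Z+2)^q)"]
    proof eventually_elim
      case (elim N)
      then have "N \<ge> 1" "(Z+2)^q \<le> N" by (simp_all only: max.bounded_iff)
      then have "(Z+2)^q < (k N + 2)^q" using k[of N] by linarith
      then show ?case using power_less_imp_less_base[of "Z+2" q "k N + 2"] by simp
    qed
  qed
  define r where "r k = (real (k+1) / real (k+2))^q" for k :: nat
  have r: "r \<longlonglongrightarrow> 1"
  proof -
    have "(\<lambda>k. real (k+1) / real (k+2)) \<longlonglongrightarrow> 1" by real_asymp
    from tendsto_power[OF this, of q] show ?thesis by (simp only: r_def[abs_def] power_one)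
  qed
  have rpos: "r k > 0" for k by (simp add: r_def)
  define u where "u k = real (c ((k+1)^q)) / real ((k+1)^q)" for k
  have u: "u \<longlonglongrightarrow> p" using lim by (simp only: u_def[abs_def])
  have low: "(\<lambda>N. u (k N) * r (k N)) \<longlonglongrightarrow> p * 1"
    by (intro tendsto_mult filterlim_compose[OF u ktop] filterlim_compose[OF r ktop])
  have u': "(\<lambda>k. u (Suc k)) \<longlonglongrightarrow> p" using u by (rule LIMSEQ_Suc)
  have up: "(\<lambda>N. u (Suc (k N)) / r (k N)) \<longlonglongrightarrow> p / 1"
    by (intro tendsto_divide filterlim_compose[OF u' ktop] filterlim_compose[OF r ktop]) auto
  show ?thesis
  proof (rule tendsto_sandwich[OF _ _ low[simplified] up[simplified]])
    show "eventually (\<lambda>N. u (k N) * r (k N) \<le> real (c N) / real N) at_top"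
      using eventually_ge_at_top[of 1]
    proof eventually_elim
      case (elim N)
      note kk = k[OF elim]
      have "u (k N) * r (k N) = real (c ((k N+1)^q)) / real ((k N+2)^q)"
        by (simp add: u_def r_def power_divide)
      also have "\<dots> \<le> real (c N) / real N"
        using kk elim monoD[OF mono, of "(k N + 1)^q" N]
        by (intro frac_le) (auto simp del: of_nat_power of_nat_add)
      finally show ?case .
    qed
    show "eventually (\<lambda>N. real (c N) / real N \<le> u (Suc (k N)) / r (k N)) at_top"
      using eventually_ge_at_top[of 1]
    proof eventually_elim
      case (elim N)
      note kk = k[OF elim]
      have "u (Suc (k N)) / r (k N) = real (c ((k N+2)^q)) / real ((k N+1)^q)"
        by (simp add: u_def r_def power_divide)
      moreover have "real (c N) / real N \<le> \<dots>"
        using kk elim monoD[OF mono, of N "(k N + 2)^q"]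
        by (intro frac_le) (auto simp del: of_nat_power of_nat_add)
      ultimately show ?case by simp
    qed
  qed
qed

lemma AE_unit_lebesgue_interior: "AE x in unit_lebesgue. x \<in> {0<..<1}"
proof -
  have "AE x in unit_lebesgue. x \<noteq> 0" "AE x in unit_lebesgue. x \<noteq> 1"
    unfolding AE_unit_lebesgue_iff
    using AE_lborel_singleton[of "0::real"] AE_lborel_singleton[of "1::real"] by (eventually_elim, simp)+
  moreover have "AE x in unit_lebesgue. x \<in> {0..1}" by (rule AE_I2) simp
  ultimately show ?thesis by eventually_elim auto
qed

lemma AE_unit_lebesgue_irrational: "AE x in unit_lebesgue. x \<notin> \<rat>"
proof -
  have "(\<rat> :: real set) \<in> sets borel" using countable_rat by (rule sets.countable[rotated]) simp
  then have "AE x in lborel. x \<notin> (\<rat> :: real set)"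
    using emeasure_lborel_countable[OF countable_rat] by (intro AE_not_in) (simp add: null_sets_def)
  then show ?thesis unfolding AE_unit_lebesgue_iff by eventually_elim simp
qed

section \<open>Joint frequencies of quasi-mixing events\<close>

text \<open>\<open>breaks S F\<close> makes \<open>S\<close> a union of at most \<open>card F + 1\<close> intervals and some points of \<open>F\<close>, so
  \<open>card F\<close> measures the scale of \<open>S\<close>. In \<open>quasi_mixing\<close> the rate \<open>H\<close> is an entropy and \<open>a\<close> is the
  allowed deviation of the logarithm of a cylinder length from \<open>H * n\<close>; the terms
  \<open>(n + 1) / a\<^sup>2\<close> are the Chebyshev bounds for larger deviations.\<close>

definition breaks :: "real set \<Rightarrow> real set \<Rightarrow> bool" where
  "breaks S F \<longleftrightarrow> finite F \<and>
     (\<forall>x y. 0 < x \<longrightarrow> x \<le> y \<longrightarrow> y < 1 \<longrightarrow> {x..y} \<inter> F = {} \<longrightarrow> (x \<in> S \<longleftrightarrow> y \<in> S))"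

definition quasi_mixing :: "real \<Rightarrow> real \<Rightarrow> real \<Rightarrow> (nat \<Rightarrow> real set) \<Rightarrow> real \<Rightarrow> bool" where
  "quasi_mixing C \<theta> H E p \<longleftrightarrow>
     (\<forall>n. E n \<in> sets unit_lebesgue) \<and> 0 \<le> p \<and> p \<le> 1 \<and>
     (\<forall>S F m n a. S \<in> sets unit_lebesgue \<longrightarrow> breaks S F \<longrightarrow> m \<le> n \<longrightarrow> 0 < a \<longrightarrow>
        \<bar>unit.prob (S \<inter> E n) - unit.prob S * p\<bar> \<le>
          C * (real (card F) * exp (a - H * real m) + (real n + 1) / a\<^sup>2 + \<theta> ^ (n - m))) \<and>
     (\<forall>n a. 0 < a \<longrightarrow> (\<exists>S F. S \<in> sets unit_lebesgue \<and> breaks S F \<and>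
        real (card F) \<le> C * exp (H * real n + a) \<and>
        unit.prob ((E n - S) \<union> (S - E n)) \<le> C * ((real n + 1) / a\<^sup>2)))"

lemma breaks_Int: "breaks S F \<Longrightarrow> breaks S' F' \<Longrightarrow> breaks (S \<inter> S') (F \<union> F')"
  unfolding breaks_def by (auto simp: Int_Un_distrib)

lemma quasi_mixing_mono:
  assumes qm: "quasi_mixing C \<theta> H E p" and "C \<le> C'" "\<theta> \<le> \<theta>'" "0 \<le> \<theta>" "0 \<le> C"
  shows "quasi_mixing C' \<theta>' H E p"
  unfolding quasi_mixing_def
proof (intro conjI allI impI)
  show "E n \<in> sets unit_lebesgue" "0 \<le> p" "p \<le> 1" for n
    using qm by (auto simp: quasi_mixing_def)
next
  fix S F :: "real set" and m n :: nat and a :: real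
  assume h: "S \<in> sets unit_lebesgue" "breaks S F" "m \<le> n" "0 < a"
  have "\<bar>unit.prob (S \<inter> E n) - unit.prob S * p\<bar> \<le>
          C * (real (card F) * exp (a - H * real m) + (real n + 1) / a\<^sup>2 + \<theta> ^ (n - m))"
    using qm h unfolding quasi_mixing_def by blast
  also have "\<dots> \<le> C' * (real (card F) * exp (a - H * real m) + (real n + 1) / a\<^sup>2 + \<theta>' ^ (n - m))"
    using assms h by (intro mult_mono add_mono power_mono) auto
  finally show "\<bar>unit.prob (S \<inter> E n) - unit.prob S * p\<bar> \<le>
          C' * (real (card F) * exp (a - H * real m) + (real n + 1) / a\<^sup>2 + \<theta>' ^ (n - m))" .
next
  fix n :: nat and a :: real
  assume a: "0 < a"
  obtain S F where S: "S \<in> sets unit_lebesgue" "breaks S F"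
        "real (card F) \<le> C * exp (H * real n + a)"
        "unit.prob ((E n - S) \<union> (S - E n)) \<le> C * ((real n + 1) / a\<^sup>2)"
    using qm a unfolding quasi_mixing_def by blast
  have "C * exp (H * real n + a) \<le> C' * exp (H * real n + a)"
       "C * ((real n + 1) / a\<^sup>2) \<le> C' * ((real n + 1) / a\<^sup>2)"
    by (rule mult_right_mono[OF \<open>C \<le> C'\<close>], simp)+
  with S show "\<exists>S F. S \<in> sets unit_lebesgue \<and> breaks S F \<and> real (card F) \<le> C' * exp (H * real n + a) \<and>
        unit.prob ((E n - S) \<union> (S - E n)) \<le> C' * ((real n + 1) / a\<^sup>2)"
    by (meson order_trans)
qed

lemma (in finite_measure) abs_measure_diff_le:
  assumes "A \<in> sets M" "B \<in> sets M"
  shows "\<bar>measure M A - measure M B\<bar> \<le> measure M ((A - B) \<union> (B - A))"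
proof -
  have "measure M A \<le> measure M (B \<union> ((A - B) \<union> (B - A)))"
       "measure M B \<le> measure M (A \<union> ((A - B) \<union> (B - A)))"
    using assms by (auto intro!: finite_measure_mono)
  moreover have "measure M (B \<union> ((A - B) \<union> (B - A))) \<le> measure M B + measure M ((A - B) \<union> (B - A))"
       "measure M (A \<union> ((A - B) \<union> (B - A))) \<le> measure M A + measure M ((A - B) \<union> (B - A))"
    using assms by (auto intro!: measure_Un_le)
  ultimately show ?thesis by linarith
qed

text \<open>In the induction on scales the intersection built so far is only close to a set with few
  breaks. Passing to that set changes the joint probability and the product by at most
  \<open>\<delta>\<close> each, hence the summand \<open>2 * \<delta>\<close>.\<close>

lemma quasi_mixing_approx:
  assumes qm: "quasi_mixing C \<theta> H E p" and "0 \<le> C"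
    and X: "X \<in> sets unit_lebesgue" and S: "S \<in> sets unit_lebesgue" "breaks S F"
    and F: "real (card F) \<le> M"
    and \<delta>: "unit.prob ((X - S) \<union> (S - X)) \<le> \<delta>" and mn: "m \<le> n" and a: "0 < a"
  shows "\<bar>unit.prob (X \<inter> E n) - unit.prob X * p\<bar> \<le>
          2 * \<delta> + C * (M * exp (a - H * real m) + (real n + 1) / a\<^sup>2 + \<theta> ^ (n - m))"
proof -
  have E: "E n \<in> sets unit_lebesgue" and p: "0 \<le> p" "p \<le> 1"
    using qm by (auto simp: quasi_mixing_def)
  have "\<bar>unit.prob (X \<inter> E n) - unit.prob (S \<inter> E n)\<bar>
      \<le> unit.prob ((X \<inter> E n - S \<inter> E n) \<union> (S \<inter> E n - X \<inter> E n))"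
    using X S E by (intro unit.abs_measure_diff_le) auto
  also have "\<dots> \<le> unit.prob ((X - S) \<union> (S - X))"
    using X S E by (intro unit.finite_measure_mono) auto
  finally have 1: "\<bar>unit.prob (X \<inter> E n) - unit.prob (S \<inter> E n)\<bar> \<le> \<delta>" using \<delta> by linarith
  have "\<bar>unit.prob X - unit.prob S\<bar> \<le> \<delta>"
    using unit.abs_measure_diff_le[OF X S(1)] \<delta> by linarith
  then have "\<bar>unit.prob X - unit.prob S\<bar> * p \<le> \<delta>"
    using p mult_left_le[of p "\<bar>unit.prob X - unit.prob S\<bar>"] by linarith
  then have 2: "\<bar>unit.prob X * p - unit.prob S * p\<bar> \<le> \<delta>"
    using p by (metis abs_mult abs_of_nonneg left_diff_distrib)
  have "\<bar>unit.prob (S \<inter> E n) - unit.prob S * p\<bar> \<le>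
          C * (real (card F) * exp (a - H * real m) + (real n + 1) / a\<^sup>2 + \<theta> ^ (n - m))"
    using qm S mn a unfolding quasi_mixing_def by blast
  also have "\<dots> \<le> C * (M * exp (a - H * real m) + (real n + 1) / a\<^sup>2 + \<theta> ^ (n - m))"
    using F \<open>0 \<le> C\<close> by (intro mult_left_mono add_mono) auto
  finally show ?thesis using 1 2 by linarith
qed

text \<open>Events are added in order of increasing scale. The intersection of the coarser ones is
  close to a set whose number of breaks is governed by the largest scale so far, which is at least
  \<open>K\<close> below the scale of the new event. Mixing of the new event against that set splits
  off one factor \<open>p\<close>. The approximating set belongs to the conclusion because the next
  step of the induction needs it.\<close>

lemma joint_mixing:
  fixes H p :: "'i \<Rightarrow> real" and E :: "'i \<Rightarrow> nat \<Rightarrow> real set" and J :: "('i \<times> nat) set"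
  defines "\<sigma> \<equiv> \<lambda>q :: 'i \<times> nat. H (fst q) * real (snd q)"
    and "X \<equiv> \<lambda>J. {x \<in> {0..1}. \<forall>q\<in>J. x \<in> E (fst q) (snd q)}"
  assumes qm: "\<And>i. i \<in> I \<Longrightarrow> quasi_mixing C \<theta> (H i) (E i) (p i)" and C: "C \<ge> 1"
    and \<theta>: "0 < \<theta>" "\<theta> < 1"
    and a: "0 < a" and K: "0 < K" and H: "\<And>i. i \<in> I \<Longrightarrow> H i > 0"
    and L: "\<And>i. i \<in> I \<Longrightarrow> H i * real L \<le> K / 2"
    and "finite J" and "J \<subseteq> I \<times> {..N}" and "\<And>q. q \<in> J \<Longrightarrow> K \<le> \<sigma> q"
    and "\<And>q q'. q \<in> J \<Longrightarrow> q' \<in> J \<Longrightarrow> q \<noteq> q' \<Longrightarrow> K \<le> \<bar>\<sigma> q - \<sigma> q'\<bar>"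
    and "real (card J) \<le> c"
  defines "\<delta> \<equiv> C * ((real N + 1) / a\<^sup>2)"
  defines "\<epsilon> \<equiv> 2 * c * \<delta> + C * (c * C * exp (2 * a - K / 2) + (real N + 1) / a\<^sup>2 + \<theta> ^ L)"
  shows "X J \<in> sets unit_lebesgue \<and>
    (\<exists>S F. S \<in> sets unit_lebesgue \<and> breaks S F \<and>
      (\<forall>s. (\<forall>q\<in>J. \<sigma> q \<le> s) \<longrightarrow> real (card F) \<le> real (card J) * (C * exp (s + a))) \<and>
      unit.prob ((X J - S) \<union> (S - X J)) \<le> real (card J) * \<delta>) \<and>
    \<bar>unit.prob (X J) - (\<Prod>q\<in>J. p (fst q))\<bar> \<le> real (card J) * \<epsilon>"
  using assms(11-15)
\<comment> \<open>This rule inserts an element of maximal \<open>\<sigma>\<close>; the element may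
  already be present, whence the case distinction below.\<close>
proof (induction J rule: finite_ranking_induct[where f = \<sigma>])
  case empty
  have "breaks {0..1} {}" by (auto simp: breaks_def)
  moreover have "X {} = {0..1}" by (auto simp: X_def)
  moreover have "{0..1} \<in> sets unit_lebesgue" by (auto simp: sets_unit_lebesgue_iff)
  moreover have "unit.prob {0..1} = 1" using unit.prob_space by simp
  ultimately show ?case
    by (intro conjI exI[of _ "{0..1}"] exI[of _ "{}"]) (simp_all del: atLeastAtMost_iff)
next
  case (insert q J)
  show ?case
  proof (cases "q \<in> J")
    case True
    then have eq: "insert q J = J" by auto
    show ?thesis unfolding eq using insert.IH insert.prems unfolding eq by blast
  next
    case False
    obtain i n where q: "q = (i, n)" by (cases q)
    have i: "i \<in> I" and n: "n \<le> N" using insert.prems(1) q by auto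
    note qi = qm[OF i]
    have \<delta>0: "0 \<le> \<delta>" using C by (simp add: \<delta>_def)
    have cJ: "real (card J) + 1 \<le> c" using insert.prems(4) False insert.hyps by simp
    then have cJ': "real (card J) \<le> c" "0 \<le> c" by linarith+
    have "X J \<in> sets unit_lebesgue \<and> (\<exists>S F. S \<in> sets unit_lebesgue \<and> breaks S F \<and>
      (\<forall>s. (\<forall>q\<in>J. \<sigma> q \<le> s) \<longrightarrow> real (card F) \<le> real (card J) * (C * exp (s + a))) \<and>
      unit.prob ((X J - S) \<union> (S - X J)) \<le> real (card J) * \<delta>) \<and>
    \<bar>unit.prob (X J) - (\<Prod>q\<in>J. p (fst q))\<bar> \<le> real (card J) * \<epsilon>"
      using insert.prems cJ' by (intro insert.IH) auto
    then obtain S F where XJ: "X J \<in> sets unit_lebesgue" and S: "S \<in> sets unit_lebesgue" "breaks S F"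
      and cardF: "\<And>s. (\<forall>q\<in>J. \<sigma> q \<le> s) \<Longrightarrow> real (card F) \<le> real (card J) * (C * exp (s + a))"
      and XS: "unit.prob ((X J - S) \<union> (S - X J)) \<le> real (card J) * \<delta>"
      and IH: "\<bar>unit.prob (X J) - (\<Prod>q\<in>J. p (fst q))\<bar> \<le> real (card J) * \<epsilon>" by blast
    have E: "E i n \<in> sets unit_lebesgue" and p: "0 \<le> p i" "p i \<le> 1"
      using qi by (auto simp: quasi_mixing_def)
    obtain S' F' where S': "S' \<in> sets unit_lebesgue" "breaks S' F'"
      and cardF': "real (card F') \<le> C * exp (H i * real n + a)"
      and ES': "unit.prob ((E i n - S') \<union> (S' - E i n)) \<le> C * ((real n + 1) / a\<^sup>2)"
      using qi a unfolding quasi_mixing_def by blast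
    have n\<delta>: "(real n + 1) / a\<^sup>2 \<le> (real N + 1) / a\<^sup>2"
      using n by (intro divide_right_mono) auto
    have XX: "X (insert q J) = X J \<inter> E i n"
      using E by (auto simp: X_def q sets_unit_lebesgue_iff)
    have A: "X (insert q J) \<in> sets unit_lebesgue" using XX XJ E by auto
    have B: "unit.prob ((X J \<inter> E i n - S \<inter> S') \<union> (S \<inter> S' - X J \<inter> E i n)) \<le> (real (card J) + 1) * \<delta>"
    proof -
      have "unit.prob ((X J \<inter> E i n - S \<inter> S') \<union> (S \<inter> S' - X J \<inter> E i n)) \<le>
        unit.prob (((X J - S) \<union> (S - X J)) \<union> ((E i n - S') \<union> (S' - E i n)))"
        using XJ E S S' by (intro unit.finite_measure_mono) auto
      also have "\<dots> \<le> unit.prob ((X J - S) \<union> (S - X J)) + unit.prob ((E i n - S') \<union> (S' - E i n))"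
        using XJ E S S' by (intro measure_Un_le) auto
      also have "\<dots> \<le> real (card J) * \<delta> + C * ((real N + 1) / a\<^sup>2)"
        using XS ES' n\<delta> C mult_left_mono[OF n\<delta>, of C] by linarith
      finally show ?thesis by (simp only: \<delta>_def distrib_right mult_1)
    qed
    have D: "real (card (F \<union> F')) \<le> (real (card J) + 1) * (C * exp (s + a))"
      if s: "\<forall>q\<in>insert q J. \<sigma> q \<le> s" for s
    proof -
      have "real (card (F \<union> F')) \<le> real (card F) + real (card F')"
        using card_Un_le[of F F'] by linarith
      also have "real (card F) \<le> real (card J) * (C * exp (s + a))"
        using s by (intro cardF) auto
      also have "real (card F') \<le> C * exp (s + a)"
      proof -
        have "H i * real n \<le> s" using s by (auto simp: q \<sigma>_def)
        then have "C * exp (H i * real n + a) \<le> C * exp (s + a)" using C by (intro mult_left_mono) auto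
        then show ?thesis using cardF' by linarith
      qed
      finally show ?thesis by (simp add: algebra_simps)
    qed
    have far: "\<forall>q'\<in>J. \<sigma> q' \<le> H i * real n - K"
    proof
      fix q' assume q': "q' \<in> J"
      then have "\<sigma> q' \<le> \<sigma> q" "K \<le> \<bar>\<sigma> q - \<sigma> q'\<bar>"
        using insert.hyps insert.prems(3)[of q q'] False by auto
      then show "\<sigma> q' \<le> H i * real n - K" by (simp add: q \<sigma>_def)
    qed
    have Kn: "K \<le> H i * real n" using insert.prems(2)[of q] by (simp add: q \<sigma>_def)
    have "H i * real L \<le> H i * real n" using L[OF i] Kn K by linarith
    then have Ln: "L \<le> n" using H[OF i] by simp
    \<comment> \<open>The gap \<open>K\<close> is divided. The last \<open>L\<close> steps, worth at
      most \<open>K / 2\<close> on the scale of map \<open>i\<close>, are left to the mixing rate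
      \<open>\<theta> ^ L\<close>. With the rest, the number of breaks, of order
      \<open>exp (H i * n - K + a)\<close>, times the cylinder length
      \<open>exp (a - H i * m)\<close> is still only of order
      \<open>exp (2 * a - K / 2)\<close>.\<close>
    define m where "m = n - L"
    have m: "m \<le> n" "n - m = L" "real m = real n - real L" using Ln by (auto simp: m_def)
    have e: "(H i * real n - K + a) + (a - H i * real m) \<le> 2 * a - K / 2"
      using L[OF i] by (simp add: m algebra_simps)
    have "\<bar>unit.prob (X J \<inter> E i n) - unit.prob (X J) * p i\<bar> \<le>
          2 * (real (card J) * \<delta>) + C * (real (card J) * (C * exp (H i * real n - K + a)) * exp (a - H i * real m)
            + (real n + 1) / a\<^sup>2 + \<theta> ^ (n - m))"
      using C by (intro quasi_mixing_approx[OF qi _ XJ S cardF[OF far] XS m(1) a]) auto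
    also have "\<dots> \<le> \<epsilon>"
    proof -
      have "exp (H i * real n - K + a) * exp (a - H i * real m) \<le> exp (2 * a - K / 2)"
        unfolding exp_add[symmetric] using e by simp
      then have "real (card J) * (C * (exp (H i * real n - K + a) * exp (a - H i * real m)))
        \<le> c * (C * exp (2 * a - K / 2))"
        using cJ' C by (intro mult_mono) auto
      then have 1: "real (card J) * (C * exp (H i * real n - K + a)) * exp (a - H i * real m) \<le> c * C * exp (2 * a - K / 2)"
        by (simp add: mult.assoc)
      have 2: "2 * (real (card J) * \<delta>) \<le> 2 * c * \<delta>"
        using cJ' \<delta>0 mult_right_mono[OF cJ'(1) \<delta>0] by linarith
      have "C * (real (card J) * (C * exp (H i * real n - K + a)) * exp (a - H i * real m)
            + (real n + 1) / a\<^sup>2 + \<theta> ^ (n - m)) \<le>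
         C * (c * C * exp (2 * a - K / 2) + (real N + 1) / a\<^sup>2 + \<theta> ^ L)"
        unfolding m(2) using C by (intro mult_left_mono add_mono 1 n\<delta> order_refl) auto
      then show ?thesis unfolding \<epsilon>_def using 2 by linarith
    qed
    finally have G: "\<bar>unit.prob (X J \<inter> E i n) - unit.prob (X J) * p i\<bar> \<le> \<epsilon>" .
    have "\<bar>unit.prob (X J) - (\<Prod>q\<in>J. p (fst q))\<bar> * p i \<le> real (card J) * \<epsilon>"
      using p IH mult_left_le[of "p i" "\<bar>unit.prob (X J) - (\<Prod>q\<in>J. p (fst q))\<bar>"] by linarith
    then have "\<bar>unit.prob (X J) * p i - (\<Prod>q\<in>J. p (fst q)) * p i\<bar> \<le> real (card J) * \<epsilon>"
      using p by (metis abs_mult abs_of_nonneg left_diff_distrib)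
    moreover have "(\<Prod>q\<in>insert q J. p (fst q)) = (\<Prod>q\<in>J. p (fst q)) * p i"
      using False insert.hyps by (simp add: q)
    ultimately have G': "\<bar>unit.prob (X J \<inter> E i n) - (\<Prod>q\<in>insert q J. p (fst q))\<bar> \<le> (real (card J) + 1) * \<epsilon>"
      using G by (simp add: algebra_simps)
    have cc: "real (card (insert q J)) = real (card J) + 1" using False insert.hyps by simp
    show ?thesis
      unfolding cc
      using A B D G' S S' breaks_Int[OF S(2) S'(2)] unfolding XX by blast
  qed
qed

section \<open>Counting close scales, and the second moment of the number of joint
  occurrences\<close>

lemma card_nat_between:
  fixes u v :: real
  assumes "u \<le> v"
  shows "finite {n::nat. u < real n \<and> real n < v}" "real (card {n::nat. u < real n \<and> real n < v}) \<le> v - u + 1"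
proof -
  let ?A = "{n::nat. u < real n \<and> real n < v}"
  have "?A \<subseteq> {..nat \<lceil>v\<rceil>}" by (auto simp: le_nat_iff) linarith
  then show fin: "finite ?A" by (rule finite_subset) auto
  show "real (card ?A) \<le> v - u + 1"
  proof (cases "?A = {}")
    case True
    show ?thesis unfolding True using assms by simp
  next
    case False
    have "?A \<subseteq> {Min ?A..Max ?A}" using fin False by auto
    then have "card ?A \<le> card {Min ?A..Max ?A}" by (intro card_mono) auto
    moreover have "Min ?A \<in> ?A" "Max ?A \<in> ?A" using fin False by (auto intro: Min_in Max_in simp del: mem_Collect_eq)
    moreover have "Min ?A \<le> Max ?A" using fin False by (intro Min.coboundedI Max_in)
    ultimately have "card ?A \<le> Max ?A + 1 - Min ?A" "u < Min ?A" "Max ?A < v" by auto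
    then show ?thesis using \<open>Min ?A \<le> Max ?A\<close> by linarith
  qed
qed

lemma card_close_multiples:
  fixes h \<alpha> K :: real
  assumes "h > 0" "K \<ge> 0"
  shows "finite {n::nat. \<bar>\<alpha> - h * real n\<bar> < K}" "real (card {n::nat. \<bar>\<alpha> - h * real n\<bar> < K}) \<le> 2 * K / h + 1"
proof -
  have "{n::nat. \<bar>\<alpha> - h * real n\<bar> < K} = {n::nat. (\<alpha> - K) / h < real n \<and> real n < (\<alpha> + K) / h}"
    using assms by (auto simp: field_simps abs_less_iff)
  moreover have "(\<alpha> - K) / h \<le> (\<alpha> + K) / h" using assms by (intro divide_right_mono) auto
  ultimately show "finite {n::nat. \<bar>\<alpha> - h * real n\<bar> < K}"
      "real (card {n::nat. \<bar>\<alpha> - h * real n\<bar> < K}) \<le> 2 * K / h + 1"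
    using card_nat_between[of "(\<alpha> - K) / h" "(\<alpha> + K) / h"]
    by (auto simp: add_divide_distrib diff_divide_distrib)
qed

lemma card_le_by_fibres:
  fixes A :: "('a \<times> 'b) set"
  assumes "A \<subseteq> Sigma B f" "finite B" "\<And>x. x \<in> B \<Longrightarrow> finite (f x)" "\<And>x. x \<in> B \<Longrightarrow> real (card (f x)) \<le> M"
  shows "finite A" "real (card A) \<le> real (card B) * M"
proof -
  have fin: "finite (Sigma B f)" using assms by auto
  then show "finite A" using assms finite_subset by blast
  have "real (card A) \<le> real (card (Sigma B f))" using card_mono[OF fin assms(1)] by simp
  also have "\<dots> = (\<Sum>x\<in>B. real (card (f x)))" using assms by simp
  also have "\<dots> \<le> (\<Sum>x\<in>B. M)" using assms by (intro sum_mono) auto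
  finally show "real (card A) \<le> real (card B) * M" by simp
qed

lemma finite_common_lower_bound:
  fixes f :: "'a \<Rightarrow> real"
  assumes "finite A" "\<And>x. x \<in> A \<Longrightarrow> 0 < f x"
  obtains z where "z > 0" "z \<le> 1" "\<And>x. x \<in> A \<Longrightarrow> z \<le> f x"
proof
  show "Min (insert 1 (f ` A)) > 0" "Min (insert 1 (f ` A)) \<le> 1" using assms by auto
  show "\<And>x. x \<in> A \<Longrightarrow> Min (insert 1 (f ` A)) \<le> f x" using assms by auto
qed

lemma quasi_mixing_common:
  assumes "finite I" and "\<And>i. i \<in> I \<Longrightarrow> \<exists>C \<theta>. 0 < \<theta> \<and> \<theta> < 1 \<and> 0 \<le> C \<and> quasi_mixing C \<theta> (H i) (E i) (p i)"
  obtains C \<theta> where "C \<ge> 1" "0 < \<theta>" "\<theta> < 1" "\<And>i. i \<in> I \<Longrightarrow> quasi_mixing C \<theta> (H i) (E i) (p i)"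
proof -
  obtain C \<theta> where c: "\<And>i. i \<in> I \<Longrightarrow> 0 < \<theta> i \<and> \<theta> i < 1 \<and> 0 \<le> C i \<and> quasi_mixing (C i) (\<theta> i) (H i) (E i) (p i)"
    using assms(2) by metis
  define C' where "C' = Max (insert 1 (C ` I))"
  define \<theta>' where "\<theta>' = Max (insert (1/2) (\<theta> ` I))"
  have fin: "finite (insert 1 (C ` I))" "finite (insert (1/2) (\<theta> ` I))" using assms by auto
  have "1 \<le> C'" unfolding C'_def using fin(1) by (intro Max_ge) auto
  have "1/2 \<le> \<theta>'" unfolding \<theta>'_def using fin(2) by (intro Max_ge) auto
  have "\<theta>' \<in> insert (1/2) (\<theta> ` I)" unfolding \<theta>'_def using fin(2) by (intro Max_in) auto
  then have "\<theta>' < 1" using c by auto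
  have qm: "quasi_mixing C' \<theta>' (H i) (E i) (p i)" if i: "i \<in> I" for i
  proof (rule quasi_mixing_mono[of "C i" "\<theta> i"])
    show "C i \<le> C'" unfolding C'_def using fin i by (intro Max_ge) auto
    show "\<theta> i \<le> \<theta>'" unfolding \<theta>'_def using fin i by (intro Max_ge) auto
  qed (use c[OF i] in auto)
  show ?thesis
    using that[of C' \<theta>'] \<open>1 \<le> C'\<close> \<open>1/2 \<le> \<theta>'\<close> \<open>\<theta>' < 1\<close> qm by auto
qed

lemma bounded_by_inverse_square:
  fixes f :: "nat \<Rightarrow> real"
  assumes "(\<lambda>k. real k ^ 2 * f k) \<longlonglongrightarrow> 0"
  obtains B where "B \<ge> 0" "\<And>k. k \<ge> 1 \<Longrightarrow> f k \<le> B / real k ^ 2"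
proof -
  have "Bseq (\<lambda>k. real k ^ 2 * f k)" using assms by (intro convergent_imp_Bseq convergentI)
  then obtain B where B: "B > 0" "\<And>k. norm (real k ^ 2 * f k) \<le> B" by (auto simp: Bseq_def)
  have "f k \<le> B / real k ^ 2" if k: "k \<ge> 1" for k
    using B(2)[of k] k by (simp add: field_simps)
  then show ?thesis using that[of B] B by auto
qed

text \<open>Up to time \<open>N = k ^ 8\<close> all but \<open>O(N ^ 2 / k ^ 2)\<close> pairs of times have all their scales at
  mutual distance at least \<open>k ^ 6\<close>, while the fluctuation allowed for each scale is \<open>k ^ 5\<close>.\<close>

lemma joint_second_moment:
  fixes H p :: "'i \<Rightarrow> real" and E :: "'i \<Rightarrow> nat \<Rightarrow> real set"
  assumes I: "finite I" and C: "C \<ge> 1" "0 < \<theta>" "\<theta> < 1"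
    and qm: "\<And>i. i \<in> I \<Longrightarrow> quasi_mixing C \<theta> (H i) (E i) (p i)"
    and H: "\<And>i. i \<in> I \<Longrightarrow> H i > 0" and inj: "inj_on H I"
  defines "Z \<equiv> \<lambda>n x. indicat_real {x \<in> {0..1}. \<forall>i\<in>I. x \<in> E i n} x - (\<Prod>i\<in>I. p i)"
  shows "\<exists>B. \<forall>k\<ge>1. (\<integral>x. (\<Sum>n<k^8. Z n x)\<^sup>2 \<partial>unit_lebesgue) \<le> (real (k^8))\<^sup>2 * (B / real k ^ 2)"
proof -
  define P where "P = (\<Prod>i\<in>I. p i)"
  define X where "X n = {x \<in> {0..1}. \<forall>i\<in>I. x \<in> E i n}" for n
  have E: "E i n \<in> sets unit_lebesgue" and p: "0 \<le> p i" "p i \<le> 1" if "i \<in> I" for i n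
    using qm[OF that] by (auto simp: quasi_mixing_def)
  have P: "0 \<le> P" "P \<le> 1" unfolding P_def using p by (auto intro!: prod_nonneg prod_le_1)
  obtain z1 where z1: "z1 > 0" "z1 \<le> 1" "\<And>i. i \<in> I \<Longrightarrow> z1 \<le> H i"
    using finite_common_lower_bound[OF I, of H] H by metis
  obtain z2 where z2: "z2 > 0" "z2 \<le> 1"
    "\<And>q. q \<in> {q \<in> I \<times> I. fst q \<noteq> snd q} \<Longrightarrow> z2 \<le> \<bar>H (fst q) - H (snd q)\<bar>"
  proof (rule finite_common_lower_bound[of "{q \<in> I \<times> I. fst q \<noteq> snd q}" "\<lambda>q. \<bar>H (fst q) - H (snd q)\<bar>"])
    show "finite {q \<in> I \<times> I. fst q \<noteq> snd q}" using I by auto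
    show "0 < \<bar>H (fst q) - H (snd q)\<bar>" if "q \<in> {q \<in> I \<times> I. fst q \<noteq> snd q}" for q
      using that inj_onD[OF inj, of "fst q" "snd q"] by auto
  qed blast
  \<comment> \<open>One bound from below for all entropies and for all differences of two of them.
    From \<open>K \<le> z * n\<close> it follows that at time \<open>n\<close> every scale is at
    least \<open>K\<close> and any two of them are at least \<open>K\<close> apart.\<close>
  define z where "z = min z1 z2"
  have z: "z > 0" "z \<le> 1" "\<And>i. i \<in> I \<Longrightarrow> z \<le> H i"
    "\<And>i j. i \<in> I \<Longrightarrow> j \<in> I \<Longrightarrow> i \<noteq> j \<Longrightarrow> z \<le> \<bar>H i - H j\<bar>"
  proof -
    show "z > 0" "z \<le> 1" using z1(1,2) z2(1,2) by (auto simp: z_def)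
    show "z \<le> H i" if "i \<in> I" for i using z1(3)[OF that] by (simp add: z_def min.coboundedI1)
    show "z \<le> \<bar>H i - H j\<bar>" if "i \<in> I" "j \<in> I" "i \<noteq> j" for i j
      using z2(3)[of "(i, j)"] that by (simp add: z_def min.coboundedI2)
  qed
  define h where "h = Max (insert 1 (H ` I))"
  have h: "1 \<le> h" "\<And>i. i \<in> I \<Longrightarrow> H i \<le> h" using I by (auto simp: h_def)
  \<comment> \<open>Two times and \<open>card I\<close> maps give at most this many events to
    decouple.\<close>
  define c where "c = 2 * real (card I)"
  have c0: "0 \<le> c" by (simp add: c_def)
  obtain B1 where B1: "B1 \<ge> 0" "\<And>k. k \<ge> 1 \<Longrightarrow> exp (2 * real k ^ 5 - real k ^ 6 / 2) \<le> B1 / real k ^ 2"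
  proof (rule bounded_by_inverse_square[of "\<lambda>k. exp (2 * real k ^ 5 - real k ^ 6 / 2)"])
    show "(\<lambda>k. real k ^ 2 * exp (2 * real k ^ 5 - real k ^ 6 / 2)) \<longlonglongrightarrow> 0" by real_asymp
  qed blast
  define \<gamma> where "\<gamma> = - ln \<theta>"
  have \<gamma>: "\<gamma> > 0" "\<theta> = exp (- \<gamma>)" using C by (auto simp: \<gamma>_def)
  obtain B2 where B2: "B2 \<ge> 0" "\<And>k. k \<ge> 1 \<Longrightarrow> exp (- \<gamma> * (real k ^ 6 / (2 * h) - 1)) \<le> B2 / real k ^ 2"
  proof (rule bounded_by_inverse_square[of "\<lambda>k. exp (- \<gamma> * (real k ^ 6 / (2 * h) - 1))"])
    have "h > 0" using h by simp
    with \<gamma>(1) show "(\<lambda>k. real k ^ 2 * exp (- \<gamma> * (real k ^ 6 / (2 * h) - 1))) \<longlonglongrightarrow> 0" by real_asymp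
  qed blast
  define B3 where "B3 = c * (2 * c * (C * 2) + C * (c * C * B1 + 2 + B2))"
  have B3: "0 \<le> B3" using c0 C B1 B2 by (auto simp: B3_def)
  define B4 where "B4 = (2 + (real (card I))\<^sup>2) * (3 / z)"
  have "(\<integral>x. (\<Sum>n<k^8. Z n x)\<^sup>2 \<partial>unit_lebesgue) \<le> (real (k^8))\<^sup>2 * ((3 * B3 + B4) / real k ^ 2)"
    if k: "k \<ge> 1" for k
  proof -
    \<comment> \<open>The three exponents are tuned so that every error is of order
      \<open>1 / k ^ 2\<close>, hence summable: \<open>(N + 1) / a\<^sup>2\<close> by the choice of
      \<open>a\<close>; \<open>exp (2 * a - K / 2)\<close> and \<open>\<theta> ^ L\<close> because
      \<open>K\<close> outgrows both \<open>a\<close> and every logarithm of \<open>k\<close>; the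
      proportion of bad pairs because it is comparable to \<open>K / N\<close>.\<close>
    define N where "N = k ^ 8"
    define K where "K = real k ^ 6"
    define a where "a = real k ^ 5"
    define L where "L = nat \<lfloor>K / (2 * h)\<rfloor>"
    have k1: "real k \<ge> 1" using k by simp
    have K1: "K \<ge> 1" unfolding K_def using k1 by (intro one_le_power) auto
    have a0: "a > 0" unfolding a_def using k by simp
    have N1: "N \<ge> 1" unfolding N_def using k by simp
    have L: "H i * real L \<le> K / 2" if i: "i \<in> I" for i
    proof -
      have "0 \<le> K / (2 * h)" using K1 h by (intro divide_nonneg_pos) auto
      then have "real L \<le> K / (2 * h)" unfolding L_def by linarith
      then have "H i * real L \<le> h * (K / (2 * h))" using h(2)[OF i] h(1) H[OF i] by (intro mult_mono) auto
      then show ?thesis using h(1) by simp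
    qed
    have Lge: "\<theta> ^ L \<le> B2 / real k ^ 2"
    proof -
      have "real L \<ge> K / (2 * h) - 1" unfolding L_def by linarith
      then have "- \<gamma> * real L \<le> - \<gamma> * (K / (2 * h) - 1)" using \<gamma>(1) by (intro mult_left_mono_neg) auto
      then have "exp (real L * (- \<gamma>)) \<le> exp (- \<gamma> * (K / (2 * h) - 1))" by (simp add: mult.commute)
      then show ?thesis using B2(2)[OF k] unfolding \<gamma>(2) exp_of_nat_mult[symmetric] K_def by linarith
    qed
    have Na: "(real N + 1) / a\<^sup>2 \<le> 2 / real k ^ 2"
    proof -
      have "real N + 1 \<le> 2 * real k ^ 8" using one_le_power[OF k1, of 8] by (simp add: N_def)
      then have "(real N + 1) / a\<^sup>2 \<le> 2 * real k ^ 8 / a\<^sup>2" by (intro divide_right_mono) auto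
      also have "\<dots> = (real k ^ 8 * 2) / (real k ^ 8 * real k ^ 2)"
        by (simp add: a_def power_mult[symmetric] power_add[symmetric])
      also have "\<dots> = 2 / real k ^ 2" by (rule mult_divide_mult_cancel_left) (use k in auto)
      finally show ?thesis .
    qed
    define \<epsilon> where "\<epsilon> = 2 * c * (C * ((real N + 1) / a\<^sup>2)) +
        C * (c * C * exp (2 * a - K / 2) + (real N + 1) / a\<^sup>2 + \<theta> ^ L)"
    have \<epsilon>: "c * \<epsilon> \<le> B3 / real k ^ 2" and \<epsilon>0: "0 \<le> \<epsilon>"
    proof -
      have "\<epsilon> \<le> 2 * c * (C * (2 / real k ^ 2)) + C * (c * C * (B1 / real k ^ 2) + 2 / real k ^ 2 + B2 / real k ^ 2)"
        unfolding \<epsilon>_def using Na Lge B1(2)[OF k] C c0 unfolding a_def K_def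
        by (intro add_mono mult_left_mono) auto
      also have "\<dots> = (2 * c * (C * 2) + C * (c * C * B1 + 2 + B2)) / real k ^ 2"
        by (simp add: add_divide_distrib distrib_left)
      finally have "c * \<epsilon> \<le> c * ((2 * c * (C * 2) + C * (c * C * B1 + 2 + B2)) / real k ^ 2)"
        using c0 by (rule mult_left_mono)
      then show "c * \<epsilon> \<le> B3 / real k ^ 2" by (simp add: B3_def)
      show "0 \<le> \<epsilon>" unfolding \<epsilon>_def using C c0 by (intro add_nonneg_nonneg mult_nonneg_nonneg) auto
    qed
    \<comment> \<open>The last clause separates the scales of the two times, also for
      \<open>i = j\<close>. Different maps at one and the same time are separated by
      \<open>K / z \<le> real n\<close>, through the choice of \<open>z\<close>.\<close>
    define good where "good = {(n, m). n < N \<and> m < N \<and> K / z \<le> real n \<and> K / z \<le> real m \<and>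
        (\<forall>i\<in>I. \<forall>j\<in>I. K \<le> \<bar>H i * real n - H j * real m\<bar>)}"
    have scale: "K \<le> H i * real n" if "i \<in> I" "K / z \<le> real n" for i n
    proof -
      have "K \<le> z * real n" using that(2) z(1) by (simp add: field_simps)
      also have "\<dots> \<le> H i * real n" using z(3)[OF that(1)] by (intro mult_right_mono) auto
      finally show ?thesis .
    qed
    have sep: "K \<le> \<bar>H i * real n - H j * real n\<bar>" if "i \<in> I" "j \<in> I" "i \<noteq> j" "K / z \<le> real n" for i j n
    proof -
      have "K \<le> z * real n" using that(4) z(1) by (simp add: field_simps)
      also have "\<dots> \<le> \<bar>H i - H j\<bar> * real n" using z(4)[OF that(1-3)] by (intro mult_right_mono) auto
      also have "\<dots> = \<bar>H i * real n - H j * real n\<bar>" by (simp add: abs_mult left_diff_distrib[symmetric])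
      finally show ?thesis .
    qed
    have mix: "{x \<in> {0..1}. \<forall>q\<in>J. x \<in> E (fst q) (snd q)} \<in> sets unit_lebesgue \<and>
       \<bar>unit.prob {x \<in> {0..1}. \<forall>q\<in>J. x \<in> E (fst q) (snd q)} - (\<Prod>q\<in>J. p (fst q))\<bar> \<le> B3 / real k ^ 2"
      if J: "J \<subseteq> I \<times> {..N}" "real (card J) \<le> c" "\<And>q. q \<in> J \<Longrightarrow> K / z \<le> real (snd q)"
        "\<And>q q'. q \<in> J \<Longrightarrow> q' \<in> J \<Longrightarrow> q \<noteq> q' \<Longrightarrow> K \<le> \<bar>H (fst q) * real (snd q) - H (fst q') * real (snd q')\<bar>" for J
    proof -
      have fJ: "finite J" using J(1) I finite_subset by blast
      have "K \<le> H (fst q) * real (snd q)" if q: "q \<in> J" for q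
        using scale[of "fst q" "snd q"] J(1,3) q by auto
      from joint_mixing[OF qm C a0 _ H L fJ J(1) this J(4) J(2)] K1
      have "{x \<in> {0..1}. \<forall>q\<in>J. x \<in> E (fst q) (snd q)} \<in> sets unit_lebesgue"
        "\<bar>unit.prob {x \<in> {0..1}. \<forall>q\<in>J. x \<in> E (fst q) (snd q)} - (\<Prod>q\<in>J. p (fst q))\<bar> \<le> real (card J) * \<epsilon>"
        unfolding \<epsilon>_def by auto
      moreover have "real (card J) * \<epsilon> \<le> c * \<epsilon>" using J(2) \<epsilon>0 by (rule mult_right_mono)
      ultimately show ?thesis using \<epsilon> by auto
    qed
    have XnE: "X n = {x \<in> {0..1}. \<forall>q\<in>I \<times> {n}. x \<in> E (fst q) (snd q)}" for n
      by (auto simp: X_def)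
    have Xs: "X n \<in> sets unit_lebesgue" for n
    proof -
      have "X n = {0..1} \<inter> (\<Inter>i\<in>I. E i n)" if "I \<noteq> {}" using that by (auto simp: X_def)
      moreover have "X n = {0..1}" if "I = {}" using that by (auto simp: X_def)
      moreover have "(\<Inter>i\<in>I. E i n) \<in> sets unit_lebesgue" if "I \<noteq> {}" using that I E by (intro sets.finite_INT) auto
      moreover have "{0..1} \<in> sets unit_lebesgue" by (simp add: sets_unit_lebesgue_iff)
      ultimately show ?thesis by (cases "I = {}") auto
    qed
    have Zdef: "Z n x = indicat_real (X n) x - P" for n x by (simp add: Z_def X_def P_def)
    have ZZ: "Z n x * Z m x = indicat_real (X n \<inter> X m) x - P * indicat_real (X n) x - P * indicat_real (X m) x + P\<^sup>2" for n m x
      unfolding Zdef by (simp add: indicator_inter_arith power2_eq_square algebra_simps)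
    have iZZ: "integrable unit_lebesgue (\<lambda>x. Z n x * Z m x)" for n m
      unfolding ZZ using Xs by (auto intro!: Bochner_Integration.integrable_add Bochner_Integration.integrable_diff
          integrable_indicator_unit_lebesgue integrable_mult_right)
    have vZZ: "(\<integral>x. Z n x * Z m x \<partial>unit_lebesgue) =
        unit.prob (X n \<inter> X m) - P * unit.prob (X n) - P * unit.prob (X m) + P\<^sup>2" for n m
    proof -
      note i = integrable_indicator_unit_lebesgue
      have "{0..1} \<inter> X n = X n" "{0..1} \<inter> X n \<inter> X m = X n \<inter> X m" for n m by (auto simp: X_def)
      then show ?thesis
        unfolding ZZ using Xs i[of "X n"] i[of "X m"] i[of "X n \<inter> X m"]
        by (simp add: Int_ac unit.prob_space)
    qed
    \<comment> \<open>In the expanded covariance each of the three terms that involve a probability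
      is within \<open>B3 / k ^ 2\<close> of plus or minus \<open>P\<^sup>2\<close>, and the
      multiples of \<open>P\<^sup>2\<close> cancel.\<close>
    have g: "(\<integral>x. Z n x * Z m x \<partial>unit_lebesgue) \<le> 3 * B3 / real k ^ 2" if nm: "(n, m) \<in> good" for n m
    proof -
      have ne: "n \<noteq> m" if "I \<noteq> {}" using nm that K1 by (force simp: good_def)
      have cI: "card (I \<times> {n}) = card I" "card (I \<times> {m}) = card I" by (auto simp: card_cartesian_product)
      have single: "\<bar>unit.prob (X l) - P\<bar> \<le> B3 / real k ^ 2" if "l \<in> {n, m}" for l
      proof -
        have "\<bar>unit.prob (X l) - (\<Prod>q\<in>I \<times> {l}. p (fst q))\<bar> \<le> B3 / real k ^ 2"
          unfolding XnE
        proof (rule conjunct2[OF mix])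
          show "real (card (I \<times> {l})) \<le> c" by (simp add: card_cartesian_product c_def)
          show "K \<le> \<bar>H (fst q) * real (snd q) - H (fst q') * real (snd q')\<bar>"
            if "q \<in> I \<times> {l}" "q' \<in> I \<times> {l}" "q \<noteq> q'" for q q'
            using that sep[of "fst q" "fst q'" l] nm \<open>l \<in> {n, m}\<close> by (cases q; cases q') (auto simp: good_def)
        qed (use that nm in \<open>auto simp: good_def\<close>)
        moreover have "(\<Prod>q\<in>I \<times> {l}. p (fst q)) = (\<Prod>i\<in>I. \<Prod>j\<in>{l}. p i)"
          by (simp only: prod.cartesian_product case_prod_unfold)
        moreover have "\<dots> = P" by (simp add: P_def)
        ultimately show ?thesis by simp
      qed
      have pair: "\<bar>unit.prob (X n \<inter> X m) - P\<^sup>2\<bar> \<le> B3 / real k ^ 2"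
      proof (cases "I = {}")
        case True
        then have "X n = {0..1}" for n by (auto simp: X_def)
        then show ?thesis using True unit.prob_space B3 by (simp add: P_def)
      next
        case False
        have "\<bar>unit.prob {x \<in> {0..1}. \<forall>q\<in>I \<times> {n, m}. x \<in> E (fst q) (snd q)} - (\<Prod>q\<in>I \<times> {n, m}. p (fst q))\<bar> \<le> B3 / real k ^ 2"
        proof (rule conjunct2[OF mix])
          show "real (card (I \<times> {n, m})) \<le> c" using ne[OF False] by (simp add: card_cartesian_product c_def)
          show "K \<le> \<bar>H (fst q) * real (snd q) - H (fst q') * real (snd q')\<bar>"
            if "q \<in> I \<times> {n, m}" "q' \<in> I \<times> {n, m}" "q \<noteq> q'" for q q'
          proof -
            obtain i l j l' where q: "q = (i, l)" "q' = (j, l')" "i \<in> I" "j \<in> I" "l \<in> {n, m}" "l' \<in> {n, m}"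
              using \<open>q \<in> I \<times> {n, m}\<close> \<open>q' \<in> I \<times> {n, m}\<close> by (cases q, cases q') auto
            have gd: "\<And>i j. i \<in> I \<Longrightarrow> j \<in> I \<Longrightarrow> K \<le> \<bar>H i * real n - H j * real m\<bar>" "K / z \<le> real n" "K / z \<le> real m"
              using nm by (auto simp: good_def)
            show ?thesis
            proof (cases "l = l'")
              case True
              then show ?thesis using q \<open>q \<noteq> q'\<close> sep[of i j l] gd(2,3) by auto
            next
              case False
              then show ?thesis using q gd(1)[of i j] gd(1)[of j i] abs_minus_commute[of "H i * real m"] by auto
            qed
          qed
        qed (use nm in \<open>auto simp: good_def\<close>)
        moreover have "{x \<in> {0..1}. \<forall>q\<in>I \<times> {n, m}. x \<in> E (fst q) (snd q)} = X n \<inter> X m"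
          by (auto simp: X_def)
        moreover have "(\<Prod>q\<in>I \<times> {n, m}. p (fst q)) = (\<Prod>i\<in>I. \<Prod>j\<in>{n, m}. p i)"
          by (simp only: prod.cartesian_product case_prod_unfold)
        moreover have "\<dots> = P\<^sup>2"
          using ne[OF False] by (simp add: P_def power2_eq_square prod.distrib)
        ultimately show ?thesis by simp
      qed
      have "\<bar>P * unit.prob (X l) - P * P\<bar> \<le> B3 / real k ^ 2" if l: "l \<in> {n, m}" for l
      proof -
        have "\<bar>P * unit.prob (X l) - P * P\<bar> = P * \<bar>unit.prob (X l) - P\<bar>"
          using P by (simp add: abs_mult right_diff_distrib[symmetric])
        also have "\<dots> \<le> \<bar>unit.prob (X l) - P\<bar>" using P by (intro mult_left_le_one_le) auto
        finally show ?thesis using single[OF l] by linarith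
      qed
      from this[of n] this[of m] pair show ?thesis
        unfolding vZZ by (simp add: power2_eq_square abs_le_iff)
    qed
    have le1: "(\<integral>x. Z n x * Z m x \<partial>unit_lebesgue) \<le> 1" for n m
    proof -
      have "\<bar>Z n x\<bar> \<le> 1" for n x
        using P by (auto simp: Z_def X_def[symmetric] P_def[symmetric] indicator_def)
      then have "\<bar>Z n x * Z m x\<bar> \<le> 1" for x unfolding abs_mult by (intro mult_le_one) auto
      then have "Z n x * Z m x \<le> 1" for x by (rule abs_le_D1)
      then have "(\<integral>x. Z n x * Z m x \<partial>unit_lebesgue) \<le> (\<integral>x. 1 \<partial>unit_lebesgue)"
        using iZZ by (intro integral_mono) auto
      then show ?thesis by simp
    qed
    define bad where "bad = {..<N} \<times> {..<N} - good"
    have bad: "real (card bad) \<le> (real N)\<^sup>2 * (B4 / real k ^ 2)"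
    proof -
      let ?s = "{n::nat. \<bar>0 - 1 * real n\<bar> < K / z}"
      define b1 where "b1 = {..<N} \<times> ?s"
      define b2 where "b2 = ?s \<times> {..<N}"
      \<comment> \<open>For fixed \<open>n\<close> at most \<open>2 * K / H j + 1\<close> times
        \<open>m\<close> have a scale within \<open>K\<close> of \<open>H i * n\<close>. So every
        kind of bad pair, like those with one early time in \<open>b1\<close> and \<open>b2\<close>,
        has at most \<open>N * M\<close> members with \<open>M\<close> proportional to
        \<open>K\<close>.\<close>
      define b3 where "b3 = (\<lambda>(i, j). Sigma {..<N} (\<lambda>n. {m::nat. \<bar>H i * real n - H j * real m\<bar> < K}))"
      define M where "M = 3 * K / z"
      have Kz: "K / z \<ge> 1" using K1 z(1,2) by (simp add: field_simps)
      have s: "finite ?s" "real (card ?s) \<le> M"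
        using card_close_multiples[of 1 "K / z" 0] Kz by (auto simp: M_def)
      have c3: "finite (b3 q) \<and> real (card (b3 q)) \<le> real N * M" if q: "q \<in> I \<times> I" for q
      proof -
        obtain i j where ij: "q = (i, j)" "i \<in> I" "j \<in> I" using q by auto
        have "2 * K / H j + 1 \<le> M"
        proof -
          have "2 * K / H j \<le> 2 * K / z" using z(3)[OF ij(3)] z(1) K1 by (intro divide_left_mono) (auto intro: mult_pos_pos H ij)
          then show ?thesis using Kz by (simp add: M_def)
        qed
        then have "finite (b3 q)" "real (card (b3 q)) \<le> real (card {..<N}) * M"
          using card_le_by_fibres[of "b3 q" "{..<N}" "\<lambda>n. {m::nat. \<bar>H i * real n - H j * real m\<bar> < K}" M]
            card_close_multiples[OF H[OF ij(3)], of K] K1 unfolding ij(1) b3_def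
          by (auto intro: order_trans)
        then show ?thesis by simp
      qed
      have "bad \<subseteq> b1 \<union> b2 \<union> (\<Union>q\<in>I \<times> I. b3 q)"
        by (auto simp: bad_def good_def b1_def b2_def b3_def not_le)
      moreover have fin: "finite (b1 \<union> b2 \<union> (\<Union>q\<in>I \<times> I. b3 q))"
        using s c3 I by (auto simp: b1_def b2_def simp del: diff_0)
      ultimately have "card bad \<le> card (b1 \<union> b2 \<union> (\<Union>q\<in>I \<times> I. b3 q))" by (intro card_mono)
      also have "\<dots> \<le> card b1 + card b2 + (\<Sum>q\<in>I \<times> I. card (b3 q))"
      proof -
        have "card (\<Union>q\<in>I \<times> I. b3 q) \<le> (\<Sum>q\<in>I \<times> I. card (b3 q))" using I by (intro card_UN_le) auto
        then show ?thesis
          using card_Un_le[of "b1 \<union> b2" "\<Union>q\<in>I \<times> I. b3 q"] card_Un_le[of b1 b2] by linarith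
      qed
      finally have "real (card bad) \<le> real (card b1) + real (card b2) + (\<Sum>q\<in>I \<times> I. real (card (b3 q)))"
        by (metis of_nat_add of_nat_le_iff of_nat_sum)
      also have "real (card b1) \<le> real N * M"
        unfolding b1_def card_cartesian_product of_nat_mult card_lessThan using s(2) by (rule mult_left_mono) simp
      also have "real (card b2) \<le> real N * M"
        unfolding b2_def card_cartesian_product of_nat_mult card_lessThan mult.commute[of _ "real N"]
        using s(2) by (rule mult_left_mono) simp
      also have "(\<Sum>q\<in>I \<times> I. real (card (b3 q))) \<le> (\<Sum>q\<in>I \<times> I. real N * M)"
        using c3 by (intro sum_mono) auto
      finally have "real (card bad) \<le> (2 + (real (card I))\<^sup>2) * (real N * M)"
        by (simp add: card_cartesian_product power2_eq_square algebra_simps)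
      also have "\<dots> = real N * (B4 * K)" by (simp add: M_def B4_def field_simps)
      also have "B4 * K = real N * (B4 / real k ^ 2)"
      proof -
        have "real N = K * real k ^ 2" by (simp add: K_def N_def power_add[symmetric])
        then show ?thesis using k1 by simp
      qed
      finally show ?thesis by (simp add: power2_eq_square mult.assoc)
    qed
    have "(\<integral>x. (\<Sum>n<N. Z n x)\<^sup>2 \<partial>unit_lebesgue) = (\<integral>x. (\<Sum>n<N. \<Sum>m<N. Z n x * Z m x) \<partial>unit_lebesgue)"
      by (simp add: power2_eq_square sum_product)
    also have "\<dots> = (\<Sum>n<N. \<Sum>m<N. (\<integral>x. Z n x * Z m x \<partial>unit_lebesgue))"
      using iZZ by (simp add: Bochner_Integration.integral_sum)
    also have "\<dots> = (\<Sum>q\<in>{..<N} \<times> {..<N}. (\<integral>x. Z (fst q) x * Z (snd q) x \<partial>unit_lebesgue))"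
      by (simp add: sum.cartesian_product case_prod_unfold)
    also have "\<dots> \<le> (\<Sum>q\<in>{..<N} \<times> {..<N}. 3 * B3 / real k ^ 2 + (if q \<in> bad then 1 else 0))"
    proof (rule sum_mono)
      fix q assume q: "q \<in> {..<N} \<times> {..<N}"
      show "(\<integral>x. Z (fst q) x * Z (snd q) x \<partial>unit_lebesgue) \<le> 3 * B3 / real k ^ 2 + (if q \<in> bad then 1 else 0)"
      proof (cases "q \<in> good")
        case True then show ?thesis using g[of "fst q" "snd q"] by (auto simp: bad_def)
      next
        case False then show ?thesis using le1[of "fst q" "snd q"] q B3 by (auto simp: bad_def add_increasing)
      qed
    qed
    also have "\<dots> = (real N)\<^sup>2 * (3 * B3 / real k ^ 2) + real (card bad)"
    proof -
      have "({..<N} \<times> {..<N}) \<inter> {q. q \<in> bad} = bad" by (auto simp: bad_def)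
      then show ?thesis by (simp add: sum.distrib sum.If_cases card_cartesian_product power2_eq_square)
    qed
    also have "\<dots> \<le> (real N)\<^sup>2 * (3 * B3 / real k ^ 2) + (real N)\<^sup>2 * (B4 / real k ^ 2)"
      using bad by simp
    also have "\<dots> = (real N)\<^sup>2 * ((3 * B3 + B4) / real k ^ 2)"
      by (simp add: add_divide_distrib distrib_left)
    finally show ?thesis by (simp add: N_def)
  qed
  then show ?thesis by blast
qed

theorem AE_joint_frequency:
  fixes H p :: "'i \<Rightarrow> real" and E :: "'i \<Rightarrow> nat \<Rightarrow> real set"
  assumes I: "finite I"
    and qm: "\<And>i. i \<in> I \<Longrightarrow> \<exists>C \<theta>. 0 < \<theta> \<and> \<theta> < 1 \<and> 0 \<le> C \<and> quasi_mixing C \<theta> (H i) (E i) (p i)"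
    and H: "\<And>i. i \<in> I \<Longrightarrow> H i > 0" and inj: "inj_on H I"
  shows "AE x in unit_lebesgue. (\<lambda>N. real (card {n. n < N \<and> (\<forall>i\<in>I. x \<in> E i n)}) / real N) \<longlonglongrightarrow> (\<Prod>i\<in>I. p i)"
proof -
  obtain C \<theta> where C: "C \<ge> 1" "0 < \<theta>" "\<theta> < 1" "\<And>i. i \<in> I \<Longrightarrow> quasi_mixing C \<theta> (H i) (E i) (p i)"
    using quasi_mixing_common[where H = H and E = E and p = p, OF I qm] by blast
  define P where "P = (\<Prod>i\<in>I. p i)"
  define X where "X n = {x \<in> {0..1}. \<forall>i\<in>I. x \<in> E i n}" for n
  define Z where "Z n x = indicat_real (X n) x - P" for n x
  obtain B where B: "\<And>k. k \<ge> 1 \<Longrightarrow> (\<integral>x. (\<Sum>n<k^8. Z n x)\<^sup>2 \<partial>unit_lebesgue) \<le> (real (k^8))\<^sup>2 * (B / real k ^ 2)"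
    using joint_second_moment[OF I C H inj] unfolding Z_def X_def P_def by blast
  have E: "E i n \<in> sets unit_lebesgue" if "i \<in> I" for i n
    using C(4)[OF that] by (auto simp: quasi_mixing_def)
  have Xs: "X n \<in> sets unit_lebesgue" for n
  proof -
    have "X n = {0..1} \<inter> (\<Inter>i\<in>I. E i n)" if "I \<noteq> {}" using that by (auto simp: X_def)
    moreover have "X n = {0..1}" if "I = {}" using that by (auto simp: X_def)
    moreover have "(\<Inter>i\<in>I. E i n) \<in> sets unit_lebesgue" if "I \<noteq> {}" using that I E by (intro sets.finite_INT) auto
    moreover have "{0..1} \<in> sets unit_lebesgue" by (simp add: sets_unit_lebesgue_iff)
    ultimately show ?thesis by (cases "I = {}") auto
  qed
  have P: "0 \<le> P" "P \<le> 1" unfolding P_def using C(4) by (auto intro!: prod_nonneg prod_le_1 simp: quasi_mixing_def)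
  have Z1: "\<bar>Z n x\<bar> \<le> 1" for n x using P by (auto simp: Z_def indicator_def)
  have Zm: "Z n \<in> borel_measurable unit_lebesgue" for n unfolding Z_def using Xs by measurable
  define f where "f k x = ((\<Sum>n<(k+1)^8. Z n x) / real ((k+1)^8))\<^sup>2" for k x
  have "AE x in unit_lebesgue. (\<lambda>k. f k x) \<longlonglongrightarrow> 0"
  proof (rule unit.AE_summable_integral_tendsto_zero)
    show "integrable unit_lebesgue (f k)" for k
    proof (rule unit.integrable_const_bound[where B = 1])
      have "\<bar>\<Sum>n<(k+1)^8. Z n x\<bar> \<le> (\<Sum>n<(k+1)^8. 1)" for x
        using Z1 by (intro order_trans[OF sum_abs] sum_mono) auto
      then have "\<bar>(\<Sum>n<(k+1)^8. Z n x) / real ((k+1)^8)\<bar> \<le> 1" for x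
        by (simp add: abs_divide divide_le_eq_1 del: of_nat_power of_nat_add)
      then have "f k x \<le> 1" for x unfolding f_def abs_square_le_1 .
      moreover have "0 \<le> f k x" for x by (simp add: f_def)
      ultimately show "AE x in unit_lebesgue. norm (f k x) \<le> 1" by (intro AE_I2) simp
      show "f k \<in> borel_measurable unit_lebesgue" unfolding f_def using Zm by measurable
    qed
    show "0 \<le> f k x" for k x by (simp add: f_def)
    show "(\<integral>x. f k x \<partial>unit_lebesgue) \<le> B * (1 / real (k+1) ^ 2)" for k
    proof -
      have "(\<integral>x. f k x \<partial>unit_lebesgue) = (\<integral>x. (\<Sum>n<(k+1)^8. Z n x)\<^sup>2 \<partial>unit_lebesgue) / (real ((k+1)^8))\<^sup>2"
        unfolding f_def power_divide by simp
      also have "\<dots> \<le> (real ((k+1)^8))\<^sup>2 * (B / real (k+1) ^ 2) / (real ((k+1)^8))\<^sup>2"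
        by (intro divide_right_mono B) auto
      also have "\<dots> = B * (1 / real (k+1) ^ 2)" by (simp del: of_nat_power of_nat_add)
      finally show ?thesis .
    qed
    show "summable (\<lambda>k. B * (1 / real (k+1) ^ 2))"
      using inverse_squares_sums by (intro summable_mult) (auto simp: sums_iff add.commute)
  qed
  then show ?thesis
  proof (rule AE_mp, intro AE_I2 impI)
    fix x :: real assume "x \<in> space unit_lebesgue" and lim: "(\<lambda>k. f k x) \<longlonglongrightarrow> 0"
    then have x: "x \<in> {0..1}" by simp
    define c where "c N = card {n. n < N \<and> (\<forall>i\<in>I. x \<in> E i n)}" for N
    have Zc: "(\<Sum>n<N. Z n x) = real (c N) - real N * P" for N
    proof -
      have "{n. n < N \<and> (\<forall>i\<in>I. x \<in> E i n)} = {..<N} \<inter> {n. x \<in> X n}" using x by (auto simp: X_def)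
      then show ?thesis by (simp add: Z_def sum_subtractf c_def indicator_def sum.If_cases)
    qed
    have "(\<lambda>k. sqrt (f k x)) \<longlonglongrightarrow> 0" using tendsto_real_sqrt[OF lim] by simp
    then have "(\<lambda>k. (\<Sum>n<(k+1)^8. Z n x) / real ((k+1)^8)) \<longlonglongrightarrow> 0"
      unfolding f_def real_sqrt_abs by (rule tendsto_rabs_zero_cancel)
    moreover have "(\<Sum>n<(k+1)^8. Z n x) / real ((k+1)^8) = real (c ((k+1)^8)) / real ((k+1)^8) - P" for k
      unfolding Zc by (simp add: diff_divide_distrib del: of_nat_power of_nat_add)
    ultimately have "(\<lambda>k. real (c ((k+1)^8)) / real ((k+1)^8) - P) \<longlonglongrightarrow> 0" by simp
    then have "(\<lambda>k. real (c ((k+1)^8)) / real ((k+1)^8)) \<longlonglongrightarrow> P" by (rule LIM_zero_cancel)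
    moreover have "mono c" unfolding c_def by (intro monoI card_mono) auto
    ultimately have "(\<lambda>N. real (c N) / real N) \<longlonglongrightarrow> P"
      by (intro frequency_tendsto_from_subsequence[of c 8]) auto
    then show "(\<lambda>N. real (card {n. n < N \<and> (\<forall>i\<in>I. x \<in> E i n)}) / real N) \<longlonglongrightarrow> (\<Prod>i\<in>I. p i)"
      unfolding c_def P_def .
  qed
qed

section \<open>Transfer operators of expanding maps\<close>

text \<open>\<open>\<phi> k\<close> is the inverse branch of \<open>T\<close> for the digit \<open>k\<close> and \<open>w k\<close> its Jacobian, extended by 0
  outside the range of the branch. The set \<open>X\<close> is \<open>[0, 1)\<close> or \<open>(0, 1]\<close>.\<close>

locale expanding_map =
  fixes T :: "real \<Rightarrow> real" and d :: "real \<Rightarrow> nat" and w \<phi> :: "nat \<Rightarrow> real \<Rightarrow> real"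
    and X :: "real set" and W :: real
  assumes X_subset: "{0<..<1} \<subseteq> X" "X \<subseteq> {0..1}" and X_borel [measurable]: "X \<in> sets borel"
    and X_convex: "\<And>x y z. x \<in> X \<Longrightarrow> y \<in> X \<Longrightarrow> x \<le> z \<Longrightarrow> z \<le> y \<Longrightarrow> z \<in> X"
    and T_borel [measurable]: "T \<in> borel_measurable borel"
    and d_borel [measurable]: "d \<in> measurable borel (count_space UNIV)"
    and T_unit: "\<And>x. x \<in> {0..1} \<Longrightarrow> T x \<in> {0..1}" and T_X: "\<And>x. x \<in> X \<Longrightarrow> T x \<in> X"
    and w_borel [measurable]: "\<And>k. w k \<in> borel_measurable borel"
    and \<phi>_borel [measurable]: "\<And>k. \<phi> k \<in> borel_measurable borel"
    and w_nonneg: "\<And>k y. y \<in> X \<Longrightarrow> 0 \<le> w k y"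
    and w_summable: "\<And>y. y \<in> X \<Longrightarrow> summable (\<lambda>k. w k y)"
    and w_sum: "\<And>y. y \<in> X \<Longrightarrow> (\<Sum>k. w k y) \<le> W"
    and branch: "\<And>k y. y \<in> X \<Longrightarrow> w k y \<noteq> 0 \<Longrightarrow> \<phi> k y \<in> X \<and> d (\<phi> k y) = k \<and> T (\<phi> k y) = y"
    and nn_transfer: "\<And>F g :: real \<Rightarrow> ennreal. F \<in> borel_measurable borel \<Longrightarrow> g \<in> borel_measurable borel \<Longrightarrow>
        (\<integral>\<^sup>+x. F x * g (T x) \<partial>unit_lebesgue) =
        (\<integral>\<^sup>+y. (\<Sum>k. ennreal (w k y) * F (\<phi> k y)) * g y \<partial>unit_lebesgue)"
    and digit_convex: "\<And>x y z. x \<in> X \<Longrightarrow> y \<in> X \<Longrightarrow> x \<le> z \<Longrightarrow> z \<le> y \<Longrightarrow> d x = d y \<Longrightarrow>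
        d z = d x \<and> (T x \<le> T z \<and> T z \<le> T y \<or> T y \<le> T z \<and> T z \<le> T x)"
begin

section \<open>Words, cylinders and the transfer operator with respect to Lebesgue measure\<close>

definition transfer :: "(real \<Rightarrow> real) \<Rightarrow> real \<Rightarrow> real" where
  "transfer F y = (if y \<in> X then \<Sum>k. w k y * F (\<phi> k y) else 0)"

definition word :: "nat \<Rightarrow> real \<Rightarrow> nat list" where
  "word m x = map (\<lambda>i. d ((T ^^ i) x)) [0..<m]"

definition cylinder :: "nat \<Rightarrow> real \<Rightarrow> real set" where
  "cylinder m x = {y \<in> X. word m y = word m x}"

lemma AE_X: "AE x in unit_lebesgue. x \<in> X"
proof -
  have "AE x in lborel. x \<noteq> (0::real)" "AE x in lborel. x \<noteq> (1::real)" by (auto intro: AE_lborel_singleton)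
  then have "AE x in lborel. x \<in> {0..1} \<longrightarrow> x \<in> X"
    by eventually_elim (use X_subset in auto)
  then show ?thesis by (simp add: AE_unit_lebesgue_iff)
qed

lemma integrable_bounded:
  fixes f :: "real \<Rightarrow> real"
  assumes "f \<in> borel_measurable borel" "\<And>x. x \<in> X \<Longrightarrow> \<bar>f x\<bar> \<le> B"
  shows "integrable unit_lebesgue f"
  using AE_X assms
  by (intro unit.integrable_const_bound[where B = B] measurable_unit_lebesgue) (auto elim!: eventually_mono)

lemma integral_cong_X:
  fixes f g :: "real \<Rightarrow> real"
  assumes "f \<in> borel_measurable borel" "g \<in> borel_measurable borel" "\<And>x. x \<in> X \<Longrightarrow> f x = g x"
  shows "(\<integral>x. f x \<partial>unit_lebesgue) = (\<integral>x. g x \<partial>unit_lebesgue)"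
  using AE_X assms by (intro integral_cong_AE measurable_unit_lebesgue) (auto elim!: eventually_mono)

lemma integral_mono_X:
  fixes f g :: "real \<Rightarrow> real"
  assumes "integrable unit_lebesgue f" "integrable unit_lebesgue g" "\<And>x. x \<in> X \<Longrightarrow> f x \<le> g x"
  shows "(\<integral>x. f x \<partial>unit_lebesgue) \<le> (\<integral>x. g x \<partial>unit_lebesgue)"
  using AE_X assms by (intro integral_mono_AE) (auto elim!: eventually_mono)

lemma iterate_borel [measurable]: "(T ^^ n) \<in> borel_measurable borel"
  by (induction n) auto

lemma iterate_X: "x \<in> X \<Longrightarrow> (T ^^ n) x \<in> X"
  by (induction n) (auto simp: T_X)

lemma word_0 [simp]: "word 0 x = []"
  by (simp add: word_def)

lemma word_Suc: "word (Suc m) x = d x # word m (T x)"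
  by (simp add: word_def upt_conv_Cons map_Suc_upt[symmetric] funpow_swap1 del: upt_Suc)

lemma word_Suc_end: "word (Suc m) x = word m x @ [d ((T ^^ m) x)]"
  by (simp add: word_def)

lemma length_word [simp]: "length (word m x) = m"
  by (simp add: word_def)

lemma word_shift: "word r ((T ^^ n) x) = drop n (word (n + r) x)"
  by (rule nth_equalityI) (simp_all add: word_def funpow_add add.commute)

text \<open>Events on words are handled as predicates on lists; splitting off the first digit leaves
  a countable union.\<close>

lemma pred_word [measurable]: "Measurable.pred borel (\<lambda>x. R (word m x))"
proof (induction m arbitrary: R)
  case (Suc m)
  have "Measurable.pred borel (\<lambda>x. \<exists>k. d x = k \<and> R (k # word m (T x)))"
  proof (intro pred_intros_countable pred_intros_logic)
    fix k
    show "Measurable.pred borel (\<lambda>x. d x = k)" by measurable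
    show "Measurable.pred borel (\<lambda>x. R (k # word m (T x)))"
      using measurable_compose[OF T_borel Suc.IH[of "\<lambda>u. R (k # u)"]] by simp
  qed
  then show ?case by (simp add: word_Suc)
qed simp

lemma sets_word: "{x \<in> {0..1}. R (word m x)} \<in> sets unit_lebesgue"
  unfolding sets_unit_lebesgue_iff by auto

lemma sets_iterate: "A \<in> sets borel \<Longrightarrow> {x \<in> {0..1}. (T ^^ n) x \<in> A} \<in> sets unit_lebesgue"
  unfolding sets_unit_lebesgue_iff by auto

lemma sets_cylinder: "cylinder m x \<in> sets unit_lebesgue"
  unfolding sets_unit_lebesgue_iff cylinder_def using X_subset by auto

text \<open>Every branch is monotone in one of the two directions, so a point between two points
  with the same digit keeps that digit and its image stays between their images. Hence cylinders are
  intervals.\<close>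

lemma word_convex:
  "x \<in> X \<Longrightarrow> y \<in> X \<Longrightarrow> x \<le> z \<Longrightarrow> z \<le> y \<Longrightarrow> word m x = word m y \<Longrightarrow> word m z = word m x"
proof (induction m arbitrary: x y z)
  case (Suc m)
  have d: "d x = d y" "word m (T x) = word m (T y)" using Suc.prems(5) by (auto simp: word_Suc)
  from digit_convex[OF Suc.prems(1-4) d(1)]
  have "d z = d x" "T x \<le> T z \<and> T z \<le> T y \<or> T y \<le> T z \<and> T z \<le> T x" by auto
  then show ?case
    using Suc.IH[of "T x" "T y" "T z"] Suc.IH[of "T y" "T x" "T z"] T_X Suc.prems d
    by (auto simp: word_Suc)
qed simp

lemma cylinder_convex: "y \<in> cylinder m x \<Longrightarrow> y' \<in> cylinder m x \<Longrightarrow> y \<le> z \<Longrightarrow> z \<le> y' \<Longrightarrow> z \<in> cylinder m x"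
  unfolding cylinder_def using word_convex[of y y' z m] X_convex[of y y' z] by auto

lemma summable_branches:
  assumes "y \<in> X" "\<And>x. x \<in> X \<Longrightarrow> 0 \<le> F x \<and> F x \<le> B"
  shows "summable (\<lambda>k. w k y * F (\<phi> k y))"
proof (rule summable_comparison_test')
  show "summable (\<lambda>k. w k y * B)" using w_summable[OF assms(1)] by (rule summable_mult2)
  show "norm (w k y * F (\<phi> k y)) \<le> w k y * B" for k
    using w_nonneg[OF assms(1), of k] assms(2) branch[OF assms(1), of k]
    by (cases "w k y = 0") (auto simp: abs_mult intro!: mult_left_mono)
qed

lemma transfer_bounds:
  assumes "\<And>x. x \<in> X \<Longrightarrow> 0 \<le> F x \<and> F x \<le> B" "y \<in> X"
  shows "0 \<le> transfer F y \<and> transfer F y \<le> W * B"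
proof -
  have t: "0 \<le> w k y * F (\<phi> k y)" "w k y * F (\<phi> k y) \<le> w k y * B" for k
    using w_nonneg[OF assms(2), of k] assms(1) branch[OF assms(2), of k]
    by (cases "w k y = 0"; auto intro!: mult_left_mono)+
  have "B \<ge> 0" using assms(1)[OF assms(2)] by linarith
  have sm: "summable (\<lambda>k. w k y * F (\<phi> k y))" using summable_branches[of y F B] assms by blast
  have "(\<Sum>k. w k y * F (\<phi> k y)) \<le> (\<Sum>k. w k y * B)"
    using t sm w_summable[OF assms(2)] by (intro suminf_le summable_mult2) auto
  also have "\<dots> = (\<Sum>k. w k y) * B" using w_summable[OF assms(2)] by (rule suminf_mult2[symmetric])
  also have "\<dots> \<le> W * B" using w_sum[OF assms(2)] \<open>B \<ge> 0\<close> by (rule mult_right_mono)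
  finally show ?thesis
    using t suminf_nonneg[OF sm] assms(2) by (auto simp: transfer_def)
qed

lemma transfer_borel [measurable]:
  assumes [measurable]: "F \<in> borel_measurable borel"
  shows "transfer F \<in> borel_measurable borel"
  unfolding transfer_def[abs_def] by measurable

lemma transfer_iterate:
  assumes "F \<in> borel_measurable borel" "\<And>x. x \<in> X \<Longrightarrow> 0 \<le> F x \<and> F x \<le> B"
  shows "(transfer ^^ n) F \<in> borel_measurable borel"
    and "\<And>x. x \<in> X \<Longrightarrow> 0 \<le> (transfer ^^ n) F x \<and> (transfer ^^ n) F x \<le> W ^ n * B"
proof (induction n)
  case (Suc n)
  { case 1 then show ?case using Suc by simp }
  { case (2 x)
    then show ?case using transfer_bounds[of "(transfer ^^ n) F" "W ^ n * B" x] Suc(2) by (simp add: mult.assoc) }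
qed (use assms in auto)

lemma transfer_iterate_mono:
  assumes "\<And>x. x \<in> X \<Longrightarrow> 0 \<le> F x \<and> F x \<le> G x \<and> G x \<le> B"
    and "F \<in> borel_measurable borel" "G \<in> borel_measurable borel" "y \<in> X"
  shows "(transfer ^^ n) F y \<le> (transfer ^^ n) G y"
  using assms(4)
proof (induction n arbitrary: y)
  case (Suc n)
  have F: "0 \<le> (transfer ^^ n) F x \<and> (transfer ^^ n) F x \<le> W ^ n * B" if "x \<in> X" for x
    using assms that by (intro transfer_iterate(2)) (auto intro: order_trans)
  have G: "0 \<le> (transfer ^^ n) G x \<and> (transfer ^^ n) G x \<le> W ^ n * B" if "x \<in> X" for x
    using assms that by (intro transfer_iterate(2)) (auto intro: order_trans)
  have "(\<Sum>k. w k y * (transfer ^^ n) F (\<phi> k y)) \<le> (\<Sum>k. w k y * (transfer ^^ n) G (\<phi> k y))"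
  proof (rule suminf_le)
    show "w k y * (transfer ^^ n) F (\<phi> k y) \<le> w k y * (transfer ^^ n) G (\<phi> k y)" for k
      using w_nonneg[OF Suc.prems, of k] branch[OF Suc.prems, of k] Suc.IH[of "\<phi> k y"]
      by (cases "w k y = 0") (auto intro!: mult_left_mono)
    show "summable (\<lambda>k. w k y * (transfer ^^ n) F (\<phi> k y))"
      using summable_branches[of y "(transfer ^^ n) F" "W ^ n * B"] Suc.prems F by blast
    show "summable (\<lambda>k. w k y * (transfer ^^ n) G (\<phi> k y))"
      using summable_branches[of y "(transfer ^^ n) G" "W ^ n * B"] Suc.prems G by blast
  qed
  then show ?case using Suc.prems by (simp add: transfer_def[where y = y])
qed (use assms in auto)

lemma integral_transfer:
  fixes g :: "real \<Rightarrow> real"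
  assumes F: "F \<in> borel_measurable borel" "\<And>x. x \<in> X \<Longrightarrow> 0 \<le> F x \<and> F x \<le> B"
    and g: "g \<in> borel_measurable borel" "\<And>x. x \<in> {0..1} \<Longrightarrow> 0 \<le> g x"
  shows "(\<integral>x. F x * g (T x) \<partial>unit_lebesgue) = (\<integral>x. transfer F x * g x \<partial>unit_lebesgue)"
proof -
  have gT: "(\<lambda>x. g (T x)) \<in> borel_measurable borel" using measurable_compose[OF T_borel g(1)] .
  have "(\<integral>x. F x * g (T x) \<partial>unit_lebesgue) = enn2real (\<integral>\<^sup>+x. ennreal (F x * g (T x)) \<partial>unit_lebesgue)"
  proof (rule integral_eq_nn_integral)
    show "(\<lambda>x. F x * g (T x)) \<in> borel_measurable unit_lebesgue"
      using measurable_unit_lebesgue[OF borel_measurable_times[OF F(1) gT]] .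
    show "AE x in unit_lebesgue. 0 \<le> F x * g (T x)"
      using AE_X by eventually_elim (use F(2) g(2) T_unit X_subset in \<open>auto intro!: mult_nonneg_nonneg\<close>)
  qed
  also have "(\<integral>\<^sup>+x. ennreal (F x * g (T x)) \<partial>unit_lebesgue) = (\<integral>\<^sup>+x. ennreal (F x) * ennreal (g (T x)) \<partial>unit_lebesgue)"
    using g(2) T_unit by (intro nn_integral_cong) (auto simp: ennreal_mult'')
  also have "\<dots> = (\<integral>\<^sup>+y. (\<Sum>k. ennreal (w k y) * ennreal (F (\<phi> k y))) * ennreal (g y) \<partial>unit_lebesgue)"
    using F g by (intro nn_transfer) auto
  also have "\<dots> = (\<integral>\<^sup>+y. ennreal (transfer F y * g y) \<partial>unit_lebesgue)"
  proof (rule nn_integral_cong_AE, use AE_X in eventually_elim)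
    fix y assume y: "y \<in> X"
    have t: "0 \<le> w k y * F (\<phi> k y)" for k
      using w_nonneg[OF y, of k] F(2) branch[OF y, of k] by (cases "w k y = 0") auto
    have "(\<Sum>k. ennreal (w k y) * ennreal (F (\<phi> k y))) = (\<Sum>k. ennreal (w k y * F (\<phi> k y)))"
      using w_nonneg[OF y] by (simp add: ennreal_mult')
    also have "\<dots> = ennreal (transfer F y)"
      using t summable_branches[of y F B] F(2) y by (simp add: suminf_ennreal2 transfer_def)
    finally show "(\<Sum>k. ennreal (w k y) * ennreal (F (\<phi> k y))) * ennreal (g y) = ennreal (transfer F y * g y)"
      using g(2)[of y] y X_subset by (subst ennreal_mult'') auto
  qed
  also have "enn2real \<dots> = (\<integral>x. transfer F x * g x \<partial>unit_lebesgue)"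
  proof (rule integral_eq_nn_integral[symmetric])
    show "(\<lambda>x. transfer F x * g x) \<in> borel_measurable unit_lebesgue"
      using measurable_unit_lebesgue[OF borel_measurable_times[OF transfer_borel[OF F(1)] g(1)]] .
    show "AE x in unit_lebesgue. 0 \<le> transfer F x * g x"
      using AE_X by eventually_elim (use transfer_bounds[OF F(2)] g(2) X_subset in \<open>auto intro!: mult_nonneg_nonneg\<close>)
  qed
  finally show ?thesis .
qed

lemma integral_transfer_iterate:
  fixes g :: "real \<Rightarrow> real"
  assumes F: "F \<in> borel_measurable borel" "\<And>x. x \<in> X \<Longrightarrow> 0 \<le> F x \<and> F x \<le> B"
    and g: "g \<in> borel_measurable borel" "\<And>x. x \<in> {0..1} \<Longrightarrow> 0 \<le> g x"
  shows "(\<integral>x. F x * g ((T ^^ n) x) \<partial>unit_lebesgue) = (\<integral>x. (transfer ^^ n) F x * g x \<partial>unit_lebesgue)"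
  using g
proof (induction n arbitrary: g)
  case (Suc n)
  have "(\<integral>x. F x * g (T ((T ^^ n) x)) \<partial>unit_lebesgue) = (\<integral>x. (transfer ^^ n) F x * g (T x) \<partial>unit_lebesgue)"
    using Suc.prems T_unit by (intro Suc.IH) auto
  also have "\<dots> = (\<integral>x. transfer ((transfer ^^ n) F) x * g x \<partial>unit_lebesgue)"
    using transfer_iterate[OF F] Suc.prems by (intro integral_transfer) auto
  finally show ?case by simp
qed simp

text \<open>A branch of nonzero weight leads to a preimage, so the iterate at \<open>y\<close>
  evaluates its argument only at \<open>m\<close>-fold preimages of \<open>y\<close>. This permits
  replacing the last digit by a constant inside one branch.\<close>

lemma transfer_iterate_local:
  "y \<in> X \<Longrightarrow> (\<And>x. x \<in> X \<Longrightarrow> (T ^^ m) x = y \<Longrightarrow> F x = F' x) \<Longrightarrow> (transfer ^^ m) F y = (transfer ^^ m) F' y"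
proof (induction m arbitrary: y)
  case (Suc m)
  have "w k y * (transfer ^^ m) F (\<phi> k y) = w k y * (transfer ^^ m) F' (\<phi> k y)" for k
  proof (cases "w k y = 0")
    case False
    with branch[OF Suc.prems(1)] have b: "\<phi> k y \<in> X" "T (\<phi> k y) = y" by auto
    then have "(transfer ^^ m) F (\<phi> k y) = (transfer ^^ m) F' (\<phi> k y)"
      by (intro Suc.IH Suc.prems) auto
    then show ?thesis by simp
  qed simp
  then have "(\<Sum>k. w k y * (transfer ^^ m) F (\<phi> k y)) = (\<Sum>k. w k y * (transfer ^^ m) F' (\<phi> k y))"
    by (rule suminf_cong)
  then show ?case by (simp add: transfer_def[where y = y])
qed simp

text \<open>Peeling off the last digit of the word keeps the branch sum a single application of the
  transfer operator, so a cone that is closed under branch sums contains all these densities.\<close>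

lemma transfer_word_cone:
  assumes const: "\<And>c. K (\<lambda>x. of_bool c)"
    and sum: "\<And>f B. (\<And>k. K (f k)) \<Longrightarrow> (\<And>k x. x \<in> X \<Longrightarrow> 0 \<le> f k x \<and> f k x \<le> B) \<Longrightarrow>
      K (\<lambda>y. if y \<in> X then \<Sum>k. w k y * f k (\<phi> k y) else 0)"
  shows "K ((transfer ^^ m) (\<lambda>x. of_bool (R (word m x))))"
proof (induction m arbitrary: R)
  case 0
  then show ?case using const by simp
next
  case (Suc m)
  define f where "f k = (transfer ^^ m) (\<lambda>x. of_bool (R (word m x @ [k])))" for k
  have f01: "0 \<le> f k x \<and> f k x \<le> W ^ m * 1" if "x \<in> X" for k x
    unfolding f_def using that by (intro transfer_iterate) auto
  have "(transfer ^^ Suc m) (\<lambda>x. of_bool (R (word (Suc m) x))) = (\<lambda>y. if y \<in> X then \<Sum>k. w k y * f k (\<phi> k y) else 0)"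
  proof
    fix y
    show "(transfer ^^ Suc m) (\<lambda>x. of_bool (R (word (Suc m) x))) y = (if y \<in> X then \<Sum>k. w k y * f k (\<phi> k y) else 0)"
    proof (cases "y \<in> X")
      case True
      have "w k y * (transfer ^^ m) (\<lambda>x. of_bool (R (word (Suc m) x))) (\<phi> k y) = w k y * f k (\<phi> k y)" for k
      proof (cases "w k y = 0")
        case False
        with branch[OF True] have b: "\<phi> k y \<in> X" "d (\<phi> k y) = k" by auto
        then have "(transfer ^^ m) (\<lambda>x. of_bool (R (word (Suc m) x))) (\<phi> k y) = f k (\<phi> k y)"
          unfolding f_def by (intro transfer_iterate_local) (auto simp: word_Suc_end)
        then show ?thesis by simp
      qed simp
      then have "(\<Sum>k. w k y * (transfer ^^ m) (\<lambda>x. of_bool (R (word (Suc m) x))) (\<phi> k y)) =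
          (\<Sum>k. w k y * f k (\<phi> k y))" by (rule suminf_cong)
      then show ?thesis using True by (simp add: transfer_def[where y = y])
    qed (simp add: transfer_def[where y = y])
  qed
  moreover have "K (\<lambda>y. if y \<in> X then \<Sum>k. w k y * f k (\<phi> k y) else 0)"
  proof (rule sum[where B = "W ^ m * 1"])
    show "K (f k)" for k unfolding f_def using Suc.IH[of "\<lambda>u. R (u @ [k])"] .
  qed (use f01 in auto)
  ultimately show ?case by simp
qed

text \<open>The indicator of the word event is pushed forward \<open>m\<close> steps, after which it
  is a density in the cone with a bound free of \<open>m\<close>. What remains of the orbit up to
  time \<open>n\<close> are \<open>n - m\<close> steps of mixing.\<close>

lemma prob_word_mixing:
  assumes cone: "\<And>R. K ((transfer ^^ m) (\<lambda>x. of_bool (R (word m x))))"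
    and bound: "\<And>R x. x \<in> X \<Longrightarrow> (transfer ^^ m) (\<lambda>x. of_bool (R (word m x))) x \<le> B"
    and mix: "\<And>f n. K f \<Longrightarrow> f \<in> borel_measurable borel \<Longrightarrow> (\<And>x. x \<in> X \<Longrightarrow> 0 \<le> f x \<and> f x \<le> B) \<Longrightarrow>
       \<bar>(\<integral>x. f x * indicator A ((T ^^ n) x) \<partial>unit_lebesgue) - (\<integral>x. f x \<partial>unit_lebesgue) * p\<bar> \<le> C * \<theta> ^ n"
    and A [measurable]: "A \<in> sets borel" and "m \<le> n"
  shows "\<bar>unit.prob ({x \<in> {0..1}. R (word m x)} \<inter> {x \<in> {0..1}. (T ^^ n) x \<in> A}) -
      unit.prob {x \<in> {0..1}. R (word m x)} * p\<bar> \<le> C * \<theta> ^ (n - m)"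
proof -
  let ?F = "\<lambda>x. of_bool (R (word m x)) :: real"
  define f where "f = (transfer ^^ m) ?F"
  have Fb: "?F \<in> borel_measurable borel" by measurable
  have F01: "0 \<le> ?F x \<and> ?F x \<le> 1" for x by simp
  have f: "f \<in> borel_measurable borel" "\<And>x. x \<in> X \<Longrightarrow> 0 \<le> f x \<and> f x \<le> B"
    unfolding f_def using transfer_iterate[OF Fb F01] bound by auto
  have shift: "(T ^^ (n - m)) ((T ^^ m) x) = (T ^^ n) x" for x
    using fun_cong[OF funpow_add[of "n - m" m T], of x] \<open>m \<le> n\<close> by simp
  have "(\<integral>x. f x * indicator A ((T ^^ (n - m)) x) \<partial>unit_lebesgue) =
      (\<integral>x. ?F x * indicator A ((T ^^ (n - m)) ((T ^^ m) x)) \<partial>unit_lebesgue)"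
    unfolding f_def using F01 by (intro integral_transfer_iterate[symmetric] Fb) auto
  also have "\<dots> = (\<integral>x. ?F x * indicator A ((T ^^ n) x) \<partial>unit_lebesgue)"
    unfolding shift ..
  also have "(\<integral>x. ?F x * indicator A ((T ^^ n) x) \<partial>unit_lebesgue) =
     (\<integral>x. indicator ({x \<in> {0..1}. R (word m x)} \<inter> {x \<in> {0..1}. (T ^^ n) x \<in> A}) x \<partial>unit_lebesgue)"
    by (intro Bochner_Integration.integral_cong) (auto simp: indicator_def)
  also have "\<dots> = unit.prob ({x \<in> {0..1}. R (word m x)} \<inter> {x \<in> {0..1}. (T ^^ n) x \<in> A})"
    by (simp add: Int_absorb2 subset_iff)
  finally have 1: "(\<integral>x. f x * indicator A ((T ^^ (n - m)) x) \<partial>unit_lebesgue) = \<dots>" .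
  have "(\<integral>x. f x * 1 \<partial>unit_lebesgue) = (\<integral>x. ?F x * 1 \<partial>unit_lebesgue)"
    unfolding f_def using F01 by (intro integral_transfer_iterate[symmetric] Fb) auto
  also have "\<dots> = (\<integral>x. indicator {x \<in> {0..1}. R (word m x)} x \<partial>unit_lebesgue)"
    by (intro Bochner_Integration.integral_cong) (auto simp: indicator_def)
  also have "\<dots> = unit.prob {x \<in> {0..1}. R (word m x)}"
    by (simp add: Int_absorb2 subset_iff)
  finally have 2: "(\<integral>x. f x \<partial>unit_lebesgue) = \<dots>" by simp
  show ?thesis using mix[OF cone[of R, folded f_def] f, of "n - m"] unfolding 1 2 .
qed

section \<open>From cylinder lengths to quasi-mixing\<close>

text \<open>\<open>R\<close> accepts a word only if all its points in the open unit interval lie in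
  \<open>S\<close>. A misclassified interior point thus lies in \<open>S\<close> and shares its
  cylinder with a point outside \<open>S\<close>; between the two there is a break, and it lies in
  that cylinder because cylinders are intervals. At most \<open>card F\<close> cylinders contain a
  break, each of length at most \<open>l\<close> unless it is covered by \<open>D\<close>.\<close>

lemma breaks_cut:
  assumes S: "S \<in> sets unit_lebesgue" "breaks S F" and D: "D \<in> sets unit_lebesgue" and "0 \<le> l"
    and len: "\<And>x. x \<in> X \<Longrightarrow> x \<notin> D \<Longrightarrow> unit.prob (cylinder m x) \<le> l"
  obtains R where "unit.prob ((S - {x \<in> {0..1}. R (word m x)}) \<union> ({x \<in> {0..1}. R (word m x)} - S))
     \<le> real (card F) * l + unit.prob D"
proof -
  define R where "R u \<longleftrightarrow> (\<forall>y\<in>{0<..<1}. word m y = u \<longrightarrow> y \<in> S)" for u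
  let ?S' = "{x \<in> {0..1}. R (word m x)}"
  define G where "G = {e \<in> F \<inter> {0<..<1}. unit.prob (cylinder m e) \<le> l}"
  have F: "finite F" using S by (auto simp: breaks_def)
  have G: "finite G" "card G \<le> card F" unfolding G_def using F by (auto intro!: card_mono)
  have sub: "(S - ?S') \<union> (?S' - S) \<subseteq> {0, 1} \<union> D \<union> (\<Union>e\<in>G. cylinder m e)"
  proof
    fix x assume x: "x \<in> (S - ?S') \<union> (?S' - S)"
    then have x01: "x \<in> {0..1}" using S by (auto simp: sets_unit_lebesgue_iff)
    show "x \<in> {0, 1} \<union> D \<union> (\<Union>e\<in>G. cylinder m e)"
    proof (rule ccontr)
      assume n: "x \<notin> {0, 1} \<union> D \<union> (\<Union>e\<in>G. cylinder m e)"
      then have x1: "x \<in> {0<..<1}" and xD: "x \<notin> D" using x01 by auto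
      then have xX: "x \<in> X" using X_subset by auto
      have "x \<in> S" "\<not> R (word m x)" using x x1 x01 by (auto simp: R_def)
      then obtain y where y: "y \<in> {0<..<1}" "word m y = word m x" "y \<notin> S" by (auto simp: R_def)
      then have yX: "y \<in> X" using X_subset by auto
      obtain e where e: "e \<in> F" "min x y \<le> e" "e \<le> max x y"
      proof (cases "x \<le> y")
        case True
        then have "{x..y} \<inter> F \<noteq> {}" using S(2) x1 y \<open>x \<in> S\<close> unfolding breaks_def by auto
        then obtain e where "e \<in> {x..y} \<inter> F" by blast
        then show ?thesis using True by (intro that[of e]) auto
      next
        case False
        then have "{y..x} \<inter> F \<noteq> {}" using S(2) x1 y \<open>x \<in> S\<close> unfolding breaks_def by auto
        then obtain e where "e \<in> {y..x} \<inter> F" by blast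
        then show ?thesis using False by (intro that[of e]) auto
      qed
      have e01: "e \<in> {0<..<1}" using e x1 y by auto
      have "word m e = word m x"
        using word_convex[OF xX yX, of e m] word_convex[OF yX xX, of e m] e y by (cases "x \<le> y") auto
      then have "cylinder m e = cylinder m x" "x \<in> cylinder m e" using xX by (auto simp: cylinder_def)
      then have "e \<in> G" using e e01 len[OF xX xD] by (auto simp: G_def)
      then show False using n \<open>x \<in> cylinder m e\<close> by auto
    qed
  qed
  define N :: "real set" where "N = {0, 1}"
  have null: "unit.prob N = 0" and s01: "N \<in> sets unit_lebesgue" unfolding N_def by (rule prob_endpoints)+
  have U: "(\<Union>e\<in>G. cylinder m e) \<in> sets unit_lebesgue" using G sets_cylinder by auto
  have "unit.prob ((S - ?S') \<union> (?S' - S)) \<le> unit.prob (N \<union> D \<union> (\<Union>e\<in>G. cylinder m e))"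
    using sub s01 D U unfolding N_def[symmetric] by (intro unit.finite_measure_mono) auto
  also have "\<dots> \<le> unit.prob (N \<union> D) + unit.prob (\<Union>e\<in>G. cylinder m e)"
    using s01 D U by (intro measure_Un_le) auto
  also have "unit.prob (N \<union> D) \<le> unit.prob N + unit.prob D"
    using s01 D by (intro measure_Un_le) auto
  also have "unit.prob (\<Union>e\<in>G. cylinder m e) \<le> (\<Sum>e\<in>G. unit.prob (cylinder m e))"
    using G sets_cylinder by (intro measure_UNION_le) auto
  also have "\<dots> \<le> (\<Sum>e\<in>G. l)" by (intro sum_mono) (auto simp: G_def)
  also have "\<dots> \<le> real (card F) * l" using G \<open>0 \<le> l\<close> by (auto intro!: mult_right_mono)
  finally show ?thesis using that[of R] null by auto
qed

text \<open>A word event can be a union of infinitely many cylinders. Only those of length at least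
  \<open>\<tau>\<close> are kept: being disjoint they number at most \<open>1 / \<tau>\<close>, and
  being intervals they have two end points each, which serve as breaks. The dropped ones lie in
  \<open>D\<close> up to the end points of the unit interval.\<close>

lemma long_cylinders_breaks:
  assumes D: "D \<in> sets unit_lebesgue" and "0 < \<tau>"
    and len: "\<And>x. x \<in> X \<Longrightarrow> x \<notin> D \<Longrightarrow> \<tau> \<le> unit.prob (cylinder m x)"
  shows "\<exists>S F. S \<in> sets unit_lebesgue \<and> breaks S F \<and> real (card F) \<le> 2 / \<tau> \<and>
    unit.prob (({x \<in> {0..1}. R (word m x)} - S) \<union> (S - {x \<in> {0..1}. R (word m x)})) \<le> unit.prob D"
proof -
  define Q where "Q = {I. \<exists>x\<in>X. I = cylinder m x \<and> \<tau> \<le> unit.prob I}"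
  have disj: "disjoint_family_on (\<lambda>I. I) Q" by (auto simp: disjoint_family_on_def Q_def cylinder_def)
  have sub: "card G \<le> nat \<lfloor>1 / \<tau>\<rfloor> \<and> real (card G) \<le> 1 / \<tau>" if G: "G \<subseteq> Q" "finite G" for G
  proof -
    have "real (card G) * \<tau> = (\<Sum>I\<in>G. \<tau>)" by simp
    also have "\<dots> \<le> (\<Sum>I\<in>G. unit.prob I)" using G by (intro sum_mono) (auto simp: Q_def)
    also have "\<dots> = unit.prob (\<Union>I\<in>G. I)"
    proof (rule unit.finite_measure_finite_Union[symmetric])
      show "(\<lambda>I. I) ` G \<subseteq> unit.events" using G sets_cylinder by (auto simp: Q_def)
      show "disjoint_family_on (\<lambda>I. I) G" using disjoint_family_on_mono[OF G(1) disj] .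
    qed fact
    also have "\<dots> \<le> 1" by simp
    finally have "real (card G) \<le> 1 / \<tau>" using \<open>0 < \<tau>\<close> by (simp add: field_simps)
    then show ?thesis by (auto simp: le_nat_floor)
  qed
  have fin: "finite Q" and cardQ: "real (card Q) \<le> 1 / \<tau>"
    using finite_if_finite_subsets_card_bdd[of Q "nat \<lfloor>1 / \<tau>\<rfloor>"] sub by auto
  define F where "F = Inf ` Q \<union> Sup ` Q"
  have "card F \<le> card Q + card Q"
    unfolding F_def using fin by (intro order_trans[OF card_Un_le] add_mono card_image_le)
  then have cF: "real (card F) \<le> 2 / \<tau>" using cardQ by (simp add: field_simps)
  define R' where "R' u \<longleftrightarrow> R u \<and> \<tau> \<le> unit.prob {y \<in> X. word m y = u}" for u
  let ?S = "{x \<in> {0..1}. R (word m x)}" and ?S' = "{x \<in> {0..1}. R' (word m x)}"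
  have key: "x \<in> ?S' \<longleftrightarrow> y \<in> ?S'" if xy: "0 < x" "x \<le> y" "y < 1" "{x..y} \<inter> F = {}" for x y
  proof -
    have X: "x \<in> X" "y \<in> X" using xy X_subset by auto
    have bdd: "bdd_above (cylinder m z)" "bdd_below (cylinder m z)" for z
      using X_subset by (auto simp: cylinder_def bdd_above_def bdd_below_def subset_iff)
    show ?thesis
    proof (cases "word m x = word m y")
      case True
      then show ?thesis using xy by auto
    next
      case False
      \<comment> \<open>A kept cylinder that contains \<open>x\<close> but not \<open>y\<close>
        would have its supremum, a point of \<open>F\<close>, in \<open>{x..y}\<close>. For
        \<open>y\<close> the same is done with the infimum.\<close>
      have "x \<notin> ?S'"
      proof
        assume "x \<in> ?S'"
        then have "cylinder m x \<in> Q" using X by (auto simp: R'_def Q_def cylinder_def)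
        then have "Sup (cylinder m x) \<notin> {x..y}" using xy(4) by (auto simp: F_def)
        moreover have "x \<le> Sup (cylinder m x)" using bdd X by (intro cSup_upper) (auto simp: cylinder_def)
        ultimately have "y < Sup (cylinder m x)" by auto
        then obtain z where z: "z \<in> cylinder m x" "y < z" using bdd X by (subst (asm) less_cSup_iff) (auto simp: cylinder_def)
        then have "y \<in> cylinder m x" using cylinder_convex[of x m x z y] X xy by (auto simp: cylinder_def)
        then show False using False by (auto simp: cylinder_def)
      qed
      moreover have "y \<notin> ?S'"
      proof
        assume "y \<in> ?S'"
        then have "cylinder m y \<in> Q" using X by (auto simp: R'_def Q_def cylinder_def)
        then have "Inf (cylinder m y) \<notin> {x..y}" using xy(4) by (auto simp: F_def)
        moreover have "Inf (cylinder m y) \<le> y" using bdd X by (intro cInf_lower) (auto simp: cylinder_def)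
        ultimately have "Inf (cylinder m y) < x" by auto
        then obtain z where z: "z \<in> cylinder m y" "z < x" using bdd X by (subst (asm) cInf_less_iff) (auto simp: cylinder_def)
        then have "x \<in> cylinder m y" using cylinder_convex[of z m y y x] X xy by (auto simp: cylinder_def)
        then show False using False by (auto simp: cylinder_def)
      qed
      ultimately show ?thesis by blast
    qed
  qed
  have br: "breaks ?S' F" unfolding breaks_def using key fin by (auto simp: F_def)
  have "unit.prob ((?S - ?S') \<union> (?S' - ?S)) \<le> unit.prob (D \<union> {0, 1})"
  proof (rule unit.finite_measure_mono)
    show "(?S - ?S') \<union> (?S' - ?S) \<subseteq> D \<union> {0, 1}"
    proof
      fix x assume x: "x \<in> (?S - ?S') \<union> (?S' - ?S)"
      then have x': "x \<in> {0..1}" "\<not> \<tau> \<le> unit.prob (cylinder m x)" by (auto simp: R'_def cylinder_def)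
      show "x \<in> D \<union> {0, 1}"
      proof (cases "x \<in> X")
        case False
        then have "x \<notin> {0<..<1}" using X_subset by blast
        then show ?thesis using x' by auto
      qed (use len[of x] x' in auto)
    qed
    show "D \<union> {0, 1} \<in> sets unit_lebesgue" using D by (auto simp: sets_unit_lebesgue_iff)
  qed
  also have "\<dots> \<le> unit.prob D + unit.prob {0, 1}"
    using D by (intro measure_Un_le) (auto simp: sets_unit_lebesgue_iff)
  also have "unit.prob {0, 1} = 0" by (rule prob_endpoints)
  finally have "unit.prob ((?S - ?S') \<union> (?S' - ?S)) \<le> unit.prob D" by simp
  with br cF sets_word[of R' m] show ?thesis by blast
qed

text \<open>\<open>S\<close> is replaced by a set of words of length \<open>m\<close>, to which the
  mixing of densities in the cone applies. The replacement error enters through the joint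
  probability and through the product, which accounts for \<open>2 * C1\<close>.\<close>

lemma quasi_mixing_word:
  assumes cone: "\<And>m R. K ((transfer ^^ m) (\<lambda>x. of_bool (R (word m x))))"
    and bound: "\<And>m R x. x \<in> X \<Longrightarrow> (transfer ^^ m) (\<lambda>x. of_bool (R (word m x))) x \<le> B"
    and mix: "\<And>f n. K f \<Longrightarrow> f \<in> borel_measurable borel \<Longrightarrow> (\<And>x. x \<in> X \<Longrightarrow> 0 \<le> f x \<and> f x \<le> B) \<Longrightarrow>
       \<bar>(\<integral>x. f x * indicator {x. R (word r x)} ((T ^^ n) x) \<partial>unit_lebesgue) - (\<integral>x. f x \<partial>unit_lebesgue) * p\<bar> \<le> C * \<theta> ^ n"
    and p: "0 \<le> p" "p \<le> 1" and C: "0 \<le> C" and \<theta>: "0 < \<theta>"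
    and len: "\<And>m a. 0 < a \<Longrightarrow> \<exists>D\<in>sets unit_lebesgue. unit.prob D \<le> C1 * ((real m + 1) / a\<^sup>2) \<and>
       (\<forall>x\<in>X - D. unit.prob (cylinder m x) \<le> C1 * exp (a - H * real m))"
    and C1: "0 \<le> C1"
    and approx: "\<And>n a. 0 < a \<Longrightarrow> \<exists>S F. S \<in> sets unit_lebesgue \<and> breaks S F \<and>
        real (card F) \<le> C2 * exp (H * real n + a) \<and>
        unit.prob (({x \<in> {0..1}. R (word r ((T ^^ n) x))} - S) \<union> (S - {x \<in> {0..1}. R (word r ((T ^^ n) x))}))
          \<le> C2 * ((real n + 1) / a\<^sup>2)"
    and C2: "0 \<le> C2"
  shows "quasi_mixing (2 * C1 + C + C2) \<theta> H (\<lambda>n. {x \<in> {0..1}. R (word r ((T ^^ n) x))}) p"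
  unfolding quasi_mixing_def
proof (intro conjI allI impI)
  let ?E = "\<lambda>n. {x \<in> {0..1}. R (word r ((T ^^ n) x))}"
  show E: "?E n \<in> sets unit_lebesgue" for n
    unfolding sets_unit_lebesgue_iff using measurable_compose[OF iterate_borel pred_word] by auto
  show "0 \<le> p" "p \<le> 1" by fact+
  show "\<exists>S F. S \<in> sets unit_lebesgue \<and> breaks S F \<and> real (card F) \<le> (2 * C1 + C + C2) * exp (H * real n + a) \<and>
        unit.prob ((?E n - S) \<union> (S - ?E n)) \<le> (2 * C1 + C + C2) * ((real n + 1) / a\<^sup>2)" if a: "0 < a" for n a
  proof -
    have "C2 * exp (H * real n + a) \<le> (2 * C1 + C + C2) * exp (H * real n + a)"
      using C C1 by (intro mult_right_mono) auto
    moreover have "C2 * ((real n + 1) / a\<^sup>2) \<le> (2 * C1 + C + C2) * ((real n + 1) / a\<^sup>2)"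
      using C C1 by (intro mult_right_mono) auto
    ultimately show ?thesis using approx[OF a, of n] by (meson order_trans)
  qed
  fix S F and m n :: nat and a :: real
  assume S: "S \<in> sets unit_lebesgue" "breaks S F" and mn: "m \<le> n" and a: "0 < a"
  obtain D where D: "D \<in> sets unit_lebesgue" "unit.prob D \<le> C1 * ((real m + 1) / a\<^sup>2)"
       "\<And>x. x \<in> X \<Longrightarrow> x \<notin> D \<Longrightarrow> unit.prob (cylinder m x) \<le> C1 * exp (a - H * real m)"
    using len[OF a, of m] by blast
  obtain R' where R': "unit.prob ((S - {x \<in> {0..1}. R' (word m x)}) \<union> ({x \<in> {0..1}. R' (word m x)} - S))
     \<le> real (card F) * (C1 * exp (a - H * real m)) + unit.prob D"
    using breaks_cut[OF S D(1) _ D(3)] C1 by auto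
  let ?S' = "{x \<in> {0..1}. R' (word m x)}"
  define \<delta> where "\<delta> = unit.prob ((S - ?S') \<union> (?S' - S))"
  have S': "?S' \<in> sets unit_lebesgue" by (rule sets_word)
  have "\<bar>unit.prob (S \<inter> ?E n) - unit.prob (?S' \<inter> ?E n)\<bar> \<le> unit.prob ((S \<inter> ?E n - ?S' \<inter> ?E n) \<union> (?S' \<inter> ?E n - S \<inter> ?E n))"
    using S S' E by (intro unit.abs_measure_diff_le) auto
  also have "\<dots> \<le> \<delta>" unfolding \<delta>_def
    using S S' E by (intro unit.finite_measure_mono) auto
  finally have 1: "\<bar>unit.prob (S \<inter> ?E n) - unit.prob (?S' \<inter> ?E n)\<bar> \<le> \<delta>" .
  have "\<bar>unit.prob S - unit.prob ?S'\<bar> \<le> \<delta>"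
    unfolding \<delta>_def using unit.abs_measure_diff_le[OF S(1) S'] .
  then have "\<bar>unit.prob S - unit.prob ?S'\<bar> * p \<le> \<delta>"
    using p mult_left_le[of p "\<bar>unit.prob S - unit.prob ?S'\<bar>"] by linarith
  then have 2: "\<bar>unit.prob S * p - unit.prob ?S' * p\<bar> \<le> \<delta>"
    using p by (metis abs_mult abs_of_nonneg left_diff_distrib)
  have A: "{x. R (word r x)} \<in> sets borel" by measurable
  have 3: "\<bar>unit.prob (?S' \<inter> ?E n) - unit.prob ?S' * p\<bar> \<le> C * \<theta> ^ (n - m)"
    using prob_word_mixing[of K m B "{x. R (word r x)}" p C \<theta> n R', OF cone bound mix A mn]
    unfolding mem_Collect_eq .
  define t1 where "t1 = real (card F) * exp (a - H * real m)"
  define t2 where "t2 = (real n + 1) / a\<^sup>2"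
  define t3 where "t3 = \<theta> ^ (n - m)"
  have t: "0 \<le> t1" "0 \<le> t2" "0 \<le> t3" using \<theta> by (auto simp: t1_def t2_def t3_def)
  have 4: "\<delta> \<le> C1 * t1 + C1 * t2"
  proof -
    have "(real m + 1) / a\<^sup>2 \<le> t2" unfolding t2_def using mn by (intro divide_right_mono) auto
    then have "C1 * ((real m + 1) / a\<^sup>2) \<le> C1 * t2" using C1 by (rule mult_left_mono)
    moreover have "real (card F) * (C1 * exp (a - H * real m)) = C1 * t1" by (simp add: t1_def)
    ultimately show ?thesis using R' D(2) unfolding \<delta>_def by linarith
  qed
  define M where "M = 2 * C1 + C + C2"
  have "2 * C1 \<le> M" "C \<le> M" using C C1 C2 by (simp_all add: M_def)
  then have M: "2 * C1 * t1 \<le> M * t1" "2 * C1 * t2 \<le> M * t2" "C * t3 \<le> M * t3"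
    using t by (simp_all only: mult_right_mono)
  have "\<bar>unit.prob (S \<inter> ?E n) - unit.prob S * p\<bar> \<le> 2 * \<delta> + C * t3"
    using 1 2 3 unfolding t3_def by linarith
  also have "\<dots> \<le> M * t1 + M * t2 + M * t3" using M 4 by linarith
  finally show "\<bar>unit.prob (S \<inter> ?E n) - unit.prob S * p\<bar> \<le>
     (2 * C1 + C + C2) * (real (card F) * exp (a - H * real m) + (real n + 1) / a\<^sup>2 + \<theta> ^ (n - m))"
    by (simp only: t1_def t2_def t3_def M_def distrib_left)
qed

end

section \<open>Beta maps\<close>

lemma nn_integral_unit_lebesgue:
  "(\<integral>\<^sup>+x. f x \<partial>unit_lebesgue) = (\<integral>\<^sup>+x. f x * indicator {0..1} x \<partial>lborel)"
  unfolding unit_lebesgue_def by (subst nn_integral_restrict_space) auto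

text \<open>The range of the last branch can be a proper subinterval of the unit interval, starting
  at 0; hence the condition on \<open>y\<close>.\<close>

definition beta_weight :: "real \<Rightarrow> nat \<Rightarrow> real \<Rightarrow> real" where
  "beta_weight \<beta> k y = (if y + real k < \<beta> then 1 / \<beta> else 0)"

definition beta_branch :: "real \<Rightarrow> nat \<Rightarrow> real \<Rightarrow> real" where
  "beta_branch \<beta> k y = (y + real k) / \<beta>"

text \<open>For \<open>a = \<beta>\<close> this counts the inverse branches at \<open>y\<close>. For
  \<open>a = \<beta> * t\<close> it counts the branches that land below \<open>t\<close>, which is
  how the transfer operator acts on the indicators that make up Parry's density.\<close>

lemma card_nat_less_diff:
  fixes a y :: real
  assumes "0 \<le> a" "0 \<le> y" "y < 1"
  shows "finite {k::nat. y + real k < a}"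
    and "real (card {k::nat. y + real k < a}) = of_int \<lfloor>a\<rfloor> + of_bool (y < frac a)"
proof -
  have eq: "{k::nat. y + real k < a} = {..<nat \<lceil>a - y\<rceil>}"
    by (auto simp: less_ceiling_iff zless_nat_eq_int_zless algebra_simps)
  have "\<lceil>a - y\<rceil> = \<lfloor>a\<rfloor> + of_bool (y < frac a)"
    using assms by (intro ceiling_unique) (auto simp: frac_def, linarith+)
  moreover have "0 \<le> \<lceil>a - y\<rceil>" using assms by linarith
  ultimately show "real (card {k::nat. y + real k < a}) = of_int \<lfloor>a\<rfloor> + of_bool (y < frac a)"
    unfolding eq by (auto simp: of_nat_nat)
  show "finite {k::nat. y + real k < a}" unfolding eq by simp
qed

locale beta_base =
  fixes \<beta> :: real
  assumes \<beta>: "\<beta> > 1"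
begin

lemma finite_branches: "0 \<le> y \<Longrightarrow> y < 1 \<Longrightarrow> finite {k::nat. y + real k < \<beta>}"
  using card_nat_less_diff(1)[of \<beta> y] \<beta> by simp

lemma weight_sums:
  assumes "0 \<le> y" "y < 1"
  shows "(\<lambda>k. beta_weight \<beta> k y * f k) sums (\<Sum>k | y + real k < \<beta>. f k / \<beta>)"
proof -
  have "(\<lambda>k. beta_weight \<beta> k y * f k) sums (\<Sum>k | y + real k < \<beta>. beta_weight \<beta> k y * f k)"
    using finite_branches[OF assms] by (intro sums_finite) (auto simp: beta_weight_def)
  then show ?thesis by (simp add: beta_weight_def)
qed

lemma nn_transfer_beta:
  fixes F g :: "real \<Rightarrow> ennreal"
  assumes [measurable]: "F \<in> borel_measurable borel" "g \<in> borel_measurable borel"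
  shows "(\<integral>\<^sup>+x. F x * g (beta_map \<beta> x) \<partial>unit_lebesgue) =
        (\<integral>\<^sup>+y. (\<Sum>k. ennreal (beta_weight \<beta> k y) * F (beta_branch \<beta> k y)) * g y \<partial>unit_lebesgue)"
proof -
  have mb [measurable]: "beta_map \<beta> \<in> borel_measurable borel"
    unfolding beta_map_def[abs_def] frac_def by measurable
  have mw [measurable]: "beta_weight \<beta> k \<in> borel_measurable borel" for k unfolding beta_weight_def[abs_def] by measurable
  have mp [measurable]: "beta_branch \<beta> k \<in> borel_measurable borel" for k unfolding beta_branch_def[abs_def] by measurable
  define D where "D k = {x \<in> {0..<1}. nat \<lfloor>\<beta> * x\<rfloor> = k}" for k
  have D [measurable]: "D k \<in> sets borel" for k unfolding D_def by measurable
  have ae1: "AE x in lborel. x \<noteq> (1::real)" by (rule AE_lborel_singleton)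
  have "(\<integral>\<^sup>+x. F x * g (beta_map \<beta> x) \<partial>unit_lebesgue) =
      (\<integral>\<^sup>+x. (\<Sum>k. indicator (D k) x * (F x * g (beta_map \<beta> x))) \<partial>lborel)"
    unfolding nn_integral_unit_lebesgue
  proof (rule nn_integral_cong_AE, use ae1 in eventually_elim)
    fix x :: real assume "x \<noteq> 1"
    have "(\<Sum>k. indicator (D k) x * (F x * g (beta_map \<beta> x))) =
      (\<Sum>k\<in>{nat \<lfloor>\<beta> * x\<rfloor>}. indicator (D k) x * (F x * g (beta_map \<beta> x)))"
      by (rule suminf_finite) (auto simp: D_def)
    then show "F x * g (beta_map \<beta> x) * indicator {0..1} x = (\<Sum>k. indicator (D k) x * (F x * g (beta_map \<beta> x)))"
      using \<open>x \<noteq> 1\<close> by (auto simp: D_def indicator_def)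
  qed
  also have "\<dots> = (\<Sum>k. \<integral>\<^sup>+x. indicator (D k) x * (F x * g (beta_map \<beta> x)) \<partial>lborel)"
    by (rule nn_integral_suminf) measurable
  also have "\<dots> = (\<Sum>k. \<integral>\<^sup>+y. ennreal (beta_weight \<beta> k y) * F (beta_branch \<beta> k y) * g y \<partial>unit_lebesgue)"
  proof (rule suminf_cong)
    fix k
    have "(\<integral>\<^sup>+x. indicator (D k) x * (F x * g (beta_map \<beta> x)) \<partial>lborel) =
      ennreal \<bar>1 / \<beta>\<bar> * (\<integral>\<^sup>+y. indicator (D k) (real k / \<beta> + 1 / \<beta> * y) *
        (F (real k / \<beta> + 1 / \<beta> * y) * g (beta_map \<beta> (real k / \<beta> + 1 / \<beta> * y))) \<partial>lborel)"
      using \<beta> by (intro nn_integral_real_affine) auto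
    also have "\<dots> = (\<integral>\<^sup>+y. ennreal \<bar>1 / \<beta>\<bar> * (indicator (D k) (real k / \<beta> + 1 / \<beta> * y) *
        (F (real k / \<beta> + 1 / \<beta> * y) * g (beta_map \<beta> (real k / \<beta> + 1 / \<beta> * y)))) \<partial>lborel)"
      by (rule nn_integral_cmult[symmetric]) measurable
    also have "\<dots> = (\<integral>\<^sup>+y. ennreal (beta_weight \<beta> k y) * F (beta_branch \<beta> k y) * g y \<partial>unit_lebesgue)"
      unfolding nn_integral_unit_lebesgue
    proof (rule nn_integral_cong_AE, use ae1 in eventually_elim)
      fix y :: real assume y1: "y \<noteq> 1"
      have br: "real k / \<beta> + 1 / \<beta> * y = beta_branch \<beta> k y" by (simp add: beta_branch_def add_divide_distrib)
      have bb: "\<beta> * beta_branch \<beta> k y = y + real k" using \<beta> by (simp add: beta_branch_def)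
      have Dk: "beta_branch \<beta> k y \<in> D k \<longleftrightarrow> y \<in> {0..<1} \<and> y + real k < \<beta>"
      proof
        assume "beta_branch \<beta> k y \<in> D k"
        then have "0 \<le> beta_branch \<beta> k y" "beta_branch \<beta> k y < 1" "nat \<lfloor>y + real k\<rfloor> = k"
          by (auto simp: D_def bb)
        moreover from this(1,2) have "0 \<le> y + real k" "y + real k < \<beta>" using \<beta> by (auto simp: beta_branch_def field_simps)
        ultimately show "y \<in> {0..<1} \<and> y + real k < \<beta>" by auto linarith+
      next
        assume y: "y \<in> {0..<1} \<and> y + real k < \<beta>"
        then have "\<lfloor>y + real k\<rfloor> = int k" by (auto intro!: floor_unique)
        then show "beta_branch \<beta> k y \<in> D k" unfolding D_def using y \<beta> bb by (auto simp: beta_branch_def)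
      qed
      have T: "beta_map \<beta> (beta_branch \<beta> k y) = y" if "y \<in> {0..<1}"
      proof -
        have "\<lfloor>y + real k\<rfloor> = int k" using that by (auto intro!: floor_unique)
        then show ?thesis unfolding beta_map_def bb frac_def by simp
      qed
      show "ennreal \<bar>1 / \<beta>\<bar> * (indicator (D k) (real k / \<beta> + 1 / \<beta> * y) *
        (F (real k / \<beta> + 1 / \<beta> * y) * g (beta_map \<beta> (real k / \<beta> + 1 / \<beta> * y)))) =
        ennreal (beta_weight \<beta> k y) * F (beta_branch \<beta> k y) * g y * indicator {0..1} y"
        unfolding br using Dk T y1 \<beta> by (auto simp: indicator_def beta_weight_def mult.assoc)
    qed
    finally show "(\<integral>\<^sup>+x. indicator (D k) x * (F x * g (beta_map \<beta> x)) \<partial>lborel) =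
       (\<integral>\<^sup>+y. ennreal (beta_weight \<beta> k y) * F (beta_branch \<beta> k y) * g y \<partial>unit_lebesgue)" .
  qed
  also have "\<dots> = (\<integral>\<^sup>+y. (\<Sum>k. ennreal (beta_weight \<beta> k y) * F (beta_branch \<beta> k y) * g y) \<partial>unit_lebesgue)"
    by (rule nn_integral_suminf[symmetric]) (intro measurable_unit_lebesgue; measurable)
  also have "\<dots> = (\<integral>\<^sup>+y. (\<Sum>k. ennreal (beta_weight \<beta> k y) * F (beta_branch \<beta> k y)) * g y \<partial>unit_lebesgue)"
    by (simp only: ennreal_suminf_multc)
  finally show ?thesis .
qed

sublocale expanding_map "beta_map \<beta>" "\<lambda>x. nat \<lfloor>\<beta> * x\<rfloor>" "beta_weight \<beta>" "beta_branch \<beta>" "{0..<1}" 2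
proof
  show "{0<..<1} \<subseteq> {0..<1::real}" "{0..<1} \<subseteq> {0..1::real}" "{0..<1} \<in> sets (borel :: real measure)" by auto
  show "beta_map \<beta> \<in> borel_measurable borel" unfolding beta_map_def[abs_def] frac_def by measurable
  show "(\<lambda>x. nat \<lfloor>\<beta> * x\<rfloor>) \<in> borel \<rightarrow>\<^sub>M count_space UNIV" by measurable
  show "beta_map \<beta> x \<in> {0..1}" "beta_map \<beta> x \<in> {0..<1}" for x
    using frac_lt_1[of "\<beta> * x"] by (auto simp: beta_map_def less_imp_le)
  show "beta_weight \<beta> k \<in> borel_measurable borel" for k unfolding beta_weight_def[abs_def] by measurable
  show "beta_branch \<beta> k \<in> borel_measurable borel" for k unfolding beta_branch_def[abs_def] by measurable
  show "0 \<le> beta_weight \<beta> k y" for k y using \<beta> by (auto simp: beta_weight_def)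
  fix y :: real assume "y \<in> {0..<1}"
  then have y: "0 \<le> y" "y < 1" by auto
  have s: "(\<lambda>k. beta_weight \<beta> k y) sums (\<Sum>k | y + real k < \<beta>. 1 / \<beta>)"
    using weight_sums[OF y, of "\<lambda>_. 1"] by simp
  then show "summable (\<lambda>k. beta_weight \<beta> k y)" by (rule sums_summable)
  have "(\<Sum>k. beta_weight \<beta> k y) = real (card {k. y + real k < \<beta>}) / \<beta>"
    using s by (simp add: sums_iff)
  \<comment> \<open>At most \<open>\<lfloor>\<beta>\<rfloor> + 1\<close> branches of weight
    \<open>1 / \<beta>\<close> contribute.\<close>
  also have "\<dots> \<le> (\<beta> + 1) / \<beta>"
    using card_nat_less_diff(2)[of \<beta> y] y \<beta> by (intro divide_right_mono) (auto simp: of_bool_def, linarith)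
  also have "\<dots> \<le> 2" using \<beta> by (simp add: field_simps)
  finally show "(\<Sum>k. beta_weight \<beta> k y) \<le> 2" .
  fix k assume "beta_weight \<beta> k y \<noteq> 0"
  then have k: "y + real k < \<beta>" by (auto simp: beta_weight_def split: if_splits)
  have bb: "\<beta> * beta_branch \<beta> k y = y + real k" using \<beta> by (simp add: beta_branch_def)
  have fl: "\<lfloor>y + real k\<rfloor> = int k" using y by (auto intro!: floor_unique)
  show "beta_branch \<beta> k y \<in> {0..<1} \<and> nat \<lfloor>\<beta> * beta_branch \<beta> k y\<rfloor> = k \<and> beta_map \<beta> (beta_branch \<beta> k y) = y"
    unfolding beta_map_def bb fl frac_def using y k \<beta> by (auto simp: beta_branch_def)
next
  fix F g :: "real \<Rightarrow> ennreal"
  assume "F \<in> borel_measurable borel" "g \<in> borel_measurable borel"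
  then show "(\<integral>\<^sup>+x. F x * g (beta_map \<beta> x) \<partial>unit_lebesgue) =
        (\<integral>\<^sup>+y. (\<Sum>k. ennreal (beta_weight \<beta> k y) * F (beta_branch \<beta> k y)) * g y \<partial>unit_lebesgue)"
    by (rule nn_transfer_beta)
next
  fix x y z :: real
  assume x: "x \<in> {0..<1}" "y \<in> {0..<1}" "x \<le> z" "z \<le> y"
  then show "z \<in> {0..<1}" by auto
  assume d: "nat \<lfloor>\<beta> * x\<rfloor> = nat \<lfloor>\<beta> * y\<rfloor>"
  have m: "\<beta> * x \<le> \<beta> * z" "\<beta> * z \<le> \<beta> * y" "0 \<le> \<beta> * x" using x \<beta> by (auto intro!: mult_left_mono)
  then have "\<lfloor>\<beta> * x\<rfloor> \<le> \<lfloor>\<beta> * z\<rfloor>" "\<lfloor>\<beta> * z\<rfloor> \<le> \<lfloor>\<beta> * y\<rfloor>" "0 \<le> \<lfloor>\<beta> * x\<rfloor>" by (auto intro!: floor_mono)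
  moreover from this have "\<lfloor>\<beta> * x\<rfloor> = \<lfloor>\<beta> * y\<rfloor>" using d by (subst (asm) eq_nat_nat_iff) linarith+
  ultimately have "\<lfloor>\<beta> * x\<rfloor> = \<lfloor>\<beta> * z\<rfloor>" "\<lfloor>\<beta> * z\<rfloor> = \<lfloor>\<beta> * y\<rfloor>" by linarith+
  then show "nat \<lfloor>\<beta> * z\<rfloor> = nat \<lfloor>\<beta> * x\<rfloor> \<and>
       (beta_map \<beta> x \<le> beta_map \<beta> z \<and> beta_map \<beta> z \<le> beta_map \<beta> y \<or>
        beta_map \<beta> y \<le> beta_map \<beta> z \<and> beta_map \<beta> z \<le> beta_map \<beta> x)"
    using m by (simp add: beta_map_def frac_def)
qed

section \<open>Decreasing densities and their Lasota-Yorke inequality\<close>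

text \<open>The inverse branches of a beta map increase and its weights decrease in
  \<open>y\<close>, so the transfer operator preserves this cone. The supremum of such a function on
  \<open>[0, 1)\<close> is its value at 0, and comparing \<open>f 0\<close> with the integral takes
  the place of a variation norm.\<close>

definition decreasing :: "(real \<Rightarrow> real) \<Rightarrow> bool" where
  "decreasing f \<longleftrightarrow> f \<in> borel_measurable borel \<and> (\<forall>x y. 0 \<le> x \<longrightarrow> x \<le> y \<longrightarrow> y < 1 \<longrightarrow> 0 \<le> f y \<and> f y \<le> f x)"

lemma decreasing_bounds: "decreasing f \<Longrightarrow> x \<in> {0..<1} \<Longrightarrow> 0 \<le> f x \<and> f x \<le> f 0"
  by (auto simp: decreasing_def)

lemma decreasing_borel: "decreasing f \<Longrightarrow> f \<in> borel_measurable borel"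
  by (simp add: decreasing_def)

lemma decreasing_integrable:
  assumes "decreasing f" shows "integrable unit_lebesgue f"
proof (rule integrable_bounded[OF decreasing_borel[OF assms]])
  show "\<bar>f x\<bar> \<le> f 0" if "x \<in> {0..<1}" for x using decreasing_bounds[OF assms that] by simp
qed

text \<open>One function per branch is allowed because \<open>transfer_word_cone\<close> asks for
  it; monotonicity is checked summand by summand.\<close>

lemma decreasing_branch_sum:
  assumes f: "\<And>k. decreasing (f k)" and B: "\<And>k x. x \<in> {0..<1} \<Longrightarrow> 0 \<le> f k x \<and> f k x \<le> B"
  shows "decreasing (\<lambda>y. if y \<in> {0..<1} then \<Sum>k. beta_weight \<beta> k y * f k (beta_branch \<beta> k y) else 0)"
  unfolding decreasing_def
proof (intro conjI allI impI)
  have [measurable]: "f k \<in> borel_measurable borel" for k using f by (auto simp: decreasing_def)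
  show "(\<lambda>y. if y \<in> {0..<1} then \<Sum>k. beta_weight \<beta> k y * f k (beta_branch \<beta> k y) else 0) \<in> borel_measurable borel"
    by measurable
  fix x y :: real assume xy: "0 \<le> x" "x \<le> y" "y < 1"
  have t: "0 \<le> beta_weight \<beta> k y * f k (beta_branch \<beta> k y)"
    "beta_weight \<beta> k y * f k (beta_branch \<beta> k y) \<le> beta_weight \<beta> k x * f k (beta_branch \<beta> k x)" for k
  proof -
    have *: "0 \<le> f k (beta_branch \<beta> k y)" "f k (beta_branch \<beta> k y) \<le> f k (beta_branch \<beta> k x)" if "y + real k < \<beta>"
      using f[of k] xy that \<beta> unfolding decreasing_def beta_branch_def by (auto simp: divide_right_mono)
    have "0 \<le> f k (beta_branch \<beta> k x)" if "x + real k < \<beta>"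
      using f[of k] xy that \<beta> unfolding decreasing_def beta_branch_def by (auto simp: divide_right_mono)
    with * show "0 \<le> beta_weight \<beta> k y * f k (beta_branch \<beta> k y)"
      "beta_weight \<beta> k y * f k (beta_branch \<beta> k y) \<le> beta_weight \<beta> k x * f k (beta_branch \<beta> k x)"
      using xy \<beta> by (auto simp: beta_weight_def divide_right_mono)
  qed
  have s: "summable (\<lambda>k. beta_weight \<beta> k z * f k (beta_branch \<beta> k z))" if "0 \<le> z" "z < 1" for z
    using weight_sums[OF that, of "\<lambda>k. f k (beta_branch \<beta> k z)"] by (rule sums_summable)
  have "0 \<le> (\<Sum>k. beta_weight \<beta> k y * f k (beta_branch \<beta> k y))"
    using t s xy by (intro suminf_nonneg) auto
  moreover have "(\<Sum>k. beta_weight \<beta> k y * f k (beta_branch \<beta> k y)) \<le> (\<Sum>k. beta_weight \<beta> k x * f k (beta_branch \<beta> k x))"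
    using t s xy by (intro suminf_le) auto
  ultimately show "0 \<le> (if y \<in> {0..<1} then \<Sum>k. beta_weight \<beta> k y * f k (beta_branch \<beta> k y) else 0)"
     "(if y \<in> {0..<1} then \<Sum>k. beta_weight \<beta> k y * f k (beta_branch \<beta> k y) else 0)
       \<le> (if x \<in> {0..<1} then \<Sum>k. beta_weight \<beta> k x * f k (beta_branch \<beta> k x) else 0)"
    using xy by auto
qed

lemma decreasing_const: "0 \<le> c \<Longrightarrow> decreasing (\<lambda>_. c)"
  by (simp add: decreasing_def)

lemma decreasing_transfer: "decreasing f \<Longrightarrow> decreasing (transfer f)"
  using decreasing_branch_sum[of "\<lambda>_. f" "f 0"] decreasing_bounds[of f]
  unfolding transfer_def[abs_def] by auto

lemma decreasing_transfer_iterate: "decreasing f \<Longrightarrow> decreasing ((transfer ^^ n) f)"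
  by (induction n) (auto simp: decreasing_transfer)

lemma integral_transfer_iterate_decreasing:
  assumes "decreasing f"
  shows "(\<integral>x. (transfer ^^ n) f x \<partial>unit_lebesgue) = (\<integral>x. f x \<partial>unit_lebesgue)"
  using integral_transfer_iterate[of f "f 0" "\<lambda>_. 1" n] assms decreasing_bounds[OF assms]
  by (auto simp: decreasing_def)

text \<open>Compared with the value at \<open>0\<close>, the branches at \<open>y\<close> can only lose the largest term of
  the sum, so averaging over \<open>y\<close> gives a Lasota-Yorke inequality for the supremum.\<close>

lemma transfer_zero_le:
  assumes f: "decreasing f"
  shows "transfer f 0 \<le> f 0 / \<beta> + (\<integral>x. f x \<partial>unit_lebesgue)"
proof -
  have s: "summable (\<lambda>k. beta_weight \<beta> k z * f (beta_branch \<beta> k z))" if "0 \<le> z" "z < 1" for z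
    using weight_sums[OF that, of "\<lambda>k. f (beta_branch \<beta> k z)"] by (rule sums_summable)
  have low: "transfer f 0 - f 0 / \<beta> \<le> transfer f y" if "y \<in> {0..<1}" for y
  proof -
    have y: "0 \<le> y" "y < 1" using that by auto
    have s0: "summable (\<lambda>k. beta_weight \<beta> (Suc k) 0 * f (beta_branch \<beta> (Suc k) 0))"
      using s[of 0] by (subst summable_Suc_iff) auto
    have "(\<Sum>k. beta_weight \<beta> (Suc k) 0 * f (beta_branch \<beta> (Suc k) 0)) = transfer f 0 - f 0 / \<beta>"
      using suminf_split_head[OF s[of 0]] \<beta> by (simp add: transfer_def beta_weight_def beta_branch_def)
    \<comment> \<open>The indices are shifted against each other: \<open>(k + 1) / \<beta>\<close>
      lies to the right of \<open>(y + k) / \<beta>\<close>, and if branch \<open>k + 1\<close>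
      exists at 0 then branch \<open>k\<close> exists at \<open>y\<close>.\<close>
    moreover have "(\<Sum>k. beta_weight \<beta> (Suc k) 0 * f (beta_branch \<beta> (Suc k) 0)) \<le> (\<Sum>k. beta_weight \<beta> k y * f (beta_branch \<beta> k y))"
    proof (intro suminf_le s0 s y)
      fix k
      have *: "f (beta_branch \<beta> (Suc k) 0) \<le> f (beta_branch \<beta> k y)" if "real (Suc k) < \<beta>"
        using f y that \<beta> unfolding decreasing_def beta_branch_def by (auto simp: divide_right_mono)
      have "0 \<le> f (beta_branch \<beta> k y)" if "y + real k < \<beta>"
        using f y that \<beta> unfolding decreasing_def beta_branch_def by auto
      with * show "beta_weight \<beta> (Suc k) 0 * f (beta_branch \<beta> (Suc k) 0) \<le> beta_weight \<beta> k y * f (beta_branch \<beta> k y)"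
        using y \<beta> by (auto simp: beta_weight_def divide_right_mono)
    qed
    ultimately show ?thesis using that by (simp add: transfer_def)
  qed
  have "transfer f 0 - f 0 / \<beta> = (\<integral>x. transfer f 0 - f 0 / \<beta> \<partial>unit_lebesgue)" by simp
  also have "\<dots> \<le> (\<integral>x. transfer f x \<partial>unit_lebesgue)"
    using low decreasing_integrable[OF decreasing_transfer[OF f]] by (intro integral_mono_X) auto
  also have "\<dots> = (\<integral>x. f x \<partial>unit_lebesgue)"
    using integral_transfer_iterate_decreasing[OF f, of 1] by simp
  finally show ?thesis by simp
qed

text \<open>The fixed point of \<open>t \<mapsto> t / \<beta> + 1\<close>, which is the recursion
  obtained by iterating the Lasota-Yorke inequality. It equals \<open>1 / (1 - 1 / \<beta>)\<close>,
  the upper bound in the definition of the Renyi measure.\<close>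

definition D :: real where "D = \<beta> / (\<beta> - 1)"

lemma D_ge_1: "D \<ge> 1" and D_step: "D / \<beta> + 1 = D"
  using \<beta> by (simp_all add: D_def field_simps)

lemma integral_decreasing_nonneg: "decreasing f \<Longrightarrow> 0 \<le> (\<integral>x. f x \<partial>unit_lebesgue)"
  using integral_mono_X[of "\<lambda>_. 0" f] decreasing_integrable[of f] decreasing_bounds[of f] by auto

lemma transfer_iterate_zero_le:
  assumes f: "decreasing f"
  shows "(transfer ^^ n) f 0 \<le> f 0 / \<beta> ^ n + D * (\<integral>x. f x \<partial>unit_lebesgue)"
proof (induction n)
  case 0
  then show ?case using D_ge_1 integral_decreasing_nonneg[OF f] by simp
next
  case (Suc n)
  let ?I = "\<integral>x. f x \<partial>unit_lebesgue"
  have "(transfer ^^ Suc n) f 0 \<le> (transfer ^^ n) f 0 / \<beta> + ?I"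
    using transfer_zero_le[OF decreasing_transfer_iterate[OF f, of n]]
    by (simp add: integral_transfer_iterate_decreasing[OF f])
  also have "\<dots> \<le> (f 0 / \<beta> ^ n + D * ?I) / \<beta> + ?I"
    using Suc \<beta> by (intro add_right_mono divide_right_mono) auto
  also have "\<dots> = f 0 / \<beta> ^ Suc n + (D / \<beta> + 1) * ?I"
    using \<beta> by (simp add: add_divide_distrib distrib_right)
  finally show ?case by (simp add: D_step)
qed

text \<open>Of the \<open>n\<close>-fold inverse branches only the one with all digits 0 is kept. It
  is complete and contracts towards 0, where a decreasing density is largest.\<close>

lemma transfer_iterate_ge_first_branch:
  assumes f: "decreasing f" and "0 \<le> y" "y < 1"
  shows "f (y / \<beta> ^ n) / \<beta> ^ n \<le> (transfer ^^ n) f y"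
  using assms(2,3)
proof (induction n arbitrary: y)
  case (Suc n)
  let ?g = "(transfer ^^ n) f"
  have g: "decreasing ?g" using decreasing_transfer_iterate[OF f] .
  have yb: "0 \<le> y / \<beta>" "y / \<beta> < 1" using Suc.prems \<beta> by (auto simp: field_simps)
  have "f (y / \<beta> / \<beta> ^ n) / \<beta> ^ n / \<beta> \<le> ?g (y / \<beta>) / \<beta>"
    using Suc.IH[OF yb] \<beta> by (intro divide_right_mono) auto
  also have "\<dots> = (\<Sum>k\<in>{0}. beta_weight \<beta> k y * ?g (beta_branch \<beta> k y))"
    using Suc.prems \<beta> by (simp add: beta_weight_def beta_branch_def)
  also have "\<dots> \<le> (\<Sum>k. beta_weight \<beta> k y * ?g (beta_branch \<beta> k y))"
  proof (rule sum_le_suminf)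
    show "summable (\<lambda>k. beta_weight \<beta> k y * ?g (beta_branch \<beta> k y))"
      using weight_sums[OF Suc.prems, of "\<lambda>k. ?g (beta_branch \<beta> k y)"] by (rule sums_summable)
    show "0 \<le> beta_weight \<beta> k y * ?g (beta_branch \<beta> k y)" for k
      using decreasing_bounds[OF g, of "beta_branch \<beta> k y"] Suc.prems \<beta> by (auto simp: beta_weight_def beta_branch_def)
  qed simp
  also have "\<dots> = (transfer ^^ Suc n) f y" using Suc.prems by (simp add: transfer_def[where y = y])
  finally show ?case by (simp add: field_simps)
qed simp

end

section \<open>Minorisation, coupling and the exponential mixing rate\<close>

context beta_base
begin

lemma integrable_decreasing_indicator:
  assumes "decreasing f" and [measurable]: "A \<in> sets borel"
  shows "integrable unit_lebesgue (\<lambda>x. f x * indicator A ((beta_map \<beta> ^^ n) x))"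
proof (rule integrable_bounded)
  show "(\<lambda>x. f x * indicator A ((beta_map \<beta> ^^ n) x)) \<in> borel_measurable borel"
    using decreasing_borel[OF assms(1)] by measurable
  show "\<bar>f x * indicator A ((beta_map \<beta> ^^ n) x)\<bar> \<le> f 0" if "x \<in> {0..<1}" for x
    using decreasing_bounds[OF assms(1) that] decreasing_bounds[OF assms(1), of 0]
    by (auto simp: indicator_def)
qed

text \<open>On \<open>[0, \<delta>)\<close> with \<open>\<delta> = 1 / (2 * M)\<close> a density
  with \<open>f 0\<close> at most \<open>M\<close> times its integral carries at most half of its
  mass, so its value at \<open>\<delta>\<close> is at least half the integral. The choice of
  \<open>q\<close> brings \<open>y / \<beta> ^ q\<close> below \<open>\<delta>\<close> for every
  \<open>y\<close>, and the branch of zeros does the rest.\<close>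

lemma transfer_iterate_minorisation:
  assumes f: "decreasing f" and M: "M \<ge> 1" and f0: "f 0 \<le> M * (\<integral>x. f x \<partial>unit_lebesgue)"
    and q: "2 * M \<le> \<beta> ^ q" and y: "0 \<le> y" "y < 1"
  shows "1 / (2 * \<beta> ^ q) * (\<integral>x. f x \<partial>unit_lebesgue) \<le> (transfer ^^ q) f y"
proof -
  let ?I = "\<integral>x. f x \<partial>unit_lebesgue"
  define \<delta> where "\<delta> = 1 / (2 * M)"
  have \<delta>: "0 < \<delta>" "\<delta> < 1" using M by (auto simp: \<delta>_def)
  have \<beta>q: "\<beta> ^ q > 0" using \<beta> by simp
  have "?I \<le> (\<integral>x. f 0 * indicator {0..<\<delta>} x + f \<delta> \<partial>unit_lebesgue)"
  proof (rule integral_mono_X[OF decreasing_integrable[OF f]])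
    show "integrable unit_lebesgue (\<lambda>x. f 0 * indicator {0..<\<delta>} x + f \<delta>)"
      by (rule integrable_bounded[where B = "\<bar>f 0\<bar> + \<bar>f \<delta>\<bar>"]) (auto simp: indicator_def)
    show "f x \<le> f 0 * indicator {0..<\<delta>} x + f \<delta>" if "x \<in> {0..<1}" for x
      using f that \<delta> unfolding decreasing_def by (cases "x < \<delta>") (auto simp: indicator_def add_increasing2)
  qed
  also have "\<dots> = f 0 * \<delta> + f \<delta>"
  proof -
    have s: "{0..<\<delta>} \<in> sets unit_lebesgue" using \<delta> by (auto simp: sets_unit_lebesgue_iff)
    have "{0..<\<delta>} \<inter> {0..1} = {0..<\<delta>}" "{0..1} \<inter> {0..<\<delta>} = {0..<\<delta>}" using \<delta> by auto
    moreover have "unit.prob {0..<\<delta>} = \<delta>" using \<delta> by (subst measure_unit_lebesgue) auto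
    ultimately show ?thesis using integrable_indicator_unit_lebesgue[OF s] by simp
  qed
  also have "f 0 * \<delta> \<le> M * ?I * \<delta>" using f0 \<delta> by (intro mult_right_mono) auto
  also have "M * ?I * \<delta> = ?I / 2" using M by (simp add: \<delta>_def)
  finally have "?I / 2 \<le> f \<delta>" by simp
  moreover have "f \<delta> \<le> f (y / \<beta> ^ q)"
  proof -
    have "1 / \<beta> ^ q \<le> \<delta>" using q M \<beta>q by (simp add: \<delta>_def field_simps)
    moreover have "y / \<beta> ^ q \<le> 1 / \<beta> ^ q" using y \<beta>q by (intro divide_right_mono) auto
    ultimately show ?thesis using f \<delta> y \<beta>q unfolding decreasing_def by auto
  qed
  ultimately have "?I / 2 / \<beta> ^ q \<le> f (y / \<beta> ^ q) / \<beta> ^ q" using \<beta>q by (intro divide_right_mono) auto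
  also have "\<dots> \<le> (transfer ^^ q) f y" by (rule transfer_iterate_ge_first_branch[OF f y])
  finally show ?thesis by simp
qed

text \<open>Iterates of the transfer operator end up with supremum at most \<open>M\<close> times their integral; \<open>q\<close>
  steps then dominate the fraction \<open>c\<close> of Lebesgue measure, which is split off.\<close>

definition M :: real where "M = 4 * D + 4"

definition q :: nat where "q = (SOME q. 2 * M \<le> \<beta> ^ q)"

definition c :: real where "c = 1 / (2 * \<beta> ^ q)"

lemma M_ge: "M \<ge> 8"
  using D_ge_1 by (simp add: M_def)

lemma q_le: "2 * M \<le> \<beta> ^ q"
proof -
  obtain n where "2 * M < \<beta> ^ n" using real_arch_pow[OF \<beta>] by blast
  then have "2 * M \<le> \<beta> ^ n" by simp
  then show ?thesis unfolding q_def by (rule someI[where P = "\<lambda>q. 2 * M \<le> \<beta> ^ q"])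
qed

lemma c_bounds: "0 < c" "c \<le> 1 / 32"
  using q_le M_ge by (auto simp: c_def field_simps)

lemma q_pos: "q > 0"
  using q_le M_ge by (cases q) auto

text \<open>Subtracting a constant keeps the function decreasing, and the minorisation keeps it
  nonnegative. By the Lasota-Yorke inequality the remainder again satisfies the bound by
  \<open>M\<close> times its own, smaller integral, so the step can be repeated.\<close>

lemma coupling_step:
  assumes f: "decreasing f" and I: "(\<integral>x. f x \<partial>unit_lebesgue) = I" and f0: "f 0 \<le> M * I"
  defines "g \<equiv> \<lambda>y. if y \<in> {0..<1} then (transfer ^^ q) f y - c * I else 0"
  shows "decreasing g" "(\<integral>x. g x \<partial>unit_lebesgue) = (1 - c) * I" "g 0 \<le> M * ((1 - c) * I)"
proof -
  note g' = decreasing_transfer_iterate[OF f, of q]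
  have I0: "0 \<le> I" using integral_decreasing_nonneg[OF f] I by simp
  have ge: "c * I \<le> (transfer ^^ q) f y" if "0 \<le> y" "y < 1" for y
    using transfer_iterate_minorisation[OF f _ _ q_le that] M_ge f0 unfolding I c_def by simp
  have [measurable]: "(transfer ^^ q) f \<in> borel_measurable borel" using g' by (rule decreasing_borel)
  have gb: "g \<in> borel_measurable borel" unfolding g_def by measurable
  then show "decreasing g" using g' ge unfolding decreasing_def by (auto simp: g_def)
  have "(\<integral>x. g x \<partial>unit_lebesgue) = (\<integral>x. (transfer ^^ q) f x - c * I \<partial>unit_lebesgue)"
    by (rule integral_cong_X[OF gb]) (auto simp: g_def)
  also have "\<dots> = (\<integral>x. (transfer ^^ q) f x \<partial>unit_lebesgue) - c * I"
    using decreasing_integrable[OF g'] by simp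
  finally show "(\<integral>x. g x \<partial>unit_lebesgue) = (1 - c) * I"
    using integral_transfer_iterate_decreasing[OF f, of q] I by (simp add: algebra_simps)
  have "f 0 / \<beta> ^ q \<le> M * I / \<beta> ^ q" using f0 \<beta> by (intro divide_right_mono) auto
  also have "\<dots> \<le> I / 2"
  proof -
    have "M / \<beta> ^ q \<le> 1 / 2" using q_le \<beta> by (simp add: field_simps)
    then have "M / \<beta> ^ q * I \<le> 1 / 2 * I" using I0 by (rule mult_right_mono)
    then show ?thesis by simp
  qed
  finally have "(transfer ^^ q) f 0 \<le> I / 2 + D * I"
    using transfer_iterate_zero_le[OF f, of q] unfolding I by linarith
  \<comment> \<open>\<open>31 / 32\<close> is the lower bound for \<open>1 - c\<close>;
    \<open>M\<close> was chosen large enough to absorb \<open>1 / 2 + D\<close> with this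
    loss.\<close>
  also have "\<dots> \<le> M * (31 / 32) * I"
    using I0 D_ge_1 mult_right_mono[of "1/2 + D" "M * (31/32)" I] by (simp add: M_def algebra_simps)
  also have "\<dots> \<le> M * (1 - c) * I"
    using I0 c_bounds M_ge by (intro mult_right_mono mult_left_mono) auto
  finally have "(transfer ^^ q) f 0 \<le> M * ((1 - c) * I)" by (simp only: mult.assoc)
  moreover have "0 \<le> c * I" using I0 c_bounds by simp
  moreover have "g 0 = (transfer ^^ q) f 0 - c * I" by (simp add: g_def)
  ultimately show "g 0 \<le> M * ((1 - c) * I)" by linarith
qed

text \<open>In each round of \<open>q\<close> steps both functions split off the same constant
  \<open>c * I\<close>; these parts evolve identically and cancel. After \<open>k\<close> rounds
  only mass \<open>(1 - c) ^ k * I\<close> is left to differ.\<close>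

lemma coupling:
  assumes A [measurable]: "A \<in> sets borel"
    and "decreasing f" "decreasing g" "(\<integral>x. f x \<partial>unit_lebesgue) = I" "(\<integral>x. g x \<partial>unit_lebesgue) = I"
    and "f 0 \<le> M * I" "g 0 \<le> M * I"
  shows "(\<integral>x. f x * indicator A ((beta_map \<beta> ^^ (q * k)) x) \<partial>unit_lebesgue)
      \<le> (\<integral>x. g x * indicator A ((beta_map \<beta> ^^ (q * k)) x) \<partial>unit_lebesgue) + (1 - c) ^ k * I"
  using assms(2-)
proof (induction k arbitrary: f g I)
  case 0
  have "(\<integral>x. f x * indicator A x \<partial>unit_lebesgue) \<le> (\<integral>x. f x \<partial>unit_lebesgue)"
    using decreasing_bounds[OF 0(1)] integrable_decreasing_indicator[OF 0(1) A, of 0] decreasing_integrable[OF 0(1)]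
    by (intro integral_mono_X) (auto simp: indicator_def)
  moreover have "0 \<le> (\<integral>x. g x * indicator A x \<partial>unit_lebesgue)"
    using decreasing_bounds[OF 0(2)] integrable_decreasing_indicator[OF 0(2) A, of 0]
      integral_mono_X[of "\<lambda>_. 0" "\<lambda>x. g x * indicator A x"] by auto
  ultimately show ?case using 0 by simp
next
  case (Suc k)
  define h where "h f y = (if y \<in> {0..<1} then (transfer ^^ q) f y - c * I else 0)" for f y
  let ?A = "\<lambda>x. indicator A ((beta_map \<beta> ^^ (q * k)) x) :: real"
  have split: "(\<integral>x. f x * indicator A ((beta_map \<beta> ^^ (q * Suc k)) x) \<partial>unit_lebesgue) =
      (\<integral>x. h f x * ?A x \<partial>unit_lebesgue) + c * I * (\<integral>x. ?A x \<partial>unit_lebesgue)"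
    if f: "decreasing f" "(\<integral>x. f x \<partial>unit_lebesgue) = I" "f 0 \<le> M * I" for f
  proof -
    have h: "decreasing (h f)" using coupling_step(1)[OF f] unfolding h_def[abs_def] .
    have iA: "integrable unit_lebesgue ?A"
      using integrable_decreasing_indicator[OF decreasing_const[of 1] A, of "q * k"] by simp
    have "(\<integral>x. f x * indicator A ((beta_map \<beta> ^^ (q * Suc k)) x) \<partial>unit_lebesgue) =
      (\<integral>x. f x * ?A ((beta_map \<beta> ^^ q) x) \<partial>unit_lebesgue)"
    proof -
      have "q * Suc k = q * k + q" by simp
      then have "(beta_map \<beta> ^^ (q * Suc k)) x = (beta_map \<beta> ^^ (q * k)) ((beta_map \<beta> ^^ q) x)" for x
        by (simp only: funpow_add comp_apply)
      then show ?thesis by simp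
    qed
    also have "\<dots> = (\<integral>x. (transfer ^^ q) f x * ?A x \<partial>unit_lebesgue)"
      using decreasing_bounds[OF f(1)] decreasing_borel[OF f(1)] by (intro integral_transfer_iterate) auto
    also have "\<dots> = (\<integral>x. h f x * ?A x + c * I * ?A x \<partial>unit_lebesgue)"
      using decreasing_borel[OF h] decreasing_borel[OF decreasing_transfer_iterate[OF f(1), of q]]
      by (intro integral_cong_X) (auto simp: h_def algebra_simps)
    also have "\<dots> = (\<integral>x. h f x * ?A x \<partial>unit_lebesgue) + c * I * (\<integral>x. ?A x \<partial>unit_lebesgue)"
      using integrable_decreasing_indicator[OF h A] iA by simp
    finally show ?thesis .
  qed
  have "(\<integral>x. h f x * ?A x \<partial>unit_lebesgue) \<le> (\<integral>x. h g x * ?A x \<partial>unit_lebesgue) + (1 - c) ^ k * ((1 - c) * I)"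
    using coupling_step[OF Suc.prems(1,3,5)] coupling_step[OF Suc.prems(2,4,6)]
    unfolding h_def[abs_def] by (intro Suc.IH) auto
  then show ?case
    using split[OF Suc.prems(1,3,5)] split[OF Suc.prems(2,4,6)] by (simp add: mult_ac)
qed

text \<open>The factor \<open>1 - c\<close> gained in \<open>q\<close> steps, distributed over
  single steps.\<close>

definition \<theta> :: real where "\<theta> = (1 - c) powr (1 / real q)"

lemma \<theta>_bounds: "0 < \<theta>" "\<theta> < 1"
proof -
  show "0 < \<theta>" using c_bounds by (simp add: \<theta>_def)
  show "\<theta> < 1" unfolding \<theta>_def using c_bounds q_pos powr_less_mono2[of "1 / real q" "1 - c" 1] by simp
qed

text \<open>Rounding \<open>n / q\<close> down costs at most one factor \<open>1 - c\<close>, which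
  is at least \<open>1 / 2\<close>.\<close>

lemma contraction_le: "(1 - c) ^ (n div q) \<le> 2 * \<theta> ^ n"
proof -
  have c1: "0 < 1 - c" "1 - c \<le> 1" "1 / 2 \<le> 1 - c" using c_bounds by auto
  have "real n / real q \<le> real (n div q) + 1"
  proof -
    have "n \<le> (n div q + 1) * q" using q_pos dividend_less_div_times[of q n] by simp
    then have "real n \<le> (real (n div q) + 1) * real q" by (metis of_nat_1 of_nat_add of_nat_le_iff of_nat_mult)
    then show ?thesis using q_pos by (simp add: pos_divide_le_eq)
  qed
  then have "(1 - c) powr (real (n div q) + 1) \<le> (1 - c) powr (real n / real q)"
    using c1 by (intro powr_mono') auto
  also have "\<dots> = \<theta> ^ n"
    using c1 by (simp add: \<theta>_def powr_realpow[symmetric] powr_powr)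
  finally have "(1 - c) ^ (n div q) * (1 - c) \<le> \<theta> ^ n"
    using c1 by (simp add: powr_add powr_realpow)
  moreover have "(1 - c) ^ (n div q) * (1 / 2) \<le> (1 - c) ^ (n div q) * (1 - c)"
    using c1 by (intro mult_left_mono) auto
  ultimately show ?thesis by simp
qed

text \<open>The coupling advances in blocks of \<open>q\<close> steps. The remaining
  \<open>n mod q\<close> steps are moved into the set, which is possible because the bound is
  uniform over all Borel sets.\<close>

lemma decreasing_coupling:
  assumes A [measurable]: "A \<in> sets borel"
    and f: "decreasing f" "(\<integral>x. f x \<partial>unit_lebesgue) = I" "f 0 \<le> M * I"
    and g: "decreasing g" "(\<integral>x. g x \<partial>unit_lebesgue) = I" "g 0 \<le> M * I"
  shows "\<bar>(\<integral>x. f x * indicator A ((beta_map \<beta> ^^ n) x) \<partial>unit_lebesgue)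
      - (\<integral>x. g x * indicator A ((beta_map \<beta> ^^ n) x) \<partial>unit_lebesgue)\<bar> \<le> 2 * I * \<theta> ^ n"
proof -
  define A' where "A' = (beta_map \<beta> ^^ (n mod q)) -` A"
  have A': "A' \<in> sets borel" unfolding A'_def using measurable_sets[OF iterate_borel A, of "n mod q"] by simp
  have eq: "indicator A ((beta_map \<beta> ^^ n) x) = (indicator A' ((beta_map \<beta> ^^ (q * (n div q))) x) :: real)" for x
  proof -
    have "n = n mod q + q * (n div q)" by simp
    then have "(beta_map \<beta> ^^ n) x = (beta_map \<beta> ^^ (n mod q)) ((beta_map \<beta> ^^ (q * (n div q))) x)"
      by (metis comp_apply funpow_add)
    then show ?thesis by (simp add: A'_def indicator_def)
  qed
  have I0: "0 \<le> I" using integral_decreasing_nonneg[OF f(1)] f by simp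
  have "\<bar>(\<integral>x. f x * indicator A ((beta_map \<beta> ^^ n) x) \<partial>unit_lebesgue)
      - (\<integral>x. g x * indicator A ((beta_map \<beta> ^^ n) x) \<partial>unit_lebesgue)\<bar> \<le> (1 - c) ^ (n div q) * I"
    unfolding eq using coupling[OF A' f(1) g(1) f(2) g(2) f(3) g(3), of "n div q"]
      coupling[OF A' g(1) f(1) g(2) f(2) g(3) f(3), of "n div q"] by linarith
  also have "\<dots> \<le> 2 * \<theta> ^ n * I" using contraction_le I0 by (rule mult_right_mono)
  finally show ?thesis by (simp add: mult_ac)
qed

section \<open>Parry's invariant density\<close>

text \<open>Parry's formula before normalisation: the indicators of \<open>[0, t)\<close> for the
  points \<open>t\<close> of the orbit of 1, weighted by powers of \<open>1 / \<beta>\<close>. The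
  orbit of 1 appears because only the incomplete last branch keeps a constant from being
  invariant.\<close>

definition parry :: "real \<Rightarrow> real" where
  "parry y = (\<Sum>n. of_bool (y < (beta_map \<beta> ^^ n) 1) / \<beta> ^ n)"

lemma orbit_one: "0 \<le> (beta_map \<beta> ^^ n) 1 \<and> (beta_map \<beta> ^^ n) 1 \<le> 1"
  by (induction n) (auto simp: beta_map_def frac_lt_1 less_imp_le)

lemma parry_geometric: "(\<lambda>n. 1 / \<beta> ^ n) sums D"
proof -
  have "(\<lambda>n. (1 / \<beta>) ^ n) sums (1 / (1 - 1 / \<beta>))" using \<beta> by (intro geometric_sums) auto
  moreover have "1 / (1 - 1 / \<beta>) = D" using \<beta> by (simp add: D_def field_simps)
  ultimately show ?thesis by (simp add: power_one_over)
qed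

lemma parry_summable: "summable (\<lambda>n. of_bool (y < (beta_map \<beta> ^^ n) 1) / \<beta> ^ n)"
  using parry_geometric \<beta> by (intro summable_comparison_test'[OF sums_summable[OF parry_geometric], of 0]) (auto simp: of_bool_def)

lemma parry_bounds:
  assumes "y < 1" shows "1 \<le> parry y" "parry y \<le> D"
proof -
  have "(\<Sum>n\<in>{0}. of_bool (y < (beta_map \<beta> ^^ n) 1) / \<beta> ^ n) \<le> parry y"
    unfolding parry_def using \<beta> by (intro sum_le_suminf parry_summable) auto
  then show "1 \<le> parry y" using assms by simp
  have "parry y \<le> (\<Sum>n. 1 / \<beta> ^ n)"
    unfolding parry_def using \<beta> sums_summable[OF parry_geometric]
    by (intro suminf_le parry_summable) (auto simp: of_bool_def)
  then show "parry y \<le> D" using parry_geometric by (simp add: sums_iff)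
qed

lemma decreasing_parry: "decreasing parry"
  unfolding decreasing_def
proof (intro conjI allI impI)
  show "parry \<in> borel_measurable borel" unfolding parry_def[abs_def] by measurable
  fix x y :: real assume xy: "0 \<le> x" "x \<le> y" "y < 1"
  show "0 \<le> parry y" using parry_bounds(1)[OF xy(3)] by simp
  show "parry y \<le> parry x"
    unfolding parry_def using \<beta> xy by (intro suminf_le parry_summable) (auto simp: of_bool_def)
qed

text \<open>Write \<open>o1 n\<close> for the orbit of 1. The indicator of \<open>[0, o1 n)\<close>
  is mapped to \<open>1 / \<beta>\<close> times the sum of
  \<open>\<lfloor>\<beta> * o1 n\<rfloor>\<close> and the indicator of
  \<open>[0, o1 (Suc n))\<close>. The floor equals \<open>\<beta> * o1 n - o1 (Suc n)\<close>, so
  the constants telescope to 1, which restores the term for \<open>n = 0\<close>.\<close>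

lemma transfer_parry:
  assumes y: "0 \<le> y" "y < 1"
  shows "transfer parry y = parry y"
proof -
  define o1 where "o1 n = (beta_map \<beta> ^^ n) 1" for n
  have o1: "0 \<le> o1 n" "o1 n \<le> 1" for n using orbit_one by (auto simp: o1_def)
  have o1_0: "o1 0 = 1" by (simp add: o1_def)
  have o1S: "o1 (Suc n) = frac (\<beta> * o1 n)" for n by (simp add: o1_def beta_map_def)
  let ?K = "{k. y + real k < \<beta>}"
  have K: "finite ?K" using finite_branches[OF y] .
  have "transfer parry y = (\<Sum>k\<in>?K. parry (beta_branch \<beta> k y) / \<beta>)"
    using sums_unique[OF weight_sums[OF y, of "\<lambda>k. parry (beta_branch \<beta> k y)"]] y by (simp add: transfer_def)
  also have "\<dots> = (\<Sum>k\<in>?K. \<Sum>n. of_bool (beta_branch \<beta> k y < o1 n) / \<beta> ^ n / \<beta>)"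
    unfolding parry_def o1_def by (intro sum.cong refl suminf_divide[symmetric] parry_summable)
  also have "\<dots> = (\<Sum>n. \<Sum>k\<in>?K. of_bool (beta_branch \<beta> k y < o1 n) / \<beta> ^ n / \<beta>)"
    unfolding o1_def by (intro suminf_sum[symmetric] summable_divide parry_summable)
  also have "(\<lambda>n. \<Sum>k\<in>?K. of_bool (beta_branch \<beta> k y < o1 n) / \<beta> ^ n / \<beta>) =
      (\<lambda>n. (o1 n / \<beta> ^ n - o1 (Suc n) / \<beta> ^ Suc n) + of_bool (y < o1 (Suc n)) / \<beta> ^ Suc n)"
  proof
    fix n
    have sub: "{k. y + real k < \<beta> * o1 n} \<subseteq> ?K"
    proof -
      have "\<beta> * o1 n \<le> \<beta>" using o1[of n] \<beta> by (intro mult_left_le) auto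
      then show ?thesis by auto
    qed
    have br: "beta_branch \<beta> k y < o1 n \<longleftrightarrow> y + real k < \<beta> * o1 n" for k
      using \<beta> by (simp add: beta_branch_def field_simps)
    have "(\<Sum>k\<in>?K. of_bool (beta_branch \<beta> k y < o1 n) / \<beta> ^ n / \<beta>) =
        (\<Sum>k\<in>?K. of_bool (y + real k < \<beta> * o1 n)) / \<beta> ^ Suc n"
      by (simp add: br sum_divide_distrib mult.commute)
    also have "(\<Sum>k\<in>?K. of_bool (y + real k < \<beta> * o1 n)) = real (card {k. y + real k < \<beta> * o1 n})"
    proof -
      have "?K \<inter> {k. y + real k < \<beta> * o1 n} = {k. y + real k < \<beta> * o1 n}" using sub by blast
      then show ?thesis using K by (simp add: of_bool_def sum.If_cases)
    qed
    also have "\<dots> = of_int \<lfloor>\<beta> * o1 n\<rfloor> + of_bool (y < o1 (Suc n))"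
      unfolding o1S using card_nat_less_diff(2)[of "\<beta> * o1 n" y] o1[of n] \<beta> y by simp
    also have "of_int \<lfloor>\<beta> * o1 n\<rfloor> = \<beta> * o1 n - o1 (Suc n)" by (simp add: o1S frac_def)
    finally show "(\<Sum>k\<in>?K. of_bool (beta_branch \<beta> k y < o1 n) / \<beta> ^ n / \<beta>) =
        (o1 n / \<beta> ^ n - o1 (Suc n) / \<beta> ^ Suc n) + of_bool (y < o1 (Suc n)) / \<beta> ^ Suc n"
      using \<beta> by (simp add: add_divide_distrib diff_divide_distrib)
  qed
  also have "(\<Sum>n. (o1 n / \<beta> ^ n - o1 (Suc n) / \<beta> ^ Suc n) + of_bool (y < o1 (Suc n)) / \<beta> ^ Suc n) = parry y"
  proof -
    have "(\<lambda>n. o1 n / \<beta> ^ n) \<longlonglongrightarrow> 0"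
    proof (rule tendsto_sandwich[where f = "\<lambda>_. 0" and h = "\<lambda>n. 1 / \<beta> ^ n"])
      show "(\<lambda>n. 1 / \<beta> ^ n) \<longlonglongrightarrow> 0" using sums_summable[OF parry_geometric] by (rule summable_LIMSEQ_zero)
    qed (use o1 \<beta> in \<open>auto simp: divide_right_mono\<close>)
    from telescope_sums'[OF this] have 1: "(\<lambda>n. o1 n / \<beta> ^ n - o1 (Suc n) / \<beta> ^ Suc n) sums 1"
      using o1_0 by simp
    have 2: "(\<lambda>n. of_bool (y < o1 (Suc n)) / \<beta> ^ Suc n) sums (parry y - 1)"
    proof -
      have "(\<lambda>n. of_bool (y < o1 n) / \<beta> ^ n) sums parry y"
        using parry_summable[of y] unfolding parry_def o1_def by (rule summable_sums)
      then show ?thesis using y o1_0 by (subst sums_Suc_iff) simp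
    qed
    from sums_add[OF 1 2] show ?thesis by (simp add: sums_iff)
  qed
  finally show ?thesis .
qed

definition parry_mass :: real where "parry_mass = (\<integral>x. parry x \<partial>unit_lebesgue)"

definition parry_density :: "real \<Rightarrow> real" where "parry_density y = parry y / parry_mass"

lemma parry_mass_bounds: "1 \<le> parry_mass" "parry_mass \<le> D"
proof -
  have "(\<integral>x. 1 \<partial>unit_lebesgue) \<le> parry_mass" "parry_mass \<le> (\<integral>x. D \<partial>unit_lebesgue)"
    unfolding parry_mass_def using parry_bounds decreasing_integrable[OF decreasing_parry]
    by (intro integral_mono_X; auto)+
  then show "1 \<le> parry_mass" "parry_mass \<le> D" by auto
qed

lemma decreasing_scale: "decreasing f \<Longrightarrow> 0 \<le> r \<Longrightarrow> decreasing (\<lambda>x. r * f x)"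
  unfolding decreasing_def by (auto intro!: mult_left_mono)

lemma decreasing_density: "decreasing parry_density"
  using decreasing_scale[OF decreasing_parry, of "1 / parry_mass"] parry_mass_bounds
  by (simp add: parry_density_def[abs_def])

lemma integral_density: "(\<integral>x. parry_density x \<partial>unit_lebesgue) = 1"
  using parry_mass_bounds by (simp add: parry_density_def parry_mass_def[symmetric])

lemma density_bounds: "y < 1 \<Longrightarrow> 1 / D \<le> parry_density y" "y < 1 \<Longrightarrow> parry_density y \<le> D"
proof -
  assume y: "y < 1"
  have "1 / D \<le> 1 / parry_mass" using parry_mass_bounds D_ge_1 by (intro divide_left_mono) auto
  also have "\<dots> \<le> parry_density y" unfolding parry_density_def using parry_bounds[OF y] parry_mass_bounds by (intro divide_right_mono) auto
  finally show "1 / D \<le> parry_density y" .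
  have "parry_density y \<le> D / 1" unfolding parry_density_def using parry_bounds[OF y] parry_mass_bounds D_ge_1 by (intro frac_le) auto
  then show "parry_density y \<le> D" by simp
qed

lemma transfer_density: "y \<in> {0..<1} \<Longrightarrow> transfer parry_density y = parry_density y"
proof -
  assume y: "y \<in> {0..<1}"
  have "transfer parry_density y = (\<Sum>k. beta_weight \<beta> k y * parry (beta_branch \<beta> k y) / parry_mass)"
    using y by (simp add: transfer_def parry_density_def)
  also have "\<dots> = transfer parry y / parry_mass"
    using y sums_summable[OF weight_sums[of y "\<lambda>k. parry (beta_branch \<beta> k y)"]]
    by (simp add: suminf_divide transfer_def)
  finally show ?thesis using transfer_parry y by (simp add: parry_density_def)
qed

lemma transfer_iterate_density: "y \<in> {0..<1} \<Longrightarrow> (transfer ^^ n) parry_density y = parry_density y"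
proof (induction n arbitrary: y)
  case (Suc n)
  have "(transfer ^^ Suc n) parry_density y = transfer parry_density y"
    using transfer_iterate_local[of y 1 "(transfer ^^ n) parry_density" parry_density] Suc T_X by auto
  then show ?case using transfer_density[OF Suc.prems] by simp
qed simp

lemma density_invariant:
  assumes A [measurable]: "A \<in> sets borel"
  shows "(\<integral>x. parry_density x * indicator A ((beta_map \<beta> ^^ n) x) \<partial>unit_lebesgue) = (\<integral>x. parry_density x * indicator A x \<partial>unit_lebesgue)"
proof -
  note d = decreasing_bounds[OF decreasing_density] decreasing_borel[OF decreasing_density]
  have "(\<integral>x. parry_density x * indicator A ((beta_map \<beta> ^^ n) x) \<partial>unit_lebesgue) =
     (\<integral>x. (transfer ^^ n) parry_density x * indicator A x \<partial>unit_lebesgue)"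
    using d by (intro integral_transfer_iterate) auto
  also have "\<dots> = (\<integral>x. parry_density x * indicator A x \<partial>unit_lebesgue)"
    using transfer_iterate_density d(2) decreasing_borel[OF decreasing_transfer_iterate[OF decreasing_density, of n]]
    by (intro integral_cong_X) auto
  finally show ?thesis .
qed

text \<open>Coupling applies only to densities with \<open>f 0\<close> at most \<open>M\<close>
  times the integral. Adding the constant \<open>B\<close> enforces this. Both \<open>f + B\<close>
  and \<open>B\<close> are coupled with multiples of the invariant density and the results are
  subtracted; as the integral of \<open>f\<close> is at most \<open>B\<close>, the errors add up to
  \<open>6 * B\<close>.\<close>

lemma decreasing_mixing:
  assumes A [measurable]: "A \<in> sets borel" and f: "decreasing f" "f 0 \<le> B"
  shows "\<bar>(\<integral>x. f x * indicator A ((beta_map \<beta> ^^ n) x) \<partial>unit_lebesgue)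
     - (\<integral>x. f x \<partial>unit_lebesgue) * (\<integral>x. parry_density x * indicator A x \<partial>unit_lebesgue)\<bar> \<le> 6 * B * \<theta> ^ n"
proof -
  define m where "m = (\<integral>x. parry_density x * indicator A x \<partial>unit_lebesgue)"
  have B: "0 \<le> B" using decreasing_bounds[OF f(1), of 0] f(2) by simp
  have main: "\<bar>(\<integral>x. g x * indicator A ((beta_map \<beta> ^^ n) x) \<partial>unit_lebesgue) - I * m\<bar> \<le> 2 * I * \<theta> ^ n"
    if g: "decreasing g" "(\<integral>x. g x \<partial>unit_lebesgue) = I" "g 0 \<le> M * I" for g I
  proof -
    have I: "0 \<le> I" using integral_decreasing_nonneg[OF g(1)] g by simp
    have "I * parry_density 0 \<le> M * I"
    proof -
      have "parry_density 0 \<le> M" using density_bounds(2)[of 0] D_ge_1 by (simp add: M_def)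
      then show ?thesis using I mult_right_mono[of "parry_density 0" M I] by (simp add: mult.commute)
    qed
    from decreasing_coupling[OF A g decreasing_scale[OF decreasing_density I] _ this, of n]
    show ?thesis using density_invariant[OF A, of n]
      by (simp add: integral_density m_def mult.assoc)
  qed
  have fi: "integrable unit_lebesgue f" by (rule decreasing_integrable[OF f(1)])
  define J where "J = (\<integral>x. f x \<partial>unit_lebesgue)"
  have J: "0 \<le> J" "J \<le> B"
  proof -
    show "0 \<le> J" unfolding J_def by (rule integral_decreasing_nonneg[OF f(1)])
    have "J \<le> (\<integral>x. B \<partial>unit_lebesgue)" unfolding J_def
      using decreasing_bounds[OF f(1)] f(2) fi by (intro integral_mono_X) (auto intro: order_trans)
    then show "J \<le> B" by simp
  qed
  have d1: "decreasing (\<lambda>x. f x + B)" using f(1) B by (auto simp: decreasing_def)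
  have MB: "B \<le> M * B" "2 * B \<le> M * (J + B)"
  proof -
    show "B \<le> M * B" using B M_ge mult_right_mono[of 1 M B] by simp
    have "2 * B \<le> M * B" using B M_ge by (intro mult_right_mono) auto
    also have "\<dots> \<le> M * (J + B)" using J M_ge by (intro mult_left_mono) auto
    finally show "2 * B \<le> M * (J + B)" .
  qed
  have 1: "\<bar>(\<integral>x. (f x + B) * indicator A ((beta_map \<beta> ^^ n) x) \<partial>unit_lebesgue) - (J + B) * m\<bar> \<le> 2 * (J + B) * \<theta> ^ n"
    using fi f(2) MB by (intro main d1) (auto simp: J_def)
  have 2: "\<bar>(\<integral>x. B * indicator A ((beta_map \<beta> ^^ n) x) \<partial>unit_lebesgue) - B * m\<bar> \<le> 2 * B * \<theta> ^ n"
    using MB B by (intro main decreasing_const) auto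
  have "(\<integral>x. (f x + B) * indicator A ((beta_map \<beta> ^^ n) x) \<partial>unit_lebesgue) =
     (\<integral>x. f x * indicator A ((beta_map \<beta> ^^ n) x) \<partial>unit_lebesgue) + (\<integral>x. B * indicator A ((beta_map \<beta> ^^ n) x) \<partial>unit_lebesgue)"
    using integrable_decreasing_indicator[OF f(1) A, of n] integrable_decreasing_indicator[OF decreasing_const[OF B] A, of n]
    by (simp only: distrib_right Bochner_Integration.integral_add)
  moreover have "2 * (J + B) * \<theta> ^ n + 2 * B * \<theta> ^ n \<le> 6 * B * \<theta> ^ n"
  proof -
    have "(2 * (J + B) + 2 * B) * \<theta> ^ n \<le> 6 * B * \<theta> ^ n" using J \<theta>_bounds by (intro mult_right_mono) auto
    then show ?thesis by (simp add: distrib_right)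
  qed
  moreover have "(J + B) * m = J * m + B * m" by (simp add: distrib_right)
  ultimately show ?thesis using 1 2 unfolding J_def[symmetric] m_def[symmetric] by linarith
qed

end

section \<open>Cylinders of beta maps, quasi-mixing of the digits, and mixing for integrable
  functions\<close>

context beta_base
begin

lemma iterate_difference:
  "word m x = word m y \<Longrightarrow> 0 \<le> x \<Longrightarrow> x < 1 \<Longrightarrow> 0 \<le> y \<Longrightarrow> y < 1 \<Longrightarrow>
    (beta_map \<beta> ^^ m) y - (beta_map \<beta> ^^ m) x = \<beta> ^ m * (y - x)"
proof (induction m)
  case (Suc m)
  let ?x = "(beta_map \<beta> ^^ m) x" and ?y = "(beta_map \<beta> ^^ m) y"
  have "nat \<lfloor>\<beta> * ?x\<rfloor> = nat \<lfloor>\<beta> * ?y\<rfloor>" "word m x = word m y" using Suc.prems(1) by (auto simp: word_Suc_end)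
  moreover have "0 \<le> \<beta> * ?x" "0 \<le> \<beta> * ?y"
    using iterate_X[of x m] iterate_X[of y m] Suc.prems \<beta> by auto
  ultimately have "\<lfloor>\<beta> * ?x\<rfloor> = \<lfloor>\<beta> * ?y\<rfloor>" by (subst (asm) eq_nat_nat_iff) auto
  then have "(beta_map \<beta> ^^ Suc m) y - (beta_map \<beta> ^^ Suc m) x = \<beta> * (?y - ?x)"
    by (simp add: beta_map_def frac_def right_diff_distrib)
  also have "?y - ?x = \<beta> ^ m * (y - x)" using Suc by (auto simp: word_Suc_end)
  finally show ?case by simp
qed simp

lemma prob_cylinder_le:
  assumes "x \<in> {0..<1}"
  shows "unit.prob (cylinder m x) \<le> 2 / \<beta> ^ m"
proof -
  define r where "r = 1 / \<beta> ^ m"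
  have r: "0 < r" using \<beta> by (simp add: r_def)
  have "cylinder m x \<subseteq> {x - r..x + r}"
  proof
    fix y assume "y \<in> cylinder m x"
    then have y: "y \<in> {0..<1}" "word m x = word m y" by (auto simp: cylinder_def)
    have "\<beta> ^ m * (y - x) = (beta_map \<beta> ^^ m) y - (beta_map \<beta> ^^ m) x"
      using iterate_difference[OF y(2)] y(1) assms by auto
    then have "- 1 \<le> \<beta> ^ m * (y - x)" "\<beta> ^ m * (y - x) \<le> 1"
      using iterate_X[OF y(1), of m] iterate_X[OF assms, of m] by auto
    then show "y \<in> {x - r..x + r}" using \<beta> by (simp add: r_def field_simps)
  qed
  then have "measure lborel (cylinder m x) \<le> measure lborel {x - r..x + r}"
    using sets_cylinder[of m x] r by (intro measure_mono_fmeasurable) (auto simp: sets_unit_lebesgue_iff fmeasurable_def)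
  also have "\<dots> = 2 * r" using r by simp
  finally show ?thesis using sets_cylinder[of m x] by (simp add: measure_unit_lebesgue sets_unit_lebesgue_iff r_def)
qed

text \<open>All inverse branches of the \<open>m\<close>-th iterate have slope
  \<open>1 / \<beta> ^ m\<close>, so applying the transfer operator to the constant 1 amounts to
  counting preimages.\<close>

lemma card_preimages:
  assumes "0 \<le> y" "y < 1"
  shows "finite {x \<in> {0..<1}. (beta_map \<beta> ^^ m) x = y} \<and>
    real (card {x \<in> {0..<1}. (beta_map \<beta> ^^ m) x = y}) = \<beta> ^ m * (transfer ^^ m) (\<lambda>_. 1) y"
  using assms
proof (induction m arbitrary: y)
  case 0
  then have "{x \<in> {0..<1}. (beta_map \<beta> ^^ 0) x = y} = {y}" by auto
  then show ?case by simp
next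
  case (Suc m)
  let ?K = "{k. y + real k < \<beta>}"
  let ?P = "\<lambda>k. {x \<in> {0..<1}. (beta_map \<beta> ^^ m) x = beta_branch \<beta> k y}"
  have K: "finite ?K" using finite_branches Suc.prems by blast
  have br: "0 \<le> beta_branch \<beta> k y" "beta_branch \<beta> k y < 1" if "k \<in> ?K" for k
    using that Suc.prems \<beta> by (auto simp: beta_branch_def)
  have IH: "finite (?P k)" "real (card (?P k)) = \<beta> ^ m * (transfer ^^ m) (\<lambda>_. 1) (beta_branch \<beta> k y)" if "k \<in> ?K" for k
    using Suc.IH[OF br[OF that]] by auto
  have eq: "{x \<in> {0..<1}. (beta_map \<beta> ^^ Suc m) x = y} = (\<Union>k\<in>?K. ?P k)"
  proof (intro set_eqI iffI)
    fix x assume x: "x \<in> {x \<in> {0..<1}. (beta_map \<beta> ^^ Suc m) x = y}"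
    define z where "z = (beta_map \<beta> ^^ m) x"
    have z: "z \<in> {0..<1}" "beta_map \<beta> z = y" using x iterate_X[of x m] by (auto simp: z_def)
    define k where "k = nat \<lfloor>\<beta> * z\<rfloor>"
    have "0 \<le> \<beta> * z" using z \<beta> by auto
    then have "y + real k = \<beta> * z" using z(2) by (simp add: k_def beta_map_def frac_def)
    then have "z = beta_branch \<beta> k y" "k \<in> ?K" using \<beta> z by (auto simp: beta_branch_def)
    then show "x \<in> (\<Union>k\<in>?K. ?P k)" using x unfolding z_def by blast
  next
    fix x assume "x \<in> (\<Union>k\<in>?K. ?P k)"
    then obtain k where k: "k \<in> ?K" "x \<in> {0..<1}" "(beta_map \<beta> ^^ m) x = beta_branch \<beta> k y" by blast
    have "beta_weight \<beta> k y \<noteq> 0" using k(1) \<beta> by (auto simp: beta_weight_def)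
    then show "x \<in> {x \<in> {0..<1}. (beta_map \<beta> ^^ Suc m) x = y}"
      using k branch[of y k] Suc.prems by auto
  qed
  have disj: "?P k \<inter> ?P l = {}" if "k \<noteq> l" for k l
    using that \<beta> by (auto simp: beta_branch_def)
  have "real (card (\<Union>k\<in>?K. ?P k)) = (\<Sum>k\<in>?K. real (card (?P k)))"
    using K IH(1) disj by (subst card_UN_disjoint) auto
  also have "\<dots> = (\<Sum>k\<in>?K. \<beta> ^ Suc m * ((transfer ^^ m) (\<lambda>_. 1) (beta_branch \<beta> k y) / \<beta>))"
  proof (intro sum.cong refl)
    fix k assume "k \<in> ?K"
    then show "real (card (?P k)) = \<beta> ^ Suc m * ((transfer ^^ m) (\<lambda>_. 1) (beta_branch \<beta> k y) / \<beta>)"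
      using IH(2)[of k] \<beta> by simp
  qed
  also have "\<dots> = \<beta> ^ Suc m * (transfer ^^ Suc m) (\<lambda>_. 1) y"
    using sums_unique[OF weight_sums[OF Suc.prems, of "\<lambda>k. (transfer ^^ m) (\<lambda>_. 1) (beta_branch \<beta> k y)"]] Suc.prems
    by (simp add: sum_distrib_left[symmetric] transfer_def[where y = y] del: times_divide_eq_right power_Suc)
  finally show ?case unfolding eq using K IH(1) by auto
qed

lemma transfer_iterate_le:
  assumes "x \<in> {0..<1}" shows "(transfer ^^ m) (\<lambda>x. of_bool (R (word m x))) x \<le> 1 + D"
proof -
  have "(transfer ^^ m) (\<lambda>x. of_bool (R (word m x))) x \<le> (transfer ^^ m) (\<lambda>_. 1) x"
    using assms by (intro transfer_iterate_mono[where B = 1]) auto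
  also have "\<dots> \<le> (transfer ^^ m) (\<lambda>_. 1) 0"
    using decreasing_bounds[OF decreasing_transfer_iterate[OF decreasing_const[of 1]] assms] by simp
  also have "\<dots> \<le> 1 / \<beta> ^ m + D"
    using transfer_iterate_zero_le[OF decreasing_const[of 1], of m] by simp
  also have "\<dots> \<le> 1 + D" using \<beta> by simp
  finally show ?thesis .
qed

text \<open>A digit can change only across a point where the map jumps to 0. Since 0 is a fixed
  point, a jump at an earlier time is still visible as a zero of the \<open>m\<close>-th
  iterate.\<close>

lemma word_eq_between_zeros:
  "0 \<le> x \<Longrightarrow> x \<le> y \<Longrightarrow> y < 1 \<Longrightarrow> (\<And>z. x \<le> z \<Longrightarrow> z \<le> y \<Longrightarrow> (beta_map \<beta> ^^ m) z \<noteq> 0) \<Longrightarrow> word m x = word m y"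
proof (induction m arbitrary: x y)
  case (Suc m)
  have m: "0 \<le> \<beta> * x" "\<beta> * x \<le> \<beta> * y" using Suc.prems \<beta> by auto
  have zero: "(beta_map \<beta> ^^ i) 0 = 0" for i by (induction i) (auto simp: beta_map_def)
  have fl: "\<lfloor>\<beta> * x\<rfloor> = \<lfloor>\<beta> * y\<rfloor>"
  proof (rule ccontr)
    assume ne: "\<lfloor>\<beta> * x\<rfloor> \<noteq> \<lfloor>\<beta> * y\<rfloor>"
    then have "\<lfloor>\<beta> * x\<rfloor> < \<lfloor>\<beta> * y\<rfloor>" using floor_mono[OF m(2)] by simp
    then have "\<beta> * x < of_int \<lfloor>\<beta> * y\<rfloor>" by (simp add: floor_less_iff)
    moreover define z where "z = of_int \<lfloor>\<beta> * y\<rfloor> / \<beta>"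
    moreover have "\<beta> * z = of_int \<lfloor>\<beta> * y\<rfloor>" using \<beta> by (simp add: z_def)
    ultimately have "\<beta> * x \<le> \<beta> * z" "\<beta> * z \<le> \<beta> * y" by linarith+
    then have "x \<le> z" "z \<le> y" using \<beta> by auto
    moreover have "beta_map \<beta> z = 0" using \<beta> by (simp add: z_def beta_map_def)
    ultimately show False using Suc.prems(4)[of z] zero by (simp add: funpow_Suc_right del: funpow.simps)
  qed
  have T: "beta_map \<beta> x = \<beta> * x - of_int \<lfloor>\<beta> * x\<rfloor>" "beta_map \<beta> y = \<beta> * y - of_int \<lfloor>\<beta> * x\<rfloor>"
    using fl by (simp_all add: beta_map_def frac_def)
  have "word m (beta_map \<beta> x) = word m (beta_map \<beta> y)"
  proof (rule Suc.IH)
    show "0 \<le> beta_map \<beta> x" "beta_map \<beta> y < 1" by (simp_all add: beta_map_def frac_lt_1)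
    show "beta_map \<beta> x \<le> beta_map \<beta> y" using T m by simp
    fix z assume z: "beta_map \<beta> x \<le> z" "z \<le> beta_map \<beta> y"
    define u where "u = (z + of_int \<lfloor>\<beta> * x\<rfloor>) / \<beta>"
    have u: "\<beta> * u = z + of_int \<lfloor>\<beta> * x\<rfloor>" using \<beta> by (simp add: u_def)
    have "\<beta> * x \<le> \<beta> * u" "\<beta> * u \<le> \<beta> * y" using z T unfolding u by linarith+
    then have xu: "x \<le> u" "u \<le> y" using \<beta> by auto
    have "0 \<le> beta_map \<beta> x" "beta_map \<beta> y < 1" by (simp_all add: beta_map_def frac_lt_1)
    then have "\<lfloor>\<beta> * u\<rfloor> = \<lfloor>\<beta> * x\<rfloor>" unfolding u using z by (intro floor_unique) linarith+
    then have "beta_map \<beta> u = z" unfolding beta_map_def frac_def using u by simp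
    then show "(beta_map \<beta> ^^ m) z \<noteq> 0"
      using Suc.prems(4)[OF xu] by (simp add: funpow_Suc_right del: funpow.simps)
  qed
  then show ?case using fl by (simp add: word_Suc)
qed simp

text \<open>The breaks are the preimages of 0 under \<open>n + r\<close> steps; their number is
  controlled by the iterates of the constant density, which stay bounded.\<close>

lemma word_set_breaks:
  "\<exists>F. breaks {x \<in> {0..1}. R (word r ((beta_map \<beta> ^^ n) x))} F \<and> real (card F) \<le> (1 + D) * \<beta> ^ (n + r)"
proof -
  define F where "F = {x \<in> {0..<1}. (beta_map \<beta> ^^ (n + r)) x = 0}"
  have F: "finite F" "real (card F) = \<beta> ^ (n + r) * (transfer ^^ (n + r)) (\<lambda>_. 1) 0"
    using card_preimages[of 0 "n + r"] by (auto simp: F_def)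
  have "breaks {x \<in> {0..1}. R (word r ((beta_map \<beta> ^^ n) x))} F"
    unfolding breaks_def
  proof (intro conjI allI impI F(1))
    fix x y :: real assume xy: "0 < x" "x \<le> y" "y < 1" "{x..y} \<inter> F = {}"
    have "word (n + r) x = word (n + r) y"
      using xy by (intro word_eq_between_zeros) (auto simp: F_def)
    then show "x \<in> {x \<in> {0..1}. R (word r ((beta_map \<beta> ^^ n) x))} \<longleftrightarrow> y \<in> {x \<in> {0..1}. R (word r ((beta_map \<beta> ^^ n) x))}"
      using xy by (auto simp: word_shift)
  qed
  moreover have "real (card F) \<le> (1 + D) * \<beta> ^ (n + r)"
    unfolding F(2) using transfer_iterate_le[of 0 "n + r" "\<lambda>_. True"] \<beta>
    by (subst mult.commute) (intro mult_right_mono; simp)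
  ultimately show ?thesis by blast
qed

text \<open>For beta maps the exceptional sets are empty: every cylinder has length at most
  \<open>2 / \<beta> ^ m\<close>, and each event is its own approximation.\<close>

theorem beta_quasi_mixing:
  "\<exists>C \<theta>. 0 < \<theta> \<and> \<theta> < 1 \<and> 0 \<le> C \<and>
     quasi_mixing C \<theta> (ln \<beta>) (\<lambda>n. {x \<in> {0..1}. R (word r ((beta_map \<beta> ^^ n) x))})
       (\<integral>x. parry_density x * indicator {x. R (word r x)} x \<partial>unit_lebesgue)"
proof -
  define p where "p = (\<integral>x. parry_density x * indicator {x. R (word r x)} x \<partial>unit_lebesgue)"
  have \<beta>m: "exp (ln \<beta> * real m) = \<beta> ^ m" for m using \<beta> by (simp add: exp_of_nat2_mult)
  have A: "{x. R (word r x)} \<in> sets borel" by measurable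
  note pd = decreasing_bounds[OF decreasing_density] decreasing_integrable[OF decreasing_density]
  have pi: "integrable unit_lebesgue (\<lambda>x. parry_density x * indicator {x. R (word r x)} x)"
    using integrable_decreasing_indicator[OF decreasing_density A, of 0] by simp
  have D0: "D \<ge> 0" using D_ge_1 by simp
  have "quasi_mixing (2 * 2 + 6 * (1 + D) + (1 + D) * \<beta> ^ r) \<theta> (ln \<beta>) (\<lambda>n. {x \<in> {0..1}. R (word r ((beta_map \<beta> ^^ n) x))}) p"
  proof (rule quasi_mixing_word[where K = decreasing and B = "1 + D"])
    show "decreasing ((transfer ^^ m) (\<lambda>x. of_bool (R (word m x))))" for m R
    proof (rule transfer_word_cone)
      show "decreasing (\<lambda>x. of_bool c)" for c by (rule decreasing_const) simp
    qed (rule decreasing_branch_sum)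
    show "(transfer ^^ m) (\<lambda>x. of_bool (R (word m x))) x \<le> 1 + D" if "x \<in> {0..<1}" for m R x
      using transfer_iterate_le[OF that] .
    show "\<bar>(\<integral>x. f x * indicator {x. R (word r x)} ((beta_map \<beta> ^^ n) x) \<partial>unit_lebesgue) - (\<integral>x. f x \<partial>unit_lebesgue) * p\<bar>
         \<le> 6 * (1 + D) * \<theta> ^ n"
      if "decreasing f" "f \<in> borel_measurable borel" "\<And>x. x \<in> {0..<1} \<Longrightarrow> 0 \<le> f x \<and> f x \<le> 1 + D" for f n
      unfolding p_def using that(3)[of 0] by (intro decreasing_mixing A that(1)) simp
    show "0 \<le> p" unfolding p_def
      using integral_mono_X[OF _ pi, of "\<lambda>_. 0"] pd(1) by (auto intro!: mult_nonneg_nonneg)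
    have "p \<le> (\<integral>x. parry_density x \<partial>unit_lebesgue)"
      unfolding p_def using pd(1) by (intro integral_mono_X pi pd(2)) (auto simp: indicator_def)
    then show "p \<le> 1" by (simp add: integral_density)
    show "0 < \<theta>" by (rule \<theta>_bounds)
    show "0 \<le> 6 * (1 + D)" "0 \<le> (1 + D) * \<beta> ^ r" "(0::real) \<le> 2" using D0 \<beta> by auto
    show "\<exists>S\<in>sets unit_lebesgue. unit.prob S \<le> 2 * ((real m + 1) / a\<^sup>2) \<and>
       (\<forall>x\<in>{0..<1} - S. unit.prob (cylinder m x) \<le> 2 * exp (a - ln \<beta> * real m))" if a: "0 < a" for m a
    proof (intro bexI[of _ "{}"] conjI ballI)
      fix x :: real assume "x \<in> {0..<1} - {}"
      then have "unit.prob (cylinder m x) \<le> 2 / \<beta> ^ m" by (intro prob_cylinder_le) auto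
      also have "\<dots> = 2 * exp (- (ln \<beta> * real m))" by (simp add: exp_minus \<beta>m divide_inverse)
      also have "\<dots> \<le> 2 * exp (a - ln \<beta> * real m)" using a by simp
      finally show "unit.prob (cylinder m x) \<le> 2 * exp (a - ln \<beta> * real m)" .
    qed auto
    show "\<exists>S F. S \<in> sets unit_lebesgue \<and> breaks S F \<and> real (card F) \<le> (1 + D) * \<beta> ^ r * exp (ln \<beta> * real n + a) \<and>
        unit.prob (({x \<in> {0..1}. R (word r ((beta_map \<beta> ^^ n) x))} - S) \<union> (S - {x \<in> {0..1}. R (word r ((beta_map \<beta> ^^ n) x))}))
          \<le> (1 + D) * \<beta> ^ r * ((real n + 1) / a\<^sup>2)" if a: "0 < a" for n a
    proof -
      let ?E = "{x \<in> {0..1}. R (word r ((beta_map \<beta> ^^ n) x))}"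
      obtain F where F: "breaks ?E F" "real (card F) \<le> (1 + D) * \<beta> ^ (n + r)" using word_set_breaks by blast
      have E: "?E \<in> sets unit_lebesgue"
        unfolding sets_unit_lebesgue_iff using measurable_compose[OF iterate_borel pred_word] by auto
      have "(1 + D) * \<beta> ^ (n + r) = (1 + D) * \<beta> ^ r * exp (ln \<beta> * real n)"
        by (simp add: \<beta>m power_add)
      also have "\<dots> \<le> (1 + D) * \<beta> ^ r * exp (ln \<beta> * real n + a)"
        using a D0 \<beta> by (intro mult_left_mono) auto
      finally have "real (card F) \<le> (1 + D) * \<beta> ^ r * exp (ln \<beta> * real n + a)" using F(2) by simp
      moreover have "unit.prob ((?E - ?E) \<union> (?E - ?E)) \<le> (1 + D) * \<beta> ^ r * ((real n + 1) / a\<^sup>2)"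
        using D0 \<beta> by simp
      ultimately show ?thesis using E F(1) by blast
    qed
  qed
  moreover have "0 \<le> 2 * 2 + 6 * (1 + D) + (1 + D) * \<beta> ^ r" using D0 \<beta> by simp
  ultimately show ?thesis unfolding p_def using \<theta>_bounds by blast
qed

text \<open>Mixing for all integrable observables: indicators of half-lines are decreasing, and the
  property passes to limits in mean.\<close>

definition mixes :: "real set \<Rightarrow> (real \<Rightarrow> real) \<Rightarrow> bool" where
  "mixes A g \<longleftrightarrow> (\<lambda>n. \<integral>x. g x * indicator A ((beta_map \<beta> ^^ n) x) \<partial>unit_lebesgue) \<longlonglongrightarrow>
     (\<integral>x. g x \<partial>unit_lebesgue) * (\<integral>x. parry_density x * indicator A x \<partial>unit_lebesgue)"

lemma measurable_iterate_indicator: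
  assumes [measurable]: "A \<in> sets borel"
  shows "(\<lambda>x. indicator A ((beta_map \<beta> ^^ n) x) :: real) \<in> borel_measurable unit_lebesgue"
  by (rule measurable_unit_lebesgue) measurable

lemma integrable_times_iterate_indicator:
  fixes g :: "real \<Rightarrow> real"
  assumes A: "A \<in> sets borel" and g: "integrable unit_lebesgue g"
  shows "integrable unit_lebesgue (\<lambda>x. g x * indicator A ((beta_map \<beta> ^^ n) x))"
proof (rule Bochner_Integration.integrable_bound[OF g])
  show "(\<lambda>x. g x * indicator A ((beta_map \<beta> ^^ n) x)) \<in> borel_measurable unit_lebesgue"
    using g measurable_iterate_indicator[OF A] by auto
qed (auto simp: indicator_def)

lemma mixes_decreasing: "A \<in> sets borel \<Longrightarrow> decreasing f \<Longrightarrow> mixes A f"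
proof -
  assume A: "A \<in> sets borel" and f: "decreasing f"
  have "(\<lambda>n. 6 * f 0 * \<theta> ^ n) \<longlonglongrightarrow> 6 * f 0 * 0"
    using \<theta>_bounds by (intro tendsto_intros LIMSEQ_power_zero) auto
  have "(\<lambda>n. (\<integral>x. f x * indicator A ((beta_map \<beta> ^^ n) x) \<partial>unit_lebesgue) -
      (\<integral>x. f x \<partial>unit_lebesgue) * (\<integral>x. parry_density x * indicator A x \<partial>unit_lebesgue)) \<longlonglongrightarrow> 0"
  proof (rule Lim_null_comparison[rotated])
    show "(\<lambda>n. 6 * f 0 * \<theta> ^ n) \<longlonglongrightarrow> 0" using \<open>(\<lambda>n. 6 * f 0 * \<theta> ^ n) \<longlonglongrightarrow> 6 * f 0 * 0\<close> by simp
    show "eventually (\<lambda>n. norm ((\<integral>x. f x * indicator A ((beta_map \<beta> ^^ n) x) \<partial>unit_lebesgue) -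
      (\<integral>x. f x \<partial>unit_lebesgue) * (\<integral>x. parry_density x * indicator A x \<partial>unit_lebesgue)) \<le> 6 * f 0 * \<theta> ^ n) sequentially"
      using decreasing_mixing[OF A f order_refl] by (intro always_eventually) simp
  qed
  then show "mixes A f" unfolding mixes_def by (rule LIM_zero_cancel)
qed

lemma mixes_add:
  "A \<in> sets borel \<Longrightarrow> integrable unit_lebesgue f \<Longrightarrow> integrable unit_lebesgue g \<Longrightarrow> mixes A f \<Longrightarrow> mixes A g \<Longrightarrow> mixes A (\<lambda>x. f x + g x)"
  unfolding mixes_def using integrable_times_iterate_indicator[of A f] integrable_times_iterate_indicator[of A g]
  by (simp add: distrib_right tendsto_add)

lemma mixes_cmult: "mixes A f \<Longrightarrow> mixes A (\<lambda>x. r * f x)"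
  unfolding mixes_def by (drule tendsto_mult_left[of _ _ _ r]) (simp add: mult.assoc)

lemma mixes_limit:
  assumes A: "A \<in> sets borel" and g: "integrable unit_lebesgue g"
    and s: "\<And>i::nat. integrable unit_lebesgue (s i)" "\<And>i. mixes A (s i)"
    and lim: "(\<lambda>i. \<integral>x. \<bar>s i x - g x\<bar> \<partial>unit_lebesgue) \<longlonglongrightarrow> 0"
  shows "mixes A g"
  unfolding mixes_def
proof (rule LIMSEQ_I)
  fix e :: real assume e: "e > 0"
  define p where "p = (\<integral>x. parry_density x * indicator A x \<partial>unit_lebesgue)"
  define u where "u g n = (\<integral>x. g x * indicator A ((beta_map \<beta> ^^ n) x) \<partial>unit_lebesgue)" for g :: "real \<Rightarrow> real" and n
  have ep: "e / (3 + 3 * \<bar>p\<bar>) > 0" using e by (intro divide_pos_pos) auto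
  then obtain i where i: "(\<integral>x. \<bar>s i x - g x\<bar> \<partial>unit_lebesgue) < e / (3 + 3 * \<bar>p\<bar>)"
    using LIMSEQ_D[OF lim ep] by fastforce
  define \<delta> where "\<delta> = (\<integral>x. \<bar>s i x - g x\<bar> \<partial>unit_lebesgue)"
  have \<delta>0: "0 \<le> \<delta>" unfolding \<delta>_def by (intro integral_nonneg_AE) auto
  have "\<delta> * (3 + 3 * \<bar>p\<bar>) < e" using i by (simp add: \<delta>_def pos_less_divide_eq)
  then have \<delta>: "3 * \<delta> + 3 * (\<delta> * \<bar>p\<bar>) < e" by (simp add: algebra_simps)
  have close: "\<bar>u (s i) n - u g n\<bar> \<le> \<delta>" for n
  proof -
    have "u (s i) n - u g n = (\<integral>x. (s i x - g x) * indicator A ((beta_map \<beta> ^^ n) x) \<partial>unit_lebesgue)"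
      unfolding u_def using integrable_times_iterate_indicator[OF A s(1)] integrable_times_iterate_indicator[OF A g]
      by (simp add: left_diff_distrib)
    also have "\<bar>\<dots>\<bar> \<le> (\<integral>x. \<bar>(s i x - g x) * indicator A ((beta_map \<beta> ^^ n) x)\<bar> \<partial>unit_lebesgue)"
      by (rule integral_abs_bound)
    also have "\<dots> \<le> \<delta>" unfolding \<delta>_def
      using s(1) g integrable_times_iterate_indicator[OF A, of "\<lambda>x. s i x - g x"]
      by (intro integral_mono) (auto simp: indicator_def)
    finally show ?thesis .
  qed
  have "\<bar>(\<integral>x. s i x \<partial>unit_lebesgue) - (\<integral>x. g x \<partial>unit_lebesgue)\<bar> \<le> \<delta>"
  proof -
    have "(\<integral>x. s i x \<partial>unit_lebesgue) - (\<integral>x. g x \<partial>unit_lebesgue) = (\<integral>x. s i x - g x \<partial>unit_lebesgue)"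
      using s(1) g by simp
    also have "\<bar>\<dots>\<bar> \<le> \<delta>" unfolding \<delta>_def by (rule integral_abs_bound)
    finally show ?thesis .
  qed
  then have "\<bar>(\<integral>x. s i x \<partial>unit_lebesgue) - (\<integral>x. g x \<partial>unit_lebesgue)\<bar> * \<bar>p\<bar> \<le> \<delta> * \<bar>p\<bar>"
    by (rule mult_right_mono) simp
  then have cl: "\<bar>(\<integral>x. s i x \<partial>unit_lebesgue) * p - (\<integral>x. g x \<partial>unit_lebesgue) * p\<bar> \<le> \<delta> * \<bar>p\<bar>"
    by (simp add: abs_mult left_diff_distrib[symmetric])
  obtain N where N: "\<And>n. n \<ge> N \<Longrightarrow> \<bar>u (s i) n - (\<integral>x. s i x \<partial>unit_lebesgue) * p\<bar> < e / 3"
    using LIMSEQ_D[OF s(2)[of i, unfolded mixes_def], of "e / 3"] e unfolding u_def p_def real_norm_def by auto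
  show "\<exists>no. \<forall>n\<ge>no. norm ((\<integral>x. g x * indicator A ((beta_map \<beta> ^^ n) x) \<partial>unit_lebesgue) -
      (\<integral>x. g x \<partial>unit_lebesgue) * (\<integral>x. parry_density x * indicator A x \<partial>unit_lebesgue)) < e"
  proof (intro exI[of _ N] allI impI)
    fix n assume "n \<ge> N"
    from N[OF this] close[of n] cl \<delta>
    have "\<bar>u g n - (\<integral>x. g x \<partial>unit_lebesgue) * p\<bar> < e" by linarith
    then show "norm ((\<integral>x. g x * indicator A ((beta_map \<beta> ^^ n) x) \<partial>unit_lebesgue) -
      (\<integral>x. g x \<partial>unit_lebesgue) * (\<integral>x. parry_density x * indicator A x \<partial>unit_lebesgue)) < e"
      by (simp add: u_def p_def)
  qed
qed

text \<open>This generality serves two purposes: ergodicity takes the indicator of an invariant set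
  for \<open>g\<close>, uniqueness the density of another Renyi measure.\<close>

lemma mixes_integrable:
  assumes A: "A \<in> sets borel" and g: "integrable unit_lebesgue g"
  shows "mixes A g"
proof -
  have ind: "integrable unit_lebesgue (indicator B :: real \<Rightarrow> real)" if "B \<in> sets borel" for B
    using that by (intro unit.integrable_const_bound[where B = 1] measurable_unit_lebesgue) (auto simp: indicator_def)
  have sets: "mixes A (indicator B)" if "B \<in> sets borel" for B
  proof -
    have Bs: "B \<in> sigma_sets UNIV (range lessThan)" using that by (simp add: borel_Iio)
    have bor: "C \<in> sets borel" if "C \<in> sigma_sets UNIV (range lessThan)" for C :: "real set"
      using that by (simp add: borel_Iio)
    show ?thesis
    proof (rule sigma_sets_induct_disjoint[OF _ _ Bs])
      show "Int_stable (range (lessThan :: real \<Rightarrow> real set))"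
      proof -
        have "{..<a} \<inter> {..<b} = {..<min a b}" for a b :: real by auto
        then show ?thesis unfolding Int_stable_def by auto
      qed
      show "range (lessThan :: real \<Rightarrow> real set) \<subseteq> Pow UNIV" by auto
      show "mixes A (indicator C)" if "C \<in> range lessThan" for C
        using that by (intro mixes_decreasing[OF A]) (auto simp: decreasing_def indicator_def)
      show "mixes A (indicator {})" by (simp add: mixes_def)
      show "mixes A (indicator (UNIV - C))" if "C \<in> sigma_sets UNIV (range lessThan)" "mixes A (indicator C)" for C
      proof -
        have "mixes A (\<lambda>x. 1 + (- 1) * indicator C x)"
          using that(2) ind[OF bor[OF that(1)]]
          by (intro mixes_add mixes_cmult A mixes_decreasing[OF A decreasing_const]) auto
        moreover have "(\<lambda>x. 1 + (- 1) * indicator C x) = (indicator (UNIV - C) :: real \<Rightarrow> real)"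
          by (auto simp: indicator_def)
        ultimately show ?thesis by simp
      qed
      fix C :: "nat \<Rightarrow> real set"
      assume dis: "disjoint_family C" and Cs: "range C \<subseteq> sigma_sets UNIV (range lessThan)"
        and C: "\<And>i. mixes A (indicator (C i))"
      have Cb: "C i \<in> sets borel" for i using Cs bor by auto
      define s where "s N x = (\<Sum>i<N. indicat_real (C i) x)" for N x
      have si: "integrable unit_lebesgue (s N)" for N
        unfolding s_def[abs_def] using ind[OF Cb] by auto
      have sm: "mixes A (s N)" for N
      proof (induction N)
        case 0
        then show ?case by (simp add: s_def[abs_def] mixes_def)
      next
        case (Suc N)
        then have "mixes A (\<lambda>x. s N x + indicator (C N) x)" using si ind[OF Cb] C A by (intro mixes_add) auto
        then show ?case by (simp add: s_def[abs_def])
      qed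
      have sl: "(\<lambda>N. \<integral>x. \<bar>s N x - indicator (\<Union>i. C i) x\<bar> \<partial>unit_lebesgue) \<longlonglongrightarrow> (\<integral>x. 0 \<partial>unit_lebesgue)"
      proof (rule integral_dominated_convergence[where w = "\<lambda>_. 1"])
        have sN: "s N x = indicator (\<Union>i<N. C i) x" for N x
          using dis unfolding s_def by (subst indicator_UN_disjoint) (auto simp: disjoint_family_on_def)
        show "AE x in unit_lebesgue. norm \<bar>s N x - indicator (\<Union>i. C i) x\<bar> \<le> 1" for N
          unfolding sN by (auto simp: indicator_def)
        show "AE x in unit_lebesgue. (\<lambda>N. \<bar>s N x - indicator (\<Union>i. C i) x\<bar>) \<longlonglongrightarrow> 0"
        proof (intro AE_I2)
          fix x
          show "(\<lambda>N. \<bar>s N x - indicator (\<Union>i. C i) x\<bar>) \<longlonglongrightarrow> 0"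
          proof (cases "\<exists>j. x \<in> C j")
            case True
            then obtain j where j: "x \<in> C j" by blast
            have "eventually (\<lambda>N. \<bar>s N x - indicator (\<Union>i. C i) x\<bar> = 0) sequentially"
              using eventually_gt_at_top[of j] by eventually_elim (use j in \<open>auto simp: sN indicator_def\<close>)
            then show ?thesis by (rule tendsto_eventually)
          qed (auto simp: sN indicator_def)
        qed
        show "(\<lambda>x. \<bar>s N x - indicator (\<Union>i. C i) x\<bar>) \<in> borel_measurable unit_lebesgue" for N
          using Cb by (intro measurable_unit_lebesgue) (simp add: s_def)
      qed auto
      have "(\<Union>i. C i) \<in> sets borel" using Cb by auto
      from mixes_limit[OF A ind[OF this] si sm] sl
      show "mixes A (indicator (\<Union>i. C i))" by simp
    qed
  qed
  show ?thesis
    using g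
  proof (induction rule: integrable_induct)
    case (base B c)
    have "B \<in> sets borel" using base by (simp add: sets_unit_lebesgue_iff)
    from mixes_cmult[OF sets[OF this], of c] show ?case by (simp add: mult.commute)
  next
    case (add f g)
    then show ?case by (intro mixes_add[OF A]) auto
  next
    case (lim f s)
    have "(\<lambda>i. \<integral>x. \<bar>s i x - f x\<bar> \<partial>unit_lebesgue) \<longlonglongrightarrow> (\<integral>x. 0 \<partial>unit_lebesgue)"
    proof (rule integral_dominated_convergence[where w = "\<lambda>x. 3 * norm (f x)"])
      show "AE x in unit_lebesgue. (\<lambda>i. \<bar>s i x - f x\<bar>) \<longlonglongrightarrow> 0"
        using lim(2) by (intro AE_I2 tendsto_rabs_zero LIM_zero) auto
      show "AE x in unit_lebesgue. norm \<bar>s i x - f x\<bar> \<le> 3 * norm (f x)" for i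
      proof (intro AE_I2)
        fix x assume "x \<in> space unit_lebesgue"
        then show "norm \<bar>s i x - f x\<bar> \<le> 3 * norm (f x)" using lim(3)[of x i] by simp
      qed
    qed (use lim in auto)
    then show ?case using lim by (intro mixes_limit[OF A, of f s]) auto
  qed
qed

end

section \<open>Existence and uniqueness of the Renyi measure, and its cylinders\<close>

context beta_base
begin

definition parry_measure :: "real measure" where
  "parry_measure = density unit_lebesgue (\<lambda>x. ennreal (parry_density x))"

lemma parry_density_nonneg: "0 \<le> parry_density x"
  unfolding parry_density_def parry_def using parry_mass_bounds \<beta>
  by (intro divide_nonneg_pos suminf_nonneg parry_summable) auto

lemma parry_density_borel: "parry_density \<in> borel_measurable borel"
  by (rule decreasing_borel[OF decreasing_density])

lemma emeasure_parry_measure: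
  assumes "A \<in> sets unit_lebesgue"
  shows "emeasure parry_measure A = ennreal (\<integral>x. parry_density x * indicator A x \<partial>unit_lebesgue)"
proof -
  have A: "A \<in> sets borel" using assms by (simp add: sets_unit_lebesgue_iff)
  have "emeasure parry_measure A = (\<integral>\<^sup>+x. ennreal (parry_density x) * indicator A x \<partial>unit_lebesgue)"
    unfolding parry_measure_def using assms parry_density_borel
    by (intro emeasure_density measurable_unit_lebesgue) auto
  also have "\<dots> = (\<integral>\<^sup>+x. ennreal (parry_density x * indicator A x) \<partial>unit_lebesgue)"
    by (intro nn_integral_cong) (auto simp: indicator_def)
  also have "\<dots> = ennreal (\<integral>x. parry_density x * indicator A x \<partial>unit_lebesgue)"
    using integrable_times_iterate_indicator[OF A decreasing_integrable[OF decreasing_density], of 0] parry_density_nonneg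
    by (intro nn_integral_eq_integral) auto
  finally show ?thesis .
qed

lemma measure_parry_measure:
  assumes "A \<in> sets unit_lebesgue"
  shows "measure parry_measure A = (\<integral>x. parry_density x * indicator A x \<partial>unit_lebesgue)"
  using emeasure_parry_measure[OF assms] parry_density_nonneg
  by (simp add: measure_def integral_nonneg_AE)

lemma beta_map_measurable: "beta_map \<beta> \<in> measurable unit_lebesgue unit_lebesgue"
proof (rule measurableI)
  show "beta_map \<beta> x \<in> space unit_lebesgue" if "x \<in> space unit_lebesgue" for x using T_unit that by simp
  show "beta_map \<beta> -` A \<inter> space unit_lebesgue \<in> sets unit_lebesgue" if "A \<in> sets unit_lebesgue" for A
    using that measurable_sets[OF T_borel, of A] by (auto simp: sets_unit_lebesgue_iff)
qed

lemma unit_interval_sets: "{0..1} \<in> sets unit_lebesgue"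
  by (simp add: sets_unit_lebesgue_iff)

lemma parry_measure_prob: "prob_space parry_measure"
proof
  have "emeasure parry_measure {0..1} = ennreal (\<integral>x. parry_density x * indicator {0..1} x \<partial>unit_lebesgue)"
    by (rule emeasure_parry_measure[OF unit_interval_sets])
  also have "(\<integral>x. parry_density x * indicator {0..1} x \<partial>unit_lebesgue) = (\<integral>x. parry_density x \<partial>unit_lebesgue)"
    by (intro Bochner_Integration.integral_cong) auto
  finally show "emeasure parry_measure (space parry_measure) = 1"
    by (simp add: parry_measure_def integral_density)
qed

lemma integral_indicator_preimage:
  fixes f :: "real \<Rightarrow> real"
  shows "(\<integral>x. f x * indicator (beta_map \<beta> -` A \<inter> {0..1}) x \<partial>unit_lebesgue) =
     (\<integral>x. f x * indicator A (beta_map \<beta> x) \<partial>unit_lebesgue)"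
  by (intro Bochner_Integration.integral_cong) (auto simp: indicator_def)

lemma parry_measure_invariant: "invariant_measure (beta_map \<beta>) parry_measure"
  unfolding invariant_measure_def
proof
  have s: "sets parry_measure = sets unit_lebesgue" by (simp add: parry_measure_def)
  have sp: "space parry_measure = {0..1}" by (simp add: parry_measure_def)
  show m: "beta_map \<beta> \<in> parry_measure \<rightarrow>\<^sub>M parry_measure"
    using beta_map_measurable by (simp cong: measurable_cong_sets add: s)
  show "distr parry_measure parry_measure (beta_map \<beta>) = parry_measure"
  proof (rule measure_eqI)
    fix A assume "A \<in> sets (distr parry_measure parry_measure (beta_map \<beta>))"
    then have A: "A \<in> sets unit_lebesgue" by (simp add: s)
    then have Ab: "A \<in> sets borel" by (simp add: sets_unit_lebesgue_iff)
    have p: "beta_map \<beta> -` A \<inter> {0..1} \<in> sets unit_lebesgue"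
      using measurable_sets[OF beta_map_measurable A] by simp
    have "emeasure (distr parry_measure parry_measure (beta_map \<beta>)) A = emeasure parry_measure (beta_map \<beta> -` A \<inter> {0..1})"
      using m A by (simp add: emeasure_distr s sp)
    also have "\<dots> = emeasure parry_measure A"
      using density_invariant[OF Ab, of 1]
      unfolding emeasure_parry_measure[OF p] emeasure_parry_measure[OF A] integral_indicator_preimage by simp
    finally show "emeasure (distr parry_measure parry_measure (beta_map \<beta>)) A = emeasure parry_measure A" .
  qed simp
qed

text \<open>Mixing of the indicator of an invariant set \<open>A\<close> against \<open>A\<close>
  itself gives \<open>unit.prob A = unit.prob A * measure parry_measure A\<close>. So either
  \<open>A\<close> is a Lebesgue null set, hence null for the Parry measure, or its Parry measure is
  1.\<close>

lemma parry_measure_ergodic: "ergodic_measure (beta_map \<beta>) parry_measure"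
  unfolding ergodic_measure_def
proof (intro ballI impI)
  fix A assume "A \<in> sets parry_measure" and inv: "beta_map \<beta> -` A \<inter> space parry_measure = A"
  then have A: "A \<in> sets unit_lebesgue" by (simp add: parry_measure_def)
  then have Ab: "A \<in> sets borel" by (simp add: sets_unit_lebesgue_iff)
  have inv': "beta_map \<beta> -` A \<inter> {0..1} = A" using inv by (simp add: parry_measure_def)
  have step: "beta_map \<beta> x \<in> A \<longleftrightarrow> x \<in> A" if "x \<in> {0..1}" for x
    using inv' that by blast
  have iter: "(beta_map \<beta> ^^ n) x \<in> {0..1} \<and> ((beta_map \<beta> ^^ n) x \<in> A \<longleftrightarrow> x \<in> A)" if "x \<in> {0..1}" for n x
    using that step T_unit by (induction n) auto
  have "(\<integral>x. indicator A x * indicator A ((beta_map \<beta> ^^ n) x) \<partial>unit_lebesgue) = unit.prob A" for n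
  proof -
    have "(\<integral>x. indicator A x * indicator A ((beta_map \<beta> ^^ n) x) \<partial>unit_lebesgue) = (\<integral>x. indicat_real A x \<partial>unit_lebesgue)"
      using iter by (intro Bochner_Integration.integral_cong) (auto simp: indicator_def)
    also have "\<dots> = unit.prob (A \<inter> {0..1})" by (simp add: Int_commute)
    also have "A \<inter> {0..1} = A" using A by (auto simp: sets_unit_lebesgue_iff)
    finally show ?thesis .
  qed
  moreover have "(\<integral>x. indicat_real A x \<partial>unit_lebesgue) = unit.prob A"
  proof -
    have "A \<inter> {0..1} = A" using A by (auto simp: sets_unit_lebesgue_iff)
    then show ?thesis by (simp add: Int_commute)
  qed
  ultimately have "(\<lambda>n. unit.prob A) \<longlonglongrightarrow> unit.prob A * measure parry_measure A"
    using mixes_integrable[OF Ab integrable_indicator_unit_lebesgue[OF A]]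
    unfolding mixes_def measure_parry_measure[OF A] by simp
  then have "unit.prob A = unit.prob A * measure parry_measure A"
    by (rule LIMSEQ_unique[OF tendsto_const])
  then consider "unit.prob A = 0" | "measure parry_measure A = 1" by auto
  then show "measure parry_measure A = 0 \<or> measure parry_measure A = 1"
  proof cases
    case 1
    then have "emeasure unit_lebesgue A = 0" by (simp add: unit.emeasure_eq_measure)
    then have "AE x in unit_lebesgue. x \<notin> A" using A by (intro AE_not_in) (simp add: null_sets_def)
    then have "(\<integral>x. parry_density x * indicator A x \<partial>unit_lebesgue) = (\<integral>x. 0 \<partial>unit_lebesgue)"
      using integrable_times_iterate_indicator[OF Ab decreasing_integrable[OF decreasing_density], of 0]
      by (intro integral_cong_AE) (auto elim!: eventually_mono)
    then show ?thesis using measure_parry_measure[OF A] by simp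
  qed simp
qed

lemma parry_measure_absolutely_continuous: "absolutely_continuous unit_lebesgue parry_measure"
  unfolding parry_measure_def using parry_density_borel
  by (intro absolutely_continuousI_density measurable_unit_lebesgue) auto

lemma D_inverse: "1 - 1 / \<beta> = 1 / D" "1 / (1 - 1 / \<beta>) = D"
  using \<beta> by (auto simp: D_def field_simps)

lemma parry_measure_is_renyi: "is_renyi_measure \<beta> parry_measure"
  unfolding is_renyi_measure_def
proof (intro conjI)
  have "AE x in unit_lebesgue. RN_deriv unit_lebesgue parry_measure x = ennreal (parry_density x)"
    using unit.RN_deriv_unique[of "\<lambda>x. ennreal (parry_density x)" parry_measure] parry_density_borel
    by (auto simp: parry_measure_def measurable_unit_lebesgue elim!: eventually_mono)
  then show "AE x in unit_lebesgue. ennreal (1 - 1 / \<beta>) \<le> RN_deriv unit_lebesgue parry_measure x \<and>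
        RN_deriv unit_lebesgue parry_measure x \<le> ennreal (1 / (1 - 1 / \<beta>))"
    using AE_X
  proof eventually_elim
    case (elim x)
    then show ?case unfolding D_inverse using density_bounds[of x] by (auto intro!: ennreal_leI)
  qed
qed (use parry_measure_prob parry_measure_invariant parry_measure_ergodic parry_measure_absolutely_continuous
  in \<open>simp_all add: parry_measure_def\<close>)

text \<open>Let \<open>g\<close> be the density of the other measure. By invariance the integral of
  \<open>g\<close> over the points whose \<open>n\<close>-th iterate lies in \<open>A\<close> is the
  same for all \<open>n\<close>; by mixing it tends to the Parry measure of
  \<open>A\<close>.\<close>

lemma is_renyi_measure_unique:
  assumes "is_renyi_measure \<beta> M'"
  shows "M' = parry_measure"
proof (rule measure_eqI)
  have s: "sets M' = sets unit_lebesgue" and "prob_space M'" and inv: "invariant_measure (beta_map \<beta>) M'"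
    and ac: "absolutely_continuous unit_lebesgue M'"
    and bd: "AE x in unit_lebesgue. ennreal (1 - 1 / \<beta>) \<le> RN_deriv unit_lebesgue M' x \<and>
        RN_deriv unit_lebesgue M' x \<le> ennreal (1 / (1 - 1 / \<beta>))"
    using assms by (auto simp: is_renyi_measure_def)
  interpret M: prob_space M' by fact
  show "sets M' = sets parry_measure" using s by (simp add: parry_measure_def)
  have sp: "space M' = {0..1}" using sets_eq_imp_space_eq[OF s] by simp
  define g where "g x = enn2real (RN_deriv unit_lebesgue M' x)" for x
  have g_meas: "g \<in> borel_measurable unit_lebesgue" unfolding g_def by measurable
  have gD: "AE x in unit_lebesgue. RN_deriv unit_lebesgue M' x = ennreal (g x) \<and> g x \<le> D"
    using bd
  proof eventually_elim
    case (elim x)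
    then have le: "RN_deriv unit_lebesgue M' x \<le> ennreal D" by (simp add: D_inverse)
    then have "RN_deriv unit_lebesgue M' x < \<top>" using le_less_trans by fastforce
    then have "RN_deriv unit_lebesgue M' x = ennreal (g x)" by (simp add: g_def)
    with le show ?case using D_ge_1 by (simp add: ennreal_le_iff)
  qed
  have g0: "0 \<le> g x" for x by (simp add: g_def)
  have gi: "integrable unit_lebesgue g"
    using gD g0 g_meas by (intro unit.integrable_const_bound[where B = D]) (auto elim!: eventually_mono)
  have M'_eq: "emeasure M' A = ennreal (\<integral>x. g x * indicator A x \<partial>unit_lebesgue)" if A: "A \<in> sets unit_lebesgue" for A
  proof -
    have Ab: "A \<in> sets borel" using A by (simp add: sets_unit_lebesgue_iff)
    have "emeasure M' A = emeasure (density unit_lebesgue (RN_deriv unit_lebesgue M')) A"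
      using unit.density_RN_deriv[OF ac s] by simp
    also have "\<dots> = (\<integral>\<^sup>+x. RN_deriv unit_lebesgue M' x * indicator A x \<partial>unit_lebesgue)"
      using A by (intro emeasure_density) auto
    also have "\<dots> = (\<integral>\<^sup>+x. ennreal (g x * indicator A x) \<partial>unit_lebesgue)"
      by (intro nn_integral_cong_AE) (use gD in \<open>eventually_elim, auto simp: indicator_def\<close>)
    also have "\<dots> = ennreal (\<integral>x. g x * indicator A x \<partial>unit_lebesgue)"
      using integrable_times_iterate_indicator[OF Ab gi, of 0] g0 by (intro nn_integral_eq_integral) auto
    finally show ?thesis .
  qed
  have g1: "(\<integral>x. g x \<partial>unit_lebesgue) = 1"
  proof -
    have "ennreal (\<integral>x. g x * indicator {0..1} x \<partial>unit_lebesgue) = 1"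
      using M'_eq[OF unit_interval_sets] M.emeasure_space_1 sp by simp
    moreover have "(\<integral>x. g x * indicator {0..1} x \<partial>unit_lebesgue) = (\<integral>x. g x \<partial>unit_lebesgue)"
      by (intro Bochner_Integration.integral_cong) auto
    ultimately show ?thesis using g0 by (simp add: integral_nonneg_AE ennreal_eq_1)
  qed
  fix A assume "A \<in> sets M'"
  then have A: "A \<in> sets unit_lebesgue" by (simp add: s)
  then have Ab: "A \<in> sets borel" by (simp add: sets_unit_lebesgue_iff)
  have inv': "(\<integral>x. g x * indicator B (beta_map \<beta> x) \<partial>unit_lebesgue) = (\<integral>x. g x * indicator B x \<partial>unit_lebesgue)"
    if B: "B \<in> sets unit_lebesgue" for B
  proof -
    have p: "beta_map \<beta> -` B \<inter> {0..1} \<in> sets unit_lebesgue"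
      using measurable_sets[OF beta_map_measurable B] by simp
    have "emeasure M' B = emeasure (distr M' M' (beta_map \<beta>)) B" using inv by (simp add: invariant_measure_def)
    also have "\<dots> = emeasure M' (beta_map \<beta> -` B \<inter> {0..1})"
      using inv B by (subst emeasure_distr) (auto simp: invariant_measure_def s sp)
    finally have "ennreal (\<integral>x. g x * indicator B x \<partial>unit_lebesgue) = ennreal (\<integral>x. g x * indicator B (beta_map \<beta> x) \<partial>unit_lebesgue)"
      unfolding M'_eq[OF B] M'_eq[OF p] integral_indicator_preimage .
    then show ?thesis using g0 by (simp add: integral_nonneg_AE)
  qed
  have "(\<integral>x. g x * indicator A ((beta_map \<beta> ^^ n) x) \<partial>unit_lebesgue) = (\<integral>x. g x * indicator A x \<partial>unit_lebesgue)" for n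
  proof (induction n)
    case (Suc n)
    define B where "B = {x \<in> {0..1}. (beta_map \<beta> ^^ n) x \<in> A}"
    have B: "B \<in> sets unit_lebesgue" unfolding B_def by (rule sets_iterate[OF Ab])
    have "(\<integral>x. g x * indicator A ((beta_map \<beta> ^^ Suc n) x) \<partial>unit_lebesgue) = (\<integral>x. g x * indicator B (beta_map \<beta> x) \<partial>unit_lebesgue)"
      using T_unit by (intro Bochner_Integration.integral_cong) (auto simp: B_def indicator_def funpow_swap1)
    also have "\<dots> = (\<integral>x. g x * indicator B x \<partial>unit_lebesgue)" by (rule inv'[OF B])
    also have "\<dots> = (\<integral>x. g x * indicator A ((beta_map \<beta> ^^ n) x) \<partial>unit_lebesgue)"
      by (intro Bochner_Integration.integral_cong) (auto simp: B_def indicator_def)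
    finally show ?case using Suc by simp
  qed simp
  then have "(\<lambda>n. \<integral>x. g x * indicator A x \<partial>unit_lebesgue) \<longlonglongrightarrow> (\<integral>x. parry_density x * indicator A x \<partial>unit_lebesgue)"
    using mixes_integrable[OF Ab gi] unfolding mixes_def g1 by simp
  then have "(\<integral>x. g x * indicator A x \<partial>unit_lebesgue) = (\<integral>x. parry_density x * indicator A x \<partial>unit_lebesgue)"
    by (rule LIMSEQ_unique[OF tendsto_const])
  then show "emeasure M' A = emeasure parry_measure A"
    unfolding M'_eq[OF A] emeasure_parry_measure[OF A] by simp
qed

lemma renyi_measure_eq: "renyi_measure \<beta> = parry_measure"
  unfolding renyi_measure_def using parry_measure_is_renyi is_renyi_measure_unique by (rule the_equality)

text \<open>For an integer base the orbit of 1 reaches 0 in one step, so of Parry's series only the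
  term for \<open>n = 0\<close> survives.\<close>

lemma parry_density_integer:
  assumes "\<beta> \<in> \<int>" "x \<in> {0..<1}"
  shows "parry_density x = 1"
proof -
  have o: "(beta_map \<beta> ^^ Suc n) 1 = 0" for n
    using assms by (induction n) (auto simp: beta_map_def)
  have p: "parry y = 1" if y: "y \<in> {0..<1}" for y
  proof -
    have "parry y = (\<Sum>n\<in>{0}. of_bool (y < (beta_map \<beta> ^^ n) 1) / \<beta> ^ n)"
      unfolding parry_def
    proof (rule suminf_finite)
      fix n :: nat assume "n \<notin> {0}"
      then obtain m where "n = Suc m" by (cases n) auto
      then show "of_bool (y < (beta_map \<beta> ^^ n) 1) / \<beta> ^ n = 0" using o[of m] y by (simp del: funpow.simps)
    qed simp
    then show ?thesis using y by simp
  qed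
  have "parry_mass = (\<integral>x. 1 \<partial>unit_lebesgue)"
    unfolding parry_mass_def using p decreasing_borel[OF decreasing_parry] by (intro integral_cong_X) auto
  then show ?thesis using p[OF assms(2)] by (simp add: parry_density_def)
qed

lemma measure_parry_measure_integer:
  assumes "\<beta> \<in> \<int>" "A \<in> sets unit_lebesgue"
  shows "measure parry_measure A = unit.prob A"
proof -
  have Ab: "A \<in> sets borel" "A \<inter> {0..1} = A" using assms by (auto simp: sets_unit_lebesgue_iff)
  have "measure parry_measure A = (\<integral>x. indicator A x \<partial>unit_lebesgue)"
    unfolding measure_parry_measure[OF assms(2)]
    using parry_density_integer[OF assms(1)] parry_density_borel Ab by (intro integral_cong_X) auto
  then show ?thesis using Ab by (simp add: Int_commute)
qed

text \<open>Digits are integers numbered from 1, words are lists of naturals numbered from 0. The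
  translation by \<open>nat\<close> is faithful because no entry of \<open>v\<close> is
  negative.\<close>

lemma digits_iff_word:
  assumes x: "x \<in> {0..<1}" and v: "set v \<subseteq> {0..}"
  shows "(\<forall>p<length v. beta_digit \<beta> x (Suc n + p) = v ! p) \<longleftrightarrow> word (length v) ((beta_map \<beta> ^^ n) x) = map nat v"
proof -
  have "beta_digit \<beta> x (Suc n + p) = v ! p \<longleftrightarrow> word (length v) ((beta_map \<beta> ^^ n) x) ! p = map nat v ! p"
    if p: "p < length v" for p
  proof -
    define z where "z = (beta_map \<beta> ^^ (n + p)) x"
    have "0 \<le> \<beta> * z" using iterate_X[OF x, of "n + p"] \<beta> by (simp add: z_def)
    then have z: "0 \<le> \<lfloor>\<beta> * z\<rfloor>" by simp
    have vp: "0 \<le> v ! p" using v p nth_mem by fastforce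
    have "(beta_map \<beta> ^^ p) ((beta_map \<beta> ^^ n) x) = z"
      unfolding z_def by (simp add: funpow_add add.commute[of n])
    then have "word (length v) ((beta_map \<beta> ^^ n) x) ! p = nat \<lfloor>\<beta> * z\<rfloor>"
      using p by (simp add: word_def)
    moreover have "beta_digit \<beta> x (Suc n + p) = \<lfloor>\<beta> * z\<rfloor>" by (simp add: beta_digit_def z_def)
    ultimately show ?thesis using p z vp by (simp add: eq_nat_nat_iff)
  qed
  then show ?thesis by (auto simp: list_eq_iff_nth_eq)
qed

lemma beta_cylinder_eq: "set v \<subseteq> {0..} \<Longrightarrow> beta_cylinder \<beta> v = {x \<in> {0..<1}. word (length v) x = map nat v}"
  unfolding beta_cylinder_def using digits_iff_word[of _ v 0] by auto

lemma sets_beta_cylinder: "set v \<subseteq> {0..} \<Longrightarrow> beta_cylinder \<beta> v \<in> sets unit_lebesgue"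
proof -
  assume v: "set v \<subseteq> {0..}"
  have "{x. word (length v) x = map nat v} \<in> sets borel"
    using pred_word[of "\<lambda>u. u = map nat v" "length v"] by (simp add: pred_def)
  then have "{0..<1} \<inter> {x. word (length v) x = map nat v} \<in> sets borel" by auto
  moreover have "{0..<1} \<inter> {x. word (length v) x = map nat v} = {x \<in> {0..<1}. word (length v) x = map nat v}" by auto
  ultimately have "{x \<in> {0..<1}. word (length v) x = map nat v} \<in> sets borel" by simp
  then show ?thesis unfolding beta_cylinder_eq[OF v] sets_unit_lebesgue_iff by auto
qed

theorem beta_digit_quasi_mixing:
  assumes v: "set v \<subseteq> {0..}"
  defines "E \<equiv> \<lambda>n. {x \<in> {0..1}. word (length v) ((beta_map \<beta> ^^ n) x) = map nat v}"
  shows "\<exists>C \<theta>. 0 < \<theta> \<and> \<theta> < 1 \<and> 0 \<le> C \<and> quasi_mixing C \<theta> (ln \<beta>) E (measure parry_measure (beta_cylinder \<beta> v))"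
proof -
  have "(\<integral>x. parry_density x * indicator {x. word (length v) x = map nat v} x \<partial>unit_lebesgue) =
     (\<integral>x. parry_density x * indicator (beta_cylinder \<beta> v) x \<partial>unit_lebesgue)"
  proof (rule integral_cong_X)
    show "(\<lambda>x. parry_density x * indicator {x. word (length v) x = map nat v} x) \<in> borel_measurable borel"
    proof -
      have "{x. word (length v) x = map nat v} \<in> sets borel"
        using pred_word[of "\<lambda>u. u = map nat v" "length v"] by (simp add: pred_def)
      then show ?thesis using parry_density_borel by measurable
    qed
    have "beta_cylinder \<beta> v \<in> sets borel" using sets_beta_cylinder[OF v] by (simp add: sets_unit_lebesgue_iff)
    then show "(\<lambda>x. parry_density x * indicator (beta_cylinder \<beta> v) x) \<in> borel_measurable borel"
      using parry_density_borel by measurable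
  qed (auto simp: beta_cylinder_eq[OF v] indicator_def)
  then show ?thesis
    using beta_quasi_mixing[of "\<lambda>u. u = map nat v" "length v"] measure_parry_measure[OF sets_beta_cylinder[OF v]]
    unfolding E_def by simp
qed

end

section \<open>The Gauss map\<close>

text \<open>The ceiling makes every branch map into \<open>(0, 1]\<close>, which is thus invariant without exceptional
  points. On irrationals this is the usual Gauss map.\<close>

definition gauss_map :: "real \<Rightarrow> real" where
  "gauss_map x = 1 / x - of_int \<lceil>1 / x\<rceil> + 1"

definition gauss_digit :: "real \<Rightarrow> nat" where
  "gauss_digit x = nat (\<lceil>1 / x\<rceil> - 1)"

text \<open>Within \<open>(0, 1]\<close> the digit 0 belongs to the point 1 alone, so this branch
  gets weight 0.\<close>

definition gauss_weight :: "nat \<Rightarrow> real \<Rightarrow> real" where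
  "gauss_weight k y = (if k = 0 then 0 else 1 / (real k + y)\<^sup>2)"

definition gauss_branch :: "nat \<Rightarrow> real \<Rightarrow> real" where
  "gauss_branch k y = 1 / (real k + y)"

lemma gauss_map_borel [measurable]: "gauss_map \<in> borel_measurable borel"
  unfolding gauss_map_def[abs_def] by measurable

lemma gauss_digit_borel [measurable]: "gauss_digit \<in> measurable borel (count_space UNIV)"
  unfolding gauss_digit_def[abs_def] by measurable

lemma gauss_weight_borel [measurable]: "gauss_weight k \<in> borel_measurable borel"
  unfolding gauss_weight_def[abs_def] by measurable

lemma gauss_branch_borel [measurable]: "gauss_branch k \<in> borel_measurable borel"
  unfolding gauss_branch_def[abs_def] by measurable

lemma gauss_map_range: "0 < gauss_map x \<and> gauss_map x \<le> 1"
  unfolding gauss_map_def using le_of_int_ceiling[of "1 / x"] ceiling_correct[of "1 / x"] by linarith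

lemma gauss_branch_inverse:
  assumes "0 < y" "y \<le> 1" "k \<ge> 1"
  shows "0 < gauss_branch k y" "gauss_branch k y < 1" "gauss_digit (gauss_branch k y) = k" "gauss_map (gauss_branch k y) = y"
proof -
  have "\<lceil>real k + y\<rceil> = int k + 1" using assms by (intro ceiling_unique) auto
  then show "gauss_digit (gauss_branch k y) = k" "gauss_map (gauss_branch k y) = y"
    by (simp_all add: gauss_digit_def gauss_map_def gauss_branch_def)
  show "0 < gauss_branch k y" "gauss_branch k y < 1" using assms by (auto simp: gauss_branch_def)
qed

lemma gauss_branch_of:
  assumes "0 < x" "x < 1"
  shows "gauss_digit x \<ge> 1" "gauss_branch (gauss_digit x) (gauss_map x) = x"
proof -
  have "1 / x > 1" using assms by simp
  then have "\<lceil>1 / x\<rceil> \<ge> 2" by (simp add: le_ceiling_iff)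
  moreover define z where "z = \<lceil>1 / x\<rceil>"
  ultimately have z: "z \<ge> 2" by simp
  then show "gauss_digit x \<ge> 1" by (simp add: gauss_digit_def z_def[symmetric])
  have "real (gauss_digit x) = of_int \<lceil>1 / x\<rceil> - 1" using z by (simp add: gauss_digit_def z_def[symmetric])
  then show "gauss_branch (gauss_digit x) (gauss_map x) = x" by (simp add: gauss_branch_def gauss_map_def)
qed

lemma nn_integral_gauss_branch:
  fixes f :: "real \<Rightarrow> ennreal"
  assumes [measurable]: "f \<in> borel_measurable borel" and "k \<ge> 1"
  shows "(\<integral>\<^sup>+x. f x * indicator {1 / (real k + 1)..1 / real k} x \<partial>lborel) =
     (\<integral>\<^sup>+y. ennreal (gauss_weight k y) * f (gauss_branch k y) * indicator {0..1} y \<partial>lborel)"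
proof -
  \<comment> \<open>The branch decreases, whereas the substitution rule is applied to an increasing
    map; hence the detour over \<open>z = 1 - y\<close>, undone by the affine substitution that
    follows.\<close>
  let ?g = "\<lambda>z. 1 / (real k + 1 - z)" and ?g' = "\<lambda>z. 1 / (real k + 1 - z)\<^sup>2"
  have "(\<integral>\<^sup>+x. f x * indicator {?g 0..?g 1} x \<partial>lborel) = (\<integral>\<^sup>+z. f (?g z) * ennreal (?g' z) * indicator {0..1} z \<partial>lborel)"
  proof (rule nn_integral_substitution_aux)
    show "(?g has_real_derivative ?g' z) (at z)" if "z \<in> {0..1}" for z
      using that \<open>k \<ge> 1\<close> by (auto intro!: derivative_eq_intros simp: power2_eq_square)
    show "continuous_on {0..1} ?g'" using \<open>k \<ge> 1\<close> by (intro continuous_intros) auto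
  qed auto
  also have "\<dots> = ennreal \<bar>- 1\<bar> * (\<integral>\<^sup>+y. f (?g (1 + (- 1) * y)) * ennreal (?g' (1 + (- 1) * y)) * indicator {0..1} (1 + (- 1) * y) \<partial>lborel)"
    by (rule nn_integral_real_affine) auto
  also have "\<dots> = (\<integral>\<^sup>+y. ennreal (gauss_weight k y) * f (gauss_branch k y) * indicator {0..1} y \<partial>lborel)"
    using \<open>k \<ge> 1\<close> by (auto intro!: nn_integral_cong simp: indicator_def gauss_weight_def gauss_branch_def mult.commute)
  finally show ?thesis by simp
qed

lemma nn_transfer_gauss:
  fixes F g :: "real \<Rightarrow> ennreal"
  assumes [measurable]: "F \<in> borel_measurable borel" "g \<in> borel_measurable borel"
  shows "(\<integral>\<^sup>+x. F x * g (gauss_map x) \<partial>unit_lebesgue) =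
        (\<integral>\<^sup>+y. (\<Sum>k. ennreal (gauss_weight k y) * F (gauss_branch k y)) * g y \<partial>unit_lebesgue)"
proof -
  define Q where "Q k = {x \<in> {0<..<1}. gauss_digit x = k}" for k
  have Q [measurable]: "Q k \<in> sets borel" for k unfolding Q_def by measurable
  have ae: "AE x in lborel. x \<noteq> (c::real)" for c by (rule AE_lborel_singleton)
  have "(\<integral>\<^sup>+x. F x * g (gauss_map x) \<partial>unit_lebesgue) =
      (\<integral>\<^sup>+x. (\<Sum>k. indicator (Q k) x * (F x * g (gauss_map x))) \<partial>lborel)"
    unfolding nn_integral_unit_lebesgue
  proof (rule nn_integral_cong_AE, use ae[of 0] ae[of 1] in eventually_elim)
    fix x :: real assume x: "x \<noteq> 0" "x \<noteq> 1"
    have "(\<Sum>k. indicator (Q k) x * (F x * g (gauss_map x))) =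
      (\<Sum>k\<in>{gauss_digit x}. indicator (Q k) x * (F x * g (gauss_map x)))"
      by (rule suminf_finite) (auto simp: Q_def)
    then show "F x * g (gauss_map x) * indicator {0..1} x = (\<Sum>k. indicator (Q k) x * (F x * g (gauss_map x)))"
      using x by (auto simp: Q_def indicator_def)
  qed
  also have "\<dots> = (\<Sum>k. \<integral>\<^sup>+x. indicator (Q k) x * (F x * g (gauss_map x)) \<partial>lborel)"
    by (rule nn_integral_suminf) measurable
  also have "\<dots> = (\<Sum>k. \<integral>\<^sup>+y. ennreal (gauss_weight k y) * F (gauss_branch k y) * g y \<partial>unit_lebesgue)"
  proof (rule suminf_cong)
    fix k
    show "(\<integral>\<^sup>+x. indicator (Q k) x * (F x * g (gauss_map x)) \<partial>lborel) =
       (\<integral>\<^sup>+y. ennreal (gauss_weight k y) * F (gauss_branch k y) * g y \<partial>unit_lebesgue)"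
    proof (cases "k = 0")
      case True
      then have "Q k = {}" using gauss_branch_of(1) by (fastforce simp: Q_def)
      then show ?thesis using True by (simp add: gauss_weight_def)
    next
      case False
      then have k: "k \<ge> 1" by simp
      have sub: "Q k \<subseteq> {1 / (real k + 1)..1 / real k}"
      proof
        fix x assume "x \<in> Q k"
        then have "0 < x" "x < 1" "gauss_digit x = k" by (auto simp: Q_def)
        then have "x = 1 / (real k + gauss_map x)" using gauss_branch_of[of x] by (simp add: gauss_branch_def)
        moreover have "1 / (real k + 1) \<le> 1 / (real k + gauss_map x)" "1 / (real k + gauss_map x) \<le> 1 / real k"
          using gauss_map_range[of x] k by (auto intro!: divide_left_mono)
        ultimately show "x \<in> {1 / (real k + 1)..1 / real k}" by simp
      qed
      have "(\<integral>\<^sup>+x. indicator (Q k) x * (F x * g (gauss_map x)) \<partial>lborel) =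
         (\<integral>\<^sup>+x. (indicator (Q k) x * (F x * g (gauss_map x))) * indicator {1 / (real k + 1)..1 / real k} x \<partial>lborel)"
        using sub by (intro nn_integral_cong) (auto simp: indicator_def)
      also have "\<dots> = (\<integral>\<^sup>+y. ennreal (gauss_weight k y) * (indicator (Q k) (gauss_branch k y) *
           (F (gauss_branch k y) * g (gauss_map (gauss_branch k y)))) * indicator {0..1} y \<partial>lborel)"
        by (rule nn_integral_gauss_branch[OF _ k]) measurable
      also have "\<dots> = (\<integral>\<^sup>+y. ennreal (gauss_weight k y) * F (gauss_branch k y) * g y \<partial>unit_lebesgue)"
        unfolding nn_integral_unit_lebesgue
      proof (rule nn_integral_cong_AE, use ae[of 0] in eventually_elim)
        fix y :: real assume "y \<noteq> 0"
        then show "ennreal (gauss_weight k y) * (indicator (Q k) (gauss_branch k y) *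
           (F (gauss_branch k y) * g (gauss_map (gauss_branch k y)))) * indicator {0..1} y =
           ennreal (gauss_weight k y) * F (gauss_branch k y) * g y * indicator {0..1} y"
          using gauss_branch_inverse[of y k] k by (auto simp: Q_def indicator_def mult.assoc)
      qed
      finally show ?thesis .
    qed
  qed
  also have "\<dots> = (\<integral>\<^sup>+y. (\<Sum>k. ennreal (gauss_weight k y) * F (gauss_branch k y) * g y) \<partial>unit_lebesgue)"
    by (rule nn_integral_suminf[symmetric]) (intro measurable_unit_lebesgue; measurable)
  also have "\<dots> = (\<integral>\<^sup>+y. (\<Sum>k. ennreal (gauss_weight k y) * F (gauss_branch k y)) * g y \<partial>unit_lebesgue)"
    by (simp only: ennreal_suminf_multc)
  finally show ?thesis .
qed

lemma gauss_weight_bound: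
  assumes "0 \<le> y"
  shows "summable (\<lambda>k. gauss_weight k y)" "(\<Sum>k. gauss_weight k y) \<le> pi\<^sup>2 / 6"
proof -
  have s: "(\<lambda>k. 1 / (real k + 1)\<^sup>2) sums (pi\<^sup>2 / 6)" using inverse_squares_sums by (simp add: add.commute)
  have le: "gauss_weight (Suc k) y \<le> 1 / (real k + 1)\<^sup>2" for k
    using assms unfolding gauss_weight_def by (auto intro!: divide_left_mono power_mono simp: add.commute)
  have nn: "0 \<le> gauss_weight k y" for k by (simp add: gauss_weight_def)
  have sS: "summable (\<lambda>k. gauss_weight (Suc k) y)"
    using le nn by (intro summable_comparison_test'[OF sums_summable[OF s], of 0]) auto
  then show "summable (\<lambda>k. gauss_weight k y)" using summable_Suc_iff[of "\<lambda>k. gauss_weight k y"] by blast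
  then have "(\<Sum>k. gauss_weight k y) = (\<Sum>k. gauss_weight (Suc k) y)"
    using suminf_split_head[of "\<lambda>k. gauss_weight k y"] by (simp add: gauss_weight_def)
  also have "\<dots> \<le> (\<Sum>k. 1 / (real k + 1)\<^sup>2)" using le sS sums_summable[OF s] by (intro suminf_le) auto
  finally show "(\<Sum>k. gauss_weight k y) \<le> pi\<^sup>2 / 6" using s by (simp add: sums_iff)
qed

lemma gauss_digit_eq_iff: "x \<in> {0<..1} \<Longrightarrow> y \<in> {0<..1} \<Longrightarrow> gauss_digit x = gauss_digit y \<longleftrightarrow> \<lceil>1 / x\<rceil> = \<lceil>1 / y\<rceil>"
proof -
  assume "x \<in> {0<..1}" "y \<in> {0<..1}"
  then have "0 < 1 / x" "0 < 1 / y" by auto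
  then have "\<lceil>1 / x\<rceil> \<ge> 1" "\<lceil>1 / y\<rceil> \<ge> 1" by (simp_all add: le_ceiling_iff)
  moreover define z1 z2 where "z1 = \<lceil>1 / x\<rceil>" and "z2 = \<lceil>1 / y\<rceil>"
  ultimately have "z1 \<ge> 1" "z2 \<ge> 1" by simp_all
  then show ?thesis by (auto simp: gauss_digit_def z1_def[symmetric] z2_def[symmetric])
qed

interpretation gauss: expanding_map gauss_map gauss_digit gauss_weight gauss_branch "{0<..1}" "pi\<^sup>2 / 6"
proof
  show "{0<..<1} \<subseteq> {0<..1::real}" "{0<..1} \<subseteq> {0..1::real}" "{0<..1} \<in> sets (borel :: real measure)" by auto
  show "gauss_map x \<in> {0..1}" "gauss_map x \<in> {0<..1}" for x using gauss_map_range[of x] by auto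
  show "0 \<le> gauss_weight k y" for k y by (simp add: gauss_weight_def)
  fix y :: real assume "y \<in> {0<..1}"
  then have y: "0 < y" "y \<le> 1" by auto
  show "summable (\<lambda>k. gauss_weight k y)" "(\<Sum>k. gauss_weight k y) \<le> pi\<^sup>2 / 6"
    using gauss_weight_bound[of y] y by auto
  fix k assume "gauss_weight k y \<noteq> 0"
  then have "k \<ge> 1" by (cases k) (auto simp: gauss_weight_def)
  then show "gauss_branch k y \<in> {0<..1} \<and> gauss_digit (gauss_branch k y) = k \<and> gauss_map (gauss_branch k y) = y"
    using gauss_branch_inverse[OF y, of k] by (simp add: less_imp_le)
next
  fix F g :: "real \<Rightarrow> ennreal"
  assume "F \<in> borel_measurable borel" "g \<in> borel_measurable borel"
  then show "(\<integral>\<^sup>+x. F x * g (gauss_map x) \<partial>unit_lebesgue) =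
        (\<integral>\<^sup>+y. (\<Sum>k. ennreal (gauss_weight k y) * F (gauss_branch k y)) * g y \<partial>unit_lebesgue)"
    by (rule nn_transfer_gauss)
next
  fix x y z :: real
  assume x: "x \<in> {0<..1}" "y \<in> {0<..1}" "x \<le> z" "z \<le> y"
  then show z: "z \<in> {0<..1}" by auto
  assume d: "gauss_digit x = gauss_digit y"
  have m: "1 / z \<le> 1 / x" "1 / y \<le> 1 / z" using x by (auto intro!: divide_left_mono)
  then have "\<lceil>1 / z\<rceil> \<le> \<lceil>1 / x\<rceil>" "\<lceil>1 / y\<rceil> \<le> \<lceil>1 / z\<rceil>" by (auto intro: ceiling_mono)
  moreover have "\<lceil>1 / x\<rceil> = \<lceil>1 / y\<rceil>" using d gauss_digit_eq_iff[OF x(1,2)] by simp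
  ultimately have c: "\<lceil>1 / z\<rceil> = \<lceil>1 / x\<rceil>" "\<lceil>1 / y\<rceil> = \<lceil>1 / x\<rceil>" by linarith+
  then show "gauss_digit z = gauss_digit x \<and>
       (gauss_map x \<le> gauss_map z \<and> gauss_map z \<le> gauss_map y \<or>
        gauss_map y \<le> gauss_map z \<and> gauss_map z \<le> gauss_map x)"
    unfolding gauss_digit_def gauss_map_def c using m by auto
qed auto

text \<open>The cone of densities \<open>f\<close> with \<open>f\<close> decreasing and \<open>(1 + x)\<^sup>2 f x\<close> increasing contains
  \<open>x \<mapsto> 1 / (q + q' x)\<^sup>2\<close> for \<open>q' \<le> q\<close>, the Jacobians of the inverse branches, and is preserved by
  every branch.\<close>

definition gauss_cone :: "(real \<Rightarrow> real) \<Rightarrow> bool" where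
  "gauss_cone f \<longleftrightarrow> f \<in> borel_measurable borel \<and> (\<forall>x y. 0 < x \<longrightarrow> x \<le> y \<longrightarrow> y \<le> 1 \<longrightarrow>
     0 \<le> f y \<and> f y \<le> f x \<and> (1 + x)\<^sup>2 * f x \<le> (1 + y)\<^sup>2 * f y)"

text \<open>With \<open>u\<close> the image of \<open>x\<close> under the branch, the weight is
  \<open>u\<^sup>2\<close>. Then \<open>u\<^sup>2 * f u\<close> is the product of
  \<open>(u / (1 + u))\<^sup>2\<close> and \<open>(1 + u)\<^sup>2 * f u\<close>, both increasing in
  \<open>u\<close>, while \<open>u\<close> decreases in \<open>x\<close>. Conversely
  \<open>(1 + x) * u = (1 + x) / (k + x)\<close> increases in \<open>x\<close> for
  \<open>k \<ge> 1\<close>, and so does \<open>f u\<close>.\<close>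

lemma gauss_cone_branch:
  assumes f: "gauss_cone f" and xy: "0 < x" "x \<le> y" "y \<le> 1"
  shows "0 \<le> gauss_weight k y * f (gauss_branch k y)"
    and "gauss_weight k y * f (gauss_branch k y) \<le> gauss_weight k x * f (gauss_branch k x)"
    and "(1 + x)\<^sup>2 * (gauss_weight k x * f (gauss_branch k x)) \<le> (1 + y)\<^sup>2 * (gauss_weight k y * f (gauss_branch k y))"
proof -
  have "0 \<le> gauss_weight k y * f (gauss_branch k y) \<and>
    gauss_weight k y * f (gauss_branch k y) \<le> gauss_weight k x * f (gauss_branch k x) \<and>
    (1 + x)\<^sup>2 * (gauss_weight k x * f (gauss_branch k x)) \<le> (1 + y)\<^sup>2 * (gauss_weight k y * f (gauss_branch k y))"
  proof (cases "k = 0")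
    case True
    then show ?thesis by (simp add: gauss_weight_def)
  next
    case False
    then have k: "k \<ge> 1" by simp
    define u where "u = gauss_branch k x"
    define v where "v = gauss_branch k y"
    have uv: "0 < u" "u \<le> 1" "0 < v" "v \<le> 1" "v \<le> u"
      using gauss_branch_inverse[of x k] gauss_branch_inverse[of y k] xy k
      by (auto simp: u_def v_def) (auto simp: gauss_branch_def intro!: divide_left_mono)
    have w: "gauss_weight k x = u\<^sup>2" "gauss_weight k y = v\<^sup>2"
      using k by (auto simp: gauss_weight_def u_def v_def gauss_branch_def power_divide)
    have fuv: "0 \<le> f v" "0 \<le> f u" "f u \<le> f v" "(1 + v)\<^sup>2 * f v \<le> (1 + u)\<^sup>2 * f u"
      using f uv unfolding gauss_cone_def by auto
    have a: "v / (1 + v) \<le> u / (1 + u)" using uv by (simp add: field_simps)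
    have "v\<^sup>2 * f v = (v / (1 + v))\<^sup>2 * ((1 + v)\<^sup>2 * f v)" using uv by (simp add: power_divide)
    also have "\<dots> \<le> (u / (1 + u))\<^sup>2 * ((1 + u)\<^sup>2 * f u)"
      by (rule mult_mono[OF power_mono[OF a]]) (use uv fuv in auto)
    also have "\<dots> = u\<^sup>2 * f u" using uv by (simp add: power_divide)
    finally have 1: "v\<^sup>2 * f v \<le> u\<^sup>2 * f u" .
    have "(1 + x) * (real k + y) \<le> (1 + y) * (real k + x)"
      using mult_right_mono[of 1 "real k" "y - x"] k xy by (simp add: algebra_simps)
    then have b: "(1 + x) * u \<le> (1 + y) * v"
      using xy k by (simp add: u_def v_def gauss_branch_def frac_le_eq divide_simps mult.commute)
    have "(1 + x)\<^sup>2 * (u\<^sup>2 * f u) = ((1 + x) * u)\<^sup>2 * f u" by (simp add: power_mult_distrib)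
    also have "\<dots> \<le> ((1 + y) * v)\<^sup>2 * f v"
      by (rule mult_mono[OF power_mono[OF b]]) (use uv xy fuv in auto)
    also have "\<dots> = (1 + y)\<^sup>2 * (v\<^sup>2 * f v)" by (simp add: power_mult_distrib)
    finally have 2: "(1 + x)\<^sup>2 * (u\<^sup>2 * f u) \<le> (1 + y)\<^sup>2 * (v\<^sup>2 * f v)" .
    show ?thesis unfolding w u_def[symmetric] v_def[symmetric] using 1 2 fuv by simp
  qed
  then show "0 \<le> gauss_weight k y * f (gauss_branch k y)"
    and "gauss_weight k y * f (gauss_branch k y) \<le> gauss_weight k x * f (gauss_branch k x)"
    and "(1 + x)\<^sup>2 * (gauss_weight k x * f (gauss_branch k x)) \<le> (1 + y)\<^sup>2 * (gauss_weight k y * f (gauss_branch k y))"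
    by auto
qed

lemma gauss_cone_branch_sum:
  assumes f: "\<And>k. gauss_cone (f k)" and B: "\<And>k x. x \<in> {0<..1} \<Longrightarrow> 0 \<le> f k x \<and> f k x \<le> B"
  shows "gauss_cone (\<lambda>y. if y \<in> {0<..1} then \<Sum>k. gauss_weight k y * f k (gauss_branch k y) else 0)"
  unfolding gauss_cone_def
proof (intro conjI allI impI)
  have [measurable]: "f k \<in> borel_measurable borel" for k using f by (auto simp: gauss_cone_def)
  show "(\<lambda>y. if y \<in> {0<..1} then \<Sum>k. gauss_weight k y * f k (gauss_branch k y) else 0) \<in> borel_measurable borel"
    by measurable
  have s: "summable (\<lambda>k. gauss_weight k z * f k (gauss_branch k z))" if "0 < z" "z \<le> 1" for z
  proof (rule summable_comparison_test'[where N = 0])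
    show "summable (\<lambda>k. gauss_weight k z * B)" using gauss_weight_bound[of z] that by (intro summable_mult2) auto
    show "norm (gauss_weight k z * f k (gauss_branch k z)) \<le> gauss_weight k z * B" for k
      using B[of "gauss_branch k z" k] gauss_branch_inverse[OF that, of k]
      by (cases "k = 0") (auto simp: gauss_weight_def abs_mult intro!: divide_right_mono)
  qed
  fix x y :: real assume xy: "0 < x" "x \<le> y" "y \<le> 1"
  note t = gauss_cone_branch[OF f xy]
  have sx: "summable (\<lambda>k. gauss_weight k x * f k (gauss_branch k x))"
   and sy: "summable (\<lambda>k. gauss_weight k y * f k (gauss_branch k y))" using s xy by auto
  have "0 \<le> (\<Sum>k. gauss_weight k y * f k (gauss_branch k y))"
    using t(1) sy by (intro suminf_nonneg) auto
  then show "0 \<le> (if y \<in> {0<..1} then \<Sum>k. gauss_weight k y * f k (gauss_branch k y) else 0)" using xy by simp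
  have "(\<Sum>k. gauss_weight k y * f k (gauss_branch k y)) \<le> (\<Sum>k. gauss_weight k x * f k (gauss_branch k x))"
    using t(2) sx sy by (intro suminf_le) auto
  then show "(if y \<in> {0<..1} then \<Sum>k. gauss_weight k y * f k (gauss_branch k y) else 0)
    \<le> (if x \<in> {0<..1} then \<Sum>k. gauss_weight k x * f k (gauss_branch k x) else 0)" using xy by simp
  have "(\<Sum>k. (1 + x)\<^sup>2 * (gauss_weight k x * f k (gauss_branch k x))) \<le> (\<Sum>k. (1 + y)\<^sup>2 * (gauss_weight k y * f k (gauss_branch k y)))"
    using t(3) sx sy by (intro suminf_le summable_mult) auto
  then show "(1 + x)\<^sup>2 * (if x \<in> {0<..1} then \<Sum>k. gauss_weight k x * f k (gauss_branch k x) else 0)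
    \<le> (1 + y)\<^sup>2 * (if y \<in> {0<..1} then \<Sum>k. gauss_weight k y * f k (gauss_branch k y) else 0)"
    using xy by (simp only: suminf_mult[OF sx] suminf_mult[OF sy]) simp
qed

lemma gauss_cone_word: "gauss_cone ((gauss.transfer ^^ m) (\<lambda>x. of_bool (R (gauss.word m x))))"
proof (rule gauss.transfer_word_cone)
  show "gauss_cone (\<lambda>x. of_bool c)" for c
    by (auto simp: gauss_cone_def intro!: power_mono)
qed (rule gauss_cone_branch_sum)

text \<open>\<open>(1 + x)\<^sup>2\<close> varies between 1 and 4 on the interval, so any two values
  of \<open>f\<close> differ at most by the factor 4.\<close>

lemma gauss_cone_le_integral:
  assumes f: "gauss_cone f" and x: "x \<in> {0<..1}" and B: "\<And>x. x \<in> {0<..1} \<Longrightarrow> f x \<le> B"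
  shows "f x \<le> 4 * (\<integral>y. f y \<partial>unit_lebesgue)"
proof -
  have le: "f x \<le> 4 * f y" if y: "y \<in> {0<..1}" for y
  proof (cases "x \<le> y")
    case True
    then have "(1 + x)\<^sup>2 * f x \<le> (1 + y)\<^sup>2 * f y" "0 \<le> f y" "0 \<le> f x"
      using f x y unfolding gauss_cone_def by auto
    moreover have "1 * f x \<le> (1 + x)\<^sup>2 * f x" using x \<open>0 \<le> f x\<close> by (intro mult_right_mono) auto
    moreover have "(1 + y)\<^sup>2 * f y \<le> 2\<^sup>2 * f y" using y \<open>0 \<le> f y\<close> by (intro mult_right_mono power_mono) auto
    ultimately show ?thesis by simp
  next
    case False
    then have "f x \<le> f y" "0 \<le> f y" using f x y unfolding gauss_cone_def by auto
    then show ?thesis by simp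
  qed
  have i: "integrable unit_lebesgue f"
    using f B by (intro gauss.integrable_bounded[where B = B]) (auto simp: gauss_cone_def)
  have "f x = (\<integral>y. f x \<partial>unit_lebesgue)" by simp
  also have "\<dots> \<le> (\<integral>y. 4 * f y \<partial>unit_lebesgue)"
    using le i by (intro gauss.integral_mono_X) auto
  finally show ?thesis by simp
qed

lemma gauss_transfer_word_le:
  assumes "x \<in> {0<..1}"
  shows "(gauss.transfer ^^ m) (\<lambda>x. of_bool (R (gauss.word m x))) x \<le> 4"
proof -
  let ?F = "\<lambda>x. of_bool (R (gauss.word m x)) :: real"
  have F: "?F \<in> borel_measurable borel" "0 \<le> ?F x \<and> ?F x \<le> 1" for x by auto
  have "(gauss.transfer ^^ m) ?F x \<le> 4 * (\<integral>y. (gauss.transfer ^^ m) ?F y \<partial>unit_lebesgue)"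
    using gauss.transfer_iterate[OF F] by (intro gauss_cone_le_integral[OF gauss_cone_word assms]) auto
  also have "(\<integral>y. (gauss.transfer ^^ m) ?F y \<partial>unit_lebesgue) = (\<integral>y. ?F y \<partial>unit_lebesgue)"
    using gauss.integral_transfer_iterate[OF F, of "\<lambda>_. 1" m] by simp
  also have "\<dots> \<le> (\<integral>y. 1 \<partial>unit_lebesgue)"
    using F by (intro gauss.integral_mono_X gauss.integrable_bounded[where B = 1]) auto
  finally show ?thesis by simp
qed

section \<open>The Markov operator of the Gauss map and Iosifescu's contraction\<close>

text \<open>The weight of the digit \<open>k + 1\<close> conjugated by the Gauss density: multiplied
  by \<open>1 + y\<close> and divided by 1 plus the branch point. These weights sum to 1, so
  \<open>gauss_op\<close> is a Markov operator, and \<open>gauss_tail k y\<close> is the total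
  weight from \<open>k\<close> on.\<close>

definition gauss_prob :: "nat \<Rightarrow> real \<Rightarrow> real" where
  "gauss_prob k y = (1 + y) / ((real k + 1 + y) * (real k + 2 + y))"

definition gauss_tail :: "nat \<Rightarrow> real \<Rightarrow> real" where
  "gauss_tail k y = (1 + y) / (real k + 1 + y)"

definition gauss_op :: "(real \<Rightarrow> real) \<Rightarrow> real \<Rightarrow> real" where
  "gauss_op f y = (\<Sum>k. gauss_prob k y * f (1 / (real k + 1 + y)))"

lemma gauss_prob_eq_tail: "0 \<le> y \<Longrightarrow> gauss_prob k y = gauss_tail k y - gauss_tail (Suc k) y"
  by (simp add: gauss_prob_def gauss_tail_def divide_simps) (simp add: algebra_simps)

lemma gauss_prob_nonneg: "0 \<le> y \<Longrightarrow> 0 \<le> gauss_prob k y"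
  by (simp add: gauss_prob_def)

lemma gauss_tail_tendsto: "(\<lambda>k. gauss_tail k y) \<longlonglongrightarrow> 0"
  unfolding gauss_tail_def by real_asymp

lemma gauss_prob_sums: "0 \<le> y \<Longrightarrow> (\<lambda>k. gauss_prob k y) sums 1"
proof -
  assume y: "0 \<le> y"
  have "(\<lambda>k. gauss_tail k y - gauss_tail (Suc k) y) sums (gauss_tail 0 y - 0)"
    by (rule telescope_sums'[OF gauss_tail_tendsto])
  then show ?thesis using y by (simp add: gauss_prob_eq_tail gauss_tail_def)
qed

lemma gauss_point: "0 \<le> y \<Longrightarrow> 1 / (real k + 1 + y) \<in> {0<..1}"
  by (auto simp: divide_simps)

lemma gauss_op_sums:
  assumes "\<And>x. x \<in> {0<..1} \<Longrightarrow> 0 \<le> f x \<and> f x \<le> B" "0 \<le> y"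
  shows "(\<lambda>k. gauss_prob k y * f (1 / (real k + 1 + y))) sums gauss_op f y"
  unfolding gauss_op_def
proof (rule summable_sums, rule summable_comparison_test'[where N = 0])
  show "summable (\<lambda>k. gauss_prob k y * B)" using gauss_prob_sums[OF assms(2)] by (intro summable_mult2) (rule sums_summable)
  show "norm (gauss_prob k y * f (1 / (real k + 1 + y))) \<le> gauss_prob k y * B" for k
    using assms(1)[OF gauss_point[OF assms(2)], of k] gauss_prob_nonneg[OF assms(2), of k]
    by (simp add: abs_mult mult_left_mono)
qed

lemma gauss_op_bounds:
  assumes "\<And>x. x \<in> {0<..1} \<Longrightarrow> 0 \<le> f x \<and> f x \<le> B" "0 \<le> y"
  shows "0 \<le> gauss_op f y \<and> gauss_op f y \<le> B"
proof
  note s = gauss_op_sums[of f B y, OF assms]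
  have t: "0 \<le> gauss_prob k y * f (1 / (real k + 1 + y))" "gauss_prob k y * f (1 / (real k + 1 + y)) \<le> gauss_prob k y * B" for k
    using assms(1)[OF gauss_point[OF assms(2)], of k] gauss_prob_nonneg[OF assms(2), of k]
    by (auto intro!: mult_left_mono)
  show "0 \<le> gauss_op f y" using sums_le[OF _ sums_zero s] t by blast
  show "gauss_op f y \<le> B" using sums_le[OF _ s sums_mult2[OF gauss_prob_sums[OF assms(2)], of B]] t by simp
qed

lemma gauss_op_const_minus:
  assumes "\<And>x. x \<in> {0<..1} \<Longrightarrow> 0 \<le> f x \<and> f x \<le> B" "0 \<le> y"
  shows "gauss_op (\<lambda>x. B - f x) y = B - gauss_op f y"
proof -
  have "(\<lambda>k. gauss_prob k y * B - gauss_prob k y * f (1 / (real k + 1 + y))) sums (1 * B - gauss_op f y)"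
    by (intro sums_diff sums_mult2 gauss_prob_sums gauss_op_sums[of f B y, OF assms] assms(2))
  then show ?thesis by (simp add: gauss_op_def sums_iff right_diff_distrib)
qed

lemma gauss_op_borel [measurable]:
  assumes [measurable]: "f \<in> borel_measurable borel"
  shows "gauss_op f \<in> borel_measurable borel"
  unfolding gauss_op_def[abs_def] gauss_prob_def by measurable

definition increasing_on_unit :: "real \<Rightarrow> real \<Rightarrow> (real \<Rightarrow> real) \<Rightarrow> bool" where
  "increasing_on_unit B v f \<longleftrightarrow> f \<in> borel_measurable borel \<and> (\<forall>x\<in>{0<..1}. 0 \<le> f x \<and> f x \<le> B) \<and>
     (\<forall>x y. 0 < x \<longrightarrow> x \<le> y \<longrightarrow> y \<le> 1 \<longrightarrow> f x \<le> f y \<and> f y - f x \<le> v)"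

text \<open>The weights of larger digits grow with \<open>y\<close>, so the operator reverses monotonicity; comparing
  its values at \<open>0\<close> and \<open>1\<close> shows that it halves the oscillation of a monotone function (Iosifescu).\<close>

lemma gauss_op_antimono:
  assumes f: "increasing_on_unit B v f" and yz: "0 \<le> y" "y \<le> z" "z \<le> 1"
  shows "gauss_op f z \<le> gauss_op f y"
proof -
  have fB: "\<And>x. x \<in> {0<..1} \<Longrightarrow> 0 \<le> f x \<and> f x \<le> B" and mono: "\<And>x y. 0 < x \<Longrightarrow> x \<le> y \<Longrightarrow> y \<le> 1 \<Longrightarrow> f x \<le> f y"
    using f by (auto simp: increasing_on_unit_def)
  \<comment> \<open>The passage from \<open>y\<close> to \<open>z\<close> is split: first the
    weights move while the values stay frozen at the points of \<open>y\<close>, then the points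
    move to the left, where \<open>f\<close> is smaller.\<close>
  define a where "a k = f (1 / (real k + 1 + y))" for k
  have aB: "0 \<le> a k" "a k \<le> B" for k using fB[OF gauss_point[OF yz(1), of k]] by (auto simp: a_def)
  have a_dec: "a (Suc k) \<le> a k" for k
    unfolding a_def using gauss_point[OF yz(1), of k] gauss_point[OF yz(1), of "Suc k"] yz
    by (intro mono) (auto intro!: divide_left_mono)
  have tail: "gauss_tail k y \<le> gauss_tail k z" for k
    using yz mult_right_mono[of y z "real k"] by (simp add: gauss_tail_def divide_simps) (simp add: algebra_simps)
  \<comment> \<open>Summation by parts: with the whole remaining weight placed on
    \<open>a n\<close>, the partial sums can be compared by induction, and this boundary term
    vanishes in the limit.\<close>
  define S where "S y n = (\<Sum>k<n. gauss_prob k y * a k)" for y n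
  have "S z n + gauss_tail n z * a n \<le> S y n + gauss_tail n y * a n" for n
  proof (induction n)
    case 0
    then show ?case using yz by (simp add: S_def gauss_tail_def)
  next
    case (Suc n)
    have e: "S u (Suc n) + gauss_tail (Suc n) u * a (Suc n) = S u n + gauss_tail n u * a n - gauss_tail (Suc n) u * (a n - a (Suc n))"
      if "0 \<le> u" for u
      by (simp add: S_def gauss_prob_eq_tail[OF that] algebra_simps)
    have "gauss_tail (Suc n) y * (a n - a (Suc n)) \<le> gauss_tail (Suc n) z * (a n - a (Suc n))"
      using tail a_dec[of n] by (intro mult_right_mono) auto
    then show ?case using Suc e[of y] e[of z] yz by linarith
  qed
  moreover have lim: "(\<lambda>n. S u n + gauss_tail n u * a n) \<longlonglongrightarrow> (\<Sum>k. gauss_prob k u * a k) + 0" if u: "0 \<le> u" for u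
  proof (intro tendsto_add)
    have "summable (\<lambda>k. gauss_prob k u * a k)"
    proof (rule summable_comparison_test'[where N = 0])
      show "summable (\<lambda>k. gauss_prob k u * B)" using gauss_prob_sums[OF u] by (intro summable_mult2) (rule sums_summable)
      show "norm (gauss_prob k u * a k) \<le> gauss_prob k u * B" for k
        using aB[of k] gauss_prob_nonneg[OF u, of k] by (simp add: abs_mult mult_left_mono)
    qed
    then show "(\<lambda>n. S u n) \<longlonglongrightarrow> (\<Sum>k. gauss_prob k u * a k)"
      unfolding S_def by (rule summable_LIMSEQ)
    show "(\<lambda>n. gauss_tail n u * a n) \<longlonglongrightarrow> 0"
    proof (rule Lim_null_comparison)
      show "(\<lambda>n. gauss_tail n u * B) \<longlonglongrightarrow> 0"
        using tendsto_mult[OF gauss_tail_tendsto[of u] tendsto_const[of B]] by simp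
      have "0 \<le> gauss_tail n u" for n using u by (simp add: gauss_tail_def)
      then show "eventually (\<lambda>n. norm (gauss_tail n u * a n) \<le> gauss_tail n u * B) sequentially"
        using aB by (intro always_eventually allI) (simp add: abs_mult mult_left_mono)
    qed
  qed
  ultimately have le: "(\<Sum>k. gauss_prob k z * a k) \<le> (\<Sum>k. gauss_prob k y * a k)"
    using LIMSEQ_le[OF lim[of z] lim[of y]] yz by auto
  have sz: "(\<lambda>k. gauss_prob k z * f (1 / (real k + 1 + z))) sums gauss_op f z"
    by (rule gauss_op_sums[of f B z]) (use fB yz in auto)
  have "gauss_op f z \<le> (\<Sum>k. gauss_prob k z * a k)"
  proof -
    have "summable (\<lambda>k. gauss_prob k z * a k)"
    proof (rule summable_comparison_test'[where N = 0])
      show "summable (\<lambda>k. gauss_prob k z * B)" using gauss_prob_sums[of z] yz by (intro summable_mult2) (auto intro: sums_summable)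
      show "norm (gauss_prob k z * a k) \<le> gauss_prob k z * B" for k
        using aB[of k] gauss_prob_nonneg[of z k] yz by (simp add: abs_mult mult_left_mono)
    qed
    moreover have "gauss_prob k z * f (1 / (real k + 1 + z)) \<le> gauss_prob k z * a k" for k
      unfolding a_def using gauss_point[OF yz(1), of k] gauss_point[of z k] gauss_prob_nonneg[of z k] yz
      by (intro mult_left_mono mono) (auto intro!: divide_left_mono)
    ultimately show ?thesis unfolding gauss_op_def using sums_summable[OF sz] by (blast intro: suminf_le)
  qed
  also note le
  also have "(\<Sum>k. gauss_prob k y * a k) = gauss_op f y" by (simp add: a_def gauss_op_def)
  finally show ?thesis .
qed

text \<open>At 0 half of the weight sits on the point 1; the other half is distributed over the
  points \<open>1 / (k + 2)\<close> exactly as the full weight at 1 is. So the difference is half of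
  \<open>f 1\<close> minus half of an average of \<open>f\<close>, at most
  \<open>v / 2\<close>.\<close>

lemma gauss_op_oscillation:
  assumes f: "increasing_on_unit B v f"
  shows "gauss_op f 0 - gauss_op f 1 \<le> v / 2"
proof -
  have fB: "\<And>x. x \<in> {0<..1} \<Longrightarrow> 0 \<le> f x \<and> f x \<le> B" and osc: "\<And>x y. 0 < x \<Longrightarrow> x \<le> y \<Longrightarrow> y \<le> 1 \<Longrightarrow> f y - f x \<le> v"
    using f by (auto simp: increasing_on_unit_def)
  define b where "b k = f (1 / (real k + 2))" for k
  define r where "r k = 1 / ((real k + 2) * (real k + 3))" for k
  have s0: "(\<lambda>k. gauss_prob k 0 * f (1 / (real k + 1))) sums gauss_op f 0"
    using gauss_op_sums[of f B 0] fB by simp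
  then have "(\<lambda>k. gauss_prob (Suc k) 0 * f (1 / (real (Suc k) + 1))) sums (gauss_op f 0 - gauss_prob 0 0 * f 1)"
    by (subst sums_Suc_iff) simp
  moreover have "gauss_prob (Suc k) 0 * f (1 / (real (Suc k) + 1)) = r k * b k" for k
    by (simp add: gauss_prob_def r_def b_def add_ac)
  moreover have "gauss_prob 0 0 = 1 / 2" by (simp add: gauss_prob_def)
  ultimately have 0: "(\<lambda>k. r k * b k) sums (gauss_op f 0 - 1 / 2 * f 1)" by simp
  have "(\<lambda>k. gauss_prob k 1 * f (1 / (real k + 1 + 1))) sums gauss_op f 1"
    by (rule gauss_op_sums[of f B 1]) (use fB in auto)
  moreover have "gauss_prob k 1 * f (1 / (real k + 1 + 1)) = 2 * (r k * b k)" for k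
    by (simp add: gauss_prob_def r_def b_def add_ac)
  ultimately have 1: "(\<lambda>k. 2 * (r k * b k)) sums gauss_op f 1" by simp
  have d: "(\<lambda>k. r k * b k - 2 * (r k * b k)) sums (gauss_op f 0 - 1 / 2 * f 1 - gauss_op f 1)" by (rule sums_diff[OF 0 1])
  have "(\<lambda>k. 2 * r k) sums 1"
    using gauss_prob_sums[of 1] by (simp add: gauss_prob_def r_def add_ac)
  from sums_mult[OF this, of "- (f 1 - v) / 2"] have r: "(\<lambda>k. - (f 1 - v) * r k) sums (- (f 1 - v) / 2)" by simp
  have "r k * b k - 2 * (r k * b k) \<le> - (f 1 - v) * r k" for k
  proof -
    have "f 1 - v \<le> b k" using osc[of "1 / (real k + 2)" 1] by (auto simp: b_def)
    then have "(f 1 - v) * r k \<le> b k * r k" by (intro mult_right_mono) (auto simp: r_def)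
    then show ?thesis by (simp add: algebra_simps)
  qed
  from sums_le[OF this d r] show ?thesis by (simp add: field_simps)
qed

text \<open>The operator turns increasing into decreasing; subtraction from the bound
  \<open>B\<close> restores the direction, so that the halving can be iterated.\<close>

lemma gauss_op_increasing:
  assumes f: "increasing_on_unit B v f"
  shows "increasing_on_unit B (v / 2) (\<lambda>y. B - gauss_op f y)"
  unfolding increasing_on_unit_def
proof (intro conjI ballI allI impI)
  have fB: "\<And>x. x \<in> {0<..1} \<Longrightarrow> 0 \<le> f x \<and> f x \<le> B" and [measurable]: "f \<in> borel_measurable borel"
    using f by (auto simp: increasing_on_unit_def)
  show "(\<lambda>y. B - gauss_op f y) \<in> borel_measurable borel" by measurable
  show "0 \<le> B - gauss_op f x" "B - gauss_op f x \<le> B" if "x \<in> {0<..1}" for x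
    using gauss_op_bounds[of f B x] fB that by auto
  fix x y :: real assume xy: "0 < x" "x \<le> y" "y \<le> 1"
  show "B - gauss_op f x \<le> B - gauss_op f y" using gauss_op_antimono[OF f, of x y] xy by simp
  have "gauss_op f x \<le> gauss_op f 0" "gauss_op f 1 \<le> gauss_op f y"
    using xy by (auto intro!: gauss_op_antimono[OF f])
  then show "B - gauss_op f y - (B - gauss_op f x) \<le> v / 2" using gauss_op_oscillation[OF f] by linarith
qed

section \<open>Integration against the Gauss density and exponential mixing\<close>

text \<open>Not normalised: the total mass is \<open>ln 2\<close>, which is why \<open>ln 2\<close>
  appears as a divisor in the mixing estimates.\<close>

definition gauss_int :: "(real \<Rightarrow> real) \<Rightarrow> real" where
  "gauss_int f = (\<integral>x. f x / (1 + x) \<partial>unit_lebesgue)"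

lemma gauss_integrable:
  assumes "f \<in> borel_measurable borel" "\<And>x. x \<in> {0<..1} \<Longrightarrow> \<bar>f x\<bar> \<le> B"
  shows "integrable unit_lebesgue (\<lambda>x. f x / (1 + x))"
proof (rule gauss.integrable_bounded[where B = B])
  show "(\<lambda>x. f x / (1 + x)) \<in> borel_measurable borel" using assms(1) by measurable
  show "\<bar>f x / (1 + x)\<bar> \<le> B" if x: "x \<in> {0<..1}" for x
  proof -
    have "\<bar>f x / (1 + x)\<bar> = \<bar>f x\<bar> / (1 + x)" using x by simp
    also have "\<dots> \<le> \<bar>f x\<bar> / 1" using x by (intro divide_left_mono) auto
    finally show ?thesis using assms(2)[OF x] by simp
  qed
qed

lemma gauss_int_one: "gauss_int (\<lambda>_. 1) = ln 2"
proof -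
  have "(\<integral>x. 1 / (1 + x) \<partial>unit_lebesgue) = (\<integral>x. (1 / (1 + x)) * indicator {0..1} x \<partial>lborel)"
    unfolding unit_lebesgue_def by (subst integral_restrict_space) (auto simp: mult.commute)
  also have "\<dots> = ln (1 + 1) - ln (1 + 0)"
  proof (rule integral_FTC_Icc_real)
    show "((\<lambda>x. ln (1 + x)) has_real_derivative 1 / (1 + x)) (at x)" if "0 \<le> x" "x \<le> 1" for x :: real
      using that by (auto intro!: derivative_eq_intros)
    show "isCont (\<lambda>x. 1 / (1 + x)) x" if "0 \<le> x" "x \<le> 1" for x :: real
      using that by (intro continuous_intros) auto
  qed simp
  finally show ?thesis by (simp add: gauss_int_def)
qed

lemma gauss_int_cmult: "gauss_int (\<lambda>x. c * f x) = c * gauss_int f"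
  by (simp add: gauss_int_def flip: times_divide_eq_right)

lemma gauss_int_const: "gauss_int (\<lambda>_. c) = c * ln 2"
  using gauss_int_cmult[of c "\<lambda>_. 1"] by (simp add: gauss_int_one)

lemma gauss_int_add:
  assumes "f \<in> borel_measurable borel" "\<And>x. x \<in> {0<..1} \<Longrightarrow> \<bar>f x\<bar> \<le> B"
    and "g \<in> borel_measurable borel" "\<And>x. x \<in> {0<..1} \<Longrightarrow> \<bar>g x\<bar> \<le> B'"
  shows "gauss_int (\<lambda>x. f x + g x) = gauss_int f + gauss_int g"
  using gauss_integrable[OF assms(1,2)] gauss_integrable[OF assms(3,4)] by (simp add: gauss_int_def add_divide_distrib)

lemma gauss_int_mono:
  assumes "f \<in> borel_measurable borel" "\<And>x. x \<in> {0<..1} \<Longrightarrow> \<bar>f x\<bar> \<le> B"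
    and "g \<in> borel_measurable borel" "\<And>x. x \<in> {0<..1} \<Longrightarrow> \<bar>g x\<bar> \<le> B'"
    and "\<And>x. x \<in> {0<..1} \<Longrightarrow> f x \<le> g x"
  shows "gauss_int f \<le> gauss_int g"
  unfolding gauss_int_def using gauss_integrable[OF assms(1,2)] gauss_integrable[OF assms(3,4)] assms(5)
  by (intro gauss.integral_mono_X) (auto intro!: divide_right_mono)

lemma gauss_int_cong:
  assumes "f \<in> borel_measurable borel" "g \<in> borel_measurable borel" "\<And>x. x \<in> {0<..1} \<Longrightarrow> f x = g x"
  shows "gauss_int f = gauss_int g"
  unfolding gauss_int_def using assms by (intro gauss.integral_cong_X) auto

text \<open>The Gauss density turns the transfer operator into \<open>gauss_op\<close>, so that
  duality and invariance carry over to \<open>gauss_int\<close>.\<close>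

lemma transfer_gauss_op:
  assumes f: "\<And>x. x \<in> {0<..1} \<Longrightarrow> 0 \<le> f x \<and> f x \<le> B" and y: "y \<in> {0<..1}"
  shows "gauss.transfer (\<lambda>x. f x / (1 + x)) y = gauss_op f y / (1 + y)"
proof -
  have y0: "0 \<le> y" using y by simp
  have e: "gauss_weight (Suc k) y * (f (gauss_branch (Suc k) y) / (1 + gauss_branch (Suc k) y)) =
     gauss_prob k y * f (1 / (real k + 1 + y)) / (1 + y)" for k
  proof -
    define u where "u = real k + 1 + y"
    have u: "u > 0" using y by (simp add: u_def)
    have "gauss_weight (Suc k) y = 1 / u\<^sup>2" "gauss_branch (Suc k) y = 1 / u"
      by (simp_all add: gauss_weight_def gauss_branch_def u_def add_ac)
    moreover have "gauss_prob k y / (1 + y) = 1 / (u * (u + 1))"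
      using y by (simp add: gauss_prob_def u_def add_ac)
    moreover have "1 / u\<^sup>2 * (1 / (1 + 1 / u)) = 1 / (u * (u + 1))"
      using u by (simp add: field_simps power2_eq_square)
    ultimately show ?thesis unfolding u_def[symmetric]
      by (metis (no_types, opaque_lifting) mult.commute mult.left_commute times_divide_eq_right times_divide_eq_left mult_1)
  qed
  have "(\<lambda>k. gauss_weight (Suc k) y * (f (gauss_branch (Suc k) y) / (1 + gauss_branch (Suc k) y))) sums (gauss_op f y / (1 + y))"
    unfolding e by (intro sums_divide gauss_op_sums[of f B y, OF f y0])
  then have "(\<lambda>k. gauss_weight k y * (f (gauss_branch k y) / (1 + gauss_branch k y))) sums (gauss_op f y / (1 + y) + 0)"
    using sums_Suc[of "\<lambda>k. gauss_weight k y * (f (gauss_branch k y) / (1 + gauss_branch k y))"] by (simp add: gauss_weight_def)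
  then show ?thesis using y by (simp add: gauss.transfer_def sums_iff)
qed

lemma gauss_int_op:
  assumes f: "f \<in> borel_measurable borel" "\<And>x. x \<in> {0<..1} \<Longrightarrow> 0 \<le> f x \<and> f x \<le> B"
    and g: "g \<in> borel_measurable borel" "\<And>x. x \<in> {0..1} \<Longrightarrow> 0 \<le> g x"
  shows "gauss_int (\<lambda>x. f x * g (gauss_map x)) = gauss_int (\<lambda>x. gauss_op f x * g x)"
proof -
  have B: "0 \<le> f x / (1 + x) \<and> f x / (1 + x) \<le> B" if x: "x \<in> {0<..1}" for x
  proof -
    have "f x / (1 + x) \<le> f x / 1" using f(2)[OF x] x by (intro divide_left_mono) auto
    then show ?thesis using f(2)[OF x] x by auto
  qed
  have m: "(\<lambda>x. f x / (1 + x)) \<in> borel_measurable borel" using f(1) by measurable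
  have "(\<integral>x. f x / (1 + x) * g (gauss_map x) \<partial>unit_lebesgue) = (\<integral>x. gauss.transfer (\<lambda>x. f x / (1 + x)) x * g x \<partial>unit_lebesgue)"
    using B g by (intro gauss.integral_transfer m) auto
  also have "\<dots> = (\<integral>x. gauss_op f x * g x / (1 + x) \<partial>unit_lebesgue)"
  proof (rule gauss.integral_cong_X)
    show "(\<lambda>x. gauss.transfer (\<lambda>x. f x / (1 + x)) x * g x) \<in> borel_measurable borel"
      using gauss.transfer_borel[OF m] g(1) by measurable
    show "(\<lambda>x. gauss_op f x * g x / (1 + x)) \<in> borel_measurable borel" using f(1) g(1) by measurable
    show "gauss.transfer (\<lambda>x. f x / (1 + x)) x * g x = gauss_op f x * g x / (1 + x)" if "x \<in> {0<..1}" for x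
      using transfer_gauss_op[of f B x] f(2) that by simp
  qed
  finally show ?thesis by (simp add: gauss_int_def)
qed

lemma gauss_int_invariant:
  assumes g: "g \<in> borel_measurable borel" "\<And>x. x \<in> {0..1} \<Longrightarrow> 0 \<le> g x"
  shows "gauss_int (\<lambda>x. g ((gauss_map ^^ n) x)) = gauss_int g"
  using g
proof (induction n arbitrary: g)
  case (Suc n)
  have "gauss_int (\<lambda>x. g (gauss_map ((gauss_map ^^ n) x))) = gauss_int (\<lambda>x. g (gauss_map x))"
    using Suc.prems gauss.T_unit by (intro Suc.IH) auto
  also have "\<dots> = gauss_int (\<lambda>x. 1 * g (gauss_map x))" by simp
  also have "\<dots> = gauss_int (\<lambda>x. gauss_op (\<lambda>_. 1) x * g x)"
    by (rule gauss_int_op[where B = 1]) (use Suc.prems in auto)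
  also have "\<dots> = gauss_int g"
  proof (rule gauss_int_cong)
    show "(\<lambda>x. gauss_op (\<lambda>_. 1) x * g x) \<in> borel_measurable borel"
      using gauss_op_borel[of "\<lambda>_. 1"] Suc.prems(1) by (intro borel_measurable_times) auto
  qed (use Suc.prems gauss_prob_sums in \<open>auto simp: gauss_op_def sums_iff\<close>)
  finally show ?case by simp
qed simp

lemma gauss_iterate_unit: "x \<in> {0..1} \<Longrightarrow> (gauss_map ^^ n) x \<in> {0..1}"
proof (induction n)
  case (Suc n)
  then show ?case using gauss.T_unit[of "(gauss_map ^^ n) x"] by simp
qed simp

text \<open>At \<open>n = 0\<close> the function \<open>f\<close> differs from its mean by at most
  \<open>v\<close> everywhere. Otherwise duality trades one iterate for the operator, and
  \<open>f\<close> is replaced by \<open>B\<close> minus its image, whose oscillation bound is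
  halved; by invariance of the Gauss measure the constant \<open>B\<close> cancels.\<close>

lemma increasing_mixing:
  assumes f: "increasing_on_unit B v f" and g: "g \<in> borel_measurable borel" "\<And>x. x \<in> {0..1} \<Longrightarrow> 0 \<le> g x \<and> g x \<le> G"
  shows "\<bar>gauss_int (\<lambda>x. f x * g ((gauss_map ^^ n) x)) - gauss_int f * gauss_int g / ln 2\<bar> \<le> v * (1 / 2) ^ n * gauss_int g"
  using f
proof (induction n arbitrary: f v)
  case 0
  have fB: "\<And>x. x \<in> {0<..1} \<Longrightarrow> 0 \<le> f x \<and> f x \<le> B" and fm: "f \<in> borel_measurable borel"
    and osc: "\<And>x y. x \<in> {0<..1} \<Longrightarrow> y \<in> {0<..1} \<Longrightarrow> f x - f y \<le> v"
  proof -
    show "\<And>x. x \<in> {0<..1} \<Longrightarrow> 0 \<le> f x \<and> f x \<le> B" "f \<in> borel_measurable borel"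
      using 0 by (auto simp: increasing_on_unit_def)
    have osc': "f x \<le> f y \<and> f y - f x \<le> v" if "0 < x" "x \<le> y" "y \<le> 1" for x y
      using 0 that by (auto simp: increasing_on_unit_def)
    show "f x - f y \<le> v" if xy: "x \<in> {0<..1}" "y \<in> {0<..1}" for x y
      using osc'[of x y] osc'[of y x] osc'[of y y] xy by (cases "x \<le> y") auto
  qed
  have fB': "\<bar>f x\<bar> \<le> B" "\<bar>g x\<bar> \<le> G" "\<bar>f x * g x\<bar> \<le> B * G" if x: "x \<in> {0<..1}" for x
    using fB[OF x] g(2)[of x] x by (auto simp: abs_mult intro!: mult_mono)
  have ln2: "ln 2 > (0::real)" by simp
  define c where "c = gauss_int f / ln 2"
  have fc: "\<bar>f x - c\<bar> \<le> v" if x: "x \<in> {0<..1}" for x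
  proof -
    have "gauss_int f \<le> gauss_int (\<lambda>_. f x + v)"
      using osc[OF _ x] by (intro gauss_int_mono[where B = B and B' = "\<bar>f x + v\<bar>"] fm) (use fB' in \<open>auto simp: algebra_simps\<close>)
    moreover have "gauss_int (\<lambda>_. f x - v) \<le> gauss_int f"
      using osc[OF x] by (intro gauss_int_mono[where B' = B and B = "\<bar>f x - v\<bar>"] fm) (use fB' in \<open>auto simp: algebra_simps\<close>)
    ultimately have "c \<le> f x + v" "f x - v \<le> c" using ln2 by (auto simp: c_def gauss_int_const field_simps)
    then show ?thesis by linarith
  qed
  have fgm: "(\<lambda>x. f x * g x) \<in> borel_measurable borel" using fm g(1) by measurable
  have "gauss_int (\<lambda>x. f x * g x) \<le> gauss_int (\<lambda>x. (c + v) * g x)"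
  proof (rule gauss_int_mono[OF fgm fB'(3)])
    show "(\<lambda>x. (c + v) * g x) \<in> borel_measurable borel" using g(1) by measurable
    show "\<bar>(c + v) * g x\<bar> \<le> \<bar>c + v\<bar> * G" if "x \<in> {0<..1}" for x
      using g(2)[of x] that by (auto simp: abs_mult intro!: mult_left_mono)
    show "f x * g x \<le> (c + v) * g x" if "x \<in> {0<..1}" for x
      using fc[OF that] g(2)[of x] that by (intro mult_right_mono) auto
  qed
  moreover have "gauss_int (\<lambda>x. (c - v) * g x) \<le> gauss_int (\<lambda>x. f x * g x)"
  proof (rule gauss_int_mono[OF _ _ fgm fB'(3)])
    show "(\<lambda>x. (c - v) * g x) \<in> borel_measurable borel" using g(1) by measurable
    show "\<bar>(c - v) * g x\<bar> \<le> \<bar>c - v\<bar> * G" if "x \<in> {0<..1}" for x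
      using g(2)[of x] that by (auto simp: abs_mult intro!: mult_left_mono)
    show "(c - v) * g x \<le> f x * g x" if "x \<in> {0<..1}" for x
      using fc[OF that] g(2)[of x] that by (intro mult_right_mono) auto
  qed
  ultimately have "\<bar>gauss_int (\<lambda>x. f x * g x) - c * gauss_int g\<bar> \<le> v * gauss_int g"
    unfolding gauss_int_cmult by (simp add: algebra_simps abs_le_iff)
  then show ?case by (simp add: c_def)
next
  case (Suc n)
  have fB: "\<And>x. x \<in> {0<..1} \<Longrightarrow> 0 \<le> f x \<and> f x \<le> B" and fm: "f \<in> borel_measurable borel"
    using Suc.prems by (auto simp: increasing_on_unit_def)
  define h where "h = (\<lambda>y. B - gauss_op f y)"
  define gn where "gn x = g ((gauss_map ^^ n) x)" for x
  have h: "increasing_on_unit B (v / 2) h" unfolding h_def by (rule gauss_op_increasing[OF Suc.prems])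
  have gnm: "gn \<in> borel_measurable borel" unfolding gn_def using g(1) by measurable
  have gnB: "0 \<le> gn x \<and> gn x \<le> G" if "x \<in> {0..1}" for x
  proof -
    have "(gauss_map ^^ n) x \<in> {0..1}" using gauss_iterate_unit[OF that] .
    then show ?thesis using g(2) by (simp add: gn_def)
  qed
  have opm: "gauss_op f \<in> borel_measurable borel" using fm by measurable
  have opB: "0 \<le> gauss_op f x \<and> gauss_op f x \<le> B" if "x \<in> {0<..1}" for x
    using gauss_op_bounds[of f B x] fB that by auto
  have hm: "h \<in> borel_measurable borel" unfolding h_def using opm by measurable
  have hB: "\<bar>h x\<bar> \<le> B" if "x \<in> {0<..1}" for x using opB[OF that] by (auto simp: h_def)
  have B0: "0 \<le> B" using fB[of 1] by auto
  have 1: "gauss_int (\<lambda>x. f x * g ((gauss_map ^^ Suc n) x)) = gauss_int (\<lambda>x. gauss_op f x * gn x)"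
  proof -
    have "(\<lambda>x. f x * g ((gauss_map ^^ Suc n) x)) = (\<lambda>x. f x * gn (gauss_map x))"
      by (simp add: gn_def funpow_swap1)
    then show ?thesis using gauss_int_op[of f B gn] fm fB gnm gnB by simp
  qed
  have hg: "\<bar>h x * gn x\<bar> \<le> B * G" if "x \<in> {0<..1}" for x
    using hB[OF that] gnB[of x] that B0 by (auto simp: abs_mult intro!: mult_mono)
  have og: "\<bar>gauss_op f x * gn x\<bar> \<le> B * G" if "x \<in> {0<..1}" for x
    using opB[OF that] gnB[of x] that B0 by (auto simp: abs_mult intro!: mult_mono)
  have 2: "gauss_int (\<lambda>x. h x * gn x) + gauss_int (\<lambda>x. gauss_op f x * gn x) = B * gauss_int g"
  proof -
    have "gauss_int (\<lambda>x. h x * gn x) + gauss_int (\<lambda>x. gauss_op f x * gn x) = gauss_int (\<lambda>x. h x * gn x + gauss_op f x * gn x)"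
      using hm opm gnm hg og by (intro gauss_int_add[symmetric]) auto
    also have "\<dots> = gauss_int (\<lambda>x. B * gn x)" by (simp add: h_def algebra_simps)
    also have "\<dots> = B * gauss_int gn" by (rule gauss_int_cmult)
    also have "gauss_int gn = gauss_int g" unfolding gn_def using g by (intro gauss_int_invariant) auto
    finally show ?thesis .
  qed
  have 3: "gauss_int h + gauss_int f = B * ln 2"
  proof -
    have "gauss_int f = gauss_int (gauss_op f)"
      using gauss_int_op[of f B "\<lambda>_. 1"] fm fB by simp
    then have "gauss_int h + gauss_int f = gauss_int (\<lambda>x. h x + gauss_op f x)"
      using hm opm hB opB by (subst gauss_int_add[of h B "gauss_op f" B]) auto
    also have "\<dots> = gauss_int (\<lambda>x. B)" by (simp add: h_def)
    finally show ?thesis by (simp add: gauss_int_const)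
  qed
  have "\<bar>gauss_int (\<lambda>x. h x * gn x) - gauss_int h * gauss_int g / ln 2\<bar> \<le> v / 2 * (1 / 2) ^ n * gauss_int g"
    unfolding gn_def by (rule Suc.IH[OF h])
  moreover have "gauss_int h * gauss_int g / ln 2 = B * gauss_int g - gauss_int f * gauss_int g / ln 2"
  proof -
    have "gauss_int h = B * ln 2 - gauss_int f" using 3 by simp
    then show ?thesis by (simp add: left_diff_distrib diff_divide_distrib)
  qed
  moreover have "v * (1 / 2) ^ Suc n * gauss_int g = v / 2 * (1 / 2) ^ n * gauss_int g" by simp
  moreover have "gauss_int (\<lambda>x. gauss_op f x * gn x) = B * gauss_int g - gauss_int (\<lambda>x. h x * gn x)" using 2 by linarith
  ultimately show ?case unfolding 1 by linarith
qed

lemma decreasing_mixing_gauss: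
  assumes f: "increasing_on_unit B v (\<lambda>x. B - f x)" and fm: "f \<in> borel_measurable borel"
    and g: "g \<in> borel_measurable borel" "\<And>x. x \<in> {0..1} \<Longrightarrow> 0 \<le> g x \<and> g x \<le> G"
  shows "\<bar>gauss_int (\<lambda>x. f x * g ((gauss_map ^^ n) x)) - gauss_int f * gauss_int g / ln 2\<bar> \<le> v * (1 / 2) ^ n * gauss_int g"
proof -
  define gn where "gn x = g ((gauss_map ^^ n) x)" for x
  have gnm: "gn \<in> borel_measurable borel" unfolding gn_def using g(1) by measurable
  have gnB: "0 \<le> gn x \<and> gn x \<le> G" if "x \<in> {0..1}" for x
  proof -
    have "(gauss_map ^^ n) x \<in> {0..1}" using gauss_iterate_unit[OF that] .
    then show ?thesis using g(2) by (simp add: gn_def)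
  qed
  define h where "h x = B - f x" for x
  have h: "0 \<le> h x \<and> h x \<le> B" if "x \<in> {0<..1}" for x using f that by (auto simp: increasing_on_unit_def h_def)
  have hm: "h \<in> borel_measurable borel" unfolding h_def using fm by measurable
  have B0: "0 \<le> B" using h[of 1] by auto
  have fB: "0 \<le> f x \<and> f x \<le> B" if "x \<in> {0<..1}" for x using h[OF that] by (auto simp: h_def)
  have hg: "\<bar>h x * gn x\<bar> \<le> B * G" "\<bar>f x * gn x\<bar> \<le> B * G" if "x \<in> {0<..1}" for x
    using h[OF that] fB[OF that] gnB[of x] that B0 by (auto simp: abs_mult intro!: mult_mono)
  have 2: "gauss_int (\<lambda>x. h x * gn x) + gauss_int (\<lambda>x. f x * gn x) = B * gauss_int g"
  proof -
    have "gauss_int (\<lambda>x. h x * gn x) + gauss_int (\<lambda>x. f x * gn x) = gauss_int (\<lambda>x. h x * gn x + f x * gn x)"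
      using hm fm gnm hg by (intro gauss_int_add[symmetric]) auto
    also have "\<dots> = gauss_int (\<lambda>x. B * gn x)" by (simp add: h_def algebra_simps)
    also have "\<dots> = B * gauss_int gn" by (rule gauss_int_cmult)
    also have "gauss_int gn = gauss_int g" unfolding gn_def using g by (intro gauss_int_invariant) auto
    finally show ?thesis .
  qed
  have 3: "gauss_int h + gauss_int f = B * ln 2"
  proof -
    have "gauss_int h + gauss_int f = gauss_int (\<lambda>x. h x + f x)"
      using hm fm h fB by (subst gauss_int_add[of h B f B]) auto
    also have "\<dots> = gauss_int (\<lambda>x. B)" by (simp add: h_def)
    finally show ?thesis by (simp add: gauss_int_const)
  qed
  have "\<bar>gauss_int (\<lambda>x. h x * gn x) - gauss_int h * gauss_int g / ln 2\<bar> \<le> v * (1 / 2) ^ n * gauss_int g"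
    unfolding gn_def h_def by (rule increasing_mixing[OF f g])
  moreover have "gauss_int h * gauss_int g / ln 2 = B * gauss_int g - gauss_int f * gauss_int g / ln 2"
  proof -
    have "gauss_int h = B * ln 2 - gauss_int f" using 3 by simp
    then show ?thesis by (simp add: left_diff_distrib diff_divide_distrib)
  qed
  moreover have "gauss_int (\<lambda>x. f x * gn x) = B * gauss_int g - gauss_int (\<lambda>x. h x * gn x)" using 2 by linarith
  ultimately show ?thesis unfolding gn_def[symmetric] by linarith
qed

text \<open>To pass from Lebesgue measure to the Gauss density, \<open>f\<close> has to be
  multiplied by \<open>1 + x\<close>, which spoils monotonicity. But \<open>(1 + x) * f x\<close> is
  the difference of \<open>2 * f x\<close> and \<open>(1 - x) * f x\<close>, both decreasing, with
  oscillations at most 8 and 4.\<close>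

lemma gauss_cone_mixing:
  assumes f: "gauss_cone f" "\<And>x. x \<in> {0<..1} \<Longrightarrow> f x \<le> 4" and A [measurable]: "A \<in> sets borel"
  shows "\<bar>(\<integral>x. f x * indicator A ((gauss_map ^^ n) x) \<partial>unit_lebesgue) -
    (\<integral>x. f x \<partial>unit_lebesgue) * (gauss_int (indicator A) / ln 2)\<bar> \<le> 12 * (1 / 2) ^ n"
proof -
  have fm [measurable]: "f \<in> borel_measurable borel" using f by (simp add: gauss_cone_def)
  have f0: "0 \<le> f x" "f y \<le> f x" if "0 < x" "x \<le> y" "y \<le> 1" for x y
    using f(1) that by (force simp: gauss_cone_def)+
  define f1 f2 where "f1 x = 2 * f x" and "f2 x = (1 - x) * f x" for x
  have m [measurable]: "f1 \<in> borel_measurable borel" "f2 \<in> borel_measurable borel" unfolding f1_def f2_def by measurable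
  define I where "I = (\<lambda>x. indicator A x :: real)"
  have I: "I \<in> borel_measurable borel" "0 \<le> I x \<and> I x \<le> 1" for x unfolding I_def by (auto simp: indicator_def)
  have i1: "increasing_on_unit 8 8 (\<lambda>x. 8 - f1 x)"
    unfolding increasing_on_unit_def f1_def using f0 f(2) by (auto simp: algebra_simps) (smt (verit) f0 f(2) greaterThanAtMost_iff)+
  have f2b: "0 \<le> f2 x \<and> f2 x \<le> 4" if "0 < x" "x \<le> 1" for x
  proof -
    have "(1 - x) * f x \<le> 1 * f x" using that f0(1)[of x x] by (intro mult_right_mono) auto
    then show ?thesis using that f0(1)[of x x] f(2)[of x] by (auto simp: f2_def)
  qed
  have i2: "increasing_on_unit 4 4 (\<lambda>x. 4 - f2 x)"
    unfolding increasing_on_unit_def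
  proof (intro conjI ballI allI impI)
    show "(\<lambda>x. 4 - f2 x) \<in> borel_measurable borel" by measurable
    show "0 \<le> 4 - f2 x" "4 - f2 x \<le> 4" if "x \<in> {0<..1}" for x using f2b[of x] that by auto
    fix x y :: real assume xy: "0 < x" "x \<le> y" "y \<le> 1"
    have "(1 - y) * f y \<le> (1 - x) * f x" using xy f0[of x y] f0[of y y] by (intro mult_mono) auto
    then show "4 - f2 x \<le> 4 - f2 y" by (simp add: f2_def)
    show "4 - f2 y - (4 - f2 x) \<le> 4" using f2b[of x] f2b[of y] xy by auto
  qed
  have e: "(\<integral>x. f x * I ((gauss_map ^^ n) x) \<partial>unit_lebesgue) =
     gauss_int (\<lambda>x. f1 x * I ((gauss_map ^^ n) x)) - gauss_int (\<lambda>x. f2 x * I ((gauss_map ^^ n) x))"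
    if I: "I \<in> borel_measurable borel" "\<And>x. 0 \<le> I x \<and> I x \<le> 1" for I n
  proof -
    have b1: "\<bar>f1 x * I ((gauss_map ^^ n) x)\<bar> \<le> 8 * 1" if "x \<in> {0<..1}" for x
      using f0(1)[of x x] f(2)[of x] that I(2)[of "(gauss_map ^^ n) x"] unfolding abs_mult by (intro mult_mono) (auto simp: f1_def)
    have b2: "\<bar>f2 x * I ((gauss_map ^^ n) x)\<bar> \<le> 4 * 1" if "x \<in> {0<..1}" for x
      using f2b[of x] that I(2)[of "(gauss_map ^^ n) x"] unfolding abs_mult by (intro mult_mono) auto
    have m1: "(\<lambda>x. f1 x * I ((gauss_map ^^ n) x)) \<in> borel_measurable borel"
     and m2: "(\<lambda>x. f2 x * I ((gauss_map ^^ n) x)) \<in> borel_measurable borel" using I(1) by measurable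
    have "gauss_int (\<lambda>x. f1 x * I ((gauss_map ^^ n) x)) - gauss_int (\<lambda>x. f2 x * I ((gauss_map ^^ n) x)) =
       (\<integral>x. f1 x * I ((gauss_map ^^ n) x) / (1 + x) - f2 x * I ((gauss_map ^^ n) x) / (1 + x) \<partial>unit_lebesgue)"
      unfolding gauss_int_def using gauss_integrable[OF m1 b1] gauss_integrable[OF m2 b2]
      by (intro Bochner_Integration.integral_diff[symmetric]) auto
    also have "\<dots> = (\<integral>x. f x * I ((gauss_map ^^ n) x) \<partial>unit_lebesgue)"
    proof (rule Bochner_Integration.integral_cong)
      fix x assume "x \<in> space unit_lebesgue"
      then have x: "1 + x \<noteq> 0" by auto
      have "f1 x * I ((gauss_map ^^ n) x) / (1 + x) - f2 x * I ((gauss_map ^^ n) x) / (1 + x) =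
        ((1 + x) * (f x * I ((gauss_map ^^ n) x))) / (1 + x)"
        by (simp add: diff_divide_distrib[symmetric] f1_def f2_def algebra_simps)
      then show "f1 x * I ((gauss_map ^^ n) x) / (1 + x) - f2 x * I ((gauss_map ^^ n) x) / (1 + x) = f x * I ((gauss_map ^^ n) x)"
        using x by simp
    qed simp
    finally show ?thesis by simp
  qed
  have t: "(\<integral>x. f x \<partial>unit_lebesgue) = gauss_int f1 - gauss_int f2"
    using e[of "\<lambda>_. 1" 0] by simp
  have J: "0 \<le> gauss_int I" "gauss_int I \<le> 1"
  proof -
    show "0 \<le> gauss_int I" using gauss_int_mono[of "\<lambda>_. 0" 0 I 1] I by (simp add: gauss_int_const)
    have "gauss_int I \<le> ln 2" using gauss_int_mono[of I 1 "\<lambda>_. 1" 1] I by (simp add: gauss_int_one)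
    then show "gauss_int I \<le> 1" using ln_2_less_1 by linarith
  qed
  define h :: real where "h = (1 / 2) ^ n"
  define X1 X2 where "X1 = gauss_int (\<lambda>x. f1 x * I ((gauss_map ^^ n) x))" and "X2 = gauss_int (\<lambda>x. f2 x * I ((gauss_map ^^ n) x))"
  define Y1 Y2 where "Y1 = gauss_int f1 * gauss_int I / ln 2" and "Y2 = gauss_int f2 * gauss_int I / ln 2"
  have h: "h * gauss_int I \<le> h" unfolding h_def using J by (intro mult_left_le) auto
  have "\<bar>X1 - Y1\<bar> \<le> 8 * (h * gauss_int I)" unfolding X1_def Y1_def h_def mult.assoc[symmetric]
    by (rule decreasing_mixing_gauss[OF i1 m(1) I(1), of 1]) (use I(2) in auto)
  moreover have "\<bar>X2 - Y2\<bar> \<le> 4 * (h * gauss_int I)" unfolding X2_def Y2_def h_def mult.assoc[symmetric]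
    by (rule decreasing_mixing_gauss[OF i2 m(2) I(1), of 1]) (use I(2) in auto)
  ultimately have "\<bar>(X1 - X2) - (Y1 - Y2)\<bar> \<le> 12 * h" using h by linarith
  moreover have "(gauss_int f1 - gauss_int f2) * (gauss_int I / ln 2) = Y1 - Y2"
    by (simp add: left_diff_distrib diff_divide_distrib Y1_def Y2_def)
  ultimately show ?thesis
    unfolding I_def[symmetric] t e[OF I, of n] X1_def X2_def h_def by simp
qed

definition bounded_borel :: "(real \<Rightarrow> real) \<Rightarrow> bool" where
  "bounded_borel f \<longleftrightarrow> f \<in> borel_measurable borel \<and> (\<exists>B. \<forall>x\<in>{0<..1}. \<bar>f x\<bar> \<le> B)"

lemma bounded_borelI: "f \<in> borel_measurable borel \<Longrightarrow> (\<And>x. x \<in> {0<..1} \<Longrightarrow> \<bar>f x\<bar> \<le> B) \<Longrightarrow> bounded_borel f"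
  unfolding bounded_borel_def by blast

lemma bounded_borel_const: "bounded_borel (\<lambda>_. c)"
  by (rule bounded_borelI[of _ "\<bar>c\<bar>"]) auto

lemma bounded_borel_add:
  assumes "bounded_borel f" "bounded_borel g" shows "bounded_borel (\<lambda>x. f x + g x)"
proof -
  obtain B B' where "\<And>x. x \<in> {0<..1} \<Longrightarrow> \<bar>f x\<bar> \<le> B" "\<And>x. x \<in> {0<..1} \<Longrightarrow> \<bar>g x\<bar> \<le> B'"
    using assms unfolding bounded_borel_def by blast
  moreover have "f \<in> borel_measurable borel" "g \<in> borel_measurable borel" using assms by (auto simp: bounded_borel_def)
  ultimately show ?thesis
  proof (intro bounded_borelI[of _ "B + B'"] borel_measurable_add)
    fix x :: real assume "x \<in> {0<..1}"
    with \<open>\<And>x. x \<in> {0<..1} \<Longrightarrow> \<bar>f x\<bar> \<le> B\<close>[of x] \<open>\<And>x. x \<in> {0<..1} \<Longrightarrow> \<bar>g x\<bar> \<le> B'\<close>[of x]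
    show "\<bar>f x + g x\<bar> \<le> B + B'" by linarith
  qed
qed

lemma bounded_borel_mult:
  assumes "bounded_borel f" "bounded_borel g" shows "bounded_borel (\<lambda>x. f x * g x)"
proof -
  obtain B B' where "\<And>x. x \<in> {0<..1} \<Longrightarrow> \<bar>f x\<bar> \<le> B" "\<And>x. x \<in> {0<..1} \<Longrightarrow> \<bar>g x\<bar> \<le> B'"
    using assms unfolding bounded_borel_def by blast
  moreover have "f \<in> borel_measurable borel" "g \<in> borel_measurable borel" using assms by (auto simp: bounded_borel_def)
  ultimately show ?thesis
  proof (intro bounded_borelI[of _ "B * B'"] borel_measurable_times)
    fix x :: real assume "x \<in> {0<..1}"
    with \<open>\<And>x. x \<in> {0<..1} \<Longrightarrow> \<bar>f x\<bar> \<le> B\<close>[of x] \<open>\<And>x. x \<in> {0<..1} \<Longrightarrow> \<bar>g x\<bar> \<le> B'\<close>[of x]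
    have "\<bar>f x\<bar> \<le> B" "\<bar>g x\<bar> \<le> B'" by simp_all
    then show "\<bar>f x * g x\<bar> \<le> B * B'" unfolding abs_mult by (rule mult_mono) (use \<open>\<bar>f x\<bar> \<le> B\<close> in linarith, simp)
  qed
qed

lemma bounded_borel_cmult: "bounded_borel f \<Longrightarrow> bounded_borel (\<lambda>x. c * f x)"
  by (rule bounded_borel_mult[OF bounded_borel_const])

lemma bounded_borel_diff: "bounded_borel f \<Longrightarrow> bounded_borel g \<Longrightarrow> bounded_borel (\<lambda>x. f x - g x)"
  using bounded_borel_add[of f "\<lambda>x. (- 1) * g x"] bounded_borel_cmult[of g "- 1"] by simp

lemma bounded_borel_sum: "(\<And>i::nat. bounded_borel (f i)) \<Longrightarrow> bounded_borel (\<lambda>x. \<Sum>i<m. f i x)"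
  by (induction m) (auto intro: bounded_borel_const bounded_borel_add)

lemma bounded_borel_iterate:
  assumes "bounded_borel f" shows "bounded_borel (\<lambda>x. f ((gauss_map ^^ n) x))"
proof -
  obtain B where "\<And>x. x \<in> {0<..1} \<Longrightarrow> \<bar>f x\<bar> \<le> B" using assms unfolding bounded_borel_def by blast
  moreover have [measurable]: "f \<in> borel_measurable borel" using assms by (simp add: bounded_borel_def)
  ultimately have "\<bar>f ((gauss_map ^^ n) x)\<bar> \<le> B" if "x \<in> {0<..1}" for x
    using gauss.iterate_X[OF that, of n] by blast
  then show ?thesis by (rule bounded_borelI[rotated]) measurable
qed

lemma bounded_borel_gauss_integrable: "bounded_borel f \<Longrightarrow> integrable unit_lebesgue (\<lambda>x. f x / (1 + x))"
proof -
  assume "bounded_borel f"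
  then obtain B where "f \<in> borel_measurable borel" "\<And>x. x \<in> {0<..1} \<Longrightarrow> \<bar>f x\<bar> \<le> B"
    unfolding bounded_borel_def by blast
  then show ?thesis by (rule gauss_integrable)
qed

lemma gauss_int_plus: "bounded_borel f \<Longrightarrow> bounded_borel g \<Longrightarrow> gauss_int (\<lambda>x. f x + g x) = gauss_int f + gauss_int g"
  using bounded_borel_gauss_integrable[of f] bounded_borel_gauss_integrable[of g]
  by (simp add: gauss_int_def add_divide_distrib)

lemma gauss_int_minus: "bounded_borel f \<Longrightarrow> bounded_borel g \<Longrightarrow> gauss_int (\<lambda>x. f x - g x) = gauss_int f - gauss_int g"
  using gauss_int_plus[of f "\<lambda>x. (- 1) * g x"] bounded_borel_cmult[of g "- 1"] gauss_int_cmult[of "- 1" g] by simp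

lemma gauss_int_le: "bounded_borel f \<Longrightarrow> bounded_borel g \<Longrightarrow> (\<And>x. x \<in> {0<..1} \<Longrightarrow> f x \<le> g x) \<Longrightarrow> gauss_int f \<le> gauss_int g"
  unfolding gauss_int_def using bounded_borel_gauss_integrable[of f] bounded_borel_gauss_integrable[of g]
  by (intro gauss.integral_mono_X) (auto intro!: divide_right_mono)

lemma gauss_int_sum: "(\<And>i::nat. bounded_borel (f i)) \<Longrightarrow> gauss_int (\<lambda>x. \<Sum>i<m. f i x) = (\<Sum>i<m. gauss_int (f i))"
  by (induction m) (auto simp: gauss_int_plus bounded_borel_sum gauss_int_const[of 0, simplified])

lemma prob_le_gauss_int:
  assumes "A \<in> sets unit_lebesgue" shows "unit.prob A \<le> 2 * gauss_int (indicator A)"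
proof -
  have A: "A \<in> sets borel" "{0..1} \<inter> A = A" using assms by (auto simp: sets_unit_lebesgue_iff)
  have "unit.prob A = (\<integral>x. indicator A x \<partial>unit_lebesgue)" using A by (simp add: Int_commute)
  also have "\<dots> \<le> (\<integral>x. 2 * (indicator A x / (1 + x)) \<partial>unit_lebesgue)"
  proof (rule gauss.integral_mono_X)
    show "integrable unit_lebesgue (indicat_real A)" using assms by (rule integrable_indicator_unit_lebesgue)
    have "integrable unit_lebesgue (\<lambda>x. indicat_real A x / (1 + x))"
      using A by (intro gauss_integrable[where B = 1]) (auto simp: indicator_def)
    then show "integrable unit_lebesgue (\<lambda>x. 2 * (indicat_real A x / (1 + x)))" by (rule integrable_mult_right)
    show "indicat_real A x \<le> 2 * (indicat_real A x / (1 + x))" if "x \<in> {0<..1}" for x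
      using that by (auto simp: indicator_def field_simps)
  qed
  also have "\<dots> = 2 * (\<integral>x. indicator A x / (1 + x) \<partial>unit_lebesgue)" by (rule integral_mult_right_zero)
  finally show ?thesis by (simp only: gauss_int_def)
qed

section \<open>A weak law for the logarithms along Gauss orbits\<close>

text \<open>Truncation at level \<open>j\<close> makes the observable bounded, so that the mixing
  lemmas apply. All estimates below are uniform in \<open>j\<close>, and the level is removed only
  at the end.\<close>

definition log_trunc :: "nat \<Rightarrow> real \<Rightarrow> real" where
  "log_trunc j x = min (real j) (- ln x)"

text \<open>A majorant, term by term, of \<open>gauss_op\<close> applied to the squared logarithm:
  the weights are bounded uniformly on the unit interval, and \<open>1 / (k + 1 + y)\<close> has a
  logarithm of modulus at most \<open>ln (k + 2)\<close>.\<close>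

definition log_square_sum :: real where
  "log_square_sum = (\<Sum>k. 2 / ((real k + 1) * (real k + 2)) * (ln (real k + 2))\<^sup>2)"

lemma log_square_summable: "summable (\<lambda>k. 2 / ((real k + 1) * (real k + 2)) * (ln (real k + 2))\<^sup>2)"
proof (rule summable_comparison_test_bigo)
  show "summable (\<lambda>k. norm (real k powr (- 3 / 2)))" by (simp add: summable_real_powr_iff)
  show "(\<lambda>k. 2 / ((real k + 1) * (real k + 2)) * (ln (real k + 2))\<^sup>2) \<in> O(\<lambda>k. real k powr (- 3 / 2))"
    by real_asymp
qed

lemma log_square_sum_nonneg: "0 \<le> log_square_sum"
  unfolding log_square_sum_def by (intro suminf_nonneg log_square_summable) auto

lemma log_trunc_bounds: "x \<in> {0<..1} \<Longrightarrow> 0 \<le> log_trunc j x \<and> log_trunc j x \<le> real j \<and> log_trunc j x \<le> - ln x"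
  by (auto simp: log_trunc_def)

lemma log_trunc_borel [measurable]: "log_trunc j \<in> borel_measurable borel"
  unfolding log_trunc_def[abs_def] by measurable

lemma bounded_borel_log_trunc: "bounded_borel (log_trunc j)"
  using log_trunc_bounds[of _ j] by (intro bounded_borelI[of _ "real j"]) auto

lemma gauss_prob_le: "0 \<le> y \<Longrightarrow> y \<le> 1 \<Longrightarrow> gauss_prob k y \<le> 2 / ((real k + 1) * (real k + 2))"
  unfolding gauss_prob_def by (intro frac_le mult_mono) auto

lemma log_trunc_square_term:
  assumes "0 \<le> y" "y \<le> 1"
  shows "gauss_prob k y * (log_trunc j (1 / (real k + 1 + y)))\<^sup>2 \<le> 2 / ((real k + 1) * (real k + 2)) * (ln (real k + 2))\<^sup>2"
proof (rule mult_mono[OF gauss_prob_le[OF assms]])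
  have "log_trunc j (1 / (real k + 1 + y)) \<le> ln (real k + 2)"
  proof -
    have "log_trunc j (1 / (real k + 1 + y)) \<le> - ln (1 / (real k + 1 + y))" by (simp add: log_trunc_def)
    also have "\<dots> = ln (real k + 1 + y)" using assms by (simp add: ln_div)
    also have "\<dots> \<le> ln (real k + 2)" using assms by simp
    finally show ?thesis .
  qed
  then show "(log_trunc j (1 / (real k + 1 + y)))\<^sup>2 \<le> (ln (real k + 2))\<^sup>2"
    using log_trunc_bounds[OF gauss_point[OF assms(1)], of j k] by (intro power_mono) auto
qed auto

lemma gauss_op_log_trunc:
  assumes "0 \<le> y" "y \<le> 1"
  shows "gauss_op (\<lambda>x. (log_trunc j x)\<^sup>2) y \<le> log_square_sum"
    and "0 \<le> gauss_op (log_trunc j) y" and "gauss_op (log_trunc j) y \<le> 1 + log_square_sum"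
proof -
  have b: "0 \<le> log_trunc j x \<and> log_trunc j x \<le> real j" "0 \<le> (log_trunc j x)\<^sup>2 \<and> (log_trunc j x)\<^sup>2 \<le> (real j)\<^sup>2"
    if "x \<in> {0<..1}" for x using log_trunc_bounds[OF that, of j] by (auto intro!: power_mono)
  have s: "(\<lambda>k. gauss_prob k y * (log_trunc j (1 / (real k + 1 + y)))\<^sup>2) sums gauss_op (\<lambda>x. (log_trunc j x)\<^sup>2) y"
    using gauss_op_sums[of "\<lambda>x. (log_trunc j x)\<^sup>2" "(real j)\<^sup>2" y] b(2) assms by simp
  have q: "(\<lambda>k. 2 / ((real k + 1) * (real k + 2)) * (ln (real k + 2))\<^sup>2) sums log_square_sum"
    unfolding log_square_sum_def by (rule summable_sums[OF log_square_summable])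
  show "gauss_op (\<lambda>x. (log_trunc j x)\<^sup>2) y \<le> log_square_sum"
    by (rule sums_le[OF log_trunc_square_term[OF assms] s q])
  show "0 \<le> gauss_op (log_trunc j) y"
    using gauss_op_bounds[of "log_trunc j" "real j" y] b(1) assms by blast
  have s1: "(\<lambda>k. gauss_prob k y * log_trunc j (1 / (real k + 1 + y))) sums gauss_op (log_trunc j) y"
    using gauss_op_sums[of "log_trunc j" "real j" y] b(1) assms by simp
  show "gauss_op (log_trunc j) y \<le> 1 + log_square_sum"
  proof (rule sums_le[OF _ s1 sums_add[OF gauss_prob_sums[OF assms(1)] q]])
    fix k
    define t where "t = log_trunc j (1 / (real k + 1 + y))"
    have "t \<le> 1 + t\<^sup>2"
    proof -
      have "0 \<le> (t - 1)\<^sup>2 + 1 + t\<^sup>2" by simp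
      then show ?thesis by (simp add: power2_eq_square algebra_simps)
    qed
    then have "gauss_prob k y * t \<le> gauss_prob k y * (1 + t\<^sup>2)"
      using gauss_prob_nonneg[OF assms(1)] by (rule mult_left_mono)
    also have "\<dots> = gauss_prob k y + gauss_prob k y * t\<^sup>2" by (simp add: distrib_left)
    also have "\<dots> \<le> gauss_prob k y + 2 / ((real k + 1) * (real k + 2)) * (ln (real k + 2))\<^sup>2"
      using log_trunc_square_term[OF assms, of k j] unfolding t_def by simp
    finally show "gauss_prob k y * log_trunc j (1 / (real k + 1 + y)) \<le>
       gauss_prob k y + 2 / ((real k + 1) * (real k + 2)) * (ln (real k + 2))\<^sup>2" unfolding t_def .
  qed
qed

text \<open>The logarithm itself is unbounded near 0, but one application of the operator averages
  it to something bounded independently of \<open>j\<close>. Monotonicity follows by reflecting at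
  \<open>j\<close>, where the bound may depend on \<open>j\<close>.\<close>

lemma gauss_op_log_trunc_increasing:
  "increasing_on_unit (1 + log_square_sum) (1 + log_square_sum) (gauss_op (log_trunc j))"
proof -
  let ?h = "\<lambda>x. real j - log_trunc j x"
  have "increasing_on_unit (real j) (real j) ?h"
    unfolding increasing_on_unit_def
  proof (intro conjI ballI allI impI)
    show "(\<lambda>x. real j - log_trunc j x) \<in> borel_measurable borel" by measurable
    show "0 \<le> real j - log_trunc j x" "real j - log_trunc j x \<le> real j" if "x \<in> {0<..1}" for x
      using log_trunc_bounds[OF that, of j] by auto
    fix x y :: real assume xy: "0 < x" "x \<le> y" "y \<le> 1"
    then have "ln x \<le> ln y" by simp
    then show "real j - log_trunc j x \<le> real j - log_trunc j y" by (auto simp: log_trunc_def)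
    show "real j - log_trunc j y - (real j - log_trunc j x) \<le> real j"
      using log_trunc_bounds[of x j] log_trunc_bounds[of y j] xy by auto
  qed
  from gauss_op_increasing[OF this]
  have inc: "increasing_on_unit (real j) (real j / 2) (\<lambda>y. real j - gauss_op ?h y)" .
  have eq: "real j - gauss_op ?h y = gauss_op (log_trunc j) y" if "0 \<le> y" for y
    using gauss_op_const_minus[of "log_trunc j" "real j" y] log_trunc_bounds[of _ j] that by auto
  show ?thesis
    unfolding increasing_on_unit_def
  proof (intro conjI ballI allI impI)
    show "gauss_op (log_trunc j) \<in> borel_measurable borel" by measurable
    show "0 \<le> gauss_op (log_trunc j) x" "gauss_op (log_trunc j) x \<le> 1 + log_square_sum" if "x \<in> {0<..1}" for x
      using gauss_op_log_trunc[of x j] that by auto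
    fix x y :: real assume xy: "0 < x" "x \<le> y" "y \<le> 1"
    then have "real j - gauss_op ?h x \<le> real j - gauss_op ?h y" using inc unfolding increasing_on_unit_def by blast
    then show "gauss_op (log_trunc j) x \<le> gauss_op (log_trunc j) y" using eq[of x] eq[of y] xy by simp
    show "gauss_op (log_trunc j) y - gauss_op (log_trunc j) x \<le> 1 + log_square_sum"
      using gauss_op_log_trunc[of x j] gauss_op_log_trunc[of y j] xy by auto
  qed
qed

definition log_mean :: "nat \<Rightarrow> real" where
  "log_mean j = gauss_int (log_trunc j) / ln 2"

lemma gauss_int_log_trunc: "gauss_int (log_trunc j) = log_mean j * ln 2"
  by (simp add: log_mean_def)

lemma log_mean_bounds: "0 \<le> log_mean j" "log_mean j \<le> 1 + log_square_sum"
proof -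
  have "gauss_int (log_trunc j) = gauss_int (gauss_op (log_trunc j))"
    using gauss_int_op[of "log_trunc j" "real j" "\<lambda>_. 1"] log_trunc_bounds[of _ j] by simp
  also have "\<dots> \<le> gauss_int (\<lambda>_. 1 + log_square_sum)"
    using gauss_op_log_trunc[of _ j] by (intro gauss_int_le bounded_borel_const bounded_borelI[of _ "1 + log_square_sum"]) auto
  finally have 1: "gauss_int (log_trunc j) \<le> (1 + log_square_sum) * ln 2" by (simp add: gauss_int_const)
  have "gauss_int (\<lambda>_. 0) \<le> gauss_int (log_trunc j)"
    using log_trunc_bounds[of _ j] by (intro gauss_int_le bounded_borel_const bounded_borel_log_trunc) auto
  then have 0: "0 \<le> gauss_int (log_trunc j)" by (simp add: gauss_int_const)
  show "0 \<le> log_mean j" "log_mean j \<le> 1 + log_square_sum"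
    using 0 1 by (auto simp: log_mean_def pos_divide_le_eq)
qed

text \<open>One of the \<open>m - i\<close> steps between the two times is spent on replacing the
  first factor by its image under the operator, which has a bound uniform in \<open>j\<close>. The
  remaining \<open>m - i - 1\<close> steps provide the decay, whence the factor 2 in front.\<close>

lemma log_trunc_covariance:
  assumes "i < m"
  shows "gauss_int (\<lambda>x. log_trunc j ((gauss_map ^^ i) x) * log_trunc j ((gauss_map ^^ m) x)) - (log_mean j)\<^sup>2 * ln 2
    \<le> 2 * (1 + log_square_sum)\<^sup>2 * (1 / 2) ^ (m - i)"
proof -
  define r where "r = m - i - 1"
  have m: "m = Suc r + i" "m - i = Suc r" using assms by (auto simp: r_def)
  let ?f = "log_trunc j"
  \<comment> \<open>Agrees with \<open>log_trunc j\<close> on \<open>(0, 1]\<close> and is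
    nonnegative on the whole line.\<close>
  define f0 where "f0 x = max 0 (?f x)" for x
  have f0: "f0 x = ?f x" if "x \<in> {0<..1}" for x using log_trunc_bounds[OF that, of j] by (simp add: f0_def)
  have f0m [measurable]: "f0 \<in> borel_measurable borel" unfolding f0_def by measurable
  have f0b: "0 \<le> f0 x \<and> f0 x \<le> real j" for x by (auto simp: f0_def log_trunc_def)
  have it: "(gauss_map ^^ n) x \<in> {0<..1}" if "x \<in> {0<..1}" for n x using gauss.iterate_X[OF that] .
  define g where "g x = f0 x * f0 ((gauss_map ^^ Suc r) x)" for x
  have gm: "g \<in> borel_measurable borel" unfolding g_def by measurable
  have "gauss_int (\<lambda>x. ?f ((gauss_map ^^ i) x) * ?f ((gauss_map ^^ m) x)) = gauss_int (\<lambda>x. g ((gauss_map ^^ i) x))"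
  proof (rule gauss_int_cong)
    show "(\<lambda>x. ?f ((gauss_map ^^ i) x) * ?f ((gauss_map ^^ m) x)) \<in> borel_measurable borel" by measurable
    show "(\<lambda>x. g ((gauss_map ^^ i) x)) \<in> borel_measurable borel" using gm by measurable
    fix x :: real assume x: "x \<in> {0<..1}"
    have "(gauss_map ^^ m) x = (gauss_map ^^ Suc r) ((gauss_map ^^ i) x)"
      unfolding m(1) funpow_add comp_apply ..
    then show "?f ((gauss_map ^^ i) x) * ?f ((gauss_map ^^ m) x) = g ((gauss_map ^^ i) x)"
      using f0[OF it[OF x, of i]] f0[OF it[OF x, of m]] by (simp add: g_def del: funpow.simps)
  qed
  also have "\<dots> = gauss_int g"
    using f0b by (intro gauss_int_invariant gm) (auto simp: g_def)
  also have "g = (\<lambda>x. f0 x * f0 ((gauss_map ^^ r) (gauss_map x)))"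
    by (rule ext) (simp only: g_def funpow_Suc_right comp_apply)
  also have "gauss_int \<dots> = gauss_int (\<lambda>x. gauss_op f0 x * f0 ((gauss_map ^^ r) x))"
    using f0b by (intro gauss_int_op[where B = "real j"]) auto
  also have "gauss_op f0 x = gauss_op ?f x" if "0 \<le> x" for x
    unfolding gauss_op_def using f0[OF gauss_point[OF that]] by simp
  then have "gauss_int (\<lambda>x. gauss_op f0 x * f0 ((gauss_map ^^ r) x)) = gauss_int (\<lambda>x. gauss_op ?f x * f0 ((gauss_map ^^ r) x))"
    by (intro gauss_int_cong) auto
  finally have 1: "gauss_int (\<lambda>x. ?f ((gauss_map ^^ i) x) * ?f ((gauss_map ^^ m) x)) = gauss_int (\<lambda>x. gauss_op ?f x * f0 ((gauss_map ^^ r) x))" .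
  have i0: "gauss_int f0 = log_mean j * ln 2"
    unfolding gauss_int_log_trunc[symmetric] using f0 by (intro gauss_int_cong) auto
  have iop: "gauss_int (gauss_op ?f) = log_mean j * ln 2"
    unfolding gauss_int_log_trunc[symmetric]
    using gauss_int_op[of "log_trunc j" "real j" "\<lambda>_. 1"] log_trunc_bounds[of _ j] by simp
  have "\<bar>gauss_int (\<lambda>x. gauss_op ?f x * f0 ((gauss_map ^^ r) x)) - gauss_int (gauss_op ?f) * gauss_int f0 / ln 2\<bar>
     \<le> (1 + log_square_sum) * (1 / 2) ^ r * gauss_int f0"
    by (rule increasing_mixing[OF gauss_op_log_trunc_increasing f0m]) (rule f0b)
  moreover have "gauss_int (gauss_op ?f) * gauss_int f0 / ln 2 = (log_mean j)\<^sup>2 * ln 2"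
    by (simp add: i0 iop power2_eq_square)
  moreover have "(1 + log_square_sum) * (1 / 2) ^ r * gauss_int f0 \<le> (1 + log_square_sum) * (1 / 2) ^ r * (1 + log_square_sum)"
  proof (rule mult_left_mono)
    have "log_mean j * ln 2 \<le> log_mean j * 1" using log_mean_bounds ln_2_less_1 by (intro mult_left_mono) auto
    then show "gauss_int f0 \<le> 1 + log_square_sum" using i0 log_mean_bounds[of j] by linarith
    show "0 \<le> (1 + log_square_sum) * (1 / 2) ^ r" using log_square_sum_nonneg by simp
  qed
  ultimately have "gauss_int (\<lambda>x. gauss_op ?f x * f0 ((gauss_map ^^ r) x)) - (log_mean j)\<^sup>2 * ln 2
      \<le> (1 + log_square_sum) * (1 / 2) ^ r * (1 + log_square_sum)" by linarith
  then show ?thesis unfolding 1 m(2) by (simp add: power2_eq_square algebra_simps)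
qed

definition log_variance :: real where
  "log_variance = log_square_sum + 4 * (1 + log_square_sum)\<^sup>2"

lemma log_variance_pos: "log_variance > 0"
proof -
  have "1 \<le> (1 + log_square_sum)\<^sup>2" using log_square_sum_nonneg by (intro one_le_power) auto
  then show ?thesis using log_square_sum_nonneg unfolding log_variance_def by linarith
qed

text \<open>Adding the time \<open>m\<close> contributes one variance and twice its covariances with
  the earlier times. These decay geometrically, so the increment is bounded and the growth is
  linear, with a constant free of \<open>j\<close>.\<close>

lemma log_trunc_second_moment:
  "gauss_int (\<lambda>x. (\<Sum>i<m. log_trunc j ((gauss_map ^^ i) x) - log_mean j)\<^sup>2) \<le> log_variance * real m"
proof (induction m)
  case 0
  then show ?case by (simp add: gauss_int_const[of 0, simplified])
next
  case (Suc m)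
  define f where "f i x = log_trunc j ((gauss_map ^^ i) x)" for i x
  define c where "c = log_mean j"
  define Z where "Z i x = f i x - c" for i x
  have bf: "bounded_borel (f i)" for i unfolding f_def by (rule bounded_borel_iterate[OF bounded_borel_log_trunc])
  have bZ: "bounded_borel (Z i)" for i unfolding Z_def by (intro bounded_borel_diff bf bounded_borel_const)
  have bS: "bounded_borel (\<lambda>x. \<Sum>i<m. Z i x)" using bZ by (rule bounded_borel_sum)
  have mean: "gauss_int (f i) = c * ln 2" for i
  proof -
    define f0 where "f0 x = max 0 (log_trunc j x)" for x
    have f0: "f0 x = log_trunc j x" if "x \<in> {0<..1}" for x using log_trunc_bounds[OF that, of j] by (simp add: f0_def)
    have f0m [measurable]: "f0 \<in> borel_measurable borel" unfolding f0_def by measurable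
    have "gauss_int (f i) = gauss_int (\<lambda>x. f0 ((gauss_map ^^ i) x))"
      using bf f0[OF gauss.iterate_X] by (intro gauss_int_cong) (auto simp: bounded_borel_def f_def)
    also have "\<dots> = gauss_int f0" by (intro gauss_int_invariant) (auto simp: f0_def)
    also have "\<dots> = gauss_int (log_trunc j)" using f0 by (intro gauss_int_cong) auto
    finally show ?thesis by (simp add: gauss_int_log_trunc c_def)
  qed
  have ZZ: "gauss_int (\<lambda>x. Z i x * Z l x) = gauss_int (\<lambda>x. f i x * f l x) - c\<^sup>2 * ln 2" for i l
  proof -
    have "gauss_int (\<lambda>x. Z i x * Z l x) = gauss_int (\<lambda>x. (f i x * f l x - c * f i x) - (c * f l x - c\<^sup>2))"
      by (simp add: Z_def algebra_simps power2_eq_square)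
    also have "\<dots> = (gauss_int (\<lambda>x. f i x * f l x) - c * gauss_int (f i)) - (c * gauss_int (f l) - c\<^sup>2 * ln 2)"
      using bf by (simp add: gauss_int_minus bounded_borel_diff bounded_borel_mult bounded_borel_cmult bounded_borel_const
          gauss_int_cmult gauss_int_const)
    finally show ?thesis by (simp add: mean power2_eq_square)
  qed
  have diag: "gauss_int (\<lambda>x. Z m x * Z m x) \<le> log_square_sum"
  proof -
    define g where "g x = (log_trunc j x)\<^sup>2" for x
    have gm: "g \<in> borel_measurable borel" unfolding g_def by measurable
    have gb: "0 \<le> g x \<and> g x \<le> (real j)\<^sup>2" if "x \<in> {0<..1}" for x
      using log_trunc_bounds[OF that, of j] by (auto simp: g_def intro!: power_mono)
    have "gauss_int (\<lambda>x. f m x * f m x) = gauss_int (\<lambda>x. g ((gauss_map ^^ m) x))" by (simp add: f_def g_def power2_eq_square)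
    also have "\<dots> = gauss_int g" by (intro gauss_int_invariant gm) (simp add: g_def)
    also have "\<dots> = gauss_int (gauss_op g)" using gauss_int_op[of g "(real j)\<^sup>2" "\<lambda>_. 1"] gm gb by simp
    also have "\<dots> \<le> gauss_int (\<lambda>_. log_square_sum)"
    proof (rule gauss_int_le[OF _ bounded_borel_const])
      show "bounded_borel (gauss_op g)"
        using gm gb gauss_op_bounds[of g "(real j)\<^sup>2"] by (intro bounded_borelI[of _ "(real j)\<^sup>2"]) auto
      show "gauss_op g x \<le> log_square_sum" if "x \<in> {0<..1}" for x
        unfolding g_def using gauss_op_log_trunc(1)[of x j] that by simp
    qed
    also have "\<dots> = log_square_sum * ln 2" by (rule gauss_int_const)
    also have "\<dots> \<le> log_square_sum * 1" using log_square_sum_nonneg ln_2_less_1 by (intro mult_left_mono) auto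
    finally have "gauss_int (\<lambda>x. f m x * f m x) \<le> log_square_sum" by simp
    moreover have "0 \<le> c\<^sup>2 * ln 2" by simp
    ultimately show ?thesis unfolding ZZ by linarith
  qed
  have geo: "(\<Sum>i<n. (1 / 2 :: real) ^ (n - i)) \<le> 1" for n
  proof (induction n)
    case (Suc n)
    have "(\<Sum>i<n. (1 / 2 :: real) ^ (Suc n - i)) = (\<Sum>i<n. 1 / 2 * (1 / 2) ^ (n - i))"
      by (intro sum.cong) (auto simp: Suc_diff_le)
    also have "\<dots> = 1 / 2 * (\<Sum>i<n. (1 / 2) ^ (n - i))" by (rule sum_distrib_left[symmetric])
    finally show ?case using Suc by simp
  qed simp
  have "gauss_int (\<lambda>x. (\<Sum>i<m. Z i x) * Z m x) = (\<Sum>i<m. gauss_int (\<lambda>x. Z i x * Z m x))"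
    unfolding sum_distrib_right by (rule gauss_int_sum) (intro bounded_borel_mult bZ)
  also have "\<dots> \<le> (\<Sum>i<m. 2 * (1 + log_square_sum)\<^sup>2 * (1 / 2) ^ (m - i))"
    unfolding ZZ f_def c_def by (intro sum_mono log_trunc_covariance) auto
  also have "\<dots> = 2 * (1 + log_square_sum)\<^sup>2 * (\<Sum>i<m. (1 / 2) ^ (m - i))" by (rule sum_distrib_left[symmetric])
  also have "\<dots> \<le> 2 * (1 + log_square_sum)\<^sup>2 * 1" by (intro mult_left_mono geo) auto
  finally have off: "gauss_int (\<lambda>x. (\<Sum>i<m. Z i x) * Z m x) \<le> 2 * (1 + log_square_sum)\<^sup>2" by simp
  have "gauss_int (\<lambda>x. (\<Sum>i<Suc m. Z i x)\<^sup>2) =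
     gauss_int (\<lambda>x. ((\<Sum>i<m. Z i x)\<^sup>2 + 2 * ((\<Sum>i<m. Z i x) * Z m x)) + Z m x * Z m x)"
    by (simp add: power2_eq_square algebra_simps)
  also have "\<dots> = gauss_int (\<lambda>x. (\<Sum>i<m. Z i x)\<^sup>2) + 2 * gauss_int (\<lambda>x. (\<Sum>i<m. Z i x) * Z m x) + gauss_int (\<lambda>x. Z m x * Z m x)"
    unfolding power2_eq_square using bS bZ
    by (simp add: gauss_int_plus bounded_borel_add bounded_borel_mult bounded_borel_cmult gauss_int_cmult)
  also have "\<dots> \<le> log_variance * real m + 2 * (2 * (1 + log_square_sum)\<^sup>2) + log_square_sum"
    using Suc off diag unfolding Z_def f_def c_def by linarith
  also have "\<dots> = log_variance * real (Suc m)" by (simp add: log_variance_def algebra_simps)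
  finally show ?case unfolding Z_def f_def c_def .
qed

text \<open>Chebyshev for the Gauss density; since \<open>1 / (1 + x) \<ge> 1 / 2\<close>, the
  return to Lebesgue measure costs the factor 2.\<close>

lemma log_trunc_deviation:
  fixes m j :: nat
  assumes "a > 0"
  defines "A \<equiv> {x \<in> {0..1}. a \<le> \<bar>\<Sum>i<m. log_trunc j ((gauss_map ^^ i) x) - log_mean j\<bar>}"
  shows "A \<in> sets unit_lebesgue" "unit.prob A \<le> 2 * log_variance * real m / a\<^sup>2"
proof -
  let ?S = "\<lambda>x. \<Sum>i<m. log_trunc j ((gauss_map ^^ i) x) - log_mean j"
  have Sm [measurable]: "?S \<in> borel_measurable borel" by measurable
  have "A \<in> sets borel" unfolding A_def by measurable
  then show A: "A \<in> sets unit_lebesgue" by (auto simp: sets_unit_lebesgue_iff A_def)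
  have bS: "bounded_borel ?S"
  proof (rule bounded_borel_sum)
    show "bounded_borel (\<lambda>x. log_trunc j ((gauss_map ^^ i) x) - log_mean j)" for i
      by (rule bounded_borel_diff[OF bounded_borel_iterate[OF bounded_borel_log_trunc] bounded_borel_const])
  qed
  have "gauss_int (indicator A) \<le> gauss_int (\<lambda>x. 1 / a\<^sup>2 * (?S x * ?S x))"
  proof (rule gauss_int_le)
    show "bounded_borel (indicator A)" using \<open>A \<in> sets borel\<close> by (intro bounded_borelI[of _ 1]) (auto simp: indicator_def)
    show "bounded_borel (\<lambda>x. 1 / a\<^sup>2 * (?S x * ?S x))" using bS by (intro bounded_borel_cmult bounded_borel_mult)
    show "indicator A x \<le> 1 / a\<^sup>2 * (?S x * ?S x)" for x
    proof (cases "x \<in> A")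
      case True
      then have "a \<le> \<bar>?S x\<bar>" by (simp add: A_def)
      then have "a\<^sup>2 \<le> \<bar>?S x\<bar>\<^sup>2" using \<open>a > 0\<close> by (intro power_mono) auto
      then have "a\<^sup>2 \<le> ?S x * ?S x" by (simp add: power2_eq_square)
      then show ?thesis using True \<open>a > 0\<close> by (simp add: field_simps)
    qed simp
  qed
  also have "\<dots> = 1 / a\<^sup>2 * gauss_int (\<lambda>x. (?S x)\<^sup>2)" by (simp only: gauss_int_cmult power2_eq_square)
  also have "\<dots> \<le> 1 / a\<^sup>2 * (log_variance * real m)" by (intro mult_left_mono log_trunc_second_moment) auto
  finally show "unit.prob A \<le> 2 * log_variance * real m / a\<^sup>2" using prob_le_gauss_int[OF A] by simp
qed

lemma prob_iterate_small:
  assumes "0 \<le> e"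
  shows "{x \<in> {0..1}. (gauss_map ^^ i) x < e} \<in> sets unit_lebesgue" "unit.prob {x \<in> {0..1}. (gauss_map ^^ i) x < e} \<le> 2 * e"
proof -
  let ?A = "{x \<in> {0..1}. (gauss_map ^^ i) x < e}"
  have Ab: "?A \<in> sets borel" by measurable
  then show A: "?A \<in> sets unit_lebesgue" by (auto simp: sets_unit_lebesgue_iff)
  have "gauss_int (indicator ?A) = gauss_int (\<lambda>x. indicator {0..<e} ((gauss_map ^^ i) x))"
    using gauss.iterate_X[of _ i] by (intro gauss_int_cong) (use Ab in \<open>auto simp: indicator_def less_imp_le\<close>)
  also have "\<dots> = gauss_int (indicator {0..<e})" by (rule gauss_int_invariant) (auto simp: indicator_def)
  also have "\<dots> \<le> e"
  proof (cases "e \<le> 1")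
    case True
    have "gauss_int (indicator {0..<e}) \<le> (\<integral>x. indicator {0..<e} x \<partial>unit_lebesgue)"
      unfolding gauss_int_def
    proof (rule gauss.integral_mono_X)
      show "integrable unit_lebesgue (\<lambda>x. indicat_real {0..<e} x / (1 + x))"
        by (intro gauss_integrable[where B = 1]) (auto simp: indicator_def)
      show "integrable unit_lebesgue (indicat_real {0..<e})"
        using True by (intro integrable_indicator_unit_lebesgue) (auto simp: sets_unit_lebesgue_iff)
      show "indicat_real {0..<e} x / (1 + x) \<le> indicat_real {0..<e} x" if "x \<in> {0<..1}" for x
        using that by (auto simp: indicator_def field_simps)
    qed
    also have "\<dots> = unit.prob {0..<e}"
    proof -
      have "{0..1} \<inter> {0..<e} = {0..<e}" using True by auto
      then show ?thesis by (simp add: Int_commute)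
    qed
    also have "\<dots> = e" using True assms by (subst measure_unit_lebesgue) auto
    finally show ?thesis .
  next
    case False
    have "gauss_int (indicator {0..<e}) \<le> gauss_int (\<lambda>_. 1)"
      by (intro gauss_int_le bounded_borel_const bounded_borelI[of _ 1]) (auto simp: indicator_def)
    then show ?thesis using False ln_2_less_1 by (simp add: gauss_int_one)
  qed
  finally show "unit.prob ?A \<le> 2 * e" using prob_le_gauss_int[OF A] by simp
qed

text \<open>The reciprocal of its square is the modulus of the derivative of the \<open>m\<close>-th
  iterate of the Gauss map, so the square has the order of the cylinder length.\<close>

definition orbit_product :: "nat \<Rightarrow> real \<Rightarrow> real" where
  "orbit_product m x = (\<Prod>i<m. (gauss_map ^^ i) x)"

lemma orbit_product_pos: "x \<in> {0<..1} \<Longrightarrow> 0 < orbit_product m x"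
  unfolding orbit_product_def using gauss.iterate_X by (intro prod_pos) auto

text \<open>The truncation level is chosen last, depending on \<open>m\<close> and \<open>a\<close>:
  so high that the truncated mean shifts the sum by at most \<open>a / 2\<close>, and that the
  probability of one of the first \<open>m\<close> orbit points falling below
  \<open>exp (- j)\<close> is at most \<open>m / a\<^sup>2\<close>. Outside these events the
  truncated and the true logarithms agree.\<close>

lemma orbit_product_concentration:
  assumes lim: "log_mean \<longlonglongrightarrow> \<kappa>" and a: "a > 0"
  shows "\<exists>S\<in>sets unit_lebesgue. unit.prob S \<le> (8 * log_variance + 1) * (real m / a\<^sup>2) \<and>
     (\<forall>x\<in>{0<..1} - S. \<bar>ln (orbit_product m x) + \<kappa> * real m\<bar> \<le> a)"
proof -
  have ev1: "eventually (\<lambda>j. \<bar>log_mean j - \<kappa>\<bar> < a / (2 * (real m + 1))) sequentially"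
    using tendstoD[OF lim, of "a / (2 * (real m + 1))"] a by (simp add: dist_real_def)
  have "(\<lambda>j. exp (- real j)) \<longlonglongrightarrow> 0" by real_asymp
  then have ev2: "eventually (\<lambda>j. exp (- real j) < 1 / (2 * a\<^sup>2)) sequentially"
    using a by (intro order_tendstoD) auto
  obtain j where j: "\<bar>log_mean j - \<kappa>\<bar> < a / (2 * (real m + 1))" "exp (- real j) < 1 / (2 * a\<^sup>2)"
    using eventually_happens[OF eventually_conj[OF ev1 ev2]] by auto
  define A where "A = {x \<in> {0..1}. a / 2 \<le> \<bar>\<Sum>i<m. log_trunc j ((gauss_map ^^ i) x) - log_mean j\<bar>}"
  define B where "B i = {x \<in> {0..1}. (gauss_map ^^ i) x < exp (- real j)}" for i
  have A: "A \<in> sets unit_lebesgue" "unit.prob A \<le> 2 * log_variance * real m / (a / 2)\<^sup>2"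
    using log_trunc_deviation[where a = "a / 2" and m = m and j = j] a unfolding A_def by auto
  have B: "B i \<in> sets unit_lebesgue" "unit.prob (B i) \<le> 2 * exp (- real j)" for i
    using prob_iterate_small[of "exp (- real j)" i] unfolding B_def by auto
  have UB: "(\<Union>i<m. B i) \<in> sets unit_lebesgue" using B by auto
  have "unit.prob (A \<union> (\<Union>i<m. B i)) \<le> unit.prob A + unit.prob (\<Union>i<m. B i)"
    using A UB by (intro measure_Un_le) auto
  also have "unit.prob (\<Union>i<m. B i) \<le> (\<Sum>i<m. unit.prob (B i))" using B by (intro measure_UNION_le) auto
  also have "\<dots> \<le> (\<Sum>i<m. 2 * exp (- real j))" using B by (intro sum_mono) auto
  also have "\<dots> = real m * (2 * exp (- real j))" by simp
  also have "\<dots> \<le> real m * (1 / a\<^sup>2)" using j(2) by (intro mult_left_mono) auto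
  also have "unit.prob A + real m * (1 / a\<^sup>2) \<le> 2 * log_variance * real m / (a / 2)\<^sup>2 + real m * (1 / a\<^sup>2)" using A by simp
  also have "\<dots> = (8 * log_variance + 1) * (real m / a\<^sup>2)" using a by (simp add: power_divide field_simps)
  finally have P: "unit.prob (A \<union> (\<Union>i<m. B i)) \<le> (8 * log_variance + 1) * (real m / a\<^sup>2)" by simp
  have "\<bar>ln (orbit_product m x) + \<kappa> * real m\<bar> \<le> a" if x: "x \<in> {0<..1}" "x \<notin> A \<union> (\<Union>i<m. B i)" for x
  proof -
    have x01: "x \<in> {0..1}" using x by auto
    have it: "(gauss_map ^^ i) x \<in> {0<..1}" for i using gauss.iterate_X[OF x(1)] .
    have "log_trunc j ((gauss_map ^^ i) x) = - ln ((gauss_map ^^ i) x)" if i: "i < m" for i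
    proof -
      have "exp (- real j) \<le> (gauss_map ^^ i) x" using x x01 i by (force simp: B_def)
      then have "- real j \<le> ln ((gauss_map ^^ i) x)" using it[of i] by (simp add: ln_ge_iff)
      then show ?thesis by (simp add: log_trunc_def)
    qed
    then have "(\<Sum>i<m. log_trunc j ((gauss_map ^^ i) x) - log_mean j) = - (\<Sum>i<m. ln ((gauss_map ^^ i) x)) - real m * log_mean j"
      by (simp add: sum_subtractf sum_negf)
    also have "(\<Sum>i<m. ln ((gauss_map ^^ i) x)) = ln (orbit_product m x)"
    proof -
      have "(gauss_map ^^ i) x \<noteq> 0" for i using it[of i] by auto
      then show ?thesis unfolding orbit_product_def by (intro ln_prod[symmetric]) auto
    qed
    finally have "\<bar>- ln (orbit_product m x) - real m * log_mean j\<bar> < a / 2" using x x01 by (auto simp: A_def)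
    moreover have "\<bar>real m * (log_mean j - \<kappa>)\<bar> \<le> a / 2"
    proof -
      have "\<bar>real m * (log_mean j - \<kappa>)\<bar> = real m * \<bar>log_mean j - \<kappa>\<bar>" by (simp add: abs_mult)
      also have "\<dots> \<le> (real m + 1) * (a / (2 * (real m + 1)))" using j(1) by (intro mult_mono) auto
      also have "\<dots> = a / 2"
      proof -
        have "t * (a / (2 * t)) = a / 2" if "t > 0" for t using that by simp
        then show ?thesis using of_nat_0_le_iff[of m] by (metis add_pos_nonneg add.commute zero_less_one)
      qed
      finally show ?thesis .
    qed
    moreover have "real m * (log_mean j - \<kappa>) = real m * log_mean j - \<kappa> * real m" by (simp add: algebra_simps)
    ultimately show ?thesis by linarith
  qed
  then show ?thesis using P A UB by (intro bexI[of _ "A \<union> (\<Union>i<m. B i)"]) auto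
qed

section \<open>Entropy and digits of continued fractions\<close>

lemma gauss_map_irrational: "x \<notin> \<rat> \<Longrightarrow> gauss_map x \<notin> \<rat>"
proof
  assume x: "x \<notin> \<rat>" and "gauss_map x \<in> \<rat>"
  then have "gauss_map x + of_int \<lceil>1 / x\<rceil> - 1 \<in> \<rat>" by simp
  then have "1 / x \<in> \<rat>" by (simp add: gauss_map_def)
  then have "1 / (1 / x) \<in> \<rat>" by (rule Rats_divide[OF Rats_1])
  then show False using x by simp
qed

lemma gauss_iterate_irrational: "x \<notin> \<rat> \<Longrightarrow> (gauss_map ^^ n) x \<notin> \<rat>"
proof (induction n)
  case (Suc n)
  then show ?case using gauss_map_irrational[of "(gauss_map ^^ n) x"] by simp
qed simp

lemma gauss_digit_one: "gauss_digit 1 = 0"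
  by (simp add: gauss_digit_def)

text \<open>The orbit stays away from the fixed point 1, the only point of \<open>(0, 1]\<close>
  with digit 0, before time \<open>m\<close>. Up to then \<open>x\<close> is the image of its
  successor under a genuine branch.\<close>

definition regular :: "nat \<Rightarrow> real \<Rightarrow> bool" where
  "regular m x \<longleftrightarrow> x \<in> {0<..1} \<and> (\<forall>i<m. gauss_digit ((gauss_map ^^ i) x) \<ge> 1)"

lemma regular_Suc: "regular (Suc m) x \<Longrightarrow> regular m x"
  by (auto simp: regular_def)

lemma irrational_regular:
  assumes "x \<in> {0<..1}" "x \<notin> \<rat>" shows "regular m x"
  unfolding regular_def
proof (intro conjI allI impI assms(1))
  fix i
  have "(gauss_map ^^ i) x \<in> {0<..1}" "(gauss_map ^^ i) x \<notin> \<rat>"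
    using gauss.iterate_X[OF assms(1)] gauss_iterate_irrational[OF assms(2)] by auto
  moreover from this(2) have "(gauss_map ^^ i) x \<noteq> 1" by auto
  ultimately show "gauss_digit ((gauss_map ^^ i) x) \<ge> 1" by (intro gauss_branch_of) auto
qed

lemma gauss_branch_of_digit:
  assumes "x \<in> {0<..1}" "gauss_digit x \<ge> 1"
  shows "x * (real (gauss_digit x) + gauss_map x) = 1"
proof -
  have "x \<noteq> 1" using assms(2) gauss_digit_one by auto
  then have "gauss_branch (gauss_digit x) (gauss_map x) = x" using assms by (intro gauss_branch_of) auto
  then have "x = 1 / (real (gauss_digit x) + gauss_map x)" by (simp add: gauss_branch_def)
  moreover have "real (gauss_digit x) + gauss_map x > 0" using gauss_map_range[of x] by (intro add_nonneg_pos) auto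
  ultimately show ?thesis by (metis divide_self_if less_irrefl times_divide_eq_left mult_1)
qed

lemma cylinder_Suc:
  "y \<in> gauss.cylinder (Suc m) x \<longleftrightarrow> y \<in> gauss.cylinder m x \<and> gauss_digit ((gauss_map ^^ m) y) = gauss_digit ((gauss_map ^^ m) x)"
  by (auto simp: gauss.cylinder_def gauss.word_Suc_end)

lemma cylinder_step:
  assumes "regular (Suc m) x" "y \<in> gauss.cylinder (Suc m) x"
  shows "(gauss_map ^^ m) y * (real (gauss_digit ((gauss_map ^^ m) x)) + (gauss_map ^^ Suc m) y) = 1"
proof -
  have y: "y \<in> {0<..1}" and d: "gauss_digit ((gauss_map ^^ m) y) = gauss_digit ((gauss_map ^^ m) x)"
    using assms(2) unfolding cylinder_Suc by (auto simp: gauss.cylinder_def)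
  have "gauss_digit ((gauss_map ^^ m) x) \<ge> 1" using assms(1) by (auto simp: regular_def)
  then show ?thesis using gauss_branch_of_digit[OF gauss.iterate_X[OF y, of m]] d by simp
qed

lemma orbit_product_Suc: "orbit_product (Suc m) y = orbit_product m y * (gauss_map ^^ m) y"
  by (simp add: orbit_product_def)

text \<open>\<open>a\<close> and \<open>b\<close> are the denominators of two successive
  convergents, which depend only on the digits; the step is their recursion,
  \<open>a * k + b\<close> becoming the new \<open>a\<close> and \<open>a\<close> the new
  \<open>b\<close>.\<close>

lemma orbit_product_moebius:
  "regular m x \<Longrightarrow> \<exists>a b. 0 < a \<and> 0 \<le> b \<and> b \<le> a \<and>
     (\<forall>y\<in>gauss.cylinder m x. orbit_product m y * (a + b * (gauss_map ^^ m) y) = 1)"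
proof (induction m)
  case 0
  show ?case by (rule exI[of _ 1], rule exI[of _ 0]) (simp add: orbit_product_def)
next
  case (Suc m)
  obtain a b where ab: "0 < a" "0 \<le> b" "b \<le> a"
      "\<And>y. y \<in> gauss.cylinder m x \<Longrightarrow> orbit_product m y * (a + b * (gauss_map ^^ m) y) = 1"
    using Suc.IH[OF regular_Suc[OF Suc.prems]] by blast
  define k where "k = real (gauss_digit ((gauss_map ^^ m) x))"
  have k: "k \<ge> 1" using Suc.prems by (auto simp: k_def regular_def)
  have "orbit_product (Suc m) y * ((a * k + b) + a * (gauss_map ^^ Suc m) y) = 1" if y: "y \<in> gauss.cylinder (Suc m) x" for y
  proof -
    define u where "u = (gauss_map ^^ m) y"
    define v where "v = (gauss_map ^^ Suc m) y"
    have uv: "u * (k + v) = 1" using cylinder_step[OF Suc.prems y] by (simp only: u_def v_def k_def)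
    have "orbit_product (Suc m) y * ((a * k + b) + a * v) = orbit_product m y * (a * (u * (k + v)) + b * u)"
      by (simp add: orbit_product_Suc u_def algebra_simps)
    also have "\<dots> = 1" using ab(4)[of y] y unfolding uv cylinder_Suc by (simp add: u_def)
    finally show ?thesis by (simp add: v_def)
  qed
  moreover have "a * 1 \<le> a * k" using ab(1) k by (intro mult_left_mono) auto
  then have "a \<le> a * k + b" using ab(2) by linarith
  moreover from this have "0 < a * k + b" using ab(1) by linarith
  ultimately have "0 < a * k + b \<and> 0 \<le> a \<and> a \<le> a * k + b \<and>
     (\<forall>y\<in>gauss.cylinder (Suc m) x. orbit_product (Suc m) y * (a * k + b + a * (gauss_map ^^ Suc m) y) = 1)"
    using ab(1) by (simp del: funpow.simps)
  then show ?case by blast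
qed

text \<open>Bounded distortion: as \<open>0 \<le> b \<le> a\<close>, the quantity
  \<open>a + b * t\<close> stays between \<open>a\<close> and \<open>2 * a\<close> for all
  \<open>t\<close> in the unit interval.\<close>

lemma orbit_product_ratio:
  assumes "regular m x" "y \<in> gauss.cylinder m x" "z \<in> gauss.cylinder m x"
  shows "orbit_product m y \<le> 2 * orbit_product m z"
proof -
  obtain a b where ab: "0 < a" "0 \<le> b" "b \<le> a"
      "\<And>y. y \<in> gauss.cylinder m x \<Longrightarrow> orbit_product m y * (a + b * (gauss_map ^^ m) y) = 1"
    using orbit_product_moebius[OF assms(1)] by blast
  have yz: "y \<in> {0<..1}" "z \<in> {0<..1}" using assms by (auto simp: gauss.cylinder_def)
  define s where "s = (gauss_map ^^ m) y"
  define t where "t = (gauss_map ^^ m) z"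
  have st: "0 < s" "0 < t" "t \<le> 1" using gauss.iterate_X[OF yz(1), of m] gauss.iterate_X[OF yz(2), of m] by (auto simp: s_def t_def)
  have p: "0 < orbit_product m y" "0 < orbit_product m z" using orbit_product_pos yz by auto
  have "b * t \<le> a" using ab st mult_mono[of b a t 1] by simp
  moreover have "0 \<le> b * s" using ab st by simp
  ultimately have "a + b * t \<le> 2 * (a + b * s)" using ab(1) unfolding distrib_left by linarith
  have "orbit_product m y = orbit_product m y * (orbit_product m z * (a + b * t))"
    using ab(4)[OF assms(3)] by (simp add: t_def)
  also have "\<dots> \<le> orbit_product m y * (orbit_product m z * (2 * (a + b * s)))"
    using p \<open>a + b * t \<le> 2 * (a + b * s)\<close> by (intro mult_left_mono) auto
  also have "\<dots> = 2 * orbit_product m z * (orbit_product m y * (a + b * s))" by simp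
  also have "\<dots> = 2 * orbit_product m z" using ab(4)[OF assms(2)] by (simp add: s_def)
  finally show ?thesis .
qed

text \<open>For a common digit \<open>k\<close> the relation \<open>u = 1 / (k + v)\<close> gives
  the exact identity that the difference of two values \<open>u\<close> is their product times the
  difference of the values \<open>v\<close>; iterating multiplies these factors up.\<close>

lemma cylinder_distance:
  "regular m x \<Longrightarrow> y \<in> gauss.cylinder m x \<Longrightarrow> z \<in> gauss.cylinder m x \<Longrightarrow>
    \<bar>y - z\<bar> = orbit_product m y * orbit_product m z * \<bar>(gauss_map ^^ m) y - (gauss_map ^^ m) z\<bar>"
proof (induction m)
  case 0
  then show ?case by (simp add: orbit_product_def)
next
  case (Suc m)
  define u where "u = (gauss_map ^^ m) y"
  define u' where "u' = (gauss_map ^^ m) z"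
  define v where "v = (gauss_map ^^ Suc m) y"
  define v' where "v' = (gauss_map ^^ Suc m) z"
  define k where "k = real (gauss_digit ((gauss_map ^^ m) x))"
  have uv: "u * (k + v) = 1" "u' * (k + v') = 1"
    using cylinder_step[OF Suc.prems(1,2)] cylinder_step[OF Suc.prems(1,3)] by (simp_all only: u_def v_def u'_def v'_def k_def)
  have yz: "y \<in> {0<..1}" "z \<in> {0<..1}" using Suc.prems by (auto simp: gauss.cylinder_def)
  have pos: "0 < u" "0 < u'" using gauss.iterate_X[OF yz(1), of m] gauss.iterate_X[OF yz(2), of m] by (auto simp: u_def u'_def)
  have "u - u' = u * (u' * (k + v')) - u' * (u * (k + v))" by (simp add: uv)
  also have "\<dots> = u * u' * (v' - v)" by (simp add: algebra_simps)
  finally have "\<bar>u - u'\<bar> = u * u' * \<bar>v - v'\<bar>" using pos by (simp add: abs_mult abs_minus_commute)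
  moreover have "\<bar>y - z\<bar> = orbit_product m y * orbit_product m z * \<bar>u - u'\<bar>"
    using Suc unfolding u_def u'_def cylinder_Suc by (auto intro: regular_Suc)
  ultimately show ?case unfolding v_def[symmetric] v'_def[symmetric] by (simp add: orbit_product_Suc u_def u'_def)
qed

text \<open>Every branch of the Gauss map is complete, so preimages can be chosen digit by
  digit.\<close>

lemma cylinder_point:
  "regular m x \<Longrightarrow> 0 < v \<Longrightarrow> v \<le> 1 \<Longrightarrow> \<exists>y\<in>gauss.cylinder m x. (gauss_map ^^ m) y = v"
proof (induction m arbitrary: x)
  case 0
  then show ?case by (intro bexI[of _ v]) (auto simp: gauss.cylinder_def)
next
  case (Suc m)
  have k: "gauss_digit x \<ge> 1" using Suc.prems by (auto simp: regular_def)
  have "gauss_digit ((gauss_map ^^ i) (gauss_map x)) \<ge> 1" if "i < m" for i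
  proof -
    have "gauss_digit ((gauss_map ^^ Suc i) x) \<ge> 1" using Suc.prems(1) that unfolding regular_def by blast
    then show ?thesis by (simp add: funpow_swap1)
  qed
  then have "regular m (gauss_map x)" using gauss_map_range[of x] by (auto simp: regular_def)
  from Suc.IH[OF this Suc.prems(2,3)] obtain y where y: "y \<in> gauss.cylinder m (gauss_map x)" "(gauss_map ^^ m) y = v" by blast
  have y01: "0 < y" "y \<le> 1" using y by (auto simp: gauss.cylinder_def)
  note b = gauss_branch_inverse[OF y01 k]
  have "gauss_branch (gauss_digit x) y \<in> gauss.cylinder (Suc m) x"
    using y b by (auto simp: gauss.cylinder_def gauss.word_Suc)
  moreover have "(gauss_map ^^ Suc m) (gauss_branch (gauss_digit x) y) = v"
    using b y by (simp add: funpow_Suc_right del: funpow.simps)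
  ultimately show ?case by blast
qed

text \<open>The exact distance formula together with bounded distortion: from above over the whole
  cylinder, from below for two well chosen points of it.\<close>

lemma prob_cylinder_bounds:
  assumes x: "regular m x"
  shows "unit.prob (gauss.cylinder m x) \<le> 4 * (orbit_product m x)\<^sup>2" "(orbit_product m x)\<^sup>2 / 8 \<le> unit.prob (gauss.cylinder m x)"
proof -
  have xX: "x \<in> {0<..1}" using x by (simp add: regular_def)
  have xc: "x \<in> gauss.cylinder m x" using xX by (simp add: gauss.cylinder_def)
  have p: "0 < orbit_product m y" if "y \<in> gauss.cylinder m x" for y
    using that by (intro orbit_product_pos) (simp add: gauss.cylinder_def)
  have X: "y \<in> {0<..1}" if "y \<in> gauss.cylinder m x" for y using that by (simp add: gauss.cylinder_def)
  define r where "r = 2 * (orbit_product m x)\<^sup>2"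
  have r: "0 < r" using p[OF xc] by (simp add: r_def)
  have cb: "gauss.cylinder m x \<in> sets borel" "gauss.cylinder m x \<subseteq> {0..1}"
    using gauss.sets_cylinder[of m x] by (auto simp: sets_unit_lebesgue_iff)
  have "gauss.cylinder m x \<subseteq> {x - r..x + r}"
  proof
    fix y assume y: "y \<in> gauss.cylinder m x"
    have "\<bar>y - x\<bar> = orbit_product m y * orbit_product m x * \<bar>(gauss_map ^^ m) y - (gauss_map ^^ m) x\<bar>"
      by (rule cylinder_distance[OF x y xc])
    also have "\<dots> \<le> orbit_product m y * orbit_product m x * 1"
      using gauss.iterate_X[OF X[OF y], of m] gauss.iterate_X[OF xX, of m] p[OF y] p[OF xc] by (intro mult_left_mono) auto
    also have "\<dots> \<le> 2 * orbit_product m x * orbit_product m x * 1"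
      using orbit_product_ratio[OF x y xc] p[OF xc] by (intro mult_right_mono) auto
    finally have "\<bar>y - x\<bar> \<le> r" by (simp add: r_def power2_eq_square)
    then show "y \<in> {x - r..x + r}" by auto
  qed
  then have "measure lborel (gauss.cylinder m x) \<le> measure lborel {x - r..x + r}"
    using cb r by (intro measure_mono_fmeasurable) (auto simp: fmeasurable_def)
  also have "\<dots> = 2 * r" using r by simp
  finally show "unit.prob (gauss.cylinder m x) \<le> 4 * (orbit_product m x)\<^sup>2"
    using cb by (simp add: measure_unit_lebesgue r_def)
  \<comment> \<open>Two points whose \<open>m\<close>-th iterates are 1 and \<open>1 / 2\<close>
    suffice, as 0 is never attained. Distortion costs a factor 2 for each of them and their distance
    another \<open>1 / 2\<close>, which makes the constant 8.\<close>
  obtain y where y: "y \<in> gauss.cylinder m x" "(gauss_map ^^ m) y = 1" using cylinder_point[OF x, of 1] by auto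
  obtain z where z: "z \<in> gauss.cylinder m x" "(gauss_map ^^ m) z = 1 / 2" using cylinder_point[OF x, of "1 / 2"] by auto
  have "(orbit_product m x)\<^sup>2 \<le> (2 * orbit_product m y) * (2 * orbit_product m z)"
    unfolding power2_eq_square using orbit_product_ratio[OF x xc] y z p[OF xc] p[OF y(1)] by (intro mult_mono) auto
  also have "\<dots> = 8 * \<bar>y - z\<bar>" using cylinder_distance[OF x y(1) z(1)] y z by simp
  finally have "(orbit_product m x)\<^sup>2 / 8 \<le> \<bar>y - z\<bar>" by simp
  also have "\<dots> = measure lborel {min y z..max y z}" by (cases "y \<le> z") auto
  also have "\<dots> = unit.prob {min y z..max y z}"
    using X[OF y(1)] X[OF z(1)] by (intro measure_unit_lebesgue[symmetric]) auto
  also have "\<dots> \<le> unit.prob (gauss.cylinder m x)"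
  proof (rule unit.finite_measure_mono[OF _ gauss.sets_cylinder])
    show "{min y z..max y z} \<subseteq> gauss.cylinder m x"
      using gauss.cylinder_convex[OF y(1) z(1)] gauss.cylinder_convex[OF z(1) y(1)] by (cases "y \<le> z") auto
  qed
  finally show "(orbit_product m x)\<^sup>2 / 8 \<le> unit.prob (gauss.cylinder m x)" .
qed

text \<open>Lengths are comparable to squares of orbit products, so the rate becomes
  \<open>2 * \<kappa>\<close> and the deviation is halved beforehand, which accounts for the factor
  4. The rationals join the exceptional set because the length bounds concern regular
  points.\<close>

lemma cylinder_length_concentration:
  assumes lim: "log_mean \<longlonglongrightarrow> \<kappa>" and a: "a > 0"
  shows "\<exists>S\<in>sets unit_lebesgue. unit.prob S \<le> 4 * (8 * log_variance + 1) * ((real m + 1) / a\<^sup>2) \<and>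
     (\<forall>x\<in>{0<..1} - S. unit.prob (gauss.cylinder m x) \<le> 4 * exp (a - 2 * \<kappa> * real m) \<and>
        exp (- a - 2 * \<kappa> * real m) / 8 \<le> unit.prob (gauss.cylinder m x))"
proof -
  obtain S where S: "S \<in> sets unit_lebesgue" "unit.prob S \<le> (8 * log_variance + 1) * (real m / (a / 2)\<^sup>2)"
     "\<And>x. x \<in> {0<..1} - S \<Longrightarrow> \<bar>ln (orbit_product m x) + \<kappa> * real m\<bar> \<le> a / 2"
    using orbit_product_concentration[OF lim, of "a / 2" m] a by auto
  define Q where "Q = \<rat> \<inter> {0..1::real}"
  have cQ: "countable Q" unfolding Q_def using countable_rat by (rule countable_Int1)
  have Q: "Q \<in> sets unit_lebesgue" "unit.prob Q = 0"
  proof -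
    have Qb: "Q \<in> sets borel" using cQ by (rule sets.countable[rotated]) simp
    then show "Q \<in> sets unit_lebesgue" by (auto simp: sets_unit_lebesgue_iff Q_def)
    have "unit.prob Q = measure lborel Q" by (rule measure_unit_lebesgue) (simp add: Q_def)
    also have "\<dots> = 0" using emeasure_lborel_countable[OF cQ] by (simp add: measure_def)
    finally show "unit.prob Q = 0" .
  qed
  have "unit.prob (S \<union> Q) \<le> unit.prob S + unit.prob Q" using S Q by (intro measure_Un_le) auto
  also have "\<dots> \<le> (8 * log_variance + 1) * (real m / (a / 2)\<^sup>2)" using S Q by simp
  also have "\<dots> = 4 * (8 * log_variance + 1) * (real m / a\<^sup>2)" by (simp add: power_divide)
  also have "\<dots> \<le> 4 * (8 * log_variance + 1) * ((real m + 1) / a\<^sup>2)"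
    using log_variance_pos by (intro mult_left_mono divide_right_mono) auto
  finally have P: "unit.prob (S \<union> Q) \<le> 4 * (8 * log_variance + 1) * ((real m + 1) / a\<^sup>2)" .
  have "unit.prob (gauss.cylinder m x) \<le> 4 * exp (a - 2 * \<kappa> * real m) \<and>
        exp (- a - 2 * \<kappa> * real m) / 8 \<le> unit.prob (gauss.cylinder m x)" if x: "x \<in> {0<..1} - (S \<union> Q)" for x
  proof -
    have "x \<notin> \<rat>" using x by (auto simp: Q_def)
    then have reg: "regular m x" using x by (intro irrational_regular) auto
    have pos: "0 < orbit_product m x" using x by (intro orbit_product_pos) auto
    define L where "L = ln (orbit_product m x)"
    have sq: "(orbit_product m x)\<^sup>2 = exp (2 * L)"
      using pos by (simp add: L_def exp_double)
    have L: "\<bar>L + \<kappa> * real m\<bar> \<le> a / 2" using S(3)[of x] x by (simp add: L_def)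
    have "2 * L \<le> a - 2 * \<kappa> * real m" "- a - 2 * \<kappa> * real m \<le> 2 * L"
      using L unfolding mult.assoc by linarith+
    then have "exp (2 * L) \<le> exp (a - 2 * \<kappa> * real m)" "exp (- a - 2 * \<kappa> * real m) \<le> exp (2 * L)"
      by (simp_all only: exp_le_cancel_iff)
    then show ?thesis using prob_cylinder_bounds[OF reg] unfolding sq by linarith
  qed
  then show ?thesis using P S Q by (intro bexI[of _ "S \<union> Q"]) auto
qed

theorem gauss_quasi_mixing:
  assumes lim: "log_mean \<longlonglongrightarrow> \<kappa>"
  shows "\<exists>C \<theta>. 0 < \<theta> \<and> \<theta> < 1 \<and> 0 \<le> C \<and>
     quasi_mixing C \<theta> (2 * \<kappa>) (\<lambda>n. {x \<in> {0..1}. R (gauss.word r ((gauss_map ^^ n) x))})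
       (gauss_int (indicator {x. R (gauss.word r x)}) / ln 2)"
proof -
  define p where "p = gauss_int (indicator {x. R (gauss.word r x)}) / ln 2"
  define K where "K = 4 * (8 * log_variance + 1)"
  define C1 where "C1 = K + 4"
  \<comment> \<open>The event at time \<open>n\<close> depends on \<open>n + r\<close> digits. The
    exponential pays for the \<open>r\<close> further digits in the number of breaks, and
    \<open>r + 1\<close> comes from \<open>n + r + 1 \<le> (r + 1) * (n + 1)\<close> in the
    exceptional probability.\<close>
  define C2 where "C2 = 16 * exp \<bar>2 * \<kappa> * real r\<bar> + K * (real r + 1)"
  have K0: "0 < K" using log_variance_pos by (simp add: K_def)
  have A: "{x. R (gauss.word r x)} \<in> sets borel" by measurable
  have "quasi_mixing (2 * C1 + 12 + C2) (1 / 2) (2 * \<kappa>) (\<lambda>n. {x \<in> {0..1}. R (gauss.word r ((gauss_map ^^ n) x))}) p"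
  proof (rule gauss.quasi_mixing_word[where K = gauss_cone and B = 4])
    show "gauss_cone ((gauss.transfer ^^ m) (\<lambda>x. of_bool (R (gauss.word m x))))" for m R by (rule gauss_cone_word)
    show "(gauss.transfer ^^ m) (\<lambda>x. of_bool (R (gauss.word m x))) x \<le> 4" if "x \<in> {0<..1}" for m R x
      by (rule gauss_transfer_word_le[OF that])
    show "\<bar>(\<integral>x. f x * indicator {x. R (gauss.word r x)} ((gauss_map ^^ n) x) \<partial>unit_lebesgue) - (\<integral>x. f x \<partial>unit_lebesgue) * p\<bar>
         \<le> 12 * (1 / 2) ^ n"
      if "gauss_cone f" "\<And>x. x \<in> {0<..1} \<Longrightarrow> 0 \<le> f x \<and> f x \<le> 4" for f n
      unfolding p_def using that by (intro gauss_cone_mixing A) auto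
    have ib: "bounded_borel (indicator {x. R (gauss.word r x)})" using A by (intro bounded_borelI[of _ 1]) (auto simp: indicator_def)
    have "gauss_int (\<lambda>_. 0) \<le> gauss_int (indicator {x. R (gauss.word r x)})"
      by (intro gauss_int_le bounded_borel_const ib) auto
    then show "0 \<le> p" by (simp add: p_def gauss_int_const)
    have "gauss_int (indicator {x. R (gauss.word r x)}) \<le> gauss_int (\<lambda>_. 1)"
      by (intro gauss_int_le bounded_borel_const ib) (auto simp: indicator_def)
    then show "p \<le> 1" by (simp add: p_def gauss_int_one)
    show "(0::real) \<le> 12" "(0::real) < 1 / 2" "0 \<le> C1" "0 \<le> C2" using K0 by (auto simp: C1_def C2_def)
    show "\<exists>S\<in>sets unit_lebesgue. unit.prob S \<le> C1 * ((real m + 1) / a\<^sup>2) \<and>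
       (\<forall>x\<in>{0<..1} - S. unit.prob (gauss.cylinder m x) \<le> C1 * exp (a - 2 * \<kappa> * real m))" if a: "0 < a" for m a
    proof -
      obtain S where S: "S \<in> sets unit_lebesgue" "unit.prob S \<le> K * ((real m + 1) / a\<^sup>2)"
        "\<And>x. x \<in> {0<..1} - S \<Longrightarrow> unit.prob (gauss.cylinder m x) \<le> 4 * exp (a - 2 * \<kappa> * real m)"
        using cylinder_length_concentration[OF lim a, of m] unfolding K_def by blast
      have "K * ((real m + 1) / a\<^sup>2) \<le> C1 * ((real m + 1) / a\<^sup>2)" "4 * exp (a - 2 * \<kappa> * real m) \<le> C1 * exp (a - 2 * \<kappa> * real m)"
        using K0 by (auto simp: C1_def intro!: divide_right_mono)
      then show ?thesis using S by (meson order_trans)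
    qed
    show "\<exists>S F. S \<in> sets unit_lebesgue \<and> breaks S F \<and> real (card F) \<le> C2 * exp (2 * \<kappa> * real n + a) \<and>
        unit.prob (({x \<in> {0..1}. R (gauss.word r ((gauss_map ^^ n) x))} - S) \<union> (S - {x \<in> {0..1}. R (gauss.word r ((gauss_map ^^ n) x))}))
          \<le> C2 * ((real n + 1) / a\<^sup>2)" if a: "0 < a" for n a
    proof -
      define N where "N = n + r"
      define \<tau> where "\<tau> = exp (- a - 2 * \<kappa> * real N) / 8"
      have \<tau>: "0 < \<tau>" by (simp add: \<tau>_def)
      obtain S where S: "S \<in> sets unit_lebesgue" "unit.prob S \<le> K * ((real N + 1) / a\<^sup>2)"
        "\<And>x. x \<in> {0<..1} \<Longrightarrow> x \<notin> S \<Longrightarrow> \<tau> \<le> unit.prob (gauss.cylinder N x)"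
        using cylinder_length_concentration[OF lim a, of N] unfolding K_def \<tau>_def by blast
      have E: "{x \<in> {0..1}. R (gauss.word r ((gauss_map ^^ n) x))} = {x \<in> {0..1}. R (drop n (gauss.word N x))}"
        by (simp add: gauss.word_shift N_def)
      obtain S' F where S': "S' \<in> sets unit_lebesgue" "breaks S' F" "real (card F) \<le> 2 / \<tau>"
        "unit.prob (({x \<in> {0..1}. R (drop n (gauss.word N x))} - S') \<union> (S' - {x \<in> {0..1}. R (drop n (gauss.word N x))})) \<le> unit.prob S"
        using gauss.long_cylinders_breaks[OF S(1) \<tau> S(3), of "\<lambda>u. R (drop n u)"] by blast
      have "2 / \<tau> = 16 * exp (2 * \<kappa> * real r) * exp (2 * \<kappa> * real n + a)"
      proof -
        have "2 / \<tau> = 16 * exp (a + 2 * \<kappa> * real N)"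
        proof -
          have "exp (- a - 2 * \<kappa> * real N) * exp (a + 2 * \<kappa> * real N) = 1" unfolding exp_add[symmetric] by simp
          then show ?thesis unfolding \<tau>_def by (simp add: divide_eq_eq mult.commute)
        qed
        also have "a + 2 * \<kappa> * real N = 2 * \<kappa> * real r + (2 * \<kappa> * real n + a)" by (simp add: N_def algebra_simps)
        finally show ?thesis by (simp add: exp_add)
      qed
      also have "\<dots> \<le> C2 * exp (2 * \<kappa> * real n + a)"
      proof (rule mult_right_mono)
        have "exp (2 * \<kappa> * real r) \<le> exp \<bar>2 * \<kappa> * real r\<bar>" by simp
        moreover have "0 \<le> K * (real r + 1)" using K0 by simp
        ultimately show "16 * exp (2 * \<kappa> * real r) \<le> C2" unfolding C2_def by linarith
      qed simp
      finally have c: "real (card F) \<le> C2 * exp (2 * \<kappa> * real n + a)" using S'(3) by simp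
      have "K * ((real N + 1) / a\<^sup>2) \<le> K * ((real r + 1) * (real n + 1) / a\<^sup>2)"
        using K0 by (intro mult_left_mono divide_right_mono) (auto simp: N_def algebra_simps)
      also have "\<dots> = K * (real r + 1) * ((real n + 1) / a\<^sup>2)" by simp
      also have "\<dots> \<le> C2 * ((real n + 1) / a\<^sup>2)"
        unfolding C2_def by (intro mult_right_mono) auto
      finally have "unit.prob S \<le> C2 * ((real n + 1) / a\<^sup>2)" using S(2) by simp
      then show ?thesis unfolding E using S' c by (meson order_trans)
    qed
  qed
  moreover have "0 \<le> 2 * C1 + 12 + C2" using K0 by (simp add: C1_def C2_def)
  moreover have "0 < (1 / 2 :: real)" "(1 / 2 :: real) < 1" by simp_all
  ultimately show ?thesis unfolding p_def by blast
qed

section \<open>The value of the entropy\<close>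

lemma continuous_on_x_ln_x: "continuous_on {0..1} (\<lambda>x::real. x * ln x)"
  unfolding continuous_on_eq_continuous_within
proof
  fix x :: real assume x: "x \<in> {0..1}"
  show "continuous (at x within {0..1}) (\<lambda>x. x * ln x)"
  proof (cases "x = 0")
    case True
    have "((\<lambda>x::real. x * ln x) \<longlongrightarrow> 0) (at_right 0)" by real_asymp
    then show ?thesis unfolding continuous_within True by (simp add: at_within_Icc_at_right)
  next
    case False
    then show ?thesis using x by (intro continuous_intros) auto
  qed
qed

lemma nn_integral_log_power:
  "(\<integral>\<^sup>+x. ennreal (- ln x * x ^ k * (1 - x)) \<partial>unit_lebesgue) = ennreal (1 / (real k + 1)\<^sup>2 - 1 / (real k + 2)\<^sup>2)"
proof -
  \<comment> \<open>A primitive of \<open>- ln x * x ^ n\<close>. Grouping \<open>x * ln x\<close>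
    makes continuity at 0 evident, and the fundamental theorem then asks for the derivative in the
    interior only.\<close>
  define F where "F n x = x ^ Suc n / (real n + 1)\<^sup>2 - x ^ n * (x * ln x) / (real n + 1)" for n and x :: real
  have cF: "continuous_on {0..1} (F n)" for n
  proof -
    have "(real n + 1)\<^sup>2 \<noteq> 0" "real n + 1 \<noteq> 0" by (auto simp: add_eq_0_iff)
    then show ?thesis unfolding F_def[abs_def]
      by (intro continuous_on_diff continuous_on_divide continuous_on_mult[OF _ continuous_on_x_ln_x]
          continuous_on_power continuous_on_id continuous_on_const) simp_all
  qed
  have dF: "(F n has_real_derivative - ln x * x ^ n) (at x)" if x: "x \<in> {0<..<1}" for n x
  proof -
    have "(F n has_real_derivative real (Suc n) * x ^ n / (real n + 1)\<^sup>2 - ((real (Suc n) * x ^ n) * ln x + x ^ Suc n * (1 / x)) / (real n + 1)) (at x)"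
    proof -
      have eq: "F n = (\<lambda>x. x ^ Suc n / (real n + 1)\<^sup>2 - x ^ Suc n * ln x / (real n + 1))"
        by (rule ext) (simp add: F_def)
      have p: "((\<lambda>x. x ^ Suc n) has_real_derivative real (Suc n) * x ^ n) (at x)"
        using DERIV_pow[of "Suc n" x] by simp
      have l: "(ln has_real_derivative 1 / x) (at x)" using x by (auto intro!: derivative_eq_intros)
      show ?thesis unfolding eq
        using DERIV_diff[OF DERIV_cdivide[OF p, of "(real n + 1)\<^sup>2"] DERIV_cdivide[OF DERIV_mult[OF p l], of "real n + 1"]]
        by (simp add: mult_ac)
    qed
    moreover have "real (Suc n) * x ^ n / (real n + 1)\<^sup>2 - ((real (Suc n) * x ^ n) * ln x + x ^ Suc n * (1 / x)) / (real n + 1) = - ln x * x ^ n"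
    proof -
      define s where "s = real n + 1"
      have s: "s > 0" "real (Suc n) = s" by (simp_all add: s_def)
      have "x ^ Suc n * (1 / x) = x ^ n" using x by simp
      then show ?thesis unfolding s(2) s_def[symmetric] using s(1) by (simp add: add_divide_distrib power2_eq_square)
    qed
    ultimately show ?thesis by simp
  qed
  let ?f = "\<lambda>x::real. - ln x * x ^ k * (1 - x)"
  have "(?f has_integral ((F k 1 - F (Suc k) 1) - (F k 0 - F (Suc k) 0))) {0..1}"
  proof (rule fundamental_theorem_of_calculus_interior)
    show "continuous_on {0..1} (\<lambda>x. F k x - F (Suc k) x)" by (intro continuous_intros cF)
    show "((\<lambda>x. F k x - F (Suc k) x) has_vector_derivative ?f x) (at x)" if "x \<in> {0<..<1}" for x
      using DERIV_diff[OF dF[OF that, of k] dF[OF that, of "Suc k"]]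
      by (simp add: has_real_derivative_iff_has_vector_derivative[symmetric] algebra_simps)
  qed simp
  moreover have "(F k 1 - F (Suc k) 1) - (F k 0 - F (Suc k) 0) = 1 / (real k + 1)\<^sup>2 - 1 / (real k + 2)\<^sup>2"
    by (simp add: F_def add.commute)
  ultimately have "(?f has_integral (1 / (real k + 1)\<^sup>2 - 1 / (real k + 2)\<^sup>2)) {0..1}" by simp
  then have hi: "((\<lambda>x. if x \<in> {0..1} then ?f x else 0) has_integral (1 / (real k + 1)\<^sup>2 - 1 / (real k + 2)\<^sup>2)) UNIV"
    by (simp only: has_integral_restrict_UNIV)
  have "(\<integral>\<^sup>+x. ennreal (if x \<in> {0..1} then ?f x else 0) \<partial>lborel) = ennreal (1 / (real k + 1)\<^sup>2 - 1 / (real k + 2)\<^sup>2)"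
  proof (rule nn_integral_has_integral_lborel[OF _ _ hi])
    show "0 \<le> (if x \<in> {0..1} then ?f x else 0)" for x :: real
      by (cases "x = 0") (auto intro!: mult_nonneg_nonneg simp: mult_nonpos_nonneg)
  qed measurable
  moreover have "(\<integral>\<^sup>+x. ennreal (if x \<in> {0..1} then ?f x else 0) \<partial>lborel) = (\<integral>\<^sup>+x. ennreal (?f x) \<partial>unit_lebesgue)"
    unfolding nn_integral_unit_lebesgue by (intro nn_integral_cong) (auto simp: indicator_def)
  ultimately show ?thesis by simp
qed

text \<open>The sum of all inverse squares minus twice those of the even numbers, which make up a
  quarter of it.\<close>

lemma alternating_inverse_squares_sums:
  "(\<lambda>n. 1 / (real (2 * n) + 1)\<^sup>2 - 1 / (real (2 * n) + 2)\<^sup>2) sums (pi\<^sup>2 / 12)"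
proof -
  define f where "f n = 1 / (real n + 1)\<^sup>2" for n :: nat
  have f: "f sums (pi\<^sup>2 / 6)" unfolding f_def using inverse_squares_sums by (simp add: add.commute)
  have "(\<lambda>n. sum f {n * 2..<n * 2 + 2}) sums (pi\<^sup>2 / 6)" by (rule sums_group[OF f]) simp
  moreover have "sum f {n * 2..<n * 2 + 2} = f (2 * n) + f (2 * n + 1)" for n
    by (simp add: numeral_2_eq_2 mult.commute)
  ultimately have 1: "(\<lambda>n. f (2 * n) + f (2 * n + 1)) sums (pi\<^sup>2 / 6)" by simp
  have 2: "(\<lambda>n. 2 * f (2 * n + 1)) sums (pi\<^sup>2 / 12)"
  proof -
    have "2 * f (2 * n + 1) = 1 / 2 * f n" for n
    proof -
      have "real (2 * n + 1) + 1 = 2 * (real n + 1)" by simp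
      then show ?thesis unfolding f_def by (simp only: power_mult_distrib) simp
    qed
    then have "(\<lambda>n. 2 * f (2 * n + 1)) = (\<lambda>n. 1 / 2 * f n)" by (rule ext)
    moreover have "1 / 2 * (pi\<^sup>2 / 6) = pi\<^sup>2 / 12" by simp
    ultimately show ?thesis using sums_mult[OF f, of "1 / 2"] by (simp only:)
  qed
  have "(\<lambda>n. f (2 * n) + f (2 * n + 1) - 2 * f (2 * n + 1)) sums (pi\<^sup>2 / 6 - pi\<^sup>2 / 12)" by (rule sums_diff[OF 1 2])
  moreover have "f (2 * n) + f (2 * n + 1) - 2 * f (2 * n + 1) = 1 / (real (2 * n) + 1)\<^sup>2 - 1 / (real (2 * n) + 2)\<^sup>2" for n
    by (simp add: f_def add.assoc)
  ultimately show ?thesis by simp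
qed

text \<open>The geometric series of \<open>1 / (1 + x)\<close> alternates; taking two consecutive
  terms together gives \<open>x ^ (2 * n) * (1 - x)\<close>, which is nonnegative, so that sum and
  integral commute.\<close>

lemma nn_integral_log: "(\<integral>\<^sup>+x. ennreal (- ln x / (1 + x)) \<partial>unit_lebesgue) = ennreal (pi\<^sup>2 / 12)"
proof -
  let ?g = "\<lambda>n x. - ln x * x ^ (2 * n) * (1 - x :: real)"
  have "(\<integral>\<^sup>+x. ennreal (- ln x / (1 + x)) \<partial>unit_lebesgue) = (\<integral>\<^sup>+x. (\<Sum>n. ennreal (?g n x)) \<partial>unit_lebesgue)"
  proof (rule nn_integral_cong_AE, use gauss.AE_X in eventually_elim)
    fix x :: real assume x: "x \<in> {0<..1}"
    have "(\<lambda>n. ?g n x) sums (- ln x / (1 + x))"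
    proof (cases "x = 1")
      case False
      then have x1: "x\<^sup>2 < 1" using x by (simp add: power_less_one_iff abs_square_less_1)
      then have "(\<lambda>n. (x\<^sup>2) ^ n) sums (1 / (1 - x\<^sup>2))" by (intro geometric_sums) simp
      from sums_mult[OF this, of "- ln x * (1 - x)"]
      have "(\<lambda>n. - ln x * (1 - x) * (x\<^sup>2) ^ n) sums (- ln x * (1 - x) * (1 / (1 - x\<^sup>2)))" .
      moreover have "(1 - x) * (1 / (1 - x\<^sup>2)) = 1 / (1 + x)"
      proof -
        have "1 - x\<^sup>2 = (1 - x) * (1 + x)" by (simp add: power2_eq_square algebra_simps)
        then show ?thesis using False x by simp
      qed
      then have "- ln x * (1 - x) * (1 / (1 - x\<^sup>2)) = - ln x / (1 + x)" by (simp only: mult.assoc) simp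
      moreover have "(\<lambda>n. - ln x * (1 - x) * (x\<^sup>2) ^ n) = (\<lambda>n. ?g n x)"
        by (rule ext) (simp only: power_mult, simp only: mult_ac)
      ultimately show ?thesis by (simp only:)
    qed simp
    moreover have "0 \<le> ?g n x" for n using x by (intro mult_nonneg_nonneg) auto
    ultimately show "ennreal (- ln x / (1 + x)) = (\<Sum>n. ennreal (?g n x))"
      by (simp add: suminf_ennreal2 sums_iff)
  qed
  also have "\<dots> = (\<Sum>n. \<integral>\<^sup>+x. ennreal (?g n x) \<partial>unit_lebesgue)"
    by (intro nn_integral_suminf measurable_unit_lebesgue) measurable
  also have "\<dots> = (\<Sum>n. ennreal (1 / (real (2 * n) + 1)\<^sup>2 - 1 / (real (2 * n) + 2)\<^sup>2))"
    by (simp only: nn_integral_log_power)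
  also have "\<dots> = ennreal (pi\<^sup>2 / 12)"
  proof -
    have "0 \<le> 1 / (real (2 * n) + 1)\<^sup>2 - 1 / (real (2 * n) + 2)\<^sup>2" for n
      by (simp add: frac_le power_mono)
    from suminf_ennreal2[OF this sums_summable[OF alternating_inverse_squares_sums]] show ?thesis
      unfolding sums_unique[OF alternating_inverse_squares_sums, symmetric] .
  qed
  finally show ?thesis .
qed

text \<open>The limit is half the entropy, since cylinder lengths are comparable to squares of orbit
  products. The untruncated integrand dominates.\<close>

lemma log_mean_tendsto: "log_mean \<longlonglongrightarrow> pi\<^sup>2 / (12 * ln 2)"
proof -
  let ?h = "\<lambda>x::real. - ln x / (1 + x)"
  have hm: "?h \<in> borel_measurable unit_lebesgue" by (intro measurable_unit_lebesgue) measurable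
  have h0: "AE x in unit_lebesgue. 0 \<le> ?h x"
    using gauss.AE_X
  proof eventually_elim
    case (elim x)
    then have "0 \<le> - ln x" by simp
    then show ?case using elim by (intro divide_nonneg_pos) auto
  qed
  have hi: "integrable unit_lebesgue ?h"
    using nn_integral_log h0 hm by (intro integrableI_nonneg) auto
  have "ennreal (\<integral>x. ?h x \<partial>unit_lebesgue) = ennreal (pi\<^sup>2 / 12)"
    using nn_integral_eq_integral[OF hi h0] nn_integral_log by simp
  then have I: "(\<integral>x. ?h x \<partial>unit_lebesgue) = pi\<^sup>2 / 12"
    using integral_nonneg_AE[OF h0] by simp
  have "(\<lambda>j. \<integral>x. log_trunc j x / (1 + x) \<partial>unit_lebesgue) \<longlonglongrightarrow> (\<integral>x. ?h x \<partial>unit_lebesgue)"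
  proof (rule integral_dominated_convergence[where w = ?h])
    show "(\<lambda>x. log_trunc j x / (1 + x)) \<in> borel_measurable unit_lebesgue" for j
      by (intro measurable_unit_lebesgue) measurable
    show "AE x in unit_lebesgue. (\<lambda>j. log_trunc j x / (1 + x)) \<longlonglongrightarrow> ?h x"
    proof (rule AE_I2)
      fix x :: real
      have "eventually (\<lambda>j. log_trunc j x / (1 + x) = ?h x) sequentially"
        using eventually_ge_at_top[of "nat \<lceil>- ln x\<rceil>"]
      proof eventually_elim
        case (elim j)
        then have "- ln x \<le> real j" by linarith
        then show ?case by (simp add: log_trunc_def)
      qed
      then show "(\<lambda>j. log_trunc j x / (1 + x)) \<longlonglongrightarrow> ?h x" by (rule tendsto_eventually)
    qed
    show "AE x in unit_lebesgue. norm (log_trunc j x / (1 + x)) \<le> ?h x" for j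
      using gauss.AE_X
    proof eventually_elim
      case (elim x)
      then have "0 < 1 + x" by simp
      then show ?case using divide_right_mono[of "log_trunc j x" "- ln x" "1 + x"] log_trunc_bounds[OF elim, of j]
        by (simp only: real_norm_def abs_divide abs_of_nonneg abs_of_pos less_imp_le)
    qed
  qed (use hm hi in auto)
  then have "(\<lambda>j. gauss_int (log_trunc j) / ln 2) \<longlonglongrightarrow> pi\<^sup>2 / 12 / ln 2"
    unfolding gauss_int_def I by (intro tendsto_divide tendsto_const) auto
  then show ?thesis by (simp add: log_mean_def[abs_def])
qed

section \<open>Continued fraction digits as digits of the Gauss orbit\<close>

lemma finite_cfrac_bounds:
  "(\<And>c. c \<in> set cs \<Longrightarrow> c \<ge> 1) \<Longrightarrow> 0 \<le> finite_cfrac cs \<and> finite_cfrac cs \<le> 1"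
proof (induction cs)
  case (Cons c cs)
  then have "0 \<le> finite_cfrac cs" "1 \<le> real c" by auto
  then show ?case by (auto simp: divide_simps)
qed simp

lemma word_ge_1:
  assumes "x \<in> {0<..1}" "x \<notin> \<rat>" "c \<in> set (gauss.word n x)" shows "c \<ge> 1"
  using irrational_regular[OF assms(1,2), of n] assms(3) by (auto simp: gauss.word_def regular_def)

text \<open>One step multiplies the distance between the point and its convergent by the product of
  the two. For successive orbit points \<open>x * (c + y) = 1\<close> with
  \<open>c \<ge> 1 \<ge> y\<close> forces \<open>x * y \<le> 1 / 2\<close>, and the convergents
  contribute a factor at most 1, so two steps halve the distance.\<close>

lemma convergent_distance:
  assumes "x \<in> {0<..1}" "x \<notin> \<rat>"
  shows "\<bar>x - finite_cfrac (gauss.word n x)\<bar> \<le> (1 / 2) ^ (n div 2)"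
  using assms
proof (induction n arbitrary: x rule: less_induct)
  case (less n)
  have x1: "\<bar>x - F\<bar> \<le> 1" if "0 \<le> F \<and> F \<le> 1" for F using less.prems that by auto
  have b: "0 \<le> finite_cfrac (gauss.word k y) \<and> finite_cfrac (gauss.word k y) \<le> 1" if "y \<in> {0<..1}" "y \<notin> \<rat>" for k y
    using word_ge_1[OF that] by (intro finite_cfrac_bounds) auto
  show ?case
  proof (cases "n < 2")
    case True
    then show ?thesis using x1[OF b[OF less.prems]] by simp
  next
    case False
    then obtain k where n: "n = Suc (Suc k)" by (metis add_2_eq_Suc le_Suc_ex not_less)
    define y where "y = gauss_map x"
    define z where "z = gauss_map y"
    have y: "y \<in> {0<..1}" "y \<notin> \<rat>" using gauss.T_X[OF less.prems(1)] gauss_map_irrational[OF less.prems(2)] by (auto simp: y_def)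
    have z: "z \<in> {0<..1}" "z \<notin> \<rat>" using gauss.T_X[OF y(1)] gauss_map_irrational[OF y(2)] by (auto simp: z_def)
    define c where "c = real (gauss_digit x)"
    define c' where "c' = real (gauss_digit y)"
    have c: "c \<ge> 1" "c' \<ge> 1"
      using irrational_regular[OF less.prems, of 1] irrational_regular[OF y, of 1] by (auto simp: regular_def c_def c'_def)
    have xc: "x * (c + y) = 1" "y * (c' + z) = 1"
      using gauss_branch_of_digit[of x] gauss_branch_of_digit[of y] less.prems y c by (auto simp: c_def c'_def y_def z_def)
    define G where "G = finite_cfrac (gauss.word k z)"
    define F' where "F' = 1 / (c' + G)"
    define F where "F = 1 / (c + F')"
    have G: "0 \<le> G" "G \<le> 1" using b[OF z] by (auto simp: G_def)
    have F': "0 < F'" "F' \<le> 1" using G c by (auto simp: F'_def divide_simps)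
    have F: "0 < F" "F \<le> 1" using F' c by (auto simp: F_def divide_simps)
    have Fn: "finite_cfrac (gauss.word n x) = F"
      by (simp add: n gauss.word_Suc F_def F'_def G_def c_def c'_def y_def z_def)
    have nz: "c' + G \<noteq> 0" "c + F' \<noteq> 0" using G c F' by linarith+
    have "F' * (c' + G) = 1" using nz(1) by (simp add: F'_def)
    moreover have "F * (c + F') = 1" using nz(2) unfolding F_def by simp
    ultimately have e: "F' * (c' + G) = 1" "F * (c + F') = 1" by auto
    have "x - F = x * (F * (c + F')) - F * (x * (c + y))" by (simp add: e xc)
    also have "\<dots> = x * F * (F' - y)" by (simp add: algebra_simps)
    finally have 1: "\<bar>x - F\<bar> = x * F * \<bar>y - F'\<bar>" using less.prems F by (simp add: abs_mult abs_minus_commute)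
    have "y - F' = y * (F' * (c' + G)) - F' * (y * (c' + z))" by (simp add: e xc)
    also have "\<dots> = y * F' * (G - z)" by (simp add: algebra_simps)
    finally have 2: "\<bar>y - F'\<bar> = y * F' * \<bar>z - G\<bar>" using y F' by (simp add: abs_mult abs_minus_commute)
    have "x * y \<le> 1 / 2"
    proof -
      have "x * y \<le> x * c" using less.prems y c by (intro mult_left_mono) auto
      moreover have "x * c + x * y = 1" using xc by (simp add: distrib_left)
      ultimately show ?thesis by linarith
    qed
    moreover have "F * F' \<le> 1" using F F' by (intro mult_le_one) auto
    ultimately have "(x * y) * (F * F') \<le> 1 / 2 * 1" using less.prems y F F' by (intro mult_mono) auto
    then have "(x * y) * (F * F') * \<bar>z - G\<bar> \<le> 1 / 2 * (1 / 2) ^ (k div 2)"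
      using less.IH[of k z] z n unfolding G_def by (intro mult_mono) auto
    moreover have "\<bar>x - F\<bar> = (x * y) * (F * F') * \<bar>z - G\<bar>" unfolding 1 2 by simp
    moreover have "n div 2 = Suc (k div 2)" by (simp add: n)
    ultimately show ?thesis unfolding Fn by simp
  qed
qed

lemma cf_expansion_gauss:
  assumes x: "x \<in> {0<..1}" "x \<notin> \<rat>"
  shows "cf_expansion x (\<lambda>n. gauss_digit ((gauss_map ^^ (n - 1)) x))"
  unfolding cf_expansion_def
proof (intro conjI allI impI)
  fix n
  show "gauss_digit ((gauss_map ^^ (n - 1)) x) \<ge> 1"
    using irrational_regular[OF x, of "Suc (n - 1)"] unfolding regular_def by blast
next
  have w: "map (\<lambda>n. gauss_digit ((gauss_map ^^ (n - 1)) x)) [1..<Suc n] = gauss.word n x" for n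
    unfolding gauss.word_def by (simp add: map_Suc_upt[symmetric] del: upt_Suc)
  have "(\<lambda>n. x - finite_cfrac (gauss.word n x)) \<longlonglongrightarrow> 0"
  proof (rule Lim_null_comparison)
    show "eventually (\<lambda>n. norm (x - finite_cfrac (gauss.word n x)) \<le> (1 / 2) ^ (n div 2)) sequentially"
      using convergent_distance[OF x] by simp
    have "filterlim (\<lambda>n::nat. n div 2) at_top at_top" by (rule filterlim_at_top_div_const_nat) simp
    then show "(\<lambda>n. (1 / 2 :: real) ^ (n div 2)) \<longlonglongrightarrow> 0"
      by (intro filterlim_compose[OF LIMSEQ_power_zero[of "1 / 2 :: real"]]) auto
  qed
  from tendsto_diff[OF tendsto_const[of x] this] show "(\<lambda>n. finite_cfrac (map (\<lambda>n. gauss_digit ((gauss_map ^^ (n - 1)) x)) [1..<Suc n])) \<longlonglongrightarrow> x"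
    unfolding w by simp
qed

text \<open>Inverting the convergents shows that those of the shifted digits converge to
  \<open>1 / x - c 1\<close>. This limit lies in the closed unit interval and is irrational, hence
  lies in the open one; so \<open>x\<close> is in the range of the branch for the digit
  \<open>c 1\<close>, which identifies the digit and the image.\<close>

lemma cf_expansion_step:
  assumes x: "x \<in> {0<..1}" "x \<notin> \<rat>" and c: "cf_expansion x c"
  shows "c 1 = gauss_digit x" "cf_expansion (gauss_map x) (\<lambda>n. c (Suc n))"
proof -
  define G where "G n = finite_cfrac (map (\<lambda>n. c (Suc n)) [1..<Suc n])" for n
  have c1: "\<And>n. n \<ge> 1 \<Longrightarrow> c n \<ge> 1" and lim: "(\<lambda>n. finite_cfrac (map c [1..<Suc n])) \<longlonglongrightarrow> x"
    using c by (auto simp: cf_expansion_def)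
  have G01: "0 \<le> G n \<and> G n \<le> 1" for n unfolding G_def using c1 by (intro finite_cfrac_bounds) auto
  have F: "finite_cfrac (map c [1..<Suc (Suc n)]) = 1 / (real (c 1) + G n)" for n
  proof -
    have "[1..<Suc (Suc n)] = 1 # map Suc [1..<Suc n]" by (simp add: upt_conv_Cons map_Suc_upt del: upt_Suc)
    then show ?thesis by (simp add: G_def comp_def del: upt_Suc)
  qed
  have "(\<lambda>n. 1 / (real (c 1) + G n)) \<longlonglongrightarrow> x" using LIMSEQ_Suc[OF lim] unfolding F .
  then have "(\<lambda>n. 1 / (1 / (real (c 1) + G n)) - real (c 1)) \<longlonglongrightarrow> 1 / x - real (c 1)"
    using x by (intro tendsto_intros) auto
  moreover have "1 / (1 / (real (c 1) + G n)) - real (c 1) = G n" for n by simp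
  ultimately have Glim: "G \<longlonglongrightarrow> 1 / x - real (c 1)" by simp
  define y where "y = 1 / x - real (c 1)"
  have y01: "0 \<le> y" "y \<le> 1"
    using LIMSEQ_le_const[OF Glim, of 0] LIMSEQ_le_const2[OF Glim, of 1] G01 unfolding y_def by blast+
  have "y \<notin> \<rat>"
  proof
    assume "y \<in> \<rat>"
    then have "y + real (c 1) \<in> \<rat>" by simp
    then have "1 / x \<in> \<rat>" by (simp add: y_def)
    then have "1 / (1 / x) \<in> \<rat>" by (rule Rats_divide[OF Rats_1])
    then show False using x by simp
  qed
  then have "y \<noteq> 0" "y \<noteq> 1" by auto
  then have y: "0 < y" "y < 1" using y01 by auto
  have "x = gauss_branch (c 1) y" using x y by (simp add: gauss_branch_def y_def)
  then have d: "gauss_digit x = c 1" "gauss_map x = y"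
    using gauss_branch_inverse[of y "c 1"] y c1[of 1] by auto
  show "c 1 = gauss_digit x" using d by simp
  show "cf_expansion (gauss_map x) (\<lambda>n. c (Suc n))"
    unfolding cf_expansion_def d using c1 Glim by (auto simp: G_def[abs_def] y_def)
qed

lemma cf_expansion_unique:
  "x \<in> {0<..1} \<Longrightarrow> x \<notin> \<rat> \<Longrightarrow> cf_expansion x c \<Longrightarrow> c (Suc n) = gauss_digit ((gauss_map ^^ n) x)"
proof (induction n arbitrary: x c)
  case 0
  then show ?case using cf_expansion_step(1)[of x c] by simp
next
  case (Suc n)
  have "c (Suc (Suc n)) = gauss_digit ((gauss_map ^^ n) (gauss_map x))"
    using Suc.IH[OF gauss.T_X[OF Suc.prems(1)] gauss_map_irrational[OF Suc.prems(2)] cf_expansion_step(2)[OF Suc.prems]] .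
  then show ?case by (simp add: funpow_swap1)
qed

lemma cf_digit_gauss:
  assumes "x \<in> {0<..1}" "x \<notin> \<rat>"
  shows "cf_digit x (Suc n) = gauss_digit ((gauss_map ^^ n) x)"
  unfolding cf_digit_def
proof (rule the_equality)
  show "\<exists>c. cf_expansion x c \<and> c (Suc n) = gauss_digit ((gauss_map ^^ n) x)"
    using cf_expansion_gauss[OF assms] by auto
qed (use cf_expansion_unique[OF assms] in auto)

lemma cf_digits_iff_word:
  assumes "x \<in> {0<..1}" "x \<notin> \<rat>"
  shows "(\<forall>r<length u. cf_digit x (Suc n + r) = u ! r) \<longleftrightarrow> gauss.word (length u) ((gauss_map ^^ n) x) = u"
proof -
  have "cf_digit x (Suc n + r) = gauss.word (length u) ((gauss_map ^^ n) x) ! r" if "r < length u" for r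
    using cf_digit_gauss[OF assms, of "n + r"] that
    by (simp add: gauss.word_def) (simp add: funpow_add add.commute[of n])
  then show ?thesis by (auto simp: list_eq_iff_nth_eq)
qed

text \<open>The cylinder omits rationals and the word set does not confine its points to the unit
  interval; under the Gauss density the difference is null.\<close>

lemma measure_gauss_cylinder:
  "measure gauss_measure (cf_cylinder u) = gauss_int (indicator {x. gauss.word (length u) x = u}) / ln 2"
proof -
  have cyl: "cf_cylinder u = {x. gauss.word (length u) x = u} \<inter> ({0<..<1} - \<rat>)"
  proof -
    have "x \<in> cf_cylinder u \<longleftrightarrow> gauss.word (length u) x = u \<and> x \<in> {0<..<1} - \<rat>" for x
    proof (cases "x \<in> {0<..<1} - \<rat>")
      case True
      then show ?thesis using cf_digits_iff_word[of x u 0] by (auto simp: cf_cylinder_def)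
    next
      case False
      then have "x \<notin> {0..<1} - \<rat>" by (cases "x = 0") auto
      then show ?thesis using False by (auto simp: cf_cylinder_def)
    qed
    then show ?thesis by blast
  qed
  define W where "W = {x. gauss.word (length u) x = u}"
  note cyl = cyl[folded W_def]
  have W [measurable]: "W \<in> sets borel"
    unfolding W_def using gauss.pred_word[of "\<lambda>v. v = u" "length u"] by (simp add: pred_def)
  have Q: "(\<rat> :: real set) \<in> sets borel" using countable_rat by (rule sets.countable[rotated]) simp
  have Cb: "cf_cylinder u \<in> sets borel" unfolding cyl using W Q by auto
  then have C: "cf_cylinder u \<in> sets unit_lebesgue" by (auto simp: sets_unit_lebesgue_iff cf_cylinder_def)
  define h where "h x = 1 / ln 2 * (1 / (1 + x))" for x :: real
  have hm [measurable]: "h \<in> borel_measurable borel" unfolding h_def by measurable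
  have i: "integrable unit_lebesgue (\<lambda>x. h x * indicator (cf_cylinder u) x)"
  proof (rule gauss.integrable_bounded[where B = "1 / ln 2"])
    show "(\<lambda>x. h x * indicator (cf_cylinder u) x) \<in> borel_measurable borel" using Cb by measurable
    show "\<bar>h x * indicator (cf_cylinder u) x\<bar> \<le> 1 / ln 2" if "x \<in> {0<..1}" for x
      using that by (auto simp: h_def indicator_def divide_simps)
  qed
  have "emeasure gauss_measure (cf_cylinder u) = (\<integral>\<^sup>+x. ennreal (h x) * indicator (cf_cylinder u) x \<partial>unit_lebesgue)"
    unfolding gauss_measure_def h_def[symmetric] using C by (intro emeasure_density measurable_unit_lebesgue) auto
  also have "\<dots> = (\<integral>\<^sup>+x. ennreal (h x * indicator (cf_cylinder u) x) \<partial>unit_lebesgue)"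
    by (intro nn_integral_cong) (auto simp: indicator_def)
  also have "\<dots> = ennreal (\<integral>x. h x * indicator (cf_cylinder u) x \<partial>unit_lebesgue)"
  proof (rule nn_integral_eq_integral[OF i])
    show "AE x in unit_lebesgue. 0 \<le> h x * indicator (cf_cylinder u) x"
      using gauss.AE_X by eventually_elim (auto simp: h_def indicator_def)
  qed
  finally have "measure gauss_measure (cf_cylinder u) = (\<integral>x. h x * indicator (cf_cylinder u) x \<partial>unit_lebesgue)"
  proof -
    assume "emeasure gauss_measure (cf_cylinder u) = ennreal (\<integral>x. h x * indicator (cf_cylinder u) x \<partial>unit_lebesgue)"
    moreover have "0 \<le> (\<integral>x. h x * indicator (cf_cylinder u) x \<partial>unit_lebesgue)"
      by (intro integral_nonneg_AE, use gauss.AE_X in eventually_elim) (auto simp: h_def indicator_def)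
    ultimately show ?thesis by (simp add: measure_def)
  qed
  also have "\<dots> = (\<integral>x. indicator W x / (1 + x) / ln 2 \<partial>unit_lebesgue)"
  proof (rule integral_cong_AE)
    show "(\<lambda>x. h x * indicator (cf_cylinder u) x) \<in> borel_measurable unit_lebesgue" using i by auto
    show "(\<lambda>x. indicator W x / (1 + x) / ln 2) \<in> borel_measurable unit_lebesgue"
      by (intro measurable_unit_lebesgue) measurable
    show "AE x in unit_lebesgue. h x * indicator (cf_cylinder u) x = indicator W x / (1 + x) / ln 2"
      using AE_unit_lebesgue_irrational AE_unit_lebesgue_interior by eventually_elim (auto simp: h_def cyl indicator_def)
  qed
  also have "\<dots> = gauss_int (indicator W) / ln 2"
    by (simp only: gauss_int_def integral_divide_zero)
  finally show ?thesis unfolding W_def .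
qed

section \<open>Joint normality\<close>

text \<open>The common interface of the three kinds of expansion. Positions start at 1 and orbit
  times at 0, hence \<open>Suc n\<close>; agreement almost everywhere absorbs the end points and,
  for continued fractions, the rationals.\<close>

definition mixing_event :: "real \<Rightarrow> (nat \<Rightarrow> real \<Rightarrow> bool) \<Rightarrow> real \<Rightarrow> bool" where
  "mixing_event H P p \<longleftrightarrow>
     (\<exists>E. (\<exists>C \<theta>. 0 < \<theta> \<and> \<theta> < 1 \<and> 0 \<le> C \<and> quasi_mixing C \<theta> H E p) \<and>
        (AE x in unit_lebesgue. \<forall>n. x \<in> E n \<longleftrightarrow> P (Suc n) x))"

lemma AE_joint_mixing_frequency:
  fixes H p :: "'i \<Rightarrow> real" and P :: "'i \<Rightarrow> nat \<Rightarrow> real \<Rightarrow> bool"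
  assumes I: "finite I" and P: "\<And>i. i \<in> I \<Longrightarrow> mixing_event (H i) (P i) (p i)"
    and H: "\<And>i. i \<in> I \<Longrightarrow> H i > 0" and inj: "inj_on H I"
  shows "AE x in unit_lebesgue.
    (\<lambda>N. real (card {n \<in> {1..N}. \<forall>i\<in>I. P i n x}) / real N) \<longlonglongrightarrow> (\<Prod>i\<in>I. p i)"
proof -
  have "\<forall>i\<in>I. \<exists>E. (\<exists>C \<theta>. 0 < \<theta> \<and> \<theta> < 1 \<and> 0 \<le> C \<and> quasi_mixing C \<theta> (H i) E (p i)) \<and>
      (AE x in unit_lebesgue. \<forall>n. x \<in> E n \<longleftrightarrow> P i (Suc n) x)"
    using P unfolding mixing_event_def by blast
  then obtain E where E: "\<And>i. i \<in> I \<Longrightarrow> \<exists>C \<theta>. 0 < \<theta> \<and> \<theta> < 1 \<and> 0 \<le> C \<and> quasi_mixing C \<theta> (H i) (E i) (p i)"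
      "\<And>i. i \<in> I \<Longrightarrow> AE x in unit_lebesgue. \<forall>n. x \<in> E i n \<longleftrightarrow> P i (Suc n) x"
    unfolding bchoice_iff by blast
  have "AE x in unit_lebesgue. (\<lambda>N. real (card {n. n < N \<and> (\<forall>i\<in>I. x \<in> E i n)}) / real N) \<longlonglongrightarrow> (\<Prod>i\<in>I. p i)"
    by (rule AE_joint_frequency[OF I E(1) H inj])
  moreover have "AE x in unit_lebesgue. \<forall>i\<in>I. \<forall>n. x \<in> E i n \<longleftrightarrow> P i (Suc n) x"
    by (rule AE_finite_allI[OF I E(2)])
  ultimately show ?thesis
  proof eventually_elim
    case (elim x)
    have "card {n. n < N \<and> (\<forall>i\<in>I. x \<in> E i n)} = card {n \<in> {1..N}. \<forall>i\<in>I. P i n x}" for N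
    proof -
      have "{n \<in> {1..N}. \<forall>i\<in>I. P i n x} = Suc ` {n. n < N \<and> (\<forall>i\<in>I. x \<in> E i n)}"
      proof (intro set_eqI iffI)
        fix n assume n: "n \<in> {n \<in> {1..N}. \<forall>i\<in>I. P i n x}"
        then obtain m where "n = Suc m" by (cases n) auto
        then show "n \<in> Suc ` {n. n < N \<and> (\<forall>i\<in>I. x \<in> E i n)}" using n elim(2) by auto
      qed (use elim(2) in auto)
      then show ?thesis by (simp add: card_image)
    qed
    then show ?case using elim(1) by simp
  qed
qed

lemma (in beta_base) beta_digits_mixing_event:
  assumes v: "set v \<subseteq> {0..}"
  shows "mixing_event (ln \<beta>) (\<lambda>n x. \<forall>p<length v. beta_digit \<beta> x (n + p) = v ! p)
    (measure (renyi_measure \<beta>) (beta_cylinder \<beta> v))"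
  unfolding mixing_event_def renyi_measure_eq
proof (rule exI, rule conjI)
  show "\<exists>C \<theta>. 0 < \<theta> \<and> \<theta> < 1 \<and> 0 \<le> C \<and>
      quasi_mixing C \<theta> (ln \<beta>) (\<lambda>n. {x \<in> {0..1}. word (length v) ((beta_map \<beta> ^^ n) x) = map nat v})
        (measure parry_measure (beta_cylinder \<beta> v))"
    by (rule beta_digit_quasi_mixing[OF v])
  show "AE x in unit_lebesgue. \<forall>n. x \<in> {x \<in> {0..1}. word (length v) ((beta_map \<beta> ^^ n) x) = map nat v} \<longleftrightarrow>
      (\<forall>p<length v. beta_digit \<beta> x (Suc n + p) = v ! p)"
    using AE_unit_lebesgue_interior
  proof eventually_elim
    case (elim x)
    then show ?case using digits_iff_word[OF _ v, of x] by auto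
  qed
qed

lemma integer_digits_mixing_event:
  assumes b: "b \<ge> 2" and v: "set v \<subseteq> {0..}"
  shows "mixing_event (ln (real_of_int b)) (\<lambda>n x. \<forall>p<length v. beta_digit (real_of_int b) x (n + p) = v ! p)
    (measure unit_lebesgue (beta_cylinder (real_of_int b) v))"
proof -
  interpret beta_base "real_of_int b" by unfold_locales (use b in simp)
  have "measure (renyi_measure (real_of_int b)) (beta_cylinder (real_of_int b) v) =
      measure unit_lebesgue (beta_cylinder (real_of_int b) v)"
    unfolding renyi_measure_eq by (rule measure_parry_measure_integer[OF _ sets_beta_cylinder[OF v]]) simp
  then show ?thesis using beta_digits_mixing_event[OF v] by simp
qed

lemma cf_digits_mixing_event:
  "mixing_event (pi\<^sup>2 / (6 * ln 2)) (\<lambda>n x. \<forall>r<length u. cf_digit x (n + r) = u ! r)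
    (measure gauss_measure (cf_cylinder u))"
  unfolding mixing_event_def measure_gauss_cylinder
proof (rule exI, rule conjI)
  have "2 * (pi\<^sup>2 / (12 * ln 2)) = pi\<^sup>2 / (6 * ln 2)" by simp
  then show "\<exists>C \<theta>. 0 < \<theta> \<and> \<theta> < 1 \<and> 0 \<le> C \<and>
      quasi_mixing C \<theta> (pi\<^sup>2 / (6 * ln 2)) (\<lambda>n. {x \<in> {0..1}. gauss.word (length u) ((gauss_map ^^ n) x) = u})
        (gauss_int (indicator {x. gauss.word (length u) x = u}) / ln 2)"
    using gauss_quasi_mixing[OF log_mean_tendsto, of "\<lambda>v. v = u" "length u"] by (simp only:)
  show "AE x in unit_lebesgue. \<forall>n. x \<in> {x \<in> {0..1}. gauss.word (length u) ((gauss_map ^^ n) x) = u} \<longleftrightarrow>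
      (\<forall>r<length u. cf_digit x (Suc n + r) = u ! r)"
    using AE_unit_lebesgue_interior AE_unit_lebesgue_irrational
  proof eventually_elim
    case (elim x)
    then show ?case using cf_digits_iff_word[of x u] by auto
  qed
qed

text \<open>\<open>10 ^ 3 < 2 ^ 10\<close> and \<open>2 ^ 24 < 11 ^ 7\<close> place the entropy strictly between \<open>ln 10\<close> and \<open>ln 11\<close>.\<close>

lemma ln_integer_neq_gauss_entropy:
  fixes b :: int
  assumes "b \<ge> 2"
  shows "ln (real_of_int b) \<noteq> pi\<^sup>2 / (6 * ln 2)"
proof
  assume "ln (real_of_int b) = pi\<^sup>2 / (6 * ln 2)"
  then have eq: "ln (real_of_int b) * (6 * ln 2) = pi\<^sup>2" by simp
  have ln2: "0.693 \<le> ln (2::real)" "ln (2::real) \<le> 25 / 36"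
    using ln_approx_bounds[of 2 3, simplified, simplified eval_nat_numeral, simplified] ln2_le_25_over_36 by simp_all
  have pi: "3.1415\<^sup>2 \<le> pi\<^sup>2" "pi\<^sup>2 \<le> 3.1416\<^sup>2"
    using pi_approx by (intro power_mono; simp)+
  show False
  \<comment> \<open>Divided by \<open>ln 2\<close>, the entropy is about 3.4237. It is separated
    from the binary logarithm of 10, about 3.3219, by \<open>10 / 3\<close>, and from that of 11,
    about 3.4594, by \<open>24 / 7\<close>, about 3.4286. The last margin is narrow and dictates the
    precision of the bounds for \<open>pi\<close> and \<open>ln 2\<close>.\<close>
  proof (cases "b \<le> 10")
    case True
    have "3 * ln 10 = ln (10 ^ 3 :: real)" by (simp only: ln_realpow)
    also have "\<dots> \<le> ln (2 ^ 10 :: real)" by simp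
    also have "\<dots> = 10 * ln (2::real)" by (simp only: ln_realpow)
    finally have "3 * ln 10 \<le> 10 * ln (2::real)" .
    moreover have "ln (real_of_int b) \<le> ln 10" using assms True by simp
    ultimately have "ln (real_of_int b) \<le> 10 / 3 * ln 2" by linarith
    then have "ln (real_of_int b) * (6 * ln 2) \<le> (10 / 3 * ln 2) * (6 * ln 2)"
      by (intro mult_right_mono) auto
    also have "\<dots> = 20 * (ln 2)\<^sup>2" by (simp add: power2_eq_square)
    also have "\<dots> \<le> 20 * (25 / 36)\<^sup>2" using ln2 by (intro mult_left_mono power_mono) auto
    also have "\<dots> < 3.1415\<^sup>2" by (simp add: power2_eq_square)
    finally show False using eq pi by linarith
  next
    case False
    have "24 * ln (2::real) = ln (2 ^ 24 :: real)" by (simp only: ln_realpow)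
    also have "\<dots> \<le> ln (11 ^ 7 :: real)" by simp
    also have "\<dots> = 7 * ln (11::real)" by (simp only: ln_realpow)
    finally have "24 * ln (2::real) \<le> 7 * ln 11" .
    moreover have "ln 11 \<le> ln (real_of_int b)" using False by simp
    ultimately have *: "24 / 7 * ln 2 \<le> ln (real_of_int b)" by linarith
    have "3.1416\<^sup>2 < 144 / 7 * (0.693 :: real)\<^sup>2" by (simp add: power2_eq_square)
    also have "\<dots> \<le> 144 / 7 * (ln 2)\<^sup>2" using ln2 by (intro mult_left_mono power_mono) auto
    also have "\<dots> = (24 / 7 * ln 2) * (6 * ln 2)" by (simp add: power2_eq_square)
    also have "\<dots> \<le> ln (real_of_int b) * (6 * ln 2)" using * by (intro mult_right_mono) auto
    finally show False using eq pi by linarith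
  qed
qed

text \<open>\<open>K\<close> is a switch: for the empty set the continued fraction contributes an
  empty conjunction and an empty product, for the full unit set one further event. So both parts of
  the result come from one statement, with the disjoint sum of the three index sets as the family of
  events.\<close>

lemma AE_string_frequency:
  fixes b :: "nat \<Rightarrow> int" and \<beta> :: "nat \<Rightarrow> real" and K :: "unit set"
  assumes b: "inj_on b {1..s}" "\<And>i. i \<in> {1..s} \<Longrightarrow> b i \<ge> 2"
    and \<beta>: "inj_on \<beta> {1..t}" "\<And>j. j \<in> {1..t} \<Longrightarrow> \<beta> j > 1 \<and> \<beta> j \<notin> \<int>"
    and K: "K = {} \<or> (\<forall>j\<in>{1..t}. ln (\<beta> j) \<noteq> pi\<^sup>2 / (6 * ln 2))"
    and VW: "admissible_strings s t b \<beta> V W"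
  shows "AE x in unit_lebesgue.
    (\<lambda>N. real (card {n \<in> {1..N}. digits_match s t b \<beta> V W x n \<and>
        (\<forall>k\<in>K. \<forall>r<length u. cf_digit x (n + r) = u ! r)}) / real N)
      \<longlonglongrightarrow> cylinder_product s t b \<beta> V W * (\<Prod>k\<in>K. measure gauss_measure (cf_cylinder u))"
proof -
  define h :: real where "h = pi\<^sup>2 / (6 * ln 2)"
  have h0: "h > 0" by (simp add: h_def)
  define H where "H = case_sum (\<lambda>i. ln (real_of_int (b i))) (case_sum (\<lambda>j. ln (\<beta> j)) (\<lambda>k::unit. h))"
  define P where "P = case_sum
      (\<lambda>i n x. \<forall>p<length (V i). beta_digit (real_of_int (b i)) x (n + p) = V i ! p)
      (case_sum (\<lambda>j n x. \<forall>q<length (W j). beta_digit (\<beta> j) x (n + q) = W j ! q)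
        (\<lambda>k::unit. \<lambda>n x. \<forall>r<length u. cf_digit x (n + r) = u ! r))"
  define p where "p = case_sum
      (\<lambda>i. measure unit_lebesgue (beta_cylinder (real_of_int (b i)) (V i)))
      (case_sum (\<lambda>j. measure (renyi_measure (\<beta> j)) (beta_cylinder (\<beta> j) (W j)))
        (\<lambda>k::unit. measure gauss_measure (cf_cylinder u)))"
  let ?I = "{1..s} <+> ({1..t} <+> K)"
  have V: "set (V i) \<subseteq> {0..}" if "i \<in> {1..s}" for i using VW that by (fastforce simp: admissible_strings_def)
  have W: "set (W j) \<subseteq> {0..}" if "j \<in> {1..t}" for j using VW that by (fastforce simp: admissible_strings_def)
  have mix: "mixing_event (H i) (P i) (p i)" if i: "i \<in> ?I" for i
    using i
  proof (elim PlusE; simp only:)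
    fix i' assume i': "i' \<in> {1..s}"
    show "mixing_event (H (Inl i')) (P (Inl i')) (p (Inl i'))"
      using integer_digits_mixing_event[OF b(2)[OF i'] V[OF i']] by (simp add: H_def P_def p_def)
  next
    fix j assume j: "j \<in> {1..t}"
    interpret beta_base "\<beta> j" by unfold_locales (use \<beta>(2)[OF j] in simp)
    show "mixing_event (H (Inr (Inl j))) (P (Inr (Inl j))) (p (Inr (Inl j)))"
      using beta_digits_mixing_event[OF W[OF j]] by (simp add: H_def P_def p_def)
  next
    fix k
    show "mixing_event (H (Inr (Inr k))) (P (Inr (Inr k))) (p (Inr (Inr k)))"
      using cf_digits_mixing_event[of u] by (simp add: H_def P_def p_def h_def)
  qed
  have pos: "H i > 0" if "i \<in> ?I" for i
    using that b(2) \<beta>(2) h0 by (fastforce simp: H_def)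
  have b1: "real_of_int (b i) > 0" if "i \<in> {1..s}" for i using b(2)[OF that] by simp
  have \<beta>1: "\<beta> j > 0" if "j \<in> {1..t}" for j using \<beta>(2)[OF that] by simp
  have n1: "ln (real_of_int (b i)) \<noteq> ln (\<beta> j)" if ij: "i \<in> {1..s}" "j \<in> {1..t}" for i j
  proof
    assume "ln (real_of_int (b i)) = ln (\<beta> j)"
    then have "\<beta> j = real_of_int (b i)" using b1[OF ij(1)] \<beta>1[OF ij(2)] by simp
    then show False using \<beta>(2)[OF ij(2)] by simp
  qed
  have n2: "ln (real_of_int (b i)) \<noteq> h" if "i \<in> {1..s}" for i
    unfolding h_def by (rule ln_integer_neq_gauss_entropy[OF b(2)[OF that]])
  have n3: "ln (\<beta> j) \<noteq> h" if "j \<in> {1..t}" "k \<in> K" for j k using K that by (auto simp: h_def)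
  have n4: "i = i'" if "ln (real_of_int (b i)) = ln (real_of_int (b i'))" "i \<in> {1..s}" "i' \<in> {1..s}" for i i'
    using that b1[OF that(2)] b1[OF that(3)] inj_onD[OF b(1)] by simp
  have n5: "j = j'" if "ln (\<beta> j) = ln (\<beta> j')" "j \<in> {1..t}" "j' \<in> {1..t}" for j j'
    using that \<beta>1[OF that(2)] \<beta>1[OF that(3)] inj_onD[OF \<beta>(1)] by simp
  \<comment> \<open>All entropies are distinct: for two bases of the same kind by injectivity, for
    an integer and a non-integer base by integrality, for an integer base and the Gauss map by the
    numerical estimate, for \<open>\<beta> j\<close> and the Gauss map by the condition on
    \<open>K\<close>.\<close>
  have inj: "inj_on H ?I"
  proof (rule inj_onI)
    fix y z assume y: "y \<in> ?I" and z: "z \<in> ?I" and e: "H y = H z"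
    from y show "y = z"
    proof (elim PlusE)
      fix i assume i: "y = Inl i" "i \<in> {1..s}"
      from z show ?thesis
        by (elim PlusE) (use i e n1[OF i(2)] n2[OF i(2)] n4[OF _ i(2)] in \<open>simp_all add: H_def\<close>)
    next
      fix y' j assume j: "y = Inr y'" "y' = Inl j" "j \<in> {1..t}"
      from z show ?thesis
        by (elim PlusE) (use j e n1[OF _ j(3)] n3[OF j(3)] n5[OF _ j(3)] in \<open>auto simp: H_def\<close>)
    next
      fix y' k assume k: "y = Inr y'" "y' = Inr k" "k \<in> K"
      from z show ?thesis
        by (elim PlusE) (use k e n2 n3[OF _ k(3)] in \<open>auto simp: H_def\<close>)
    qed
  qed
  have "finite K" by simp
  then have fin: "finite ?I" by simp
  have "(\<forall>i\<in>?I. P i n x) \<longleftrightarrow> digits_match s t b \<beta> V W x n \<and>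
      (\<forall>k\<in>K. \<forall>r<length u. cf_digit x (n + r) = u ! r)" for n x
    unfolding Plus_def P_def digits_match_def by (simp add: ball_Un)
  moreover have "(\<Prod>i\<in>?I. p i) = cylinder_product s t b \<beta> V W * (\<Prod>k\<in>K. measure gauss_measure (cf_cylinder u))"
    by (simp add: prod.Plus p_def cylinder_product_def comp_def)
  ultimately show ?thesis using AE_joint_mixing_frequency[OF fin mix pos inj] by simp
qed

lemma digits_match_cong:
  assumes "\<And>i. i \<in> {1..s} \<Longrightarrow> V i = V' i" "\<And>j. j \<in> {1..t} \<Longrightarrow> W j = W' j"
  shows "digits_match s t b \<beta> V W = digits_match s t b \<beta> V' W'"
    "cylinder_product s t b \<beta> V W = cylinder_product s t b \<beta> V' W'"
    "admissible_strings s t b \<beta> V W = admissible_strings s t b \<beta> V' W'"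
  using assms by (auto simp: digits_match_def[abs_def] cylinder_product_def admissible_strings_def intro!: ext prod.cong arg_cong2[where f = "(*)"])

text \<open>Strings are taken from the countable type of lists, so that the exceptional null sets can be
  united.\<close>

lemma AE_all_string_frequencies:
  fixes b :: "nat \<Rightarrow> int" and \<beta> :: "nat \<Rightarrow> real" and K :: "unit set"
  assumes "inj_on b {1..s}" "\<And>i. i \<in> {1..s} \<Longrightarrow> b i \<ge> 2"
    and "inj_on \<beta> {1..t}" "\<And>j. j \<in> {1..t} \<Longrightarrow> \<beta> j > 1 \<and> \<beta> j \<notin> \<int>"
    and "K = {} \<or> (\<forall>j\<in>{1..t}. ln (\<beta> j) \<noteq> pi\<^sup>2 / (6 * ln 2))"
  shows "AE x in unit_lebesgue. \<forall>V W u. admissible_strings s t b \<beta> V W \<longrightarrow>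
    (\<lambda>N. real (card {n \<in> {1..N}. digits_match s t b \<beta> V W x n \<and>
        (\<forall>k\<in>K. \<forall>r<length u. cf_digit x (n + r) = u ! r)}) / real N)
      \<longlonglongrightarrow> cylinder_product s t b \<beta> V W * (\<Prod>k\<in>K. measure gauss_measure (cf_cylinder u))"
    (is "AE x in _. \<forall>V W u. ?Q x V W u")
proof -
  have "AE x in unit_lebesgue. ?Q x V W u" for V W u
    using AE_string_frequency[OF assms, where V = V and W = W and u = u]
    by (cases "admissible_strings s t b \<beta> V W") auto
  then have "AE x in unit_lebesgue. \<forall>vs ws :: int list list. \<forall>u. ?Q x (\<lambda>i. vs ! (i - 1)) (\<lambda>j. ws ! (j - 1)) u"
    by (simp only: AE_all_countable) simp
  then show ?thesis
  proof eventually_elim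
    case (elim x)
    show ?case
    proof (intro allI)
      fix V W :: "nat \<Rightarrow> int list" and u
      \<comment> \<open>Only the strings with indices in \<open>1..s\<close> and \<open>1..t\<close>
        are inspected, so arbitrary families may be read off finite lists.\<close>
      define V' where "V' i = map V [1..<Suc s] ! (i - 1)" for i
      define W' where "W' j = map W [1..<Suc t] ! (j - 1)" for j
      have nth: "map F [1..<Suc m] ! (i - 1) = F i" if "i \<in> {1..m}" for F :: "nat \<Rightarrow> int list" and i m
        using that by (subst nth_map) (auto simp del: upt_Suc)
      have "V i = V' i" if "i \<in> {1..s}" for i unfolding V'_def by (rule nth[OF that, symmetric])
      moreover have "W j = W' j" if "j \<in> {1..t}" for j unfolding W'_def by (rule nth[OF that, symmetric])
      ultimately have eq: "digits_match s t b \<beta> V W = digits_match s t b \<beta> V' W'"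
          "cylinder_product s t b \<beta> V W = cylinder_product s t b \<beta> V' W'"
          "admissible_strings s t b \<beta> V W = admissible_strings s t b \<beta> V' W'"
        using digits_match_cong[of s V V' t W W' b \<beta>] by blast+
      have "?Q x V' W' u" unfolding V'_def[abs_def] W'_def[abs_def] using elim by blast
      then show "?Q x V W u" unfolding eq .
    qed
  qed
qed

theorem corollary1p6:
  fixes s t :: nat and b :: "nat \<Rightarrow> int" and \<beta> :: "nat \<Rightarrow> real"
  assumes "s \<ge> 1" and "t \<ge> 1"
    and "inj_on b {1..s}" and "\<And>i. i \<in> {1..s} \<Longrightarrow> b i \<ge> 2"
    and "inj_on \<beta> {1..t}" and "\<And>j. j \<in> {1..t} \<Longrightarrow> \<beta> j > 1 \<and> \<beta> j \<notin> \<int>"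
  shows "(AE x in lborel. x \<in> {0..<1} \<longrightarrow> jointly_normal s t b \<beta> x) \<and>
    ((\<forall>j\<in>{1..t}. ln (\<beta> j) \<noteq> pi\<^sup>2 / (6 * ln 2)) \<longrightarrow>
      (AE x in lborel. x \<in> {0..<1} \<longrightarrow> jointly_CF_normal s t b \<beta> x))"
proof (intro conjI impI)
  have freq: "AE x in unit_lebesgue. \<forall>V W u. admissible_strings s t b \<beta> V W \<longrightarrow>
    (\<lambda>N. real (card {n \<in> {1..N}. digits_match s t b \<beta> V W x n \<and>
        (\<forall>k\<in>K. \<forall>r<length u. cf_digit x (n + r) = u ! r)}) / real N)
      \<longlonglongrightarrow> cylinder_product s t b \<beta> V W * (\<Prod>k\<in>K. measure gauss_measure (cf_cylinder u))"
    if "K = {} \<or> (\<forall>j\<in>{1..t}. ln (\<beta> j) \<noteq> pi\<^sup>2 / (6 * ln 2))" for K :: "unit set"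
    using assms(3-6) that by (rule AE_all_string_frequencies)
  have "AE x in unit_lebesgue. jointly_normal s t b \<beta> x"
    using freq[of "{}"] by simp (simp add: jointly_normal_def)
  then show "AE x in lborel. x \<in> {0..<1} \<longrightarrow> jointly_normal s t b \<beta> x"
    unfolding AE_unit_lebesgue_iff by eventually_elim auto
  assume "\<forall>j\<in>{1..t}. ln (\<beta> j) \<noteq> pi\<^sup>2 / (6 * ln 2)"
  then have "AE x in unit_lebesgue. jointly_CF_normal s t b \<beta> x"
  proof -
    assume "\<forall>j\<in>{1..t}. ln (\<beta> j) \<noteq> pi\<^sup>2 / (6 * ln 2)"
    from freq[of "{()}", OF disjI2[OF this]] AE_unit_lebesgue_irrational show ?thesis
    proof eventually_elim
      case (elim x)
      then show ?case by (simp add: jointly_CF_normal_def)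
    qed
  qed
  then show "AE x in lborel. x \<in> {0..<1} \<longrightarrow> jointly_CF_normal s t b \<beta> x"
    unfolding AE_unit_lebesgue_iff by eventually_elim auto
qed

end
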